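(* Let $G,H$ be loopless, weakly connected digraphs with at least two vertices and let $\alpha,\beta:G\to H$ be homomorphisms. One can find in time $O(|V(G)|)$ a vertex $q\in V(G)$ such that, with $\Pi_q$ denoting the set of reduced walks from $\alpha(q)$ to $\beta(q)$ that are $H$-realizable for $\alpha,\beta,q$, one of the following holds: (1) $\Pi_q=\emptyset$; (2) $\Pi_q=\{Q\}$ for some $Q\in\pi(H)$; (3) $\Pi_q=\{R^nP: n\in\mathbb{Z}\}$ for some $R,P\in\pi(H)$; (4) $\Pi_q$ contains all reduced walks of even length from $\alpha(q)$ to $\beta(q)$ that satisfy the zigzag condition (with respect to $q$). Moreover, one can determine in time $O(|V(G)|\cdot|E(G)|+|E(H)|)$ which case holds and output $Q$, respectively $R,P$, in cases (2) and (3).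
   Context: Walks in a digraph ignore orientation: a walk is $(v_1v_2)\cdots(v_{n-1}v_n)$ with $v_i\to v_{i+1}$ or $v_{i+1}\to v_i$ for each $i$. Reduction deletes $(v_iv_{i+1})(v_{i+1}v_{i+2})$ when $v_i=v_{i+2}$ (or a loop step); a walk is reduced if no reduction applies; $\pi(H)$ is the groupoid of walks up to having the same reduction, with concatenation; equalities "in $\pi(H)$" mean equal reductions. An $H$-recoloring sequence from $\alpha$ to $\beta$ is a sequence $\sigma_0=\alpha,\dots,\sigma_\ell=\beta$ of homomorphisms $G\to H$, consecutive ones differing on exactly one vertex. It satisfies the monochromatic neighborhood property if whenever a vertex $v$ changes color between $\sigma_i$ and $\sigma_{i+1}$, all neighbors of $v$ (in the underlying undirected graph of $G$) have one common color $h$ in $\sigma_i$ (equivalently in $\sigma_{i+1}$). For such a sequence and $v\in V(G)$, let $S(v)$ be the concatenation over $i$ of $\varepsilon$ if $\sigma_i(v)=\sigma_{i+1}(v)$ and of $(\sigma_i(v)\,h)(h\,\sigma_{i+1}(v))$ otherwise. A reduced walk $Q$ from $\alpha(q)$ to $\beta(q)$ is $H$-realizable for $\alpha,\beta,q$ if there is an $H$-recoloring sequence from $\alpha$ to $\beta$ with the monochromatic neighborhood property such that $Q=S(q)$ in $\pi(H)$. A walk $(a_1a_2)\cdots(a_{n-1}a_n)$ of even length satisfies the zigzag condition with respect to a vertex $v$ of $G$ if: whenever $v$ has an in-neighbor in $G$, $a_1\leftarrow a_2\to a_3\leftarrow\cdots\leftarrow a_{n-1}\to a_n$ in $H$, and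 whenever $v$ has an out-neighbor in $G$, $a_1\to a_2\leftarrow a_3\to\cdots\to a_{n-1}\leftarrow a_n$ in $H$. *)

theory Defs
  imports "Graph_Theory.Graph_Theory"
begin

section \<open>Walks, reduction and the groupoid of a digraph\<close>

abbreviation underlying :: "'a pair_pre_digraph \<Rightarrow> 'a pair_pre_digraph" where
  "underlying G \<equiv> mk_symmetric (with_proj G)"

text \<open>Walks ignore orientation; a walk is the list of its steps, so the trivial walk is the
  empty list and concatenation is append.\<close>

abbreviation walk :: "'a pair_pre_digraph \<Rightarrow> 'a \<Rightarrow> ('a \<times> 'a) list \<Rightarrow> 'a \<Rightarrow> bool" where
  "walk H a w b \<equiv> pre_digraph.awalk (with_proj (underlying H)) a w b"

inductive reduces :: "('a \<times> 'a) list \<Rightarrow> ('a \<times> 'a) list \<Rightarrow> bool" where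
  backtrack: "reduces (xs @ [(u, v), (v, u)] @ ys) (xs @ ys)"
| loop_step: "reduces (xs @ [(u, u)] @ ys) (xs @ ys)"

definition reduced :: "('a \<times> 'a) list \<Rightarrow> bool" where
  "reduced w \<longleftrightarrow> (\<nexists>w'. reduces w w')"

text \<open>Equality in the groupoid.\<close>

definition same_reduction :: "('a \<times> 'a) list \<Rightarrow> ('a \<times> 'a) list \<Rightarrow> bool" where
  "same_reduction w w' \<longleftrightarrow> (\<exists>r. reduced r \<and> reduces\<^sup>*\<^sup>* w r \<and> reduces\<^sup>*\<^sup>* w' r)"

text \<open>The morphisms from \<open>a\<close> to \<open>b\<close>, every class being represented by its reduced walk.\<close>

definition pi_hom :: "'a pair_pre_digraph \<Rightarrow> 'a \<Rightarrow> 'a \<Rightarrow> ('a \<times> 'a) list set" where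
  "pi_hom H a b = {w. walk H a w b \<and> reduced w}"

definition walk_inverse :: "('a \<times> 'a) list \<Rightarrow> ('a \<times> 'a) list" where
  "walk_inverse w = rev (map prod.swap w)"

definition walk_power :: "('a \<times> 'a) list \<Rightarrow> int \<Rightarrow> ('a \<times> 'a) list" where
  "walk_power w n =
     (if 0 \<le> n then concat (replicate (nat n) w)
      else concat (replicate (nat (- n)) (walk_inverse w)))"


section \<open>Recoloring sequences\<close>

text \<open>A coloring is a total function of which only the values on the vertices of \<open>G\<close> matter.\<close>

definition digraph_hom ::
  "'a pair_pre_digraph \<Rightarrow> 'b pair_pre_digraph \<Rightarrow> ('a \<Rightarrow> 'b) \<Rightarrow> bool" where
  "digraph_hom G H f \<longleftrightarrow>
     (\<forall>v\<in>pverts G. f v \<in> pverts H) \<and> (\<forall>(u, v)\<in>parcs G. (f u, f v) \<in> parcs H)"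

definition recoloring_sequence ::
  "'a pair_pre_digraph \<Rightarrow> 'b pair_pre_digraph \<Rightarrow> ('a \<Rightarrow> 'b) \<Rightarrow> ('a \<Rightarrow> 'b) \<Rightarrow> ('a \<Rightarrow> 'b) list \<Rightarrow> bool"
  where
  "recoloring_sequence G H \<alpha> \<beta> \<sigma> \<longleftrightarrow>
     \<sigma> \<noteq> [] \<and> (\<forall>f\<in>set \<sigma>. digraph_hom G H f) \<and>
     (\<forall>v\<in>pverts G. hd \<sigma> v = \<alpha> v) \<and> (\<forall>v\<in>pverts G. last \<sigma> v = \<beta> v) \<and>
     (\<forall>i. Suc i < length \<sigma> \<longrightarrow> (\<exists>!v. v \<in> pverts G \<and> (\<sigma> ! i) v \<noteq> (\<sigma> ! Suc i) v))"

definition nbrs :: "'a pair_pre_digraph \<Rightarrow> 'a \<Rightarrow> 'a set" where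
  "nbrs G v = {u. (u, v) \<in> parcs (underlying G)}"

definition monochromatic_neighborhood ::
  "'a pair_pre_digraph \<Rightarrow> ('a \<Rightarrow> 'b) list \<Rightarrow> bool" where
  "monochromatic_neighborhood G \<sigma> \<longleftrightarrow>
     (\<forall>i. Suc i < length \<sigma> \<longrightarrow>
        (\<forall>v\<in>pverts G. (\<sigma> ! i) v \<noteq> (\<sigma> ! Suc i) v \<longrightarrow> (\<exists>h. \<forall>u\<in>nbrs G v. (\<sigma> ! i) u = h)))"

text \<open>In a connected digraph with at least two vertices every \<open>nbrs G v\<close> is nonempty, so under
  the monochromatic neighborhood property the \<open>the_elem\<close> below is the common color.\<close>

definition step_walk ::
  "'a pair_pre_digraph \<Rightarrow> ('a \<Rightarrow> 'b) \<Rightarrow> ('a \<Rightarrow> 'b) \<Rightarrow> 'a \<Rightarrow> ('b \<times> 'b) list" where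
  "step_walk G f f' v =
     (if f v = f' v then []
      else let h = the_elem (f ` nbrs G v) in [(f v, h), (h, f' v)])"

definition vertex_walk :: "'a pair_pre_digraph \<Rightarrow> ('a \<Rightarrow> 'b) list \<Rightarrow> 'a \<Rightarrow> ('b \<times> 'b) list" where
  "vertex_walk G \<sigma> v =
     concat (map (\<lambda>i. step_walk G (\<sigma> ! i) (\<sigma> ! Suc i) v) [0..<length \<sigma> - 1])"

definition realizable_walks ::
  "'a pair_pre_digraph \<Rightarrow> 'b pair_pre_digraph \<Rightarrow> ('a \<Rightarrow> 'b) \<Rightarrow> ('a \<Rightarrow> 'b) \<Rightarrow> 'a \<Rightarrow> ('b \<times> 'b) list set"
  where
  "realizable_walks G H \<alpha> \<beta> q =
     {Q \<in> pi_hom H (\<alpha> q) (\<beta> q).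
        \<exists>\<sigma>. recoloring_sequence G H \<alpha> \<beta> \<sigma> \<and> monochromatic_neighborhood G \<sigma> \<and>
            same_reduction Q (vertex_walk G \<sigma> q)}"

text \<open>Steps are numbered from 0 here: step \<open>i\<close> is \<open>(a\<^sub>i\<^sub>+\<^sub>1, a\<^sub>i\<^sub>+\<^sub>2)\<close> in the notation
  \<open>a\<^sub>1 a\<^sub>2 \<dots> a\<^sub>n\<close>.\<close>

definition zigzag ::
  "'a pair_pre_digraph \<Rightarrow> 'b pair_pre_digraph \<Rightarrow> 'a \<Rightarrow> ('b \<times> 'b) list \<Rightarrow> bool" where
  "zigzag G H v w \<longleftrightarrow>
     ((\<exists>u. (u, v) \<in> parcs G) \<longrightarrow>
        (\<forall>i<length w. (if even i then prod.swap (w ! i) else w ! i) \<in> parcs H)) \<and>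
     ((\<exists>u. (v, u) \<in> parcs G) \<longrightarrow>
        (\<forall>i<length w. (if even i then w ! i else prod.swap (w ! i)) \<in> parcs H))"

definition zigzag_walks ::
  "'a pair_pre_digraph \<Rightarrow> 'b pair_pre_digraph \<Rightarrow> ('a \<Rightarrow> 'b) \<Rightarrow> ('a \<Rightarrow> 'b) \<Rightarrow> 'a \<Rightarrow> ('b \<times> 'b) list set"
  where
  "zigzag_walks G H \<alpha> \<beta> q =
     {Q \<in> pi_hom H (\<alpha> q) (\<beta> q). even (length Q) \<and> zigzag G H q Q}"

text \<open>The reduced walks equal to \<open>R\<^sup>n P\<close> for some integer \<open>n\<close>, where \<open>R\<close> is a closed walk at
  \<open>a\<close> and \<open>P\<close> a walk from \<open>a\<close> to \<open>b\<close>.\<close>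

definition power_walks ::
  "'b pair_pre_digraph \<Rightarrow> 'b \<Rightarrow> 'b \<Rightarrow> ('b \<times> 'b) list \<Rightarrow> ('b \<times> 'b) list \<Rightarrow> ('b \<times> 'b) list set" where
  "power_walks H a b R P =
     {Q \<in> pi_hom H a b. \<exists>n::int. same_reduction Q (walk_power R n @ P)}"


section \<open>Running time\<close>

text \<open>A uniform-cost random access machine over the natural numbers, as a small structured
  language. A program has finitely many registers and finitely many arrays of unbounded length
  (equivalently, one memory into which these arrays are interleaved). The arithmetic
  operations are addition and truncated subtraction only: without multiplication, unit cost is
  a realistic measure. An assignment or a test costs one unit; the expressions of a fixed
  program have bounded size, so this is the number of elementary operations up to a constant
  factor.\<close>

record ram_state =
  regs :: "string \<Rightarrow> nat"
  arrs :: "string \<Rightarrow> nat \<Rightarrow> nat"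

datatype aexp =
    Const nat
  | Reg string
  | Read string aexp
  | Add aexp aexp
  | Sub aexp aexp

datatype bexp =
    Less aexp aexp
  | Neg bexp
  | Conj bexp bexp

datatype com =
    Skip
  | Assign string aexp
  | Store string aexp aexp
  | Seq com com
  | Cond bexp com com
  | While bexp com

primrec aval :: "aexp \<Rightarrow> ram_state \<Rightarrow> nat" where
  "aval (Const k) s = k"
| "aval (Reg x) s = regs s x"
| "aval (Read A e) s = arrs s A (aval e s)"
| "aval (Add e f) s = aval e s + aval f s"
| "aval (Sub e f) s = aval e s - aval f s"

primrec bval :: "bexp \<Rightarrow> ram_state \<Rightarrow> bool" where
  "bval (Less e f) s \<longleftrightarrow> aval e s < aval f s"
| "bval (Neg b) s \<longleftrightarrow> \<not> bval b s"
| "bval (Conj b c) s \<longleftrightarrow> bval b s \<and> bval c s"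

text \<open>\<open>exec c s t s'\<close>: started in \<open>s\<close>, the program \<open>c\<close> halts in \<open>s'\<close> after time \<open>t\<close>.\<close>

inductive exec :: "com \<Rightarrow> ram_state \<Rightarrow> nat \<Rightarrow> ram_state \<Rightarrow> bool" where
  Skip: "exec Skip s 1 s"
| Assign: "exec (Assign x e) s 1 (s\<lparr>regs := (regs s)(x := aval e s)\<rparr>)"
| Store: "exec (Store A i e) s 1
     (s\<lparr>arrs := (arrs s)(A := (arrs s A)(aval i s := aval e s))\<rparr>)"
| Seq: "exec c s t s' \<Longrightarrow> exec d s' t' s'' \<Longrightarrow> exec (Seq c d) s (t + t') s''"
| CondTrue: "bval b s \<Longrightarrow> exec c s t s' \<Longrightarrow> exec (Cond b c d) s (Suc t) s'"
| CondFalse: "\<not> bval b s \<Longrightarrow> exec d s t s' \<Longrightarrow> exec (Cond b c d) s (Suc t) s'"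
| WhileFalse: "\<not> bval b s \<Longrightarrow> exec (While b c) s 1 s"
| WhileTrue: "bval b s \<Longrightarrow> exec c s t s' \<Longrightarrow> exec (While b c) s' t' s'' \<Longrightarrow>
     exec (While b c) s (Suc (t + t')) s''"

text \<open>Digraphs are given by out- and in-adjacency lists, in arbitrary order. The lists of the
  vertices \<open>0, 1, \<dots>, n - 1\<close> are stored consecutively in one array; a second array of length
  \<open>n + 1\<close> holds the positions at which they begin (the last entry being the total length).\<close>

definition adj_lists :: "nat pair_pre_digraph \<Rightarrow> (nat \<Rightarrow> nat set) \<Rightarrow> nat list list \<Rightarrow> bool" where
  "adj_lists G N L \<longleftrightarrow>
     length L = card (pverts G) \<and> (\<forall>v<length L. distinct (L ! v) \<and> set (L ! v) = N v)"

definition out_lists :: "nat pair_pre_digraph \<Rightarrow> nat list list \<Rightarrow> bool" where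
  "out_lists G L \<longleftrightarrow> adj_lists G (\<lambda>v. {w. (v, w) \<in> parcs G}) L"

definition in_lists :: "nat pair_pre_digraph \<Rightarrow> nat list list \<Rightarrow> bool" where
  "in_lists G L \<longleftrightarrow> adj_lists G (\<lambda>v. {u. (u, v) \<in> parcs G}) L"

definition offsets :: "nat list list \<Rightarrow> nat list" where
  "offsets L = map (\<lambda>v. length (concat (take v L))) [0..<Suc (length L)]"

definition arr :: "nat list \<Rightarrow> nat \<Rightarrow> nat" where
  "arr xs i = (if i < length xs then xs ! i else 0)"

definition input_state ::
  "nat pair_pre_digraph \<Rightarrow> nat pair_pre_digraph \<Rightarrow> (nat \<Rightarrow> nat) \<Rightarrow> (nat \<Rightarrow> nat) \<Rightarrow> ram_state \<Rightarrow> bool"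
  where
  "input_state G H \<alpha> \<beta> s \<longleftrightarrow>
     (\<exists>GO GI HO HI.
        out_lists G GO \<and> in_lists G GI \<and> out_lists H HO \<and> in_lists H HI \<and>
        s = \<lparr> regs = (\<lambda>_. 0)(''nG'' := card (pverts G), ''nH'' := card (pverts H)),
              arrs = (\<lambda>_ _. 0)
                (''G_out'' := arr (concat GO), ''G_out_off'' := arr (offsets GO),
                 ''G_in'' := arr (concat GI), ''G_in_off'' := arr (offsets GI),
                 ''H_out'' := arr (concat HO), ''H_out_off'' := arr (offsets HO),
                 ''H_in'' := arr (concat HI), ''H_in_off'' := arr (offsets HI),
                 ''alpha'' := arr (map \<alpha> [0..<card (pverts G)]),
                 ''beta'' := arr (map \<beta> [0..<card (pverts G)])) \<rparr>)"

text \<open>A walk with \<open>l\<close> steps is output as \<open>l\<close>, in register \<open>X\<close>, and its \<open>l + 1\<close> successive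
  vertices, in array \<open>X\<close>.\<close>

definition output_walk :: "ram_state \<Rightarrow> string \<Rightarrow> (nat \<times> nat) list" where
  "output_walk s X = map (\<lambda>i. (arrs s X i, arrs s X (Suc i))) [0..<regs s X]"

definition standard_vertices :: "nat pair_pre_digraph \<Rightarrow> bool" where
  "standard_vertices G \<longleftrightarrow> pverts G = {..<card (pverts G)}"

end

theory Submission
 imports Defs
begin

text \<open>Write the groupoid in terms of vertex lists in normal form. Fix a spanning tree with root \<open>q\<close>; a
  reduced walk \<open>Q\<close> from \<open>\<alpha> q\<close> to \<open>\<beta> q\<close> determines a walk \<open>S v\<close> for every vertex \<open>v\<close>. It is
  realizable iff for every arc the two ways of transporting \<open>Q\<close> around the fundamental cycle agree, every
  \<open>S v\<close> satisfies the zigzag condition, and \<open>S v\<close> is trivial on every vertex of a bi-infinite walk whose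
  \<open>\<alpha>\<close>-image is reduced: then one can always find a vertex that is free to move one step along
  \<open>S v\<close>. Each of these tests is closed under the heap operation \<open>Q\<^sub>1 Q\<^sub>2\<^sup>-\<^sup>1 Q\<^sub>3\<close>.

  If some fundamental cycle has a nontrivial \<open>\<alpha>\<close>-image, then \<open>Q\<close> must translate its axis to the axis of
  the \<open>\<beta>\<close>-image, so the candidates form a progression \<open>R\<^sup>n P\<close>. A test passed by a candidate far away from
  the origin is passed by all of them; so if some candidate fails a test, the only one that can pass it lies in
  a window of length \<open>O(|V(G)|)\<close>. Otherwise all arc tests are trivial, and either all zigzag walks at \<open>q\<close>
  are realizable or a vertex with both in- and out-arcs whose tree path has an image using a one-way arc of \<open>H\<close>
  leaves a single candidate. Hence \<open>q\<close> is chosen with both in- and out-arcs if possible.\<close>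

text \<open>Walks are vertex lists in which a repeated vertex cancels too: composition is plain
  append, and a closed walk that cancels leaves its base vertex behind. The time bound is the
  obstacle. Verifying one candidate against all tests costs \<open>|V(G)| |E(G)|\<close> up to a
  constant, and the window holds about \<open>|V(G)|\<close> candidates. But a rejected candidate
  exhibits one failed test, and one test costs only \<open>|V(G)|\<close> per candidate; scanning
  the window with that test leaves at most one candidate. So two full verifications suffice, and the
  quadratic cost of the scans is absorbed by \<open>|V(G)| <= 2 |E(G)|\<close>. The tests at tight
  walks are not listed in advance: when the arc and zigzag tests hold, a blocked vertex has a
  neighbor that must move as well, and peeling off unblocked vertices uncovers a tight walk that
  fails. The summand \<open>|E(H)|\<close> uses that arrays are 0 initially: an adjacency matrix of
  \<open>H\<close> costs one store per arc. The window constant 16 covers test words conjugated by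
  tails and tree paths (at most 6 + 6) and one period (at most 2), in units of
  \<open>|V(G)| + 1\<close>.\<close>

abbreviation (input) iff_notation :: "bool => bool => bool" (infixr "<->" 25) where
 "A <-> B == A = B"

section \<open>Normal forms of vertex lists\<close>

text \<open>The top of the stack is the head. Pushing the top again is a loop step; pushing the
  vertex below the top is a backtrack and pops. Since stuttering counts as a reduction, walks with a
  common endpoint compose by append.\<close>

fun push :: "'b => 'b list => 'b list" where
 "push x [] = [x]"
| "push x [y] = (if x = y then [y] else [x, y])"
| "push x (y # z # zs) = (if x = y then y # z # zs else if x = z then z # zs else x # y # z # zs)"

fun red :: "'b list => bool" where
 "red (x # y # z # zs) <-> x ~= y & x ~= z & red (y # z # zs)"
| "red [x, y] <-> x ~= y"
| "red _ <-> True"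

definition nf :: "'b list => 'b list" where
 "nf xs = rev (fold push xs [])"

lemma red_push: "red st ==> red (push x st)"
 by (induction x st rule: push.induct) (auto elim: red.elims)

lemma red_fold_push: "red st ==> red (fold push xs st)"
 by (induction xs arbitrary: st) (auto intro: red_push)

text \<open>The condition is local and symmetric, so prefixes, suffixes and reversals of reduced
  lists are reduced.\<close>

lemma red_iff: "red xs <-> (ALL i. Suc i < length xs --> xs ! i ~= xs ! Suc i) &
  (ALL i. Suc (Suc i) < length xs --> xs ! i ~= xs ! Suc (Suc i))"
proof (induction xs rule: red.induct)
 case (1 x y z zs)
 show ?case (is "_ <-> ?r")
 proof
  assume "red (x # y # z # zs)"
  with 1 show ?r by (auto simp: nth_Cons split: nat.splits)
 next
  assume r: ?r
  from r have "x ~= y" "x ~= z" by (auto dest: spec[of _ 0])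
  moreover have "red (y # z # zs)" unfolding 1
   using r by (metis Suc_less_eq length_Cons nth_Cons_Suc)
  ultimately show "red (x # y # z # zs)" by simp
 qed
next
 case (2 x y) thus ?case by (auto simp: less_Suc_eq)
qed auto

lemma red_rev_imp: "red xs ==> red (rev xs)"
 unfolding red_iff
proof (intro conjI allI impI; elim conjE)
 fix i assume a: "ALL i. Suc i < length xs --> xs ! i ~= xs ! Suc i" and i: "Suc i < length (rev xs)"
 show "rev xs ! i ~= rev xs ! Suc i"
 proof -
  obtain k where "length xs = Suc (Suc (i + k))" using i less_iff_Suc_add by auto
  thus ?thesis using a[rule_format, of k] by (auto simp: rev_nth)
 qed
next
 fix i assume a: "ALL i. Suc (Suc i) < length xs --> xs ! i ~= xs ! Suc (Suc i)" and i: "Suc (Suc i) < length (rev xs)"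
 obtain k where "length xs = Suc (Suc (Suc (i + k)))" using i less_iff_Suc_add by auto
 thus "rev xs ! i ~= rev xs ! Suc (Suc i)"
  using a[rule_format, of k] by (auto simp: rev_nth)
qed

lemma red_rev[simp]: "red (rev xs) <-> red xs"
 using red_rev_imp[of xs] red_rev_imp[of "rev xs"] by auto

lemma red_nf[simp]: "red (nf xs)"
 by (simp add: nf_def red_fold_push)

lemma red_take: "red xs ==> red (take k xs)"
 by (auto simp: red_iff)

lemma red_drop: "red xs ==> red (drop k xs)"
 by (auto simp: red_iff)

lemma red_appendD1: "red (xs @ ys) ==> red xs"
 using red_take[of "xs @ ys" "length xs"] by simp

lemma red_appendD2: "red (xs @ ys) ==> red ys"
 using red_drop[of "xs @ ys" "length xs"] by simp

lemma push_red_Cons: "red (x # st) ==> push x st = x # st"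
 by (cases "(x, st)" rule: push.cases) auto

lemma nf_red[simp]: "red xs ==> nf xs = xs"
proof (induction xs rule: rev_induct)
 case (snoc x xs)
 from snoc.prems have "red (rev (xs @ [x]))" by (simp only: red_rev)
 hence "push x (rev xs) = x # rev xs" by (intro push_red_Cons) simp
 moreover have "fold push xs [] = rev xs"
  using snoc.IH red_appendD1[OF snoc.prems] by (metis nf_def rev_rev_ident)
 ultimately show ?case by (simp add: nf_def)
qed (simp add: nf_def)

lemma nf_nf[simp]: "nf (nf xs) = nf xs" by simp

lemma push_neq_Nil[simp]: "push x st ~= []"
 by (cases "(x, st)" rule: push.cases) auto

lemma hd_push[simp]: "hd (push x st) = x"
 by (cases "(x, st)" rule: push.cases) auto

lemma last_push[simp]: "last (push x st) = (if st = [] then x else last st)"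
 by (cases "(x, st)" rule: push.cases) auto

lemma push_push_same[simp]: "push x (push x st) = push x st"
 by (cases "(x, st)" rule: push.cases) (auto, (metis push.simps(1,2,3) list.exhaust)+)

text \<open>The backtrack rule at the level of stacks; it is what makes the order of reductions
  irrelevant.\<close>

lemma push_back: "red st ==> push x (push y (push x st)) = push x st"
proof -
 assume r: "red st"
 define t where "t = push x st"
 have t: "red t" "hd t = x" "t ~= []" using r by (simp_all add: t_def red_push)
 then obtain r where tr: "t = x # r" by (metis list.collapse)
 show ?thesis
 proof (cases "y = x")
  case False
  show ?thesis unfolding t_def[symmetric]
  proof (cases r)
   case Nil thus "push x (push y t) = t" using False tr by auto
  next
   case (Cons z zs)
   thus "push x (push y t) = t" using False tr t
    by (cases zs) auto
  qed
 qed simp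
qed

lemma fold_push_neq_Nil: "xs ~= [] ==> fold push xs st ~= []"
 by (induction xs rule: rev_induct) auto

lemma nf_eq_Nil[simp]: "nf xs = [] <-> xs = []"
 using fold_push_neq_Nil[of xs "[]"] by (auto simp: nf_def)

lemma nf_Nil[simp]: "nf [] = []" by simp

lemma last_nf[simp]: "last (nf xs) = last xs"
 by (cases xs rule: rev_cases) (auto simp: nf_def last_rev)

lemma last_fold_push: "st ~= [] ==> last (fold push xs st) = last st"
 by (induction xs arbitrary: st) auto

lemma hd_nf[simp]: "hd (nf xs) = hd xs"
 by (cases xs) (auto simp: nf_def hd_rev last_fold_push)

lemma nf_snoc: "nf (xs @ [x]) = rev (push x (rev (nf xs)))"
 by (simp add: nf_def)

text \<open>Confluence. In the induction a pop inside \<open>nf xs\<close> corresponds to a detour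
  in \<open>xs\<close>, which \<open>push_back\<close> removes. This makes \<open>nf\<close> a
  congruence for append.\<close>

lemma fold_push_nf: "red st ==> fold push (nf xs) st = fold push xs st"
proof (induction xs rule: rev_induct)
 case (snoc x xs)
 define r where "r = rev (nf xs)"
 have IH: "fold push (rev r) st = fold push xs st" using snoc by (simp add: r_def)
 have "fold push (rev (push x r)) st = push x (fold push (rev r) st)"
 proof (cases "(x, r)" rule: push.cases)
  case (3 x' y z zs)
  show ?thesis
  proof (cases "x = z & x ~= y")
   case True
   have "red (fold push (rev zs) st)" using snoc.prems by (rule red_fold_push)
   thus ?thesis using 3 True by (auto simp: push_back)
  qed (use 3 in auto)
 qed auto
 thus ?case using IH by (simp add: nf_snoc r_def)
qed simp

lemma nf_append: "nf (xs @ ys) = rev (fold push ys (rev (nf xs)))"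
 by (simp add: nf_def)

lemma nf_nf_append[simp]: "nf (nf xs @ ys) = nf (xs @ ys)"
 by (simp add: nf_append)

lemma nf_append_nf[simp]: "nf (xs @ nf ys) = nf (xs @ ys)"
 by (simp add: nf_append fold_push_nf)

lemma nf_append_nf2[simp]: "nf (xs @ nf ys @ zs) = nf (xs @ ys @ zs)"
 by (metis append.assoc nf_append_nf nf_nf_append)

lemma nf_cong: "nf X = nf Y ==> nf (A @ X @ B) = nf (A @ Y @ B)"
 by (metis nf_append_nf2)

lemma nf_cong_l: "nf X = nf Y ==> nf (X @ B) = nf (Y @ B)"
 using nf_cong[of X Y "[]"] by simp

lemma nf_cong_r: "nf X = nf Y ==> nf (A @ X) = nf (A @ Y)"
 using nf_cong[of X Y _ "[]"] by simp

lemma nf_dup: "nf (A @ x # x # B) = nf (A @ x # B)"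
 using nf_cong[of "[x,x]" "[x]" A B] by (simp add: nf_def)

lemma nf_back: "nf (A @ x # y # x # B) = nf (A @ x # B)"
 using nf_cong[of "[x,y,x]" "[x]" A B] by (simp add: nf_def)

text \<open>The vertex \<open>hd X\<close> stays behind, since the surrounding lists need not
  contain the common endpoint.\<close>

lemma nf_cancel: "X ~= [] ==> nf (A @ X @ rev X @ B) = nf (A @ hd X # B)"
proof (induction X arbitrary: A B)
 case (Cons x X)
 show ?case
 proof (cases X)
  case Nil thus ?thesis by (simp add: nf_dup)
 next
  case (Cons y Y)
  hence "nf ((A @ [x]) @ X @ rev X @ (x # B)) = nf ((A @ [x]) @ hd X # x # B)"
   using Cons.IH[of "A @ [x]" "x # B"] by simp
  thus ?thesis using Cons by (simp add: nf_back)
 qed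
qed simp

lemma nf_cancel': "X ~= [] ==> nf (A @ rev X @ X @ B) = nf (A @ last X # B)"
 using nf_cancel[of "rev X" A B] by (simp add: hd_rev)

lemma nf_join: "X ~= [] ==> last X = y ==> nf (A @ X @ y # B) = nf (A @ X @ B)"
 by (cases X rule: rev_cases) (use nf_dup[of "A @ _"] in auto)

lemma nf_join': "Y ~= [] ==> hd Y = x ==> nf (A @ x # Y @ B) = nf (A @ Y @ B)"
 by (cases Y) (auto simp: nf_dup)

text \<open>The stack reads from the left, so invariance under reversal is not visible in the
  definition. The argument is uniqueness of inverses: \<open>rev X\<close> reduces like
  \<open>rev X @ Y @ rev Y\<close>, hence like \<open>rev X @ X @ rev Y\<close>, hence like
  \<open>rev Y\<close>.\<close>

lemma nf_rev_cong: assumes "nf X = nf Y" shows "nf (rev X) = nf (rev Y)"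
proof (cases "X = []")
 case True thus ?thesis using assms nf_eq_Nil by metis
next
 case False
 hence Y: "Y ~= []" using assms nf_eq_Nil by metis
 have h: "hd X = hd Y" "last X = last Y" using assms hd_nf last_nf by metis+
 have "nf (rev X) = nf (rev X @ [hd X])" using nf_join[of "rev X" "hd X" "[]" "[]"] False by (simp add: last_rev)
 also have "\<dots> = nf (rev X @ Y @ rev Y)" using nf_cancel[OF Y, of "rev X" "[]"] h by simp
 also have "\<dots> = nf (rev X @ X @ rev Y)" using nf_cong[OF assms, of "rev X" "rev Y"] by simp
 also have "\<dots> = nf (last X # rev Y)" using nf_cancel'[OF False, of "[]" "rev Y"] by simp
 also have "\<dots> = nf (rev Y)" using nf_join'[of "rev Y" "last X" "[]" "[]"] Y h by (simp add: hd_rev)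
 finally show ?thesis .
qed

lemma nf_rev: "nf (rev X) = rev (nf X)"
proof -
 have "nf (rev X) = nf (rev (nf X))" by (rule nf_rev_cong) simp
 also have "\<dots> = rev (nf X)" by (intro nf_red) simp
 finally show ?thesis .
qed

lemma set_push: "set (push x st) <= insert x (set st)"
 by (cases "(x, st)" rule: push.cases) auto

lemma set_nf: "set (nf xs) <= set xs"
proof (induction xs rule: rev_induct)
 case (snoc x xs) thus ?case using set_push[of x "rev (nf xs)"] by (auto simp: nf_snoc)
qed simp

lemma length_push: "length (push x st) <= Suc (length st)"
 by (cases "(x, st)" rule: push.cases) auto

lemma length_nf: "length (nf xs) <= length xs"
proof (induction xs rule: rev_induct)
 case (snoc x xs) thus ?case using length_push[of x "rev (nf xs)"] by (auto simp: nf_snoc)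
qed simp

lemma length_nf_1: "length (nf X) = 1 <-> X ~= [] & nf X = [hd X]"
 by (metis One_nat_def hd_nf length_0_conv length_Suc_conv list.sel(1) list.size(3) nat.distinct(1) nf_eq_Nil)

text \<open>The cancellation of two reduced walks takes place in one block \<open>c\<close>.\<close>

lemma red_append_decomp:
 assumes "red X" "red Y" "X ~= []" "Y ~= []" "last X = hd Y"
 shows "EX A c B. c ~= [] & X = A @ c & Y = rev c @ B & red (A @ hd c # B)"
 using assms
proof (induction X arbitrary: Y rule: rev_induct)
 case (snoc x X)
 obtain Y' where Y: "Y = x # Y'" using snoc.prems by (cases Y) auto
 show ?case
 proof (cases "X = [] | Y' = [] | last X ~= hd Y'")
  case True
  have "red (X @ x # Y')"
  proof (cases "X = [] | Y' = []")
   case True thus ?thesis using snoc.prems Y by auto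
  next
   case False
   then obtain X1 a b Y1 where e: "X = X1 @ [a]" "Y' = b # Y1" by (metis rev_exhaust list.exhaust)
   have ab: "a ~= b" using True False e by auto
   have r1: "red (X1 @ [a, x])" using snoc.prems e by simp
   have r2: "red (x # b # Y1)" using snoc.prems e Y by simp
   have "red (X1 @ a # x # b # Y1)" using r1
   proof (induction X1)
    case Nil thus ?case using r2 ab by simp
   next
    case (Cons u X1)
    thus ?case
     by (cases X1; cases "tl X1") (auto elim: red.elims)
   qed
   thus ?thesis using e by simp
  qed
  thus ?thesis using Y by (intro exI[of _ X] exI[of _ "[x]"] exI[of _ Y']) auto
 next
  case False
  then obtain A c B where d: "c ~= []" "X = A @ c" "Y' = rev c @ B" "red (A @ hd c # B)"
   using snoc.IH[of Y'] red_appendD1[of X "[x]"] red_appendD2[of "[x]" Y'] snoc.prems Y by auto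
  thus ?thesis using Y
   by (intro exI[of _ A] exI[of _ "c @ [x]"] exI[of _ B]) auto
 qed
qed simp

lemma nf_decomp:
 assumes "c ~= []" "red (A @ hd c # B)"
 shows "nf ((A @ c) @ (rev c @ B)) = A @ hd c # B"
 using nf_cancel[OF assms(1), of A B] assms(2) by simp

section \<open>Zigzag walks and bi-infinite walks\<close>

text \<open>\<open>E x y\<close> relates a vertex \<open>x\<close> in an even position to a neighbor
  \<open>y\<close> in an odd position; the flag says whether the list begins in an even
  position.\<close>

fun zz :: "('b => 'b => bool) => bool => 'b list => bool" where
 "zz E p (x # y # r) <-> (if p then E x y else E y x) & zz E (~ p) (y # r)"
| "zz E p _ <-> True"

lemma zz_append:
 "zz E p (xs @ x # ys) <-> zz E p (xs @ [x]) & zz E (p = even (length xs)) (x # ys)"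
proof (induction xs arbitrary: p)
 case (Cons a xs)
 show ?case using Cons.IH[of "~ p"] by (cases xs; cases "even (length xs)") auto
qed simp

lemma zz_rev: "zz E p (rev xs) <-> zz E (p = odd (length xs)) xs"
proof (induction xs arbitrary: p)
 case (Cons x xs)
 show ?case
 proof (cases xs)
  case (Cons y zs)
  have "zz E p (rev (x # xs)) <-> zz E p (rev xs) & zz E (p = even (length zs)) [y, x]"
   using zz_append[of E p "rev zs" y "[x]"] Cons by simp
  thus ?thesis unfolding Cons.IH by (cases "even (length zs)") (use Cons in auto)
 qed simp
qed simp

lemma zz_mono: "zz E p xs ==> (!!x y. E x y ==> E' x y) ==> zz E' p xs"
 by (induction E p xs rule: zz.induct) (auto split: if_splits)

lemma zz_flip: "zz E (~ p) xs <-> zz (%x y. E y x) p xs"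
 by (induction E p xs rule: zz.induct) auto

text \<open>Irreflexivity rules out stutters, so a reduction only deletes pairs of vertices, and
  every survivor keeps the parity of its position.\<close>

lemma zz_nf:
 assumes "irreflp E" "zz E p xs"
 shows "zz E p (nf xs) & (even (length (nf xs)) <-> even (length xs))"
 using assms(2)
proof (induction xs rule: rev_induct)
 case (snoc x xs)
 show ?case
 proof (cases "xs = []")
  case False
  then obtain xs' y where xs: "xs = xs' @ [y]" by (metis rev_exhaust)
  have z: "zz E p xs" "zz E (p = even (length xs')) [y, x]"
   using snoc.prems zz_append[of E p xs' y "[x]"] xs by auto
  have IH: "zz E p (nf xs)" "even (length (nf xs)) <-> even (length xs)" using snoc.IH z by auto
  have "last (nf xs) = y" "nf xs ~= []" using xs by auto
  then obtain N where N: "nf xs = N @ [y]" by (metis append_butlast_last_id)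
  have xy: "x ~= y" using z(2) assms(1) by (auto simp: irreflp_def split: if_splits)
  show ?thesis
  proof (cases "EX M. N = M @ [x]")
   case True
   then obtain M where M: "N = M @ [x]" by auto
   hence "nf (xs @ [x]) = M @ [x]" using xy N by (simp add: nf_snoc)
   thus ?thesis using IH N M zz_append[of E p M x "[y]"] by simp
  next
   case False
   hence "nf (xs @ [x]) = N @ [y, x]" using xy N by (cases N rule: rev_cases) (auto simp: nf_snoc)
   moreover have "even (length N) = even (length xs')" using IH(2) N xs by simp
   ultimately show ?thesis using IH N zz_append[of E p N y "[x]"] z(2) xs by simp
  qed
 qed (simp add: nf_def)
qed simp

text \<open>An odd number of vertices is an even number of steps.\<close>

definition zo :: "('b => 'b => bool) => 'b list => bool" where
 "zo E xs <-> zz E True xs & odd (length xs)"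

lemma zo_nf: "irreflp E ==> zo E xs ==> zo E (nf xs)"
 using zz_nf[of E True xs] by (auto simp: zo_def)

lemma zo_rev: "zo E xs ==> zo E (rev xs)"
 by (simp add: zo_def zz_rev)

lemma zo_nonempty: "zo E xs ==> xs ~= []"
 by (auto simp: zo_def)

lemma zo_append_tl:
 assumes "zo E A" "zo E B" "last A = hd B"
 shows "zo E (A @ tl B)"
proof -
 obtain A' y where A: "A = A' @ [y]" using assms zo_nonempty by (metis rev_exhaust)
 obtain B' where B: "B = y # B'" using assms zo_nonempty A by (metis last_snoc list.collapse)
 show ?thesis using assms A B zz_append[of E True A' y B'] by (auto simp: zo_def)
qed

lemma nf_append_tl: "A ~= [] ==> B ~= [] ==> last A = hd B ==> nf (A @ tl B) = nf (A @ B)"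
 by (cases A rule: rev_cases; cases B) (use nf_dup[of _ "hd B" "tl B"] in auto)

lemma zo_join:
 assumes "irreflp E" "zo E A" "zo E B" "last A = hd B"
 shows "zo E (nf (A @ B))"
 using zo_nf[OF assms(1) zo_append_tl[OF assms(2-4)]] nf_append_tl[of A B] assms zo_nonempty by metis

text \<open>Used to pass to a neighboring vertex of \<open>G\<close>: a new first vertex shifts all
  positions by one, so \<open>E\<close> has to contain the converse of \<open>E'\<close>.\<close>

lemma zo_ends:
 assumes "zo E' X" "!!x y. E' x y ==> E y x" "E a (hd X)" "E b (last X)"
 shows "zo E (a # X @ [b])"
proof -
 obtain X' y where X: "X = X' @ [y]" using assms(1) zo_nonempty by (metis rev_exhaust)
 have "zz (%x y. E y x) True X" using assms(1,2) zz_mono by (metis zo_def)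
 hence "zz E False X" using zz_flip[of E True X] by simp
 hence "zz E False (X' @ y # [b])"
  unfolding zz_append[of _ _ X' y "[b]"] using assms X by (auto simp: zo_def)
 thus ?thesis using assms X by (cases X') (auto simp: zo_def)
qed

text \<open>The number of genuine steps; its parity is invariant under both reduction rules.\<close>

fun flips :: "'b list => nat" where
 "flips (x # y # r) = (if x = y then 0 else 1) + flips (y # r)"
| "flips _ = 0"

lemma flips_append: "flips (xs @ x # ys) = flips (xs @ [x]) + flips (x # ys)"
proof (induction xs)
 case (Cons a xs) thus ?case by (cases xs) auto
qed simp

lemma flips_join: "xs ~= [] ==> ys ~= [] ==> last xs = hd ys ==> flips (xs @ ys) = flips xs + flips ys"
 by (cases xs rule: rev_cases; cases ys) (use flips_append[of _ "hd ys" ys] in auto)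

lemma even_length_nf: "xs ~= [] ==> even (length (nf xs)) <-> odd (flips xs)"
proof (induction xs rule: rev_induct)
 case (snoc x xs)
 show ?case
 proof (cases "xs = []")
  case False
  then obtain xs' y where xs: "xs = xs' @ [y]" by (metis rev_exhaust)
  have f: "flips (xs @ [x]) = flips xs + (if y = x then 0 else 1)"
   using flips_append[of xs' y "[x]"] xs by simp
  have "last (nf xs) = y" "nf xs ~= []" using xs by auto
  then obtain N where N: "nf xs = N @ [y]" by (metis append_butlast_last_id)
  have IH: "even (length (nf xs)) <-> odd (flips xs)" using snoc False by auto
  show ?thesis
  proof (cases "x = y")
   case True
   thus ?thesis using f IH N by (cases N rule: rev_cases) (auto simp: nf_snoc)
  next
   case False
   thus ?thesis using f IH N by (cases N rule: rev_cases) (auto simp: nf_snoc)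
  qed
 qed (simp add: nf_def)
qed simp

section \<open>Segments of bi-infinite walks\<close>

definition sg :: "(int => 'b) => int => int => 'b list" where
 "sg f i j = map f (if i <= j then [i..j] else rev [j..i])"

definition bired :: "(int => 'b) => bool" where
 "bired f <-> (ALL i. f i ~= f (i + 1) & f i ~= f (i + 2))"

definition per :: "(int => 'b) => int => bool" where
 "per f p <-> (ALL i. f (i + p) = f i)"

lemma sg_neq_Nil[simp]: "sg f i j ~= []" by (auto simp: sg_def)

lemma hd_sg[simp]: "hd (sg f i j) = f i"
 by (auto simp: sg_def hd_map hd_rev last_map upto_rec1[of i j] upto_rec2[of j i])

lemma rev_sg: "rev (sg f i j) = sg f j i"
 by (auto simp: sg_def rev_map)

lemma last_sg[simp]: "last (sg f i j) = f j"
 by (metis hd_rev hd_sg rev_sg)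

lemma length_sg[simp]: "length (sg f i j) = Suc (nat \<bar>j - i\<bar>)"
 by (auto simp: sg_def)

lemma sg_self[simp]: "sg f i i = [f i]" by (simp add: sg_def)

lemma nth_sg: "i <= j ==> int t <= j - i ==> sg f i j ! t = f (i + int t)"
 by (simp add: sg_def)

lemma sg_shift: "(!!i. g i = f (i + p)) ==> sg g i j = sg f (i + p) (j + p)"
proof -
 assume g: "!!i. g i = f (i + p)"
 have "map g [i..j] = map f [i+p..j+p]" for i j
  by (rule nth_equalityI) (auto simp: g algebra_simps)
 thus ?thesis by (auto simp: sg_def rev_map[symmetric])
qed

lemma red_sg: "bired f ==> red (sg f i j)"
proof -
 assume f: "bired f"
 have "red (sg f i j)" if "i <= j" for i j
  unfolding red_iff
 proof (intro conjI allI impI)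
  fix t assume "Suc t < length (sg f i j)"
  thus "sg f i j ! t ~= sg f i j ! Suc t"
   using that f by (simp add: nth_sg bired_def) (metis add.assoc add.commute)
 next
  fix t assume "Suc (Suc t) < length (sg f i j)"
  thus "sg f i j ! t ~= sg f i j ! Suc (Suc t)"
   using that f spec[of "%i. f i ~= f (i + 1) & f i ~= f (i + 2)" "i + int t"]
   by (simp add: nth_sg bired_def algebra_simps)
 qed
 thus ?thesis by (metis linear red_rev rev_sg)
qed

lemma nf_sg_step: "nf (sg f i j @ [f (j + 1)]) = nf (sg f i (j + 1))"
proof (cases "i <= j")
 case True
 hence "sg f i (j + 1) = sg f i j @ [f (j + 1)]" by (simp add: sg_def upto_rec2[of i "j+1"])
 thus ?thesis by simp
next
 case False
 hence "sg f j i = f j # sg f (j + 1) i" by (simp add: sg_def upto_rec1[of j])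
 hence "sg f i j = sg f i (j + 1) @ [f j]" by (metis rev.simps(2) rev_sg)
 moreover have "sg f i (j + 1) = butlast (sg f i (j + 1)) @ [f (j + 1)]"
  by (metis append_butlast_last_id last_sg sg_neq_Nil)
 ultimately show ?thesis using nf_back[of "butlast (sg f i (j+1))" "f (j+1)" "f j" "[]"]
  by (metis append.assoc append_Cons append_Nil)
qed

lemma nf_sg_step': "nf (sg f i j @ [f (j - 1)]) = nf (sg f i (j - 1))"
proof -
 have m: "sg f i j = sg (%t. f (- t)) (- i) (- j)" for f :: "int => 'b" and i j
 proof -
  have "map (%t. f (- t)) [- j..- i] = rev (map f [i..j])" for i j
   by (rule nth_equalityI) (auto simp: rev_nth nat_diff_distrib)
  thus ?thesis by (simp add: sg_def rev_map[symmetric])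
 qed
 show ?thesis using nf_sg_step[of "%t. f (- t)" "- i" "- j"] by (simp only: m[of f]) simp
qed

text \<open>Segments may run in either direction, so no order of the three indices is assumed:
  overlapping pieces run against each other and cancel.\<close>

lemma nf_sg_trans0: "nf (sg f i j @ sg f j k) = nf (sg f i k)"
proof (induction k rule: int_induct[of _ j])
 case base
 thus ?case using nf_join[of "sg f i j" "f j" "[]" "[]"] by simp
next
 case (step1 k)
 have "nf (sg f i j @ sg f j (k + 1)) = nf (sg f i j @ sg f j k @ [f (k + 1)])"
  by (metis nf_append_nf nf_sg_step)
 also have "\<dots> = nf (sg f i k @ [f (k + 1)])" using nf_cong_l[OF step1(2)] by simp
 finally show ?case by (simp add: nf_sg_step)
next
 case (step2 k)
 have "nf (sg f i j @ sg f j (k - 1)) = nf (sg f i j @ sg f j k @ [f (k - 1)])"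
  by (metis nf_append_nf nf_sg_step')
 also have "\<dots> = nf (sg f i k @ [f (k - 1)])" using nf_cong_l[OF step2(2)] by simp
 finally show ?case by (simp add: nf_sg_step')
qed

lemma nf_sg_trans: "nf (A @ sg f i j @ sg f j k @ B) = nf (A @ sg f i k @ B)"
 using nf_cong[OF nf_sg_trans0[of f i j k], of A B] by simp

lemma per_mult: "per f p ==> f (i + k * p) = f i"
proof (induction k rule: int_induct[of _ 0])
 case (step1 k)
 have "f (i + (k + 1) * p) = f ((i + k * p) + p)" by (simp add: algebra_simps)
 thus ?case using step1 by (simp add: per_def)
next
 case (step2 k)
 have "f (i + k * p) = f ((i + (k - 1) * p) + p)" by (simp add: algebra_simps)
 thus ?case using step2 by (simp add: per_def)
qed simp

lemma per_agree:
 assumes "per f L" "per g L" "0 < L" "!!s. j <= s ==> s < j + L ==> f s = g (s + d)"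
 shows "f s = g (s + d)"
proof -
 define r where "r = j + (s - j) mod L"
 have s: "s = r + (s - j) div L * L" by (simp add: r_def)
 have "f r = g (r + d)" using assms(3,4) by (simp add: r_def)
 moreover have "f s = f r" using per_mult[OF assms(1), of r "(s - j) div L"] s by simp
 moreover have "g (s + d) = g (r + d)"
  using per_mult[OF assms(2), of "r + d" "(s - j) div L"] s by (simp add: algebra_simps)
 ultimately show ?thesis by simp
qed

text \<open>Far enough along the bi-infinite walks \<open>f\<close> and \<open>g\<close> neither \<open>X\<close> nor \<open>Y\<close> is felt, so both
  sides agree there on a whole period; hence \<open>g\<close> is a shift of \<open>f\<close> and \<open>X\<close> runs along \<open>f\<close>.\<close>

lemma axis_lemma:
 fixes f g :: "int => 'b"
 assumes "bired f" "bired g" "per f L" "per g L" "0 < L" "red X" "red Y" "X ~= []" "Y ~= []"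
  and ends: "last X = g 0" "hd Y = f N"
  and N: "int (length X) + int (length Y) + L <= N"
  and eq: "nf (X @ sg g 0 N) = nf (sg f 0 N @ Y)"
 shows "EX k. X = sg f 0 k & (ALL i. g i = f (i + k))"
proof -
 obtain A c B where d: "c ~= []" "X = A @ c" "sg g 0 N = rev c @ B" "red (A @ hd c # B)"
  using red_append_decomp[of X "sg g 0 N"] assms red_sg by (metis hd_sg sg_neq_Nil)
 obtain A' c' B' where d': "c' ~= []" "sg f 0 N = A' @ c'" "Y = rev c' @ B'" "red (A' @ hd c' # B')"
  using red_append_decomp[of "sg f 0 N" Y] assms red_sg by (metis last_sg sg_neq_Nil)
 have W: "A @ hd c # B = A' @ hd c' # B'"
  using nf_decomp[OF d(1,4)] nf_decomp[OF d'(1,4)] eq d(2,3) d'(2,3) by simp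
 \<comment> \<open>\<open>i\<close> is the index on \<open>g\<close> at which the cancellation with
   \<open>X\<close> ends, \<open>j\<close> the number of vertices of \<open>X\<close> in front of
   the cancelled block.\<close>
 define i j where "i = length c - 1" and "j = length A"
 have lc: "length c = Suc i" using d(1) by (cases c) (auto simp: i_def)
 have lX: "length X = j + Suc i" using d lc by (simp add: j_def)
 have N0: "0 <= N" using N assms(5) by simp
 have lB: "Suc i + length B = Suc (nat N)" using arg_cong[OF d(3), of length] lc N0 by simp
 have lA': "length A' + length c' = Suc (nat N)" using arg_cong[OF d'(2), of length] N0 by simp
 have c'Y: "length c' <= length Y" using d' by simp
 have g1: "rev c ! t = g (int t)" if "t <= i" for t
 proof -
  have "sg g 0 N ! t = rev c ! t" using d(3) that lc by (simp add: nth_append)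
  thus ?thesis using that lB nth_sg[of 0 N t g] N0 by simp
 qed
 have g2: "(A @ hd c # B) ! (j + t) = g (int (i + t))" if "i + t <= nat N" for t
 proof (cases t)
  case 0
  have "hd c = rev c ! i" using d(1) lc by (simp add: rev_nth hd_conv_nth)
  thus ?thesis using 0 g1[of i] by (simp add: j_def)
 next
  case (Suc t')
  have "(A @ hd c # B) ! (j + t) = B ! t'" using Suc by (simp add: j_def nth_append)
  also have "\<dots> = sg g 0 N ! (i + t)" using d(3) lc Suc by (simp add: nth_append)
  finally show ?thesis using nth_sg[of 0 N "i + t" g] that N0 by simp
 qed
 have f1: "(A' @ hd c' # B') ! s = f (int s)" if "s <= length A'" for s
 proof -
  have "(A' @ hd c' # B') ! s = sg f 0 N ! s"
   using that d'(1,2) by (auto simp: nth_append hd_conv_nth less_Suc_eq)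
  thus ?thesis using nth_sg[of 0 N s f] that lA' N0 d'(1) by (cases c') auto
 qed
 \<comment> \<open>On the window from \<open>j\<close> to \<open>j + L\<close> the common normal
   form still runs along \<open>f\<close>, because \<open>Y\<close> cancels only near index
   \<open>N\<close>, and it already runs along \<open>g\<close>, because \<open>X\<close> has
   ended.\<close>
 have agree: "f s = g (s + (int i - int j))" for s
 proof (rule per_agree[OF assms(3-5), of "int j"])
  fix s assume s: "int j <= s" "s < int j + L"
  then obtain t where t: "s = int (j + t)" by (metis nonneg_int_cases add.commute diff_add_cancel diff_ge_0_iff_ge of_nat_add)
  have "int (length A') + int (length Y) \<ge> N + 1" using lA' c'Y N0 by linarith
  hence "j + t <= length A'" using s t N lX by linarith
  moreover have "i + t <= nat N" using s t N lX by linarith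
  ultimately show "f s = g (s + (int i - int j))" using f1[of "j + t"] g2[of t] W t by (simp add: add.commute)
 qed
 define k where "k = int j - int i"
 have gf: "g t = f (t + k)" for t using agree[of "t + k"] by (simp add: k_def)
 have A: "A @ [f (int j)] = sg f 0 (int j)"
 proof (rule nth_equalityI)
  fix s assume "s < length (A @ [f (int j)])"
  hence s: "s <= j" by (simp add: j_def)
  have "j <= length A'"
   using lA' c'Y lX N assms(5) by linarith
  hence "s ~= j ==> A ! s = f (int s)" using f1[of s] W s by (metis append_eq_conv_conj j_def le_neq_implies_less nth_append order_trans)
  thus "(A @ [f (int j)]) ! s = sg f 0 (int j) ! s" using s by (cases "s = j") (auto simp: nth_append j_def nth_sg)
 qed (simp add: j_def)
 have "rev c = sg g 0 (int i)"
  by (rule nth_equalityI) (auto simp: lc g1 nth_sg)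
 hence "c = sg g (int i) 0" by (metis rev_rev_ident rev_sg)
 hence c: "c = sg f (int j) k" using sg_shift[of g f k "int i" 0] gf by (simp add: k_def)
 \<comment> \<open>\<open>X\<close> follows \<open>f\<close> up to index \<open>j\<close>, and its
   cancelled block is \<open>g\<close> read backwards, that is, again a piece of
   \<open>f\<close>.\<close>
 have "X = nf (A @ c)" using d assms(6) by simp
 also have "\<dots> = nf ((A @ [f (int j)]) @ c)" using nf_join'[of c "f (int j)" A "[]"] c by simp
 also have "\<dots> = nf (sg f 0 k)" using nf_sg_trans0[of f 0 "int j" k] A c by simp
 also have "\<dots> = sg f 0 k" using red_sg[OF assms(1)] by simp
 finally show ?thesis using gf by blast
qed

section \<open>Recoloring sequences\<close>

definition vl :: "'b => ('b \<times> 'b) list => 'b list" where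
 "vl a w = a # map snd w"

definition steps :: "'b list => ('b \<times> 'b) list" where
 "steps xs = zip xs (tl xs)"

lemma steps_vl: "pcas a w b ==> steps (vl a w) = w"
 by (induction a w b rule: pcas.induct) (auto simp: steps_def vl_def)

lemma last_vl: "pcas a w b ==> last (vl a w) = b"
 by (induction a w b rule: pcas.induct) (auto simp: vl_def)

lemma vl_steps: "xs ~= [] ==> vl (hd xs) (steps xs) = xs"
 by (cases xs) (auto simp: vl_def steps_def map_snd_zip_take)

lemma pcas_steps: "xs ~= [] ==> pcas (hd xs) (steps xs) (last xs)"
 by (induction xs rule: induct_list012) (auto simp: steps_def)

lemma pcas_append: "pcas a (xs @ ys) b <-> pcas a xs (last (vl a xs)) & pcas (last (vl a xs)) ys b"
 by (induction xs arbitrary: a) (auto simp: vl_def)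

lemma vl_append: "vl a (xs @ ys) = vl a xs @ map snd ys"
 by (simp add: vl_def)

lemma vl_neq_Nil[simp]: "vl a w ~= []" by (simp add: vl_def)

lemma hd_vl[simp]: "hd (vl a w) = a" by (simp add: vl_def)

text \<open>The decrease in length gives termination, the invariance of the normal form gives
  uniqueness of the result.\<close>

lemma reduces_nf:
 assumes "reduces w w'" "pcas a w b"
 shows "nf (vl a w) = nf (vl a w') & pcas a w' b & length w' < length w"
 using assms
proof (cases rule: reduces.cases)
 case (backtrack xs u v ys)
 have l: "last (vl a xs) = u" using assms(2) backtrack by (auto simp: pcas_append)
 hence e: "vl a xs = butlast (vl a xs) @ [u]" by (metis append_butlast_last_id vl_neq_Nil)
 have "nf (vl a w) = nf (vl a w')"
  using nf_back[of "butlast (vl a xs)" u v "map snd ys"] backtrack e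
  by (simp add: vl_append) (metis append.assoc append_Cons append_Nil)
 thus ?thesis using backtrack assms(2) l by (auto simp: pcas_append)
next
 case (loop_step xs u ys)
 have l: "last (vl a xs) = u" using assms(2) loop_step by (auto simp: pcas_append)
 hence e: "vl a xs = butlast (vl a xs) @ [u]" by (metis append_butlast_last_id vl_neq_Nil)
 have "nf (vl a w) = nf (vl a w')"
  using nf_dup[of "butlast (vl a xs)" u "map snd ys"] loop_step e
  by (simp add: vl_append) (metis append.assoc append_Cons append_Nil)
 thus ?thesis using loop_step assms(2) l by (auto simp: pcas_append)
qed

lemma reduces_Cons: "reduces w w' ==> reduces (e # w) (e # w')"
 by (erule reduces.cases) (auto intro: reduces.intros(1)[of "e # _", simplified] reduces.intros(2)[of "e # _", simplified])

lemma reduced_iff_red: assumes "pcas a w b" shows "reduced w <-> red (vl a w)"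
proof
 assume "red (vl a w)"
 show "reduced w" unfolding reduced_def
 proof
  assume "EX w'. reduces w w'"
  then obtain w' where "reduces w w'" by blast
  note r = reduces_nf[OF this assms]
  hence "vl a w = nf (vl a w')" using \<open>red (vl a w)\<close> by simp
  moreover have "length (vl a w') < length (vl a w)" using r by (simp add: vl_def)
  ultimately show False using length_nf[of "vl a w'"] by simp
 qed
next
 have "EX w'. reduces w w'" if "pcas a w b" "~ red (vl a w)"
  using that
 proof (induction w arbitrary: a)
  case (Cons e w)
  then obtain v where e: "e = (a, v)" "pcas v w b" by (cases e) auto
  show ?case
  proof (cases "a = v")
   case True thus ?thesis using reduces.loop_step[of "[]" a w] e by auto
  next
   case av: False
   show ?thesis
   proof (cases w)
    case Nil thus ?thesis using Cons.prems e av by (simp add: vl_def)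
   next
    case C: (Cons e' w')
    then obtain u where e': "e' = (v, u)" using e by (cases e') auto
    show ?thesis
    proof (cases "u = a")
     case True thus ?thesis using reduces.backtrack[of "[]" a v w'] e e' C by auto
    next
     case False
     hence "~ red (vl v w)" using Cons.prems e e' C av by (auto simp: vl_def)
     thus ?thesis using Cons.IH[OF e(2)] reduces_Cons by blast
    qed
   qed
  qed
 qed (simp add: vl_def)
 thus "reduced w ==> red (vl a w)" using assms by (auto simp: reduced_def)
qed

lemma reduces_star_nf:
 "reduces\<^sup>*\<^sup>* w w' ==> pcas a w b ==> nf (vl a w) = nf (vl a w') & pcas a w' b"
 by (induction rule: rtranclp_induct) (auto dest: reduces_nf)

lemma reduces_star_ex: "pcas a w b ==> EX r. reduces\<^sup>*\<^sup>* w r & reduced r"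
proof (induction "length w" arbitrary: w rule: less_induct)
 case less
 show ?case
 proof (cases "reduced w")
  case False
  then obtain w' where w': "reduces w w'" by (auto simp: reduced_def)
  then obtain r where "reduces\<^sup>*\<^sup>* w' r" "reduced r" using less reduces_nf[OF w' less.prems] by blast
  thus ?thesis using w' by (meson converse_rtranclp_into_rtranclp)
 qed auto
qed

text \<open>Normal forms of vertex lists decide equality in the groupoid: reduction terminates, and
  a walk is recovered from its vertex list. The start is explicit because an empty arc list does not
  record it.\<close>

lemma same_reduction_iff:
 assumes "pcas a w b" "pcas a w' b'"
 shows "same_reduction w w' <-> nf (vl a w) = nf (vl a w')"
proof
 assume "same_reduction w w'"
 thus "nf (vl a w) = nf (vl a w')"
  using reduces_star_nf assms by (metis same_reduction_def)
next
 assume eq: "nf (vl a w) = nf (vl a w')"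
 obtain r r' where r: "reduces\<^sup>*\<^sup>* w r" "reduced r" "reduces\<^sup>*\<^sup>* w' r'" "reduced r'"
  using reduces_star_ex assms by metis
 have p: "pcas a r b" "pcas a r' b'" using r reduces_star_nf assms by metis+
 hence "red (vl a r)" "red (vl a r')" using reduced_iff_red r by metis+
 hence "vl a r = vl a r'" using reduces_star_nf[OF r(1) assms(1)] reduces_star_nf[OF r(3) assms(2)] eq by simp
 hence "r = r'" using steps_vl p by metis
 thus "same_reduction w w'" using r by (auto simp: same_reduction_def)
qed

lemma all_nat_Suc: "(ALL i. P i) <-> P 0 & (ALL i. P (Suc i))"
 by (metis not0_implies_Suc)

lemma zz_nth: "zz E p xs <-> (ALL i. Suc i < length xs -->
  (if p = even i then E (xs ! i) (xs ! Suc i) else E (xs ! Suc i) (xs ! i)))"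
proof (induction E p xs rule: zz.induct)
 case (1 E p x y r)
 show ?case (is "_ <-> (ALL i. ?P i)")
 proof -
  have "(ALL i. ?P i) <-> ?P 0 & (ALL i. ?P (Suc i))" by (rule all_nat_Suc)
  thus ?thesis using 1 by (cases p) simp_all
 qed
qed auto

section \<open>Walks traced by recoloring sequences\<close>

locale hom_pair =
 fixes G :: "'a pair_pre_digraph" and H :: "'b pair_pre_digraph"
 assumes G: "pair_digraph G" and conn: "connected (with_proj G)" and card_G: "2 <= card (pverts G)"
  and H: "pair_digraph H"
begin

definition adj :: "'a => 'a => bool" where
 "adj u v <-> (u, v) : parcs G | (v, u) : parcs G"

definition adjH :: "'b => 'b => bool" where
 "adjH x y <-> (x, y) : parcs H | (y, x) : parcs H"

text \<open>An even position \<open>x\<close> and an adjacent odd position \<open>y\<close> of a zigzag walk for \<open>v\<close>.\<close>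

definition EE :: "'a => 'b => 'b => bool" where
 "EE v x y <-> ((EX u. (v, u) : parcs G) --> (x, y) : parcs H) &
       ((EX u. (u, v) : parcs G) --> (y, x) : parcs H)"

lemma finV: "finite (pverts G)"
 using G by (simp add: pair_digraph_def pair_fin_digraph.pair_finite_verts)

lemma nbrs_adj: "nbrs G v = {u. adj u v}"
proof -
 have "(u, v) : parcs (underlying G) <-> adj u v" for u
  by (auto simp: adj_def parcs_mk_symmetric intro: bexI[of _ "(u, v)"] bexI[of _ "(v, u)"])
 thus ?thesis by (simp add: nbrs_def)
qed

lemma adj_sym: "adj u v ==> adj v u" by (auto simp: adj_def)

lemma parcs_V: "(u, v) : parcs G ==> u : pverts G & v : pverts G"
 using G pair_wf_digraph.wellformed'[of G] by (auto simp: pair_digraph_def pair_fin_digraph_def)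

lemma parcs_VH: "(u, v) : parcs H ==> u : pverts H & v : pverts H"
 using H pair_wf_digraph.wellformed'[of H] by (auto simp: pair_digraph_def pair_fin_digraph_def)

lemma adj_V: "adj u v ==> u : pverts G & v : pverts G"
 using parcs_V by (auto simp: adj_def)

lemma adj_neq: "adj u v ==> u ~= v"
 using G pair_loopfree_digraph.pair_no_loops[of G] by (fastforce simp: pair_digraph_def adj_def)

lemma adjH_neq: "adjH u v ==> u ~= v"
 using H pair_loopfree_digraph.pair_no_loops[of H] by (fastforce simp: pair_digraph_def adjH_def)

lemma conn_rtrancl: "u : pverts G ==> v : pverts G ==> adj\<^sup>*\<^sup>* u v"
proof -
 assume "u : pverts G" "v : pverts G"
 hence "(u, v) : rtrancl_on (pverts G) ((parcs G)\<^sup>s)"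
  using conn by (simp add: connected_conv)
 hence "(u, v) : ((parcs G)\<^sup>s)\<^sup>*" by (rule rtrancl_on_rtranclI)
 thus ?thesis
 proof (induction rule: rtrancl_induct)
  case (step y z)
  hence "adj y z" by (auto simp: adj_def symcl_def)
  thus ?case using step by (meson rtranclp.rtrancl_into_rtrancl)
 qed simp
qed

lemma ex_nbr: "v : pverts G ==> EX u. adj u v"
proof -
 assume v: "v : pverts G"
 have "~ pverts G <= {v}" using card_G card_mono[of "{v}" "pverts G"] by auto
 then obtain u where "u : pverts G" "u ~= v" by auto
 thus ?thesis using conn_rtrancl[of u v] v by (metis rtranclp.cases)
qed

lemma conn_induct:
 assumes "u : pverts G" "v : pverts G" "P u" "!!x y. adj x y ==> P x ==> P y"
 shows "P v"
 using conn_rtrancl[OF assms(1,2)] assms(3) by (induction rule: rtranclp_induct) (auto intro: assms(4))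

lemma EE_adjH: "v : pverts G ==> EE v x y ==> adjH x y"
 using ex_nbr[of v] by (auto simp: EE_def adjH_def adj_def)

lemma EE_irrefl: "v : pverts G ==> irreflp (EE v)"
 using EE_adjH adjH_neq by (metis irreflpI)

lemma hom_adj: "digraph_hom G H f ==> adj u v ==> adjH (f u) (f v)"
 by (auto simp: digraph_hom_def adj_def adjH_def)

lemma hom_EE: "digraph_hom G H f ==> (ALL u. adj u v --> f u = h) ==> EE v (f v) h"
 by (fastforce simp: digraph_hom_def adj_def EE_def)

text \<open>Recoloring sequences and the monochromatic neighborhood property in one recursive
  predicate, to be unfolded one recoloring at a time.\<close>

fun rseq :: "('a => 'b) list => bool" where
 "rseq [] <-> False"
| "rseq [f] <-> digraph_hom G H f"
| "rseq (f # g # r) <-> digraph_hom G H f &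
   (EX v:pverts G. f v ~= g v & (ALL u:pverts G. u ~= v --> f u = g u) & (EX h. ALL u. adj u v --> f u = h)) &
   rseq (g # r)"

lemma rseq_iff0: "rseq sm <-> sm ~= [] & (ALL f:set sm. digraph_hom G H f) &
  (ALL i. Suc i < length sm --> (EX! v. v : pverts G & (sm ! i) v ~= (sm ! Suc i) v) &
   (ALL v:pverts G. (sm ! i) v ~= (sm ! Suc i) v --> (EX h. ALL u:nbrs G v. (sm ! i) u = h)))"
proof (induction sm rule: rseq.induct)
 case (3 f g r)
 let ?P = "%f g. (EX! v. v : pverts G & f v ~= g v) &
   (ALL v:pverts G. f v ~= g v --> (EX h. ALL u:nbrs G v. f u = h))"
 have split: "(ALL i. Suc i < length (f # g # r) --> ?P ((f # g # r) ! i) ((f # g # r) ! Suc i)) <->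
  ?P f g & (ALL i. Suc i < length (g # r) --> ?P ((g # r) ! i) ((g # r) ! Suc i))" (is "(ALL i. ?Q i) <-> _")
 proof -
  have "(ALL i. ?Q i) <-> ?Q 0 & (ALL i. ?Q (Suc i))" by (rule all_nat_Suc)
  thus ?thesis by simp
 qed
 have "?P f g <-> (EX v:pverts G. f v ~= g v & (ALL u:pverts G. u ~= v --> f u = g u) & (EX h. ALL u. adj u v --> f u = h))"
  unfolding nbrs_adj by (auto; metis)
 thus ?case unfolding rseq.simps(3) 3 split by auto
qed auto

lemma rseq_iff: "recoloring_sequence G H al be2 sm & monochromatic_neighborhood G sm <->
  rseq sm & (ALL v:pverts G. hd sm v = al v) & (ALL v:pverts G. last sm v = be2 v)"
 unfolding rseq_iff0 recoloring_sequence_def monochromatic_neighborhood_def by blast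

fun VL :: "('a => 'b) list => 'a => 'b list" where
 "VL [] v = []"
| "VL [f] v = [f v]"
| "VL (f # g # r) v = (if f v = g v then [] else [f v, the_elem (f ` nbrs G v)]) @ VL (g # r) v"

lemma VL_neq_Nil[simp]: "VL (f # r) v ~= []"
 by (induction "f # r" v arbitrary: f r rule: VL.induct) auto

lemma hd_VL[simp]: "hd (VL (f # r) v) = f v"
 by (induction "f # r" v arbitrary: f r rule: VL.induct) auto

lemma last_VL: "sm ~= [] ==> last (VL sm v) = last sm v"
 by (induction sm v rule: VL.induct) auto

lemma vertex_walk_Cons: "vertex_walk G (f # g # r) v = step_walk G f g v @ vertex_walk G (g # r) v"
proof -
 have "[0..<length (f # g # r) - 1] = 0 # map Suc [0..<length (g # r) - 1]"
  using map_Suc_upt[of 0 "length r"] upt_conv_Cons[of 0 "Suc (length r)"] by simp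
 thus ?thesis by (simp add: vertex_walk_def o_def)
qed

lemma vl_vertex_walk:
 "sm ~= [] ==> vl (hd sm v) (vertex_walk G sm v) = VL sm v & pcas (hd sm v) (vertex_walk G sm v) (last sm v)"
proof (induction sm v rule: VL.induct)
 case (2 f v) thus ?case by (simp add: vertex_walk_def vl_def)
next
 case (3 f g r v)
 thus ?case by (auto simp: vertex_walk_Cons step_walk_def Let_def vl_def)
qed auto

text \<open>One recoloring of \<open>w\<close> through the common color \<open>h\<close> of its neighbors.\<close>

lemma rseq_step:
 assumes "rseq (f # g # r)"
 obtains w h where "w : pverts G" "f w ~= g w" "!!u. u : pverts G ==> u ~= w ==> f u = g u"
  "!!u. adj u w ==> f u = h" "!!u. adj u w ==> g u = h" "!!v. v : pverts G ==> VL (f # g # r) v = (if v = w then [f w, h] else []) @ VL (g # r) v"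
  "EE w (f w) h" "EE w (g w) h" "digraph_hom G H f" "digraph_hom G H g"
proof -
 obtain w h where w: "w : pverts G" "f w ~= g w" "ALL u:pverts G. u ~= w --> f u = g u"
  "ALL u. adj u w --> f u = h" using assms by auto
 have g: "digraph_hom G H g" using assms by (cases r) auto
 have f: "digraph_hom G H f" using assms by auto
 have gu: "g u = h" if "adj u w" for u using w that adj_V adj_neq by metis
 have "f ` nbrs G w = {h}" using ex_nbr[OF w(1)] w(4) by (auto simp: nbrs_adj image_def)
 hence "VL (f # g # r) v = (if v = w then [f w, h] else []) @ VL (g # r) v" if "v : pverts G" for v
  using w that by auto
 thus ?thesis using that w gu hom_EE[OF f, of w h] hom_EE[OF g, of w h] f g by blast
qed

text \<open>If \<open>v\<close> is recolored, then \<open>u\<close> has the color \<open>h\<close>,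
  and the new beginning \<open>h, f v, h\<close> backtracks. If \<open>u\<close> is recolored, then
  \<open>v\<close> has the color \<open>h\<close>, and \<open>h, g u, h\<close> backtracks. This is
  the use of the monochromatic neighborhood property.\<close>

lemma VL_edge:
 assumes "rseq sm" "adj u v"
 shows "nf (VL sm u) = nf (hd sm u # VL sm v @ [last sm u])"
 using assms
proof (induction sm rule: rseq.induct)
 case (2 f)
 thus ?case using nf_back[of "[]" "f u" "f v" "[]"] by simp
next
 case (3 f g r)
 obtain w h where w: "w : pverts G" "f w ~= g w" "!!u. u : pverts G ==> u ~= w ==> f u = g u"
  "!!u. adj u w ==> f u = h" "!!u. adj u w ==> g u = h"
  "!!v. v : pverts G ==> VL (f # g # r) v = (if v = w then [f w, h] else []) @ VL (g # r) v"
  by (rule rseq_step[OF 3(2)]) blast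
 have IH: "nf (VL (g # r) u) = nf (g u # VL (g # r) v @ [last (g # r) u])" using 3 by simp
 have uv: "u : pverts G" "v : pverts G" "u ~= v" using adj_V adj_neq \<open>adj u v\<close> by auto
 define e where "e = last (g # r) u"
 obtain t where t: "VL (g # r) v = g v # t" by (metis VL_neq_Nil hd_VL list.collapse)
 consider "v = w" | "u = w" | "v ~= w" "u ~= w" by blast
 thus ?case
 proof cases
  case 1
  have fu: "f u = h" "g u = h" using w(4,5) 1 \<open>adj u v\<close> by auto
  have "nf (VL (f # g # r) u) = nf (h # VL (g # r) v @ [e])"
   using w(6)[OF uv(1)] 1 uv IH fu by (simp add: e_def)
  also have "\<dots> = nf (h # f w # h # VL (g # r) v @ [e])"
   using nf_back[of "[]" h "f w" "VL (g # r) v @ [e]"] by simp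
  finally show ?thesis using w(6)[OF uv(2)] 1 fu by (simp add: e_def)
 next
  case 2
  have fv: "f v = h" "g v = h" using w(4,5) 2 \<open>adj u v\<close> adj_sym by auto
  have "nf (VL (f # g # r) u) = nf ([f u, h] @ VL (g # r) u)"
   using w(6)[OF uv(1)] 2 by simp
  also have "\<dots> = nf ([f u, h] @ g u # VL (g # r) v @ [e])" using IH nf_cong_r by (metis e_def)
  also have "\<dots> = nf ([f u] @ VL (g # r) v @ [e])"
   using nf_back[of "[f u]" h "g u" "t @ [e]"] t fv by simp
  finally show ?thesis using w(6)[OF uv(2)] 2 uv by (simp add: e_def)
 next
  case 3
  thus ?thesis using w(3,6) uv IH by (simp add: e_def)
 qed
qed simp

text \<open>A recoloring adds two vertices. The old and the new color are both joined to
  \<open>h\<close> as \<open>EE\<close> demands, because the coloring is a homomorphism before and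
  after.\<close>

lemma VL_zo: "rseq sm ==> v : pverts G ==> zo (EE v) (VL sm v)"
proof (induction sm rule: rseq.induct)
 case (3 f g r)
 obtain w h where w: "!!v. v : pverts G ==> VL (f # g # r) v = (if v = w then [f w, h] else []) @ VL (g # r) v"
  "EE w (f w) h" "EE w (g w) h"
  by (rule rseq_step[OF 3(2)]) blast
 obtain t where t: "VL (g # r) v = g v # t" by (metis VL_neq_Nil hd_VL list.collapse)
 have IH: "zo (EE v) (VL (g # r) v)" using 3 by auto
 thus ?case unfolding w(1)[OF 3(3)] using w(2,3) t by (auto simp: zo_def)
qed (auto simp: zo_def)

text \<open>A closed walk of \<open>G\<close> wrapped around the integers. For a homomorphism
  \<open>f\<close> its image is reduced: adjacent vertices have different colors, and the last
  condition excludes backtracks.\<close>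

definition tight :: "('a => 'b) => (int => 'a) => bool" where
 "tight f w <-> (EX k>0. ALL i. w (i + k) = w i) & (ALL i. adj (w i) (w (i + 1))) & (ALL i. f (w i) ~= f (w (i + 2)))"

text \<open>Otherwise the two neighbors of \<open>v\<close> on the walk, whose colors differ, would
  both have the color \<open>h\<close>.\<close>

lemma tight_fixed:
 assumes "tight f w" "!!u. adj u v ==> f u = h"
 shows "w i ~= v"
proof
 assume "w i = v"
 have a: "adj (w (i - 1)) (w i)" "adj (w i) (w (i + 1))" "f (w (i - 1)) ~= f (w (i + 1))"
  using assms(1) by (auto simp: tight_def) (metis diff_add_cancel add.commute add_diff_eq one_add_one add.assoc)+
 thus False using assms(2) adj_sym \<open>w i = v\<close> by metis
qed

lemma tight_cong: "tight f w ==> (!!i. f (w i) = g (w i)) ==> tight g w"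
 by (simp add: tight_def)

text \<open>A recoloring cannot touch a tight walk, so the walk is still tight afterwards and the
  argument repeats.\<close>

lemma VL_tight: "rseq sm ==> tight (hd sm) w ==> VL sm (w i) = [hd sm (w i)]"
proof (induction sm rule: rseq.induct)
 case (3 f g r)
 obtain x h where x: "!!u. u : pverts G ==> u ~= x ==> f u = g u"
  "!!u. adj u x ==> f u = h"
  "!!v. v : pverts G ==> VL (f # g # r) v = (if v = x then [f x, h] else []) @ VL (g # r) v"
  by (rule rseq_step[OF 3(2)]) blast
 have t: "tight f w" using 3 by simp
 have wx: "w i ~= x" for i using tight_fixed[OF t] x(2) by metis
 have wV: "w i : pverts G" for i using t adj_V by (auto simp: tight_def)
 have "tight g w" by (rule tight_cong[OF t]) (use x(1) wx wV in auto)
 hence "VL (g # r) (w i) = [g (w i)]" using 3 by auto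
 thus ?case using x(3)[OF wV] wx x(1)[OF wV wx] by simp
qed auto

end

section \<open>Realizability\<close>

lemma nf_cancel_L: "X ~= [] ==> A ~= [] ==> last A = hd X ==> nf (A @ X @ rev X @ B) = nf (A @ B)"
 using nf_cancel[of X A B] nf_join[of A "hd X" "[]" B] by simp

lemma nf_cancel_R: "X ~= [] ==> B ~= [] ==> hd B = hd X ==> nf (A @ X @ rev X @ B) = nf (A @ B)"
 using nf_cancel[of X A B] nf_join'[of B "hd X" A "[]"] by simp

lemma nf_cancel'_L: "X ~= [] ==> A ~= [] ==> last A = last X ==> nf (A @ rev X @ X @ B) = nf (A @ B)"
 using nf_cancel_L[of "rev X" A B] by (simp add: hd_rev)

lemma nf_cancel'_R: "X ~= [] ==> B ~= [] ==> hd B = last X ==> nf (A @ rev X @ X @ B) = nf (A @ B)"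
 using nf_cancel_R[of "rev X" B A] by (simp add: hd_rev)

lemma nf_loop_iff:
 assumes "P ~= []" "hd P = hd Q" "last P = last Q" "Q ~= []"
 shows "nf (rev Q @ P) = [last Q] <-> nf P = nf Q"
proof
 assume "nf (rev Q @ P) = [last Q]"
 hence "nf (Q @ (rev Q @ P)) = nf (Q @ [last Q])" by (metis nf_append_nf)
 thus "nf P = nf Q"
  using nf_cancel_R[of Q P "[]"] nf_join[of Q "last Q" "[]" "[]"] assms by simp
next
 assume "nf P = nf Q"
 hence "nf (rev Q @ P) = nf (rev Q @ Q)" by (rule nf_cong_r)
 thus "nf (rev Q @ P) = [last Q]" using nf_cancel'[of Q "[]" "[]"] assms by simp
qed

text \<open>Turns the equation \<open>X Q = Q Y\<close> into the triviality of one closed walk,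
  which a program can test by its length.\<close>

lemma nf_conj_iff:
 assumes "X ~= []" "Y ~= []" "Q ~= []" "hd X = hd Q" "last X = hd Q" "hd Y = last Q" "last Y = last Q"
 shows "nf (rev Q @ X @ Q @ rev Y) = [last Q] <-> nf (X @ Q) = nf (Q @ Y)"
proof
 assume a: "nf (rev Q @ X @ Q @ rev Y) = [last Q]"
 have "nf (X @ Q) = nf (Q @ rev Q @ X @ Q)" using nf_cancel_R[of Q "X @ Q" "[]"] assms by simp
 also have "\<dots> = nf (Q @ (rev Q @ X @ Q @ rev Y) @ Y)"
  using nf_cancel'_L[of Y "Q @ rev Q @ X @ Q" "[]"] assms by simp
 also have "\<dots> = nf (Q @ [last Q] @ Y)" using nf_cong[of "rev Q @ X @ Q @ rev Y" "[last Q]" Q Y] a by simp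
 also have "\<dots> = nf (Q @ Y)" using nf_join[of Q "last Q" "[]" Y] assms by simp
 finally show "nf (X @ Q) = nf (Q @ Y)" .
next
 assume a: "nf (X @ Q) = nf (Q @ Y)"
 have "nf (rev Q @ X @ Q @ rev Y) = nf (rev Q @ Q @ Y @ rev Y)" using nf_cong[OF a, of "rev Q" "rev Y"] by simp
 also have "\<dots> = nf (rev Q @ Q)" using nf_cancel_L[of Y "rev Q @ Q" "[]"] assms by simp
 finally show "nf (rev Q @ X @ Q @ rev Y) = [last Q]" using nf_cancel'[of Q "[]" "[]"] assms by simp
qed

text \<open>By pigeonhole two of the first \<open>n + 1\<close> points coincide, so the orbit has
  entered its cycle by time \<open>n\<close>.\<close>

lemma orbit_recurrent:
 assumes "finite U" "!!x. x : U ==> s x : U" "v : U" "card U <= n"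
 shows "EX k>0. (s ^^ k) ((s ^^ n) v) = (s ^^ n) v"
proof -
 have U: "(s ^^ i) v : U" for i by (induction i) (auto simp: assms)
 have "~ inj_on (%i. (s ^^ i) v) {..n}"
 proof
  assume "inj_on (%i. (s ^^ i) v) {..n}"
  hence "card {..n} <= card U" using U assms(1) by (intro card_inj_on_le) auto
  thus False using assms(4) by simp
 qed
 then obtain i j where ij: "i < j" "j <= n" "(s ^^ i) v = (s ^^ j) v"
  unfolding inj_on_def by (metis atMost_iff linorder_neqE_nat)
 have p: "(s ^^ a) ((s ^^ b) v) = (s ^^ (a + b)) v" for a b by (simp add: funpow_add)
 have "(s ^^ (j - i)) ((s ^^ n) v) = (s ^^ ((n - i) + j)) v" using ij p by (simp add: add.commute)
 also have "\<dots> = (s ^^ (n - i)) ((s ^^ i) v)" using ij p by metis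
 also have "\<dots> = (s ^^ n) v" using ij(1,2) p[of "n - i" i] by simp
 finally show ?thesis using ij by (intro exI[of _ "j - i"]) auto
qed

lemma periodic_orbit:
 assumes "0 < k" "(s ^^ k) p = p"
 shows "EX w::int => 'a. w 0 = p & (ALL t. w (t + 1) = s (w t)) & (ALL t. w (t + int k) = w t) & (ALL t. EX m. w t = (s ^^ m) p)"
proof (intro exI[of _ "%t. (s ^^ nat (t mod int k)) p"] conjI allI)
 fix t
 show "(s ^^ nat ((t + 1) mod int k)) p = s ((s ^^ nat (t mod int k)) p)"
 proof (cases "t mod int k + 1 = int k")
  case True
  hence "(t + 1) mod int k = 0" by (metis mod_add_left_eq mod_self)
  moreover have "Suc (nat (t mod int k)) = k" using True assms(1) by linarith
  ultimately show ?thesis using assms(2) by (metis funpow.simps(2) funpow_0 comp_apply nat_0)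
 next
  case False
  have "t mod int k < int k" using assms(1) by simp
  hence "t mod int k + 1 < int k" using False by linarith
  hence "(t + 1) mod int k = t mod int k + 1"
   by (metis mod_add_left_eq mod_pos_pos_trivial assms(1) of_nat_0_less_iff add_nonneg_nonneg pos_mod_sign zero_le_one)
  hence "nat ((t + 1) mod int k) = Suc (nat (t mod int k))" using assms(1) by (simp add: nat_add_distrib)
  thus ?thesis by simp
 qed
qed auto

text \<open>A further vertex removes at most the last one; among three or more vertices the second
  survives.\<close>

lemma nf_snoc_nth1:
 assumes "red X" "3 <= length X"
 shows "nf (X @ [b]) ! 1 = X ! 1 & 2 <= length (nf (X @ [b]))"
proof -
 obtain X' z y where X: "X = X' @ [z, y]" "X' ~= []"
 proof -
  have "length (drop (length X - 2) X) = Suc (Suc 0)" using assms(2) by simp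
  then obtain z y where "drop (length X - 2) X = [z, y]" unfolding length_Suc_conv by auto
  hence "X = take (length X - 2) X @ [z, y]" by (metis append_take_drop_id)
  moreover have "take (length X - 2) X ~= []" using assms(2) by auto
  ultimately show thesis using that by blast
 qed
 have "nf (X @ [b]) : {X, X' @ [z], X @ [b]}"
 proof -
  have "nf (X @ [b]) = rev (push b (rev X))" using nf_snoc[of X b] assms(1) by simp
  also have "rev X = y # z # rev X'" using X(1) by simp
  finally show ?thesis using X(1) by simp
 qed
 moreover obtain x X'' where "X' = x # X''" using X(2) by (cases X') auto
 ultimately show ?thesis using X(1) by (cases X'') auto
qed

section \<open>Systems of walks and blocking neighbors\<close>

context hom_pair
begin

text \<open>The walks \<open>S v\<close> of the vertices determine each other along the edges of \<open>G\<close>.\<close>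

definition psys :: "('a => 'b) => ('a => 'b) => ('a => 'b list) => bool" where
 "psys al be2 S <->
  (ALL v:pverts G. red (S v) & hd (S v) = al v & last (S v) = be2 v & zo (EE v) (S v)) &
  (ALL u v. adj u v --> S u = nf (al u # S v @ [be2 u]))"

definition sys :: "('a => 'b) => ('a => 'b) => ('a => 'b list) => bool" where
 "sys al be2 S <-> psys al be2 S & (ALL w i. tight al w --> S (w i) = [al (w i)])"

lemma tight_V: "tight f w ==> w i : pverts G"
 using adj_V by (auto simp: tight_def)

lemma sys_of_rseq:
 assumes "rseq sm" "ALL v:pverts G. hd sm v = al v" "ALL v:pverts G. last sm v = be2 v"
 shows "sys al be2 (%v. nf (VL sm v))"
proof -
 obtain f r where s: "sm = f # r" using assms(1) by (cases sm) auto
 have "zo (EE v) (nf (VL sm v))" if "v : pverts G" for v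
  using zo_nf[OF EE_irrefl] VL_zo assms(1) that by blast
 moreover have "nf (VL sm u) = nf (al u # nf (VL sm v) @ [be2 u])" if "adj u v" for u v
  using VL_edge[OF assms(1) that] assms(2,3) adj_V[OF that] nf_append_nf2[of "[al u]" "VL sm v"] by simp
 moreover have "nf (VL sm (w i)) = [al (w i)]" if "tight al w" for w i
 proof -
  have "tight (hd sm) w" using tight_cong[OF that, of "hd sm"] assms(2) tight_V[OF that] by simp
  thus ?thesis using VL_tight[OF assms(1)] assms(2) tight_V[OF that] by simp
 qed
 ultimately show ?thesis using assms s last_VL[of sm] by (auto simp: sys_def psys_def)
qed

lemma psys_cons:
 assumes "psys al be2 S" "v : pverts G" "1 < length (S v)"
 obtains h b t where "S v = al v # h # b # t" "EE v (al v) h" "EE v b h" "zo (EE v) (b # t)"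
proof -
 have v: "red (S v)" "hd (S v) = al v" "zo (EE v) (S v)" using assms by (auto simp: psys_def)
 obtain a h r where 1: "S v = a # h # r" using assms(3) by (cases "S v"; cases "tl (S v)") auto
 then obtain b t where "r = b # t" using v by (cases r) (auto simp: zo_def)
 thus ?thesis using that[of h b t] v 1 by (auto simp: zo_def)
qed

text \<open>\<open>v\<close> has to move through \<open>S v ! 1\<close>, and a neighbor
  \<open>u\<close> of another color blocks it. Then \<open>al u\<close> does not cancel against
  \<open>S v\<close>, so \<open>S u\<close> is nontrivial and begins with a step to
  \<open>al v\<close>: the blocker has to move as well.\<close>

lemma psys_step:
 assumes "psys al be2 S" "v : pverts G" "1 < length (S v)" "adj u v" "al u ~= S v ! 1" "adjH (al u) (al v)"
 shows "1 < length (S u) & S u ! 1 = al v"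
proof -
 obtain h b t where S: "S v = al v # h # b # t" by (rule psys_cons[OF assms(1-3)])
 have "red (al u # S v)" using S assms adjH_neq by (auto simp: psys_def)
 moreover have "S u = nf ((al u # S v) @ [be2 u])" using assms by (simp add: psys_def)
 ultimately show ?thesis using nf_snoc_nth1[of "al u # S v" "be2 u"] S by simp
qed

text \<open>\<open>s\<close> chooses a blocker for every vertex of \<open>U\<close>, and its orbit
  enters a cycle within \<open>n\<close> steps. The image of the cycle has no backtrack: each vertex
  has to move through the color of the vertex that it blocks, and its own blocker has a different
  color.\<close>

lemma orbit_tight:
 assumes "psys al be2 S" "digraph_hom G H al" "U <= {v : pverts G. 1 < length (S v)}" "v : U" "card U <= n"
  and s: "!!v. v : U ==> s v : U & adj (s v) v & al (s v) ~= S v ! 1"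
 shows "EX w. tight al w & w 0 = (s ^^ n) v"
proof -
 have fin: "finite U" using assms(3) finV finite_subset by fastforce
 obtain k where k: "0 < k" "(s ^^ k) ((s ^^ n) v) = (s ^^ n) v"
  using orbit_recurrent[OF fin _ assms(4,5)] s by blast
 obtain w where w: "w 0 = (s ^^ n) v" "!!t. w (t + 1) = s (w t)" "!!t. w (t + int k) = w t"
  "!!t. EX m. w t = (s ^^ m) ((s ^^ n) v)"
  using periodic_orbit[OF k] by metis
 have pow: "(s ^^ m) v : U" for m by (induction m) (use s assms(4) in auto)
 have wU: "w t : U" for t using w(4)[of t] pow by (metis funpow_add comp_apply)
 have a: "adj (w (t + 1)) (w t)" for t using s[OF wU] w(2) by simp
 have 2: "al (w (t + 2)) ~= al (w t)" for t
 proof -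
  have "S (w (t + 1)) ! 1 = al (w t)"
   using psys_step[OF assms(1), of "w t" "w (t + 1)"] s[OF wU[of t]] wU[of t] assms(3) w(2)
    hom_adj[OF assms(2)] by auto
  moreover have "w (t + 2) = s (w (t + 1))" using w(2)[of "t + 1"] by (simp add: add.assoc)
  ultimately show ?thesis using s[OF wU[of "t + 1"]] by metis
 qed
 have "tight al w" unfolding tight_def
  using k(1) w(3) a adj_sym 2 by (metis of_nat_0_less_iff)
 thus ?thesis using w(1) by blast
qed

lemma tight_chain1:
 assumes "psys al be2 S" "digraph_hom G H al" "!!i. adj (w (Suc i)) (w i)" "!!i. al (w (Suc (Suc i))) ~= al (w i)"
  "1 < length (S (w 0))" "S (w 0) ! 1 ~= al (w 1)"
 shows "1 < length (S (w n)) & al (w (Suc n)) ~= S (w n) ! 1"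
proof (induction n)
 case (Suc n)
 have "1 < length (S (w (Suc n))) & S (w (Suc n)) ! 1 = al (w n)"
  using psys_step[OF assms(1), of "w n" "w (Suc n)"] Suc assms(3) adj_V hom_adj[OF assms(2)] by metis
 thus ?case using assms(4)[of n] by simp
qed (use assms in auto)

text \<open>The two neighbors of \<open>w i\<close> on the walk have different colors, so one of
  them blocks it. Continuing on that side, every next vertex blocks the one before. Hence such a
  vertex is never removed when unblocked vertices are peeled off.\<close>

lemma tight_chain:
 assumes "psys al be2 S" "digraph_hom G H al" "tight al w" "1 < length (S (w i))"
 shows "EX x::nat => 'a. x 0 = w i & (ALL n. 1 < length (S (x n)) & adj (x (Suc n)) (x n) & al (x (Suc n)) ~= S (x n) ! 1)"
proof (cases "S (w i) ! 1 = al (w (i + 1))")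
 case False
 have "1 < length (S (w (i + int n))) & al (w (i + int (Suc n))) ~= S (w (i + int n)) ! 1" for n
 proof (rule tight_chain1[OF assms(1,2), where w = "%n. w (i + int n)"])
  fix n
  show "adj (w (i + int (Suc n))) (w (i + int n))"
   using assms(3) adj_sym by (auto simp: tight_def add.assoc add.commute[of 1]) (metis add.assoc)
  have "al (w (i + int n)) ~= al (w (i + int n + 2))" using assms(3) by (auto simp: tight_def)
  moreover have "i + int n + 2 = i + int (Suc (Suc n))" by simp
  ultimately show "al (w (i + int (Suc (Suc n)))) ~= al (w (i + int n))" by metis
 qed (use assms False in auto)
 moreover have "adj (w (i + int (Suc n))) (w (i + int n))" for n
  using assms(3) adj_sym by (auto simp: tight_def add.assoc add.commute[of 1]) (metis add.assoc)
 ultimately show ?thesis by (intro exI[of _ "%n. w (i + int n)"]) auto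
next
 case True
 have a: "adj (w (i - int (Suc n))) (w (i - int n))" for n
 proof -
  have "i - int n = (i - int (Suc n)) + 1" by simp
  thus ?thesis using assms(3) unfolding tight_def by metis
 qed
 have t: "al (w (i - int (Suc (Suc n)))) ~= al (w (i - int n))" for n
 proof -
  have "i - int n = (i - int (Suc (Suc n))) + 2" by simp
  thus ?thesis using assms(3) unfolding tight_def by metis
 qed
 have "(i - 1) + 2 = i + 1" by simp
 hence "al (w (i - 1)) ~= al (w (i + 1))" using assms(3) unfolding tight_def by metis
 hence "1 < length (S (w (i - int n))) & al (w (i - int (Suc n))) ~= S (w (i - int n)) ! 1" for n
  by (intro tight_chain1[OF assms(1,2), where w = "%n. w (i - int n)"]) (use a t assms True in auto)
 thus ?thesis using a by (intro exI[of _ "%n. w (i - int n)"]) auto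
qed

text \<open>Induction on the total length of the walks. Some vertex \<open>v\<close> with a
  nontrivial walk is not blocked; recoloring it to the third vertex of \<open>S v\<close> shortens
  that walk by two and leaves a system of the same kind.\<close>

lemma sys_imp_rseq:
 assumes "sys al be2 S" "digraph_hom G H al"
 shows "EX sm. rseq sm & (ALL v:pverts G. hd sm v = al v) & (ALL v:pverts G. last sm v = be2 v) &
   (ALL v:pverts G. nf (VL sm v) = S v)"
 using assms
proof (induction "SUM v:pverts G. length (S v)" arbitrary: al S rule: less_induct)
 case less
 have ps: "psys al be2 S" using less.prems(1) by (simp add: sys_def)
 show ?case
 proof (cases "EX v:pverts G. 1 < length (S v)")
  case False
  have "S v = [al v] & al v = be2 v" if "v : pverts G" for v
  proof -
   have "hd (S v) = al v" "last (S v) = be2 v" "S v ~= []" "~ 1 < length (S v)"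
    using ps that False zo_nonempty by (auto simp: psys_def)
   thus ?thesis by (cases "S v") auto
  qed
  thus ?thesis using less.prems(2) by (intro exI[of _ "[al]"]) simp
 next
  case True
  define U where "U = {v : pverts G. 1 < length (S v)}"
  \<comment> \<open>Otherwise every vertex with a nontrivial walk has a blocker, and following
    blockers leads to a tight walk on which \<open>S\<close> is nontrivial.\<close>
  have "EX v:U. ALL u. adj u v --> al u = S v ! 1"
  proof (rule ccontr)
   assume "~ ?thesis"
   hence "ALL v:U. EX u. adj u v & al u ~= S v ! 1" by blast
   then obtain s where s: "!!v. v : U ==> adj (s v) v & al (s v) ~= S v ! 1" by metis
   have sU: "s v : U" if "v : U" for v
    using psys_step[OF ps, of v "s v"] s[OF that] that adj_V hom_adj[OF less.prems(2)] by (auto simp: U_def)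
   obtain v where v: "v : U" using True by (auto simp: U_def)
   obtain w where w: "tight al w" "w 0 = (s ^^ card U) v"
    using orbit_tight[OF ps less.prems(2), of U v "card U" s] s sU v U_def by blast
   have "(s ^^ m) v : U" for m by (induction m) (use sU v in auto)
   hence "1 < length (S (w 0))" using w by (auto simp: U_def)
   moreover have "S (w 0) = [al (w 0)]" using less.prems(1) w(1) by (simp add: sys_def)
   ultimately show False by simp
  qed
  then obtain v where v: "v : pverts G" "1 < length (S v)" "ALL u. adj u v --> al u = S v ! 1"
   by (auto simp: U_def)
  obtain h b t where S: "S v = al v # h # b # t" "EE v (al v) h" "EE v b h" "zo (EE v) (b # t)"
   by (rule psys_cons[OF ps v(1,2)])
  have nb: "al u = h" if "adj u v" for u using v(3) S(1) that by simp
  define al' where "al' = al(v := b)"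
  define S' where "S' = S(v := b # t)"
  have hom': "digraph_hom G H al'"
   unfolding digraph_hom_def
  proof (intro conjI ballI; clarify?)
   fix u assume "u : pverts G"
   thus "al' u : pverts H"
    using less.prems(2) EE_adjH[OF v(1) S(3)] parcs_VH by (auto simp: al'_def digraph_hom_def adjH_def)
  next
   fix x y assume xy: "(x, y) : parcs G"
   hence "x ~= y" using adj_neq by (auto simp: adj_def)
   moreover have "al x = h" if "y = v" using nb[of x] xy that by (auto simp: adj_def)
   moreover have "al y = h" if "x = v" using nb[of y] xy that by (auto simp: adj_def)
   ultimately show "(al' x, al' y) : parcs H"
    using xy S(3) less.prems(2) by (auto simp: al'_def digraph_hom_def EE_def)
  qed
  \<comment> \<open>A tight walk for the new coloring avoids \<open>v\<close>, whose neighbors all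
    have the color \<open>h\<close>; so it was tight for the old coloring too.\<close>
  have t': "tight al w & w i ~= v" if "tight al' w" for w i
  proof -
   have "al' u = h" if "adj u v" for u using nb[OF that] adj_neq[OF that] by (simp add: al'_def)
   hence n: "w i ~= v" for i using tight_fixed[OF that] by blast
   thus ?thesis using tight_cong[OF that, of al] by (auto simp: al'_def)
  qed
  have rSv: "red (S v)" using ps v(1) by (auto simp: psys_def)
  have rbt: "red (b # t)" using red_appendD2[of "[al v, h]" "b # t"] S(1) ps v(1) by (auto simp: psys_def)
  have edge: "S' u = nf (al' u # S' x @ [be2 u])" if ux: "adj u x" for u x
  proof -
   have e: "S u = nf (al u # S x @ [be2 u])" using ps ux by (auto simp: psys_def)
   consider "u = v" | "x = v" | "u ~= v" "x ~= v" by blast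
   thus ?thesis
   proof cases
    case 1
    have x: "x ~= v" "x : pverts G" using adj_neq ux 1 adj_V by auto
    have "al x = h" using nb adj_sym ux 1 by metis
    then obtain r where r: "S x = h # r" using ps x by (metis psys_def zo_nonempty list.collapse)
    have "S' u = nf (b # t)" using 1 rbt by (simp add: S'_def)
    also have "\<dots> = nf (b # h # b # t)" using nf_back[of "[]" b h t] by simp
    also have "\<dots> = nf ([b, h] @ al v # h # b # t)" using nf_back[of "[b]" h "al v" "b # t"] by simp
    also have "\<dots> = nf ([b, h] @ al v # S x @ [be2 v])" using e S(1) 1 nf_append_nf by metis
    also have "\<dots> = nf (b # S x @ [be2 v])" using nf_back[of "[b]" h "al v" "r @ [be2 v]"] r by simp
    finally show ?thesis using 1 x by (simp add: S'_def al'_def)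
   next
    case 2
    hence u: "u ~= v" "al u = h" using adj_neq ux nb by auto
    thus ?thesis using e 2 S(1) nf_back[of "[]" h "al v" "b # t @ [be2 u]"] by (simp add: S'_def al'_def)
   next
    case 3 thus ?thesis using e by (simp add: S'_def al'_def)
   qed
  qed
  have "psys al' be2 S'" using rbt ps edge S v(1) unfolding psys_def
   by (auto simp: S'_def al'_def)
  moreover have "S' (w i) = [al' (w i)]" if "tight al' w" for w i
   using t'[OF that] less.prems(1) by (auto simp: S'_def al'_def sys_def)
  ultimately have sys': "sys al' be2 S'" by (simp add: sys_def)
  have "(SUM v:pverts G. length (S' v)) < (SUM v:pverts G. length (S v))"
   by (rule sum_strict_mono_ex1[OF finV]) (use S v in \<open>auto simp: S'_def\<close>)
  from less.hyps[OF this sys' hom'] obtain sm where s: "rseq sm" "ALL v:pverts G. hd sm v = al' v"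
   "ALL v:pverts G. last sm v = be2 v" "ALL v:pverts G. nf (VL sm v) = S' v" by blast
  obtain g r where sm: "sm = g # r" using s(1) by (cases sm) auto
  have "al v ~= b" using S(1) ps v(1) by (auto simp: psys_def)
  hence g: "g v = b" "!!u. u : pverts G ==> u ~= v ==> g u = al u" "al v ~= g v"
   using s(2) v(1) sm by (auto simp: al'_def)
  have rs: "rseq (al # sm)" unfolding sm rseq.simps
   using less.prems(2) s(1) sm g nb v(1) by auto
  have "al ` nbrs G v = {h}" using nb ex_nbr[OF v(1)] by (auto simp: nbrs_adj image_def)
  hence VLv: "VL (al # sm) v = [al v, h] @ VL sm v" using g sm by simp
  have "nf (VL (al # sm) v) = nf ([al v, h] @ S' v)" using VLv s(4) v(1) by (metis nf_append_nf)
  moreover have "nf ([al v, h] @ S' v) = S v" using S(1) nf_red[OF rSv] by (simp add: S'_def)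
  ultimately have "nf (VL (al # sm) v) = S v" by simp
  moreover have "nf (VL (al # sm) u) = S u" if "u : pverts G" "u ~= v" for u
   using that g(2)[OF that] s(4) sm by (simp add: S'_def)
  ultimately have "ALL u:pverts G. nf (VL (al # sm) u) = S u" by metis
  moreover have "last (al # sm) = last sm" using sm by simp
  ultimately show ?thesis using rs s(3) by (metis list.sel(1))
 qed
qed

end

text \<open>Tree paths may stutter, so that a program can pad them to a common length by repeating
  the root.\<close>

locale hom_pair_based = hom_pair +
 fixes al be2 :: "'a => 'b" and q :: 'a and up :: "'a => 'a list"
 assumes hom_al: "digraph_hom G H al" and hom_be2: "digraph_hom G H be2" and q: "q : pverts G"
  and up: "!!v. v : pverts G ==> up v ~= [] & hd (up v) = v & last (up v) = q &
    successively (%x y. x = y | adj x y) (up v)"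
  and up_q: "set (up q) = {q}"
begin

definition SS :: "'b list => 'a => 'b list" where
 "SS Q v = nf (map al (up v) @ Q @ map be2 (rev (up v)))"

text \<open>For adjacent \<open>u\<close> and \<open>v\<close> the fundamental cycle at
  \<open>q\<close>; the edge is the junction of the two tree paths.\<close>

definition cyc :: "'a => 'a => 'a list" where
 "cyc u v = rev (up u) @ up v"

text \<open>Conjugation by \<open>Q\<close> takes the \<open>al\<close>-image of the cycle to its
  \<open>be2\<close>-image.\<close>

definition arcT :: "'a => 'a => 'b list => bool" where
 "arcT u v Q <-> nf (rev Q @ map al (cyc u v) @ Q @ map be2 (rev (cyc u v))) = [be2 q]"

definition base :: "'b list => bool" where
 "base Q <-> Q ~= [] & red Q & hd Q = al q & last Q = be2 q"

lemma nf_replicate: "n ~= 0 ==> nf (A @ replicate n x @ B) = nf (A @ x # B)"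
proof (induction n)
 case (Suc n)
 thus ?case by (cases n) (auto simp: nf_dup)
qed simp

lemma up_q_replicate: "up q = replicate (length (up q)) q"
 using up_q by (metis replicate_length_same singletonD)

lemma SS_q: "base Q ==> SS Q q = Q"
proof -
 assume b: "base Q"
 define n where "n = length (up q)"
 have n: "up q = replicate n q" "n ~= 0" using up_q_replicate up[OF q] by (auto simp: n_def)
 have "SS Q q = nf (replicate n (al q) @ Q @ replicate n (be2 q))" by (simp add: SS_def n)
 also have "\<dots> = nf ((al q # Q) @ replicate n (be2 q))" using nf_replicate[OF n(2), of "[]"] by simp
 also have "\<dots> = nf (al q # Q @ [be2 q])" using nf_replicate[OF n(2), of "al q # Q" _ "[]"] by simp
 also have "\<dots> = nf (Q @ [be2 q])" using nf_join'[of Q "al q" "[]" "[be2 q]"] b by (simp add: base_def)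
 also have "\<dots> = nf Q" using nf_join[of Q "be2 q" "[]" "[]"] b by (simp add: base_def)
 finally show "SS Q q = Q" using b by (simp add: base_def)
qed

text \<open>Induction along the tree path, with the edge relation at every step. At a stutter the
  added vertices are the ends of the walk already and disappear.\<close>

lemma psys_SS:
 assumes "psys al be2 S" "v : pverts G"
 shows "S v = SS (S q) v"
proof -
 have "S (hd p) = nf (map al p @ S q @ map be2 (rev p))"
  if "p ~= []" "last p = q" "hd p : pverts G" "successively (%x y. x = y | adj x y) p" for p
  using that
 proof (induction p rule: induct_list012)
  case (2 x)
  have "S q = nf (S q)" "hd (S q) = al q" "last (S q) = be2 q" "S q ~= []"
   using assms(1) q zo_nonempty by (auto simp: psys_def)
  thus ?case using 2 nf_join'[of "S q" "al q" "[]" "[be2 q]"] nf_join[of "S q" "be2 q" "[]" "[]"] by simp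
 next
  case (3 x y p)
  let ?p = "y # p"
  have xy: "x = y | adj x y" using 3 by simp
  hence IH: "S y = nf (map al ?p @ S q @ map be2 (rev ?p))" using 3 adj_V by auto
  have "S x = nf (al x # S y @ [be2 x])"
  proof (cases "x = y")
   case True
   have "S y = nf (S y)" "hd (S y) = al y" "last (S y) = be2 y" "S y ~= []"
    using assms(1) zo_nonempty 3 True by (auto simp: psys_def)
   thus ?thesis using True nf_join'[of "S y" "al y" "[]" "[be2 y]"] nf_join[of "S y" "be2 y" "[]" "[]"] by simp
  qed (use xy assms(1) in \<open>auto simp: psys_def\<close>)
  also have "\<dots> = nf ([al x] @ (map al ?p @ S q @ map be2 (rev ?p)) @ [be2 x])"
   using nf_cong[of "S y" "map al ?p @ S q @ map be2 (rev ?p)" "[al x]" "[be2 x]"] IH by simp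
  finally show ?case by simp
 qed simp
 from this[of "up v"] show ?thesis using up[OF assms(2)] assms(2) by (simp add: SS_def)
qed

lemma cyc_closed:
 assumes "u : pverts G" "v : pverts G"
 shows "cyc u v ~= []" "hd (cyc u v) = q" "last (cyc u v) = q"
 using up[OF assms(1)] up[OF assms(2)] by (auto simp: cyc_def hd_rev hd_append)

lemma arcT_iff:
 assumes "base Q" "u : pverts G" "v : pverts G"
 shows "arcT u v Q <-> nf (map al (cyc u v) @ Q) = nf (Q @ map be2 (cyc u v))"
 unfolding arcT_def rev_map
 using nf_conj_iff[of "map al (cyc u v)" "map be2 (cyc u v)" Q] assms(1) cyc_closed[OF assms(2,3)]
 by (simp add: base_def hd_map last_map rev_map)

text \<open>Both sides say that transporting \<open>Q\<close> along the tree to \<open>u\<close>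
  agrees with transporting it along the tree to \<open>v\<close> and then over the edge; they differ
  only in the side of the equation on which the tree paths stand.\<close>

lemma arcT_SS:
 assumes "base Q" "adj u v"
 shows "arcT u v Q <-> SS Q u = nf (al u # SS Q v @ [be2 u])"
proof -
 have V: "u : pverts G" "v : pverts G" using assms adj_V by auto
 define A B where "A = map al (up u)" and "B = map al (up v)"
 define C D where "C = map be2 (up u)" and "D = map be2 (up v)"
 have ne: "A ~= []" "B ~= []" "C ~= []" "D ~= []" "Q ~= []"
  and h: "hd A = al u" "last A = al q" "hd B = al v" "last B = al q" "hd C = be2 u" "last C = be2 q"
   "hd D = be2 v" "last D = be2 q" "hd Q = al q" "last Q = be2 q"
  using up[OF V(1)] up[OF V(2)] assms(1) by (auto simp: A_def B_def C_def D_def hd_map last_map base_def)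
 have L: "arcT u v Q <-> nf (rev A @ B @ Q) = nf (Q @ rev C @ D)"
  using arcT_iff[OF assms(1) V] by (simp add: cyc_def A_def B_def C_def D_def rev_map)
 have R: "SS Q u = nf (al u # SS Q v @ [be2 u]) <-> nf (A @ Q @ rev C) = nf ([al u] @ B @ Q @ rev D @ [be2 u])"
  using nf_append_nf2[of "[al u]" "B @ Q @ rev D" "[be2 u]"]
  by (simp add: SS_def A_def B_def C_def D_def rev_map)
 show ?thesis unfolding L R
 proof
  assume a: "nf (rev A @ B @ Q) = nf (Q @ rev C @ D)"
  have "nf (A @ Q @ rev C) = nf (A @ (Q @ rev C @ D) @ rev D @ [be2 u])"
   using nf_cancel[OF ne(4), of "A @ Q @ rev C" "[be2 u]"] nf_back[of "A @ Q @ butlast (rev C)" "be2 u" "be2 v" "[]"]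
    ne(3) h(5,7) append_butlast_last_id[of "rev C"] by (simp add: last_rev) (metis append.assoc append_Cons append_Nil)
  also have "\<dots> = nf (A @ rev A @ B @ Q @ rev D @ [be2 u])"
   using nf_cong[OF a, of A "rev D @ [be2 u]"] by simp
  also have "\<dots> = nf ([al u] @ B @ Q @ rev D @ [be2 u])"
   using nf_cancel[OF ne(1), of "[]" "B @ Q @ rev D @ [be2 u]"] h by simp
  finally show "nf (A @ Q @ rev C) = nf ([al u] @ B @ Q @ rev D @ [be2 u])" .
 next
  assume a: "nf (A @ Q @ rev C) = nf ([al u] @ B @ Q @ rev D @ [be2 u])"
  have "nf (Q @ rev C @ D) = nf (rev A @ (A @ Q @ rev C) @ D)"
   using nf_cancel'_R[of A "Q @ rev C @ D" "[]"] ne h by simp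
  also have "\<dots> = nf (rev A @ [al u] @ B @ Q @ rev D @ be2 u # D)"
   using nf_cong[OF a, of "rev A" D] by simp
  also have "\<dots> = nf (rev A @ [al u] @ B @ Q @ rev D @ D)"
  proof -
   obtain D' where D: "D = be2 v # D'" using ne h by (metis list.collapse)
   show ?thesis using nf_back[of "rev A @ [al u] @ B @ Q @ rev D'" "be2 v" "be2 u" D']
     nf_dup[of "rev A @ [al u] @ B @ Q @ rev D'" "be2 v" D'] by (simp add: D)
  qed
  also have "\<dots> = nf (rev A @ [al u] @ B @ Q)"
   using nf_cancel'_L[of D "rev A @ [al u] @ B @ Q" "[]"] ne h by simp
  also have "\<dots> = nf (rev A @ B @ Q)"
   using nf_join[of "rev A" "al u" "[]" "B @ Q"] ne h by (simp add: last_rev)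
  finally show "nf (rev A @ B @ Q) = nf (Q @ rev C @ D)" ..
 qed
qed

text \<open>Inverting and rotating a closed word preserves its triviality, so each edge may be
  tested in the direction of its arc.\<close>

lemma arcT_sym: "base Q ==> u : pverts G ==> v : pverts G ==> arcT u v Q <-> arcT v u Q"
proof -
 assume a: "base Q" "u : pverts G" "v : pverts G"
 have c: "cyc v u = rev (cyc u v)" by (simp add: cyc_def)
 have "rev (nf (rev Q @ map al (cyc u v) @ Q @ map be2 (rev (cyc u v)))) = nf (map be2 (cyc u v) @ rev Q @ map al (cyc v u) @ Q)"
  unfolding nf_rev[symmetric] c by (simp add: rev_map)
 hence "arcT u v Q <-> nf (map be2 (cyc u v) @ rev Q @ map al (cyc v u) @ Q) = [be2 q]"
  unfolding arcT_def by (metis rev_rev_ident rev_singleton_conv)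
 also have "\<dots> <-> nf (rev (map be2 (cyc v u)) @ (rev Q @ map al (cyc v u) @ Q)) = [last (map be2 (cyc v u))]"
  using cyc_closed[OF a(3,2)] c by (simp add: rev_map last_map)
 also have "\<dots> <-> nf (rev Q @ map al (cyc v u) @ Q) = nf (map be2 (cyc v u))"
  using cyc_closed[OF a(3,2)] a(1)
  by (intro nf_loop_iff) (auto simp: base_def hd_map last_map hd_rev hd_append)
 also have "\<dots> <-> nf (rev Q @ (map al (cyc v u) @ Q)) = nf (rev Q @ (Q @ map be2 (cyc v u)))"
  using nf_cancel'_R[of Q "map be2 (cyc v u)" "[]"] cyc_closed[OF a(3,2)] a(1) by (simp add: base_def hd_map)
 also have "\<dots> <-> nf (map al (cyc v u) @ Q) = nf (Q @ map be2 (cyc v u))"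
 proof
  assume "nf (rev Q @ (map al (cyc v u) @ Q)) = nf (rev Q @ (Q @ map be2 (cyc v u)))"
  hence "nf (Q @ rev Q @ (map al (cyc v u) @ Q)) = nf (Q @ rev Q @ (Q @ map be2 (cyc v u)))"
   by (rule nf_cong_r)
  thus "nf (map al (cyc v u) @ Q) = nf (Q @ map be2 (cyc v u))"
   using nf_cancel_R[of Q "map al (cyc v u) @ Q" "[]"] nf_cancel_R[of Q "Q @ map be2 (cyc v u)" "[]"]
    cyc_closed[OF a(3,2)] a(1) by (simp add: base_def hd_map)
 qed (rule nf_cong_r)
 also have "\<dots> <-> arcT v u Q" using arcT_iff[OF a(1,3,2)] ..
 finally show ?thesis .
qed

lemma SS_ends: "base Q ==> v : pverts G ==> red (SS Q v) & hd (SS Q v) = al v & last (SS Q v) = be2 v & SS Q v ~= []"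
 using up[of v] by (auto simp: SS_def base_def hd_append hd_map last_map last_rev)

lemma psys_iff:
 assumes "base Q"
 shows "psys al be2 (SS Q) <-> (ALL (u, v):parcs G. arcT u v Q) & (ALL v:pverts G. zo (EE v) (SS Q v))"
proof -
 have "(ALL u v. adj u v --> SS Q u = nf (al u # SS Q v @ [be2 u])) <-> (ALL u v. adj u v --> arcT u v Q)"
  using arcT_SS[OF assms] by blast
 also have "\<dots> <-> (ALL (u, v):parcs G. arcT u v Q)"
  using arcT_sym[OF assms] parcs_V unfolding adj_def by fast
 finally show ?thesis using SS_ends[OF assms] unfolding psys_def by blast
qed

definition Real :: "'b list => bool" where
 "Real Q <-> (EX sm. recoloring_sequence G H al be2 sm & monochromatic_neighborhood G sm & nf (VL sm q) = Q)"

text \<open>Necessity: the walks of a recoloring sequence form a system, and a system is determined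
  by its walk at \<open>q\<close>. Sufficiency: the transported walks form a system, from which a
  sequence is built.\<close>

theorem Real_iff:
 assumes "base Q"
 shows "Real Q <-> (ALL (u, v):parcs G. arcT u v Q) & (ALL v:pverts G. zo (EE v) (SS Q v)) &
  (ALL w i. tight al w --> SS Q (w i) = [al (w i)])"
proof
 assume "Real Q"
 then obtain sm where "rseq sm" "ALL v:pverts G. hd sm v = al v" "ALL v:pverts G. last sm v = be2 v" and Q: "nf (VL sm q) = Q"
  unfolding Real_def using rseq_iff by blast
 hence s: "sys al be2 (%v. nf (VL sm v))" by (intro sys_of_rseq)
 have e: "nf (VL sm v) = SS Q v" if "v : pverts G" for v
  using psys_SS[of "%v. nf (VL sm v)" v] s that Q by (simp add: sys_def)
 have "psys al be2 (SS Q)" using s e adj_V unfolding sys_def psys_def by metis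
 moreover have "ALL w i. tight al w --> SS Q (w i) = [al (w i)]" using s e tight_V unfolding sys_def by metis
 ultimately show "(ALL (u, v):parcs G. arcT u v Q) & (ALL v:pverts G. zo (EE v) (SS Q v)) &
  (ALL w i. tight al w --> SS Q (w i) = [al (w i)])" using psys_iff[OF assms] by blast
next
 assume "(ALL (u, v):parcs G. arcT u v Q) & (ALL v:pverts G. zo (EE v) (SS Q v)) &
  (ALL w i. tight al w --> SS Q (w i) = [al (w i)])"
 hence "sys al be2 (SS Q)" using psys_iff[OF assms] by (simp add: sys_def)
 from sys_imp_rseq[OF this hom_al] obtain sm where "rseq sm" "ALL v:pverts G. hd sm v = al v"
  "ALL v:pverts G. last sm v = be2 v" and e: "ALL v:pverts G. nf (VL sm v) = SS Q v" by blast
 hence "recoloring_sequence G H al be2 sm & monochromatic_neighborhood G sm" using rseq_iff by blast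
 thus "Real Q" using e SS_q[OF assms] q unfolding Real_def by (intro exI[of _ sm]) auto
qed

lemma Real_base: "Real Q ==> base Q"
proof -
 assume "Real Q"
 then obtain sm where "rseq sm" "ALL v:pverts G. hd sm v = al v" "ALL v:pverts G. last sm v = be2 v" and Q: "nf (VL sm q) = Q"
  unfolding Real_def using rseq_iff by blast
 hence "sys al be2 (%v. nf (VL sm v))" by (intro sys_of_rseq)
 thus "base Q" using q Q zo_nonempty unfolding sys_def psys_def base_def by metis
qed

lemma zz_adjH: "v : pverts G ==> zz (EE v) p xs ==> successively adjH xs"
 by (induction "EE v" p xs rule: zz.induct) (auto split: if_splits dest: EE_adjH simp: adjH_def)

lemma walk_iff: "walk H a w b <-> a : pverts H & pcas a w b & (ALL (x, y):set w. adjH x y)"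
proof -
 have "(x, y) : parcs (underlying H) <-> adjH x y" for x y
  by (auto simp: adjH_def parcs_mk_symmetric intro: bexI[of _ "(x, y)"] bexI[of _ "(y, x)"])
 hence "set w <= parcs (underlying H) <-> (ALL (x, y):set w. adjH x y)" by (auto simp: subset_iff)
 thus ?thesis by (auto simp: pre_digraph.awalk_def cas_with_proj_eq)
qed

lemma steps_adjH: "(ALL (x, y):set (steps xs). adjH x y) <-> successively adjH xs"
 by (induction xs rule: induct_list012) (auto simp: steps_def)

lemma pi_hom_steps:
 assumes "xs ~= []" "hd xs : pverts H" "a = hd xs" "b = last xs"
 shows "steps xs : pi_hom H a b <-> red xs & successively adjH xs"
 using assms pcas_steps[of xs] reduced_iff_red[OF pcas_steps[OF assms(1)]] vl_steps[OF assms(1)]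
 by (auto simp: pi_hom_def walk_iff steps_adjH)

lemma pi_homE:
 assumes "w : pi_hom H a b"
 obtains xs where "w = steps xs" "xs ~= []" "hd xs = a" "last xs = b" "red xs" "successively adjH xs" "xs = vl a w" "pcas a w b"
proof -
 have w: "pcas a w b" "reduced w" "ALL (x, y):set w. adjH x y" using assms by (auto simp: pi_hom_def walk_iff)
 thus ?thesis
  using that[of "vl a w"] steps_vl[OF w(1)] last_vl[OF w(1)] reduced_iff_red[OF w(1)] steps_adjH[of "vl a w"] by auto
qed

text \<open>Back from vertex lists to arc lists. That the walk uses arcs of \<open>H\<close> is a
  consequence of the zigzag test at \<open>q\<close>.\<close>

lemma realizable_walks_eq: "realizable_walks G H al be2 q = steps ` {Q. Real Q}"
proof (rule set_eqI)
 fix w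
 show "w : realizable_walks G H al be2 q <-> w : steps ` {Q. Real Q}"
 proof
  assume "w : realizable_walks G H al be2 q"
  then obtain sm where w: "w : pi_hom H (al q) (be2 q)" and s: "recoloring_sequence G H al be2 sm"
   "monochromatic_neighborhood G sm" "same_reduction w (vertex_walk G sm q)" by (auto simp: realizable_walks_def)
  obtain xs where xs: "w = steps xs" "red xs" "xs = vl (al q) w" "pcas (al q) w (be2 q)" by (rule pi_homE[OF w]) blast
  have "sm ~= []" "hd sm q = al q" using s(1) q by (auto simp: recoloring_sequence_def)
  hence "nf (vl (al q) w) = nf (VL sm q)"
   using same_reduction_iff[OF xs(4)] vl_vertex_walk[of sm q] s(3) by metis
  hence "Real xs" using s xs unfolding Real_def by (metis nf_red)
  thus "w : steps ` {Q. Real Q}" using xs(1) by blast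
 next
  assume "w : steps ` {Q. Real Q}"
  then obtain Q where w: "w = steps Q" "Real Q" by auto
  then obtain sm where s: "recoloring_sequence G H al be2 sm"
   "monochromatic_neighborhood G sm" "nf (VL sm q) = Q" by (auto simp: Real_def)
  have b: "base Q" using w Real_base by simp
  have "zo (EE q) Q" using Real_iff[OF b] w(2) SS_q[OF b] q by metis
  hence a: "successively adjH Q" using zz_adjH[OF q] by (auto simp: zo_def)
  have p: "pcas (al q) w (be2 q)" "vl (al q) w = Q" using pcas_steps[of Q] vl_steps[of Q] b w by (auto simp: base_def)
  have "w : pi_hom H (al q) (be2 q)"
   using pi_hom_steps[of Q] a b w hom_al q by (auto simp: base_def digraph_hom_def)
  moreover have "same_reduction w (vertex_walk G sm q)"
  proof -
   have "sm ~= []" "hd sm q = al q" using s(1) q by (auto simp: recoloring_sequence_def)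
   hence "pcas (al q) (vertex_walk G sm q) (last sm q)" "vl (al q) (vertex_walk G sm q) = VL sm q"
    using vl_vertex_walk[of sm q] by auto
   thus ?thesis using same_reduction_iff[OF p(1)] p(2) s(3) b by (simp add: base_def)
  qed
  ultimately show "w : realizable_walks G H al be2 q" using s by (auto simp: realizable_walks_def)
 qed
qed

end

section \<open>Tests and the case of trivial cycles\<close>

fun pre :: "('b => 'b => bool) => 'b list => 'b list" where
 "pre B (x # y # r) = (if B x y then x # pre B (y # r) else [x])"
| "pre B xs = xs"

lemma pre_neq_Nil[simp]: "pre B xs = [] <-> xs = []"
 by (induction B xs rule: pre.induct) auto

lemma hd_pre[simp]: "hd (pre B xs) = hd xs"
 by (induction B xs rule: pre.induct) auto

lemma pre_prefix: "EX ys. xs = pre B xs @ ys"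
 by (induction B xs rule: pre.induct) auto

lemma pre_append: "successively B (xs @ [x]) ==> pre B (xs @ x # ys) = xs @ pre B (x # ys)"
 by (induction xs rule: induct_list012) auto

lemma pre_append_bad: "~ successively B (xs @ [x]) ==> pre B (xs @ x # ys) = pre B (xs @ [x])"
 by (induction xs rule: induct_list012) auto

lemma zz_sym: "(!!x y. E x y ==> E y x) ==> zz E p xs <-> successively E xs"
 by (induction E p xs rule: zz.induct) auto

lemma successively_rev_sym: "(!!x y. B x y ==> B y x) ==> successively B (rev xs) <-> successively B xs"
 by (induction xs rule: induct_list012) (auto simp: successively_append_iff)

lemma successively_nf: "(!!x y. B x y ==> B y x) ==> irreflp B ==> successively B xs ==> successively B (nf xs)"
 using zz_nf[of B True xs] zz_sym[of B] by blast

text \<open>\<open>Q\<close> cancels only \<open>B\<close>-steps of \<open>w\<close>, as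
  \<open>B\<close> is symmetric; so the first step of \<open>w\<close> outside \<open>B\<close>, if
  any, survives.\<close>

lemma pre_nf_left:
 assumes "red Q" "red w" "Q ~= []" "w ~= []" "last Q = hd w" "successively B Q"
  and sym: "!!x y. B x y ==> B y x"
 shows "pre B (nf (Q @ w)) = nf (Q @ pre B w) & (successively B (nf (Q @ w)) <-> successively B w)"
proof -
 obtain A c C where d: "c ~= []" "Q = A @ c" "w = rev c @ C" "red (A @ hd c # C)"
  using red_append_decomp[OF assms(1-5)] by blast
 obtain h c' where c: "c = h # c'" using d(1) by (cases c) auto
 have n: "nf (Q @ w) = A @ h # C" using nf_decomp[OF d(1,4)] d(2,3) c by simp
 have sA: "successively B (A @ [h])" using assms(6) d(2) c by (auto simp: successively_append_iff)
 have sc: "successively B (rev c' @ [h])"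
  using assms(6) d(2) c successively_rev_sym[of B c] sym by (auto simp: successively_append_iff)
 have p1: "pre B (A @ h # C) = A @ pre B (h # C)" using pre_append[OF sA] .
 have p2: "pre B w = rev c' @ pre B (h # C)" using pre_append[OF sc] d(3) c by simp
 obtain D where D: "pre B (h # C) = h # D" using hd_pre[of B "h # C"] by (cases "pre B (h # C)") auto
 obtain ys where ys: "h # C = (h # D) @ ys" using pre_prefix[of "h # C" B] D by metis
 have r: "red (A @ h # D)" using d(4) c ys red_appendD1[of "A @ h # D" ys] by simp
 have "nf (Q @ pre B w) = A @ h # D"
  using nf_decomp[of c A D] d c r p2 D by simp
 moreover have "successively B (A @ h # C) <-> successively B (h # C)"
  using sA by (auto simp: successively_append_iff)
 moreover have "successively B w <-> successively B (h # C)"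
  using sc d(3) c by (auto simp: successively_append_iff)
 ultimately show ?thesis using n p1 D by simp
qed

text \<open>\<open>S\<close> can cancel only \<open>B\<close>-steps, so the cancellation stops
  before it reaches the first step of \<open>a\<close> outside \<open>B\<close>.\<close>

lemma pre_nf_right:
 assumes "red a" "red S" "a ~= []" "S ~= []" "last a = hd S" "successively B S" "~ successively B a"
  and sym: "!!x y. B x y ==> B y x"
 shows "pre B (nf (a @ S)) = pre B a & ~ successively B (nf (a @ S))"
proof -
 obtain A c C where d: "c ~= []" "a = A @ c" "S = rev c @ C" "red (A @ hd c # C)"
  using red_append_decomp[OF assms(1-5)] by blast
 obtain h c' where c: "c = h # c'" using d(1) by (cases c) auto
 have n: "nf (a @ S) = A @ h # C" using nf_decomp[OF d(1,4)] d(2,3) c by simp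
 have "successively B (rev c)" using assms(6) d(3) by (auto simp: successively_append_iff)
 hence "successively B c" using successively_rev_sym[of B c] sym by blast
 hence bad: "~ successively B (A @ [h])"
  using assms(7) d(2) c by (auto simp: successively_append_iff)
 have "pre B (A @ h # C) = pre B (A @ [h])" "pre B a = pre B (A @ [h])"
  using pre_append_bad[OF bad] d(2) c by auto
 moreover have "~ successively B (A @ h # C)" using bad by (auto simp: successively_append_iff)
 ultimately show ?thesis using n by simp
qed

section \<open>Tests and the heap operation\<close>

datatype 'v test = TArc 'v 'v | TZig 'v | TEps 'v

context hom_pair_based
begin

fun passes :: "'a test => 'b list => bool" where
 "passes (TArc u v) Q <-> arcT u v Q"
| "passes (TZig v) Q <-> zo (EE v) (SS Q v)"
| "passes (TEps v) Q <-> SS Q v = [al v]"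

definition tests :: "'a test set" where
 "tests = {TArc u v |u v. (u, v) : parcs G} Un {TZig v |v. v : pverts G} Un {TEps (w i) |w i. tight al w}"

definition wft :: "'a test => bool" where
 "wft t <-> set_test t <= pverts G"

lemma wft_tests: "t : tests ==> wft t"
 using parcs_V tight_V by (fastforce simp: tests_def wft_def)

lemma ball_tests: "(ALL t:tests. P t) <-> (ALL (u, v):parcs G. P (TArc u v)) & (ALL v:pverts G. P (TZig v)) &
  (ALL w i. tight al w --> P (TEps (w i)))"
 unfolding tests_def by blast

lemma Real_iff_tests: "base Q ==> Real Q <-> (ALL t:tests. passes t Q)"
 unfolding Real_iff ball_tests by simp

lemma base_torsor: "base Q1 ==> base Q2 ==> base Q3 ==> base (nf (Q1 @ rev Q2 @ Q3))"
 by (auto simp: base_def)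

text \<open>The tree paths between the factors cancel, so transport commutes with the heap
  operation.\<close>

lemma SS_torsor:
 assumes "base Q1" "base Q2" "base Q3" "v : pverts G"
 shows "SS (nf (Q1 @ rev Q2 @ Q3)) v = nf (SS Q1 v @ rev (SS Q2 v) @ SS Q3 v)"
proof -
 define A B where "A = map al (up v)" and "B = map be2 (up v)"
 have ne: "A ~= []" "B ~= []" "last A = al q" "last B = be2 q" using up[OF assms(4)]
  by (auto simp: A_def B_def last_map)
 have Q: "Q1 ~= []" "Q2 ~= []" "Q3 ~= []" "hd Q3 = al q" "last Q1 = be2 q" "hd Q2 = al q" using assms by (auto simp: base_def)
 have "nf (SS Q1 v @ rev (SS Q2 v) @ SS Q3 v) = nf ((A @ Q1) @ rev B @ B @ (rev Q2 @ rev A @ A @ Q3 @ rev B))"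
  using nf_append_nf[of "(A @ Q1 @ rev B) @ B @ rev Q2 @ rev A" "A @ Q3 @ rev B"]
  by (simp add: SS_def A_def B_def rev_map nf_rev[symmetric])
 also have "\<dots> = nf ((A @ Q1 @ rev Q2) @ rev A @ A @ (Q3 @ rev B))"
  using nf_cancel'_L[OF ne(2), of "A @ Q1"] Q ne by simp
 also have "\<dots> = nf (A @ Q1 @ rev Q2 @ Q3 @ rev B)"
  using nf_cancel'_R[OF ne(1), of "Q3 @ rev B" "A @ Q1 @ rev Q2"] Q ne by simp
 also have "\<dots> = SS (nf (Q1 @ rev Q2 @ Q3)) v"
  using nf_append_nf2[of A "Q1 @ rev Q2 @ Q3" "rev B"] by (simp add: SS_def A_def B_def rev_map)
 finally show ?thesis ..
qed

text \<open>Conjugators of \<open>X\<close> into \<open>Y\<close>, zigzag walks, and walks with a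
  prescribed transport are each closed under the heap operation.\<close>

lemma passes_torsor:
 assumes "base Q1" "base Q2" "base Q3" "wft t" "passes t Q1" "passes t Q2" "passes t Q3"
 shows "passes t (nf (Q1 @ rev Q2 @ Q3))"
proof (cases t)
 case (TArc u v)
 hence V: "u : pverts G" "v : pverts G" using assms(4) by (auto simp: wft_def)
 define X Y where "X = map al (cyc u v)" and "Y = map be2 (cyc u v)"
 have XY: "X ~= []" "Y ~= []" "hd X = al q" "last X = al q" "hd Y = be2 q" "last Y = be2 q"
  using cyc_closed[OF V] by (auto simp: X_def Y_def hd_map last_map)
 have Q: "Q1 ~= []" "Q2 ~= []" "Q3 ~= []" "hd Q1 = al q" "hd Q2 = al q" "hd Q3 = al q"
  "last Q1 = be2 q" "last Q2 = be2 q" "last Q3 = be2 q" using assms by (auto simp: base_def)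
 have e: "nf (X @ Q1) = nf (Q1 @ Y)" "nf (X @ Q2) = nf (Q2 @ Y)" "nf (X @ Q3) = nf (Q3 @ Y)"
  using arcT_iff[OF _ V] assms TArc by (auto simp: X_def Y_def)
 have inv: "nf (Y @ rev Q2) = nf (rev Q2 @ X)"
 proof -
  have "nf (Y @ rev Q2) = nf (rev Q2 @ (Q2 @ Y) @ rev Q2)" using nf_cancel'_R[of Q2 "Y @ rev Q2" "[]"] Q XY by simp
  also have "\<dots> = nf (rev Q2 @ (X @ Q2) @ rev Q2)" using nf_cong[OF e(2), of "rev Q2" "rev Q2"] by simp
  also have "\<dots> = nf (rev Q2 @ X)" using nf_cancel_L[of Q2 "rev Q2 @ X" "[]"] Q XY by simp
  finally show ?thesis .
 qed
 have "nf (X @ nf (Q1 @ rev Q2 @ Q3)) = nf ((X @ Q1) @ rev Q2 @ Q3)" by simp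
 also have "\<dots> = nf ((Q1 @ Y) @ rev Q2 @ Q3)" by (rule nf_cong_l[OF e(1)])
 also have "\<dots> = nf (Q1 @ (rev Q2 @ X) @ Q3)" using nf_cong[OF inv, of Q1 Q3] by simp
 also have "\<dots> = nf ((Q1 @ rev Q2) @ (Q3 @ Y))" using nf_cong_r[OF e(3), of "Q1 @ rev Q2"] by simp
 also have "\<dots> = nf (nf (Q1 @ rev Q2 @ Q3) @ Y)" by simp
 finally show ?thesis using TArc arcT_iff[OF base_torsor[OF assms(1-3)] V] by (simp add: X_def Y_def)
next
 case (TZig v)
 hence v: "v : pverts G" using assms(4) by (auto simp: wft_def)
 have z: "zo (EE v) (SS Q1 v)" "zo (EE v) (rev (SS Q2 v))" "zo (EE v) (SS Q3 v)"
  using assms TZig zo_rev by auto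
 have "zo (EE v) (nf (SS Q1 v @ rev (SS Q2 v)))"
  using SS_ends[OF assms(1) v] SS_ends[OF assms(2) v]
  by (intro zo_join EE_irrefl v z) (simp add: hd_rev)
 hence "zo (EE v) (nf (nf (SS Q1 v @ rev (SS Q2 v)) @ SS Q3 v))"
  using SS_ends[OF assms(3) v] SS_ends[OF assms(2) v]
  by (intro zo_join[OF EE_irrefl[OF v] _ z(3)]) (auto simp: last_rev)
 thus ?thesis using TZig SS_torsor[OF assms(1-3) v] by simp
next
 case (TEps v)
 hence v: "v : pverts G" using assms(4) by (auto simp: wft_def)
 have "nf [al v, al v, al v] = [al v]" by (simp add: nf_def)
 thus ?thesis using TEps SS_torsor[OF assms(1-3) v] assms by simp
qed

section \<open>Trivial fundamental cycles\<close>

definition trivial_arcs :: "('a => 'b) => bool" where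
 "trivial_arcs f <-> (ALL (u, v):parcs G. nf (map f (cyc u v)) = [f q])"

text \<open>A trivial \<open>al\<close>-cycle turns the equation into \<open>Q = Q Y\<close>, where
  \<open>Q\<close> cancels: the outcome is the same for all candidates.\<close>

lemma trivial_arcT:
 assumes "base Q" "(u, v) : parcs G" "nf (map al (cyc u v)) = [al q]"
 shows "arcT u v Q <-> nf (map be2 (cyc u v)) = [be2 q]"
proof -
 have V: "u : pverts G" "v : pverts G" using parcs_V assms by auto
 have "nf (map al (cyc u v) @ Q) = nf ([al q] @ Q)" using assms(3) by (metis nf_nf_append)
 also have "\<dots> = nf Q" using nf_join'[of Q "al q" "[]" "[]"] assms(1) by (simp add: base_def)
 finally have *: "arcT u v Q <-> nf (Q @ map be2 (cyc u v)) = nf Q" using arcT_iff[OF assms(1) V] by auto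
 show ?thesis
 proof
  assume "arcT u v Q"
  hence "nf (rev Q @ (Q @ map be2 (cyc u v))) = nf (rev Q @ Q)" using * nf_cong_r by metis
  thus "nf (map be2 (cyc u v)) = [be2 q]"
   using nf_cancel'_R[of Q "map be2 (cyc u v)" "[]"] nf_cancel'[of Q "[]" "[]"] cyc_closed[OF V] assms(1)
   by (simp add: base_def hd_map)
 next
  assume "nf (map be2 (cyc u v)) = [be2 q]"
  hence "nf (Q @ map be2 (cyc u v)) = nf (Q @ [be2 q])" by (metis nf_append_nf)
  thus "arcT u v Q" using * nf_join[of Q "be2 q" "[]" "[]"] assms(1) by (simp add: base_def)
 qed
qed

text \<open>With trivial cycles, extending the tree walk \<open>a u\<close> over an edge to
  \<open>v\<close> gives \<open>a v\<close> up to reduction. So the image of a closed walk reduces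
  to a point, whereas the image of a tight walk is reduced and has positive length.\<close>

lemma trivial_no_tight:
 assumes "trivial_arcs al" "tight al w"
 shows False
proof -
 define a where "a v = map al (rev (up v))" for v
 have a: "a v ~= []" "last (a v) = al v" "hd (a v) = al q" if "v : pverts G" for v
  using up[OF that] by (auto simp: a_def last_map hd_map last_rev hd_rev)
 have st: "nf (a u @ [al v]) = nf (a v)" if uv: "adj u v" for u v
 proof -
  have V: "u : pverts G" "v : pverts G" using uv adj_V by auto
  have t: "nf (map al (cyc u v)) = [al q]"
  proof (cases "(u, v) : parcs G")
   case False
   hence "nf (map al (cyc v u)) = [al q]" using uv assms(1) by (auto simp: trivial_arcs_def adj_def)
   hence "rev (nf (map al (cyc v u))) = [al q]" by simp
   thus ?thesis by (simp add: nf_rev[symmetric] rev_map cyc_def)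
  qed (use assms(1) in \<open>auto simp: trivial_arcs_def\<close>)
  have "nf (a u @ [al v]) = nf (a u @ rev (a v) @ a v)"
   using nf_cancel[of "rev (a v)" "a u" "[]"] a[OF V(2)] by (simp add: hd_rev)
  also have "\<dots> = nf (map al (cyc u v) @ a v)" by (simp add: a_def cyc_def rev_map)
  also have "\<dots> = nf ([al q] @ a v)" using t by (metis nf_nf_append)
  also have "\<dots> = nf (a v)" using nf_join'[of "a v" "al q" "[]" "[]"] a[OF V(2)] by simp
  finally show ?thesis .
 qed
 define f where "f = al \<circ> w"
 have ad: "adj (w i) (w (i + 1))" for i using assms(2) by (simp add: tight_def)
 hence bf: "bired f" using assms(2) hom_adj[OF hom_al] adjH_neq by (auto simp: bired_def f_def tight_def)
 obtain k where k: "k > 0" "w (0 + k) = w 0" using assms(2) unfolding tight_def by blast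
 have "nf (a (w 0) @ sg f 0 (int m)) = nf (a (w (int m)))" for m
 proof (induction m)
  case 0
  thus ?case using nf_join[of "a (w 0)" "al (w 0)" "[]" "[]"] a[of "w 0"] tight_V[OF assms(2)] by (simp add: f_def)
 next
  case (Suc m)
  have "nf (a (w 0) @ sg f 0 (int m + 1)) = nf (a (w 0) @ sg f 0 (int m) @ [f (int m + 1)])"
   by (metis nf_append_nf nf_sg_step)
  also have "\<dots> = nf (a (w (int m)) @ [f (int m + 1)])" using nf_cong_l[OF Suc] by simp
  also have "\<dots> = nf (a (w (int m + 1)))" using st[OF ad] by (simp add: f_def)
  finally show ?case by (simp add: add.commute)
 qed
 from this[of "nat k"] have "nf (a (w 0) @ sg f 0 k) = nf (a (w 0))" using k by simp
 hence "nf (rev (a (w 0)) @ a (w 0) @ sg f 0 k) = nf (rev (a (w 0)) @ a (w 0))" by (rule nf_cong_r)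
 hence "nf (sg f 0 k) = [al (w 0)]"
  using nf_cancel'_R[of "a (w 0)" "sg f 0 k" "[]"] nf_cancel'[of "a (w 0)" "[]" "[]"] a[of "w 0"] tight_V[OF assms(2)]
  by (simp add: f_def)
 hence "sg f 0 k = [al (w 0)]" using red_sg[OF bf] by simp
 hence "length (sg f 0 k) = 1" by simp
 thus False using k by simp
qed

lemma trivial_Real_iff:
 assumes "trivial_arcs al" "base Q"
 shows "Real Q <-> trivial_arcs be2 & (ALL v:pverts G. zo (EE v) (SS Q v))"
proof -
 have "(ALL (u, v):parcs G. arcT u v Q) <-> trivial_arcs be2"
  using trivial_arcT[OF assms(2)] assms(1) by (simp add: trivial_arcs_def Ball_def split_paired_All)
 thus ?thesis using Real_iff[OF assms(2)] trivial_no_tight[OF assms(1)] by blast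
qed

definition bi :: "'a => bool" where
 "bi v <-> (EX u. (u, v) : parcs G) & (EX u. (v, u) : parcs G)"

definition BB :: "'b => 'b => bool" where
 "BB x y <-> (x, y) : parcs H & (y, x) : parcs H"

lemma EE_bi: "bi v ==> EE v = BB"
 by (auto simp: EE_def BB_def bi_def fun_eq_iff)

lemma BB_sym: "BB x y ==> BB y x" by (simp add: BB_def)

lemma BB_irrefl: "irreflp BB"
 using adjH_neq by (auto simp: irreflp_def BB_def adjH_def)

text \<open>If \<open>y\<close> has arcs in one direction only, the edge to \<open>x\<close> has
  this direction, and so \<open>x\<close> has an arc of the opposite direction.\<close>

lemma EE_step:
 assumes "adj x y" "~ bi y"
 shows "EE x a b ==> EE y b a"
 using assms by (auto simp: EE_def adj_def bi_def)

lemma EE_hom: "digraph_hom G H f ==> adj x y ==> ~ bi y ==> EE y (f y) (f x)"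
 unfolding EE_def adj_def bi_def digraph_hom_def by blast

definition down :: "('a => 'b) => 'a => 'b list" where
 "down f v = nf (map f (rev (up v)))"

lemma down_props: "v : pverts G ==> down f v ~= [] & red (down f v) & hd (down f v) = f q & last (down f v) = f v"
 using up[of v] by (auto simp: down_def last_map hd_map last_rev hd_rev)

lemma SS_down: "v : pverts G ==> SS Q v = nf (rev (down al v) @ Q @ down be2 v)"
 unfolding SS_def down_def nf_rev[symmetric]
 using nf_append_nf[of "map al (up v) @ Q" "map be2 (rev (up v))"] by (simp add: rev_map)

text \<open>Spread from \<open>q\<close> along edges. At a vertex with arcs in one direction only,
  the zigzag condition is inherited from the neighbor. At the others the relation is
  \<open>BB\<close>, and the transported walk is a composition of three \<open>BB\<close>-walks;
  only the parity of its length comes from the neighbor.\<close>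

lemma all_zigzag:
 assumes "base Q" "zo (EE q) Q" "trivial_arcs al" "trivial_arcs be2" "!!v. bi v ==> bi q"
  and ok: "!!v. v : pverts G ==> bi v ==> successively BB (down al v) & successively BB (down be2 v)"
 shows "Real Q"
proof -
 have "zo (EE v) (SS Q v)" if "v : pverts G" for v
 proof (rule conn_induct[OF q that, where P = "%v. zo (EE v) (SS Q v)"])
  show "zo (EE q) (SS Q q)" using assms(2) SS_q[OF assms(1)] by simp
 next
  fix x y assume xy: "adj x y" and z: "zo (EE x) (SS Q x)"
  have V: "x : pverts G" "y : pverts G" using adj_V xy by auto
  have "arcT y x Q"
  proof (cases "(y, x) : parcs G")
   case True
   thus ?thesis using trivial_arcT[OF assms(1) True] assms(3,4) by (auto simp: trivial_arcs_def)
  next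
   case False
   hence xy': "(x, y) : parcs G" using xy by (auto simp: adj_def)
   hence "arcT x y Q" using trivial_arcT[OF assms(1) xy'] assms(3,4) by (auto simp: trivial_arcs_def)
   thus ?thesis using arcT_sym[OF assms(1) V] by simp
  qed
  hence e: "SS Q y = nf (al y # SS Q x @ [be2 y])" using arcT_SS[OF assms(1) adj_sym[OF xy]] by simp
  have Sx: "SS Q x ~= []" "hd (SS Q x) = al x" "last (SS Q x) = be2 x" "red (SS Q x)" using SS_ends[OF assms(1) V(1)] by auto
  show "zo (EE y) (SS Q y)"
  proof (cases "bi y")
   case False
   have "zo (EE y) (al y # SS Q x @ [be2 y])"
    using EE_hom[OF hom_al xy False] EE_hom[OF hom_be2 xy False] Sx
    by (intro zo_ends[OF z]) (auto dest: EE_step[OF xy False])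
   thus ?thesis using zo_nf[OF EE_irrefl[OF V(2)]] e by simp
  next
   case True
   hence Eq: "EE y = BB" "EE q = BB" using EE_bi assms(5) by auto
   have s: "successively BB Q" using assms(2) Eq zz_sym[of BB] BB_sym by (auto simp: zo_def)
   define A B where "A = down al y" and "B = down be2 y"
   have AB: "successively BB (rev A)" "successively BB B" "A ~= []" "B ~= []" "hd A = al q" "hd B = be2 q"
    using ok[OF V(2) True] successively_rev_sym[of BB A] BB_sym down_props[OF V(2)] by (auto simp: A_def B_def)
   have Q: "Q ~= []" "hd Q = al q" "last Q = be2 q" using assms(1) by (auto simp: base_def)
   obtain A' where A': "rev A = A' @ [al q]" using AB by (metis last_rev rev_is_Nil_conv append_butlast_last_id)
   obtain Q' where Q': "Q = Q' @ [be2 q]" using Q by (metis append_butlast_last_id)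
   have glue: "successively BB (X @ Y)" if "successively BB (X @ [y])" "successively BB Y" "Y ~= []" "hd Y = y" for X Y y
    using that by (cases Y) (auto simp: successively_append_iff)
   have "successively BB (Q' @ B)" using glue[of Q' "be2 q" B] s Q' AB by simp
   moreover have "hd (Q' @ B) = al q" using Q' Q AB by (cases Q') auto
   ultimately have "successively BB (A' @ Q' @ B)"
    using glue[of A' "al q" "Q' @ B"] AB A' by simp
   moreover have "nf (A' @ Q' @ B) = SS Q y"
   proof -
    have "nf (rev A @ Q @ B) = nf (A' @ Q @ B)" using nf_join'[of Q "al q" A' B] Q A' by simp
    also have "\<dots> = nf (A' @ Q' @ B)" using nf_join'[of B "be2 q" "A' @ Q'" "[]"] Q' AB by simp
    finally show ?thesis using SS_down[OF V(2)] by (simp add: A_def B_def)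
   qed
   ultimately have "successively BB (SS Q y)" using successively_nf[of BB] BB_sym BB_irrefl by metis
   \<comment> \<open>The new ends contribute two genuine steps, and the parity of
     \<open>flips\<close> is invariant under reduction.\<close>
   moreover have "odd (length (SS Q y))"
   proof -
    have ne: "al y ~= al x" "be2 x ~= be2 y" using adjH_neq[OF hom_adj[OF hom_al xy]] adjH_neq[OF hom_adj[OF hom_be2 xy]] by auto
    obtain S' where S': "SS Q x = S' @ [be2 x]" using Sx by (metis append_butlast_last_id)
    obtain S'' where S'': "SS Q x = al x # S''" using Sx by (metis list.collapse)
    have "flips (al y # SS Q x @ [be2 y]) = 1 + flips (SS Q x @ [be2 y])" using S'' ne by simp
    also have "flips (SS Q x @ [be2 y]) = flips (SS Q x) + 1" using flips_append[of S' "be2 x" "[be2 y]"] S' ne by simp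
    finally have "even (length (nf (al y # SS Q x @ [be2 y]))) <-> odd (flips (SS Q x))"
     using even_length_nf[of "al y # SS Q x @ [be2 y]"] by simp
    thus ?thesis using e even_length_nf[OF Sx(1)] Sx(4) z by (simp add: zo_def)
   qed
   ultimately show ?thesis using Eq zz_sym[of BB] BB_sym by (auto simp: zo_def)
  qed
 qed
 thus ?thesis using trivial_Real_iff[OF assms(3,1)] assms(4) by blast
qed

text \<open>Let \<open>A\<close> and \<open>B\<close> be the tree path images and
  \<open>S = SS Q v\<close>. In \<open>Q B = A S\<close> both \<open>Q\<close> and \<open>S\<close>
  consist of two-way steps. The longest two-way prefix is \<open>Q\<close> times that of
  \<open>B\<close> on the left and that of \<open>A\<close> on the right, which determines
  \<open>Q\<close>.\<close>

lemma Real_bad: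
 assumes "Real Q" "bi q" "bi v" "v : pverts G"
  and bad: "~ (successively BB (down al v) & successively BB (down be2 v))"
 shows "Q = nf (pre BB (down al v) @ rev (pre BB (down be2 v)))"
proof -
 have b: "base Q" using Real_base assms(1) .
 have z: "zo (EE v) (SS Q v)" "zo (EE q) (SS Q q)" using Real_iff[OF b] assms q by auto
 hence s: "successively BB (SS Q v)" "successively BB Q"
  using EE_bi assms zz_sym[of BB] BB_sym SS_q[OF b] by (auto simp: zo_def)
 define A B where "A = down al v" and "B = down be2 v"
 have AB: "A ~= []" "B ~= []" "hd A = al q" "hd B = be2 q" "last A = al v" "red A" "red B"
  using down_props[OF assms(4)] by (auto simp: A_def B_def)
 have Q: "Q ~= []" "hd Q = al q" "last Q = be2 q" "red Q" using b by (auto simp: base_def)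
 have S: "SS Q v ~= []" "hd (SS Q v) = al v" "red (SS Q v)" using SS_ends[OF b assms(4)] by auto
 have e: "nf (Q @ B) = nf (A @ SS Q v)"
 proof -
  have "nf (A @ SS Q v) = nf (A @ rev A @ Q @ B)" using SS_down[OF assms(4)] by (simp add: A_def B_def)
  thus ?thesis using nf_cancel_R[of A "Q @ B" "[]"] AB Q by simp
 qed
 have L: "pre BB (nf (Q @ B)) = nf (Q @ pre BB B)" "successively BB (nf (Q @ B)) <-> successively BB B"
  using pre_nf_left[of Q B BB] Q AB s BB_sym by auto
 have bA: "~ successively BB A"
 proof
  assume a: "successively BB A"
  have "successively BB (nf (A @ SS Q v))"
   using pre_nf_left[of A "SS Q v" BB] AB S s a BB_sym by auto
  thus False using a bad L(2) e by (simp add: A_def B_def)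
 qed
 have "pre BB (nf (A @ SS Q v)) = pre BB A"
  using pre_nf_right[of A "SS Q v" BB] AB S s bA BB_sym by auto
 hence p: "nf (Q @ pre BB B) = pre BB A" using L e by simp
 have "nf (pre BB A @ rev (pre BB B)) = nf (Q @ pre BB B @ rev (pre BB B))"
  using nf_nf_append[of "Q @ pre BB B" "rev (pre BB B)"] p by simp
 also have "\<dots> = Q" using nf_cancel_L[of "pre BB B" Q "[]"] AB Q by simp
 finally show ?thesis by (simp add: A_def B_def)
qed

end

section \<open>Candidates along an axis\<close>

lemma sg_neg: "sg (%t. f (- t)) i j = sg f (- i) (- j)"
proof -
 have A: "map (%t. f (- t)) [- j..- i] = rev (map f [i..j])" for i j
  by (rule nth_equalityI) (auto simp: rev_nth nat_diff_distrib)
 have "map (%t. f (- t)) [i..j] = rev (map f [- j..- i])" for i j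
  using A[where i = "- j" and j = "- i"] by simp
 thus ?thesis by (simp add: sg_def rev_map[symmetric])
qed

lemma sg_split: "i <= m ==> m <= k ==> sg f i k = butlast (sg f i m) @ sg f m k"
proof -
 assume "i <= m" "m <= k"
 hence "[i..k] = [i..m - 1] @ [m..k]" using upto_split1[of i m k] by simp
 moreover have "[i..m] = [i..m - 1] @ [m]" using \<open>i <= m\<close> by (simp add: upto_rec2)
 ultimately show ?thesis using \<open>i <= m\<close> \<open>m <= k\<close> by (simp add: sg_def butlast_append)
qed

lemma sg_butlast: "sg f i m = butlast (sg f i m) @ [f m]"
 by (metis append_butlast_last_id last_sg sg_neq_Nil)

lemma sg_Cons: "sg f i m = f i # tl (sg f i m)"
 by (metis hd_sg list.collapse sg_neq_Nil)

lemma flips_red: "red xs ==> xs ~= [] ==> flips xs = length xs - 1"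
 by (induction xs rule: red.induct) auto

text \<open>Parity is measured from the fixed index \<open>i\<close>, so one condition on the axis
  serves all of its segments, in both directions.\<close>

lemma zz_sg:
 assumes "!!s. if p0 = even (s - i) then E (f s) (f (s + 1)) else E (f (s + 1)) (f s)"
 shows "zz E (p0 = even (a - i)) (sg f a b)"
proof -
 have up: "zz E (p0 = even (a - i)) (sg f a b)" if "a <= b" for a b :: int
  unfolding zz_nth
 proof (intro allI impI)
  fix n assume n: "Suc n < length (sg f a b)"
  have "even (a + int n - i) = (even (a - i) = even n)" by simp presburger
  thus "if (p0 = even (a - i)) = even n then E (sg f a b ! n) (sg f a b ! Suc n)
   else E (sg f a b ! Suc n) (sg f a b ! n)"
   using assms[of "a + int n"] n that by (cases p0) (auto simp: nth_sg add.assoc add.commute[of 1] split: if_splits)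
 qed
 show ?thesis
 proof (cases "a <= b")
  case False
  have "even (nat (a - b)) <-> even (a - b)" using False by (simp add: even_nat_iff)
  hence "odd (length (sg f b a)) <-> even (a - b)" using False by simp
  moreover have "((p0 = even (a - i)) = even (a - b)) = (p0 = even (b - i))" by (cases p0) (simp; presburger)+
  ultimately show ?thesis using up[of b a] False zz_rev[of E "p0 = even (a - i)" "sg f b a"] by (simp add: rev_sg)
 qed (rule up)
qed

text \<open>\<open>T1\<close> leads from \<open>al q\<close> to the axis \<open>f\<close>, and
  \<open>T2\<close> from the axis \<open>g\<close> to \<open>be2 q\<close>. The bound
  \<open>nn\<close> on tree paths is the unit in which all other lengths are measured.\<close>

locale axis0 = hom_pair_based +
 fixes f g :: "int => 'b" and T1 T2 :: "'b list" and L :: int and nn :: nat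
 assumes bired_f: "bired f" and bired_g: "bired g" and per_f: "per f L" and L: "0 < L" "L <= 2 * int nn"
  and T1: "T1 ~= []" "hd T1 = al q" "last T1 = f 0" "length T1 <= 2 * nn"
  and T2: "T2 ~= []" "hd T2 = g 0" "last T2 = be2 q" "length T2 <= 2 * nn"
  and up_len: "!!v. v : pverts G ==> length (up v) <= nn"
begin

definition cand :: "int => 'b list" where
 "cand k = nf (T1 @ sg f 0 k @ T2)"

text \<open>The amounts by which to slide along \<open>f\<close> so that the two axes coincide as
  labelled lines.\<close>

definition Lam :: "int set" where
 "Lam = {k. ALL i. g i = f (i + k)}"

definition LamE :: "int set" where
 "LamE = {k : Lam. odd (length (cand k))}"

lemma Lam_0: "k : Lam ==> f k = g 0"
 unfolding Lam_def by (metis (mono_tags, lifting) add_0 mem_Collect_eq)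

lemma base_cand: "base (cand k)"
 using T1 T2 by (auto simp: cand_def base_def)

lemma SS_cand:
 "SS (cand k) v = nf (nf (map al (up v) @ T1) @ sg f 0 k @ nf (T2 @ map be2 (rev (up v))))"
 using nf_append_nf2[of "map al (up v)" "T1 @ sg f 0 k @ T2" "map be2 (rev (up v))"]
  nf_append_nf[of "map al (up v) @ T1 @ sg f 0 k" "T2 @ map be2 (rev (up v))"]
 by (simp add: SS_def cand_def)

text \<open>Conjugated by the tails, the test words \<open>X\<close> and \<open>Y\<close> have at
  most \<open>6 * nn\<close> vertices each; with one period this makes \<open>14 * nn\<close>,
  within reach of \<open>axis_lemma\<close>. Applied with \<open>f\<close> as both axes, it shows
  that \<open>X\<close> translates the axis to itself, and such a word is compatible with every
  slide.\<close>

lemma far_arc: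
 assumes V: "u : pverts G" "v : pverts G" and k: "k : Lam" "16 * int nn <= k" "k' : Lam" and p: "arcT u v (cand k)"
 shows "arcT u v (cand k')"
proof -
 define X0 Y0 where "X0 = map al (cyc u v)" and "Y0 = map be2 (cyc u v)"
 have XY: "X0 ~= []" "Y0 ~= []" "hd X0 = al q" "last X0 = al q" "hd Y0 = be2 q" "last Y0 = be2 q"
  using cyc_closed[OF V] by (auto simp: X0_def Y0_def hd_map last_map)
 have XYl: "length X0 <= 2 * nn" "length Y0 <= 2 * nn"
  using up_len[OF V(1)] up_len[OF V(2)] by (auto simp: X0_def Y0_def cyc_def)
 define X Y where "X = nf (rev T1 @ X0 @ T1)" and "Y = nf (T2 @ Y0 @ rev T2)"
 have fk: "f k = g 0" "f k' = g 0" using k Lam_0 by auto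
 have e: "nf (X0 @ T1 @ sg f 0 k @ T2) = nf (T1 @ sg f 0 k @ T2 @ Y0)"
  using p arcT_iff[OF base_cand V] by (simp add: cand_def X0_def Y0_def)
 have eq: "nf (X @ sg f 0 k) = nf (sg f 0 k @ Y)"
 proof -
  have "nf (X @ sg f 0 k) = nf (rev T1 @ (X0 @ T1 @ sg f 0 k @ T2) @ rev T2)"
   using nf_cancel_L[of T2 "rev T1 @ X0 @ T1 @ sg f 0 k" "[]"] T1 T2 fk by (simp add: X_def)
  also have "\<dots> = nf (rev T1 @ (T1 @ sg f 0 k @ T2 @ Y0) @ rev T2)" by (rule nf_cong[OF e])
  also have "\<dots> = nf (sg f 0 k @ Y)"
   using nf_cancel'_R[of T1 "sg f 0 k @ T2 @ Y0 @ rev T2" "[]"] T1 by (simp add: Y_def)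
  finally show ?thesis .
 qed
 have len: "length X <= 6 * nn" "length Y <= 6 * nn"
  using length_nf[of "rev T1 @ X0 @ T1"] length_nf[of "T2 @ Y0 @ rev T2"] XYl T1 T2 by (auto simp: X_def Y_def)
 obtain p where pX: "X = sg f 0 p" and pp: "ALL i. f i = f (i + p)"
  using axis_lemma[OF bired_f bired_f per_f per_f L(1), of X Y k] len L k(2) T1 T2 XY fk eq
  by (auto simp: X_def Y_def)
 have sh: "sg f (i + p) (j + p) = sg f i j" for i j using sg_shift[of f f p i j] pp by simp
 have sgk: "sg f k (k + p) = sg g 0 p" "sg f k' (k' + p) = sg g 0 p"
  using sg_shift[of g f k 0 p] sg_shift[of g f k' 0 p] k by (simp_all add: Lam_def add.commute)
 have X: "nf (X @ sg f 0 k) = nf (sg f 0 k @ sg g 0 p)" if "sg f k (k + p) = sg g 0 p" for k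
 proof -
  have "nf (X @ sg f 0 k) = nf (sg f 0 p @ sg f p (k + p))" using sh[of 0 k] pX by simp
  also have "\<dots> = nf (sg f 0 k @ sg f k (k + p))" by (simp add: nf_sg_trans0)
  finally show ?thesis using that by simp
 qed
 have Y: "Y = nf (sg g 0 p)"
 proof -
  have "nf (sg f 0 k @ Y) = nf (sg f 0 k @ sg g 0 p)" using X[OF sgk(1)] eq by simp
  hence "nf (rev (sg f 0 k) @ sg f 0 k @ Y) = nf (rev (sg f 0 k) @ sg f 0 k @ sg g 0 p)" by (rule nf_cong_r)
  thus ?thesis
   using nf_cancel'_R[of "sg f 0 k" Y "[]"] nf_cancel'_R[of "sg f 0 k" "sg g 0 p" "[]"] fk T2 by (simp add: Y_def)
 qed
 have e': "nf (X @ sg f 0 k') = nf (sg f 0 k' @ Y)" using X[OF sgk(2)] Y by simp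
 have "nf (X0 @ cand k') = nf (T1 @ (rev T1 @ X0 @ T1) @ sg f 0 k' @ T2)"
  using nf_cancel_R[of T1 "X0 @ T1 @ sg f 0 k' @ T2" "[]"] T1 XY by (simp add: cand_def)
 also have "\<dots> = nf (T1 @ (X @ sg f 0 k') @ T2)" by (simp add: X_def)
 also have "\<dots> = nf (T1 @ (sg f 0 k' @ Y) @ T2)" by (rule nf_cong[OF e'])
 also have "\<dots> = nf ((T1 @ sg f 0 k') @ (T2 @ Y0 @ rev T2) @ T2)"
  using nf_append_nf2[of "T1 @ sg f 0 k'" "T2 @ Y0 @ rev T2" T2] by (simp add: Y_def)
 also have "\<dots> = nf (cand k' @ Y0)"
  using nf_cancel'_L[of T2 "T1 @ sg f 0 k' @ T2 @ Y0" "[]"] T2 XY by (simp add: cand_def)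
 finally show ?thesis using arcT_iff[OF base_cand V] by (simp add: X0_def Y0_def)
qed

text \<open>A trivial transport would express a segment of \<open>k\<close> steps by a word of at
  most \<open>6 * nn + 1\<close> vertices.\<close>

lemma far_eps:
 assumes v: "v : pverts G" and k: "k : Lam" "16 * int nn <= k"
 shows "SS (cand k) v ~= [al v]"
proof
 define A B where "A = map al (up v)" and "B = map be2 (up v)"
 have AB: "A ~= []" "B ~= []" "hd A = al v" "last A = al q" "last B = be2 q" "length A <= nn" "length B <= nn"
  using up[OF v] up_len[OF v] by (auto simp: A_def B_def hd_map last_map)
 assume "SS (cand k) v = [al v]"
 hence e: "nf (A @ T1 @ sg f 0 k @ T2 @ rev B) = nf [al v]"
  by (simp add: SS_def cand_def A_def B_def rev_map)
 have fk: "f k = g 0" using k Lam_0 by auto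
 have "nf (sg f 0 k) = nf ((sg f 0 k @ T2) @ rev B @ B @ rev T2)"
  using nf_cancel'_L[of B "sg f 0 k @ T2" "rev T2"] nf_cancel_L[of T2 "sg f 0 k" "[]"] AB T2 fk by simp
 also have "\<dots> = nf (rev T1 @ rev A @ A @ T1 @ (sg f 0 k @ T2) @ rev B @ B @ rev T2)"
  using nf_cancel'_R[of A "T1 @ (sg f 0 k @ T2) @ rev B @ B @ rev T2" "rev T1"]
   nf_cancel'_R[of T1 "(sg f 0 k @ T2) @ rev B @ B @ rev T2" "[]"] AB T1 by simp
 also have "\<dots> = nf ((rev T1 @ rev A) @ [al v] @ B @ rev T2)"
  using nf_cong[OF e, of "rev T1 @ rev A" "B @ rev T2"] by simp
 finally have "sg f 0 k = nf ((rev T1 @ rev A) @ [al v] @ B @ rev T2)" using red_sg[OF bired_f] by simp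
 hence "length (sg f 0 k) <= length ((rev T1 @ rev A) @ [al v] @ B @ rev T2)" using length_nf by metis
 hence "nat \<bar>k\<bar> <= 6 * nn" using AB T1(4) T2(4) by simp
 moreover have "0 < nn" using AB by (cases nn) auto
 ultimately show False using k(2) by linarith
qed

text \<open>Tails and tree paths cancel at most \<open>3 * nn\<close> vertices at either end, so
  more than \<open>2 * L\<close> steps of the axis survive. Two periods are used because
  \<open>L\<close> may be odd and the condition depends on the parity of the position. Hence the
  whole axis is zigzag with this parity, and sliding by an even amount preserves the
  condition.\<close>

lemma far_zig:
 assumes v: "v : pverts G" and k: "k : Lam" "16 * int nn <= k" "k' : Lam" "even (k - k')" and z: "zo (EE v) (SS (cand k) v)"
 shows "zo (EE v) (SS (cand k') v)"
proof -
 define U U' where "U = nf (map al (up v) @ T1)" and "U' = nf (T2 @ map be2 (rev (up v)))"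
 have UU: "U ~= []" "U' ~= []" "red U" "red U'" "last U = f 0" "hd U' = g 0" "length U <= 3 * nn" "length U' <= 3 * nn"
  using T1 T2 up[OF v] up_len[OF v] length_nf[of "map al (up v) @ T1"] length_nf[of "T2 @ map be2 (rev (up v))"]
  by (auto simp: U_def U'_def)
 have nn: "0 < nn" using up[OF v] up_len[OF v] by (cases nn) auto
 have k0: "0 <= k" using k(2) by linarith
 have fk: "f k = g 0" "f k' = g 0" using k Lam_0 by auto
 obtain A1 c B1 where d: "c ~= []" "U = A1 @ c" "sg f 0 k = rev c @ B1" "red (A1 @ hd c # B1)"
  using red_append_decomp[of U "sg f 0 k"] UU red_sg[OF bired_f] by auto
 define i where "i = int (length c) - 1"
 have i: "0 <= i" "i < 3 * int nn" using d(1,2) UU(7) by (auto simp: i_def Suc_leI)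
 have ik: "i <= k" using i k(2) by linarith
 have cB: "rev c = sg f 0 i" "hd c # B1 = sg f i k"
 proof -
  have "sg f 0 k = sg f 0 i @ tl (sg f i k)"
   using sg_split[OF i(1) ik, of f] sg_butlast[of f 0 i] sg_Cons[of f i k]
   by (metis append.assoc append_Cons append_Nil)
  moreover have "length (sg f 0 i) = length (rev c)" using d(1) by (cases c) (auto simp: i_def)
  ultimately have *: "rev c = sg f 0 i & B1 = tl (sg f i k)" using d(3) by (metis append_eq_append_conv)
  have "hd c = last (rev c)" using d(1) by (simp add: last_rev)
  thus "rev c = sg f 0 i" "hd c # B1 = sg f i k" using * sg_Cons[of f i k] by auto
 qed
 have c: "c = sg f i 0" using cB(1) rev_sg by (metis rev_rev_ident)
 have W1: "nf (U @ sg f 0 k) = A1 @ sg f i k" "red (A1 @ sg f i k)"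
  using nf_decomp[OF d(1,4)] d cB(2) by simp_all
 obtain W2 c' B2 where d': "c' ~= []" "A1 @ sg f i k = W2 @ c'" "U' = rev c' @ B2" "red (W2 @ hd c' # B2)"
  using red_append_decomp[of "A1 @ sg f i k" U'] UU W1(2) fk by auto
 define m where "m = k - (int (length c') - 1)"
 have lc': "1 <= length c'" "length c' <= 3 * nn" using d' UU(8) by (auto simp: Suc_leI)
 have m: "i <= m" "m <= k" "2 * L <= m - i" using lc' i k(2) L(2) by (auto simp: m_def)
 have cW: "c' = sg f m k" "W2 = A1 @ butlast (sg f i m)"
 proof -
  have "(A1 @ butlast (sg f i m)) @ sg f m k = W2 @ c'" using d'(2) sg_split[OF m(1,2), of f] by simp
  moreover have "length (sg f m k) = length c'" using lc' m by (simp add: m_def)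
  ultimately show "c' = sg f m k" "W2 = A1 @ butlast (sg f i m)" by (metis append_eq_append_conv)+
 qed
 have U': "U' = sg f k m @ B2" using d'(3) cW(1) by (simp add: rev_sg)
 have S: "SS (cand k) v = A1 @ sg f i m @ B2"
 proof -
  have "SS (cand k) v = nf ((A1 @ sg f i k) @ U')"
   using SS_cand[of k v] W1(1) nf_nf_append[of "U @ sg f 0 k" U'] by (simp add: U_def U'_def)
  also have "\<dots> = W2 @ hd c' # B2" using nf_decomp[OF d'(1,4)] d'(2,3) by simp
  also have "\<dots> = A1 @ butlast (sg f i m) @ [f m] @ B2" using cW by simp
  also have "\<dots> = A1 @ sg f i m @ B2" using sg_butlast[of f i m] by (metis append.assoc)
  finally show ?thesis .
 qed
 define p0 where "p0 = even (length A1)"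
 have zA: "zz (EE v) True (A1 @ [f i])" and zr: "zz (EE v) p0 (sg f i m @ B2)"
  using z zz_append[of "EE v" True A1 "f i" "tl (sg f i m) @ B2"] sg_Cons[of f i m]
  unfolding S zo_def p0_def by (simp, metis append_Cons)+
 have par_m: "even (length (butlast (sg f i m))) <-> even (m - i)" using m by (simp add: even_nat_iff)
 have zs: "zz (EE v) p0 (sg f i m)" and zB: "zz (EE v) (p0 = even (m - i)) (f m # B2)"
 proof -
  define M where "M = butlast (sg f i m)"
  have M: "sg f i m = M @ [f m]" using sg_butlast[of f i m] by (simp only: M_def)
  have "zz (EE v) p0 (M @ f m # B2)" using zr M by simp
  thus "zz (EE v) p0 (sg f i m)" "zz (EE v) (p0 = even (m - i)) (f m # B2)"
   using zz_append[of "EE v" p0 M "f m" B2] par_m M by (simp_all add: M_def[symmetric])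
 qed
 \<comment> \<open>Every index can be moved into the surviving segment by a multiple of
   \<open>2 * L\<close>, which changes neither the label nor the parity.\<close>
 have ED: "if p0 = even (s - i) then EE v (f s) (f (s + 1)) else EE v (f (s + 1)) (f s)" for s
 proof -
  define n where "n = nat ((s - i) mod (2 * L))"
  have n: "int n = (s - i) mod (2 * L)" using L(1) by (simp add: n_def)
  hence nm: "int n < m - i" using m(3) L(1) pos_mod_bound[of "2 * L" "s - i"] by linarith
  define D where "D = (s - i) div (2 * L)"
  have "D * (2 * L) + int n = s - i" unfolding n D_def by (rule div_mult_mod_eq)
  hence si: "s = i + int n + (D * 2) * L" by (simp add: algebra_simps)
  have fs: "f s = f (i + int n)" "f (s + 1) = f (i + int n + 1)"
  proof -
   show "f s = f (i + int n)" using per_mult[OF per_f, of "i + int n" "D * 2"] si by simp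
   have "s + 1 = i + int n + 1 + (D * 2) * L" using si by simp
   thus "f (s + 1) = f (i + int n + 1)" using per_mult[OF per_f, of "i + int n + 1" "D * 2"] by metis
  qed
  have ev: "even (s - i) = even n" using si by simp
  have "if p0 = even n then EE v (sg f i m ! n) (sg f i m ! Suc n) else EE v (sg f i m ! Suc n) (sg f i m ! n)"
   using zs nm m(1) unfolding zz_nth by auto
  moreover have "sg f i m ! n = f (i + int n)" "sg f i m ! Suc n = f (i + int n + 1)"
   using nth_sg[of i m n f] nth_sg[of i m "Suc n" f] nm m(1) by (simp_all add: algebra_simps)
  ultimately show ?thesis unfolding fs ev by metis
 qed
 \<comment> \<open>The index at which the walk leaves the axis on the right moves along with the
   candidate.\<close>
 define m' where "m' = k' - (k - m)"
 have mm: "f m' = f m"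
 proof -
  have "g (m - k) = f (m - k + k')" "g (m - k) = f (m - k + k)" using k(1,3) unfolding Lam_def by blast+
  thus ?thesis by (simp add: m'_def algebra_simps)
 qed
 have ev: "even (m' - i) = even (m - i)" using k(4) by (simp add: m'_def) presburger
 have "zz (EE v) p0 (sg f i m')" using zz_sg[where a = i and b = m' and i = i and ?p0.0 = p0 and E = "EE v" and f = f] ED by simp
 moreover have "even (length (butlast (sg f i m'))) <-> even (m' - i)" by (simp add: even_nat_iff)
 ultimately have z': "zz (EE v) p0 (sg f i m' @ B2)"
 proof -
  define M where "M = butlast (sg f i m')"
  have M: "sg f i m' = M @ [f m']" using sg_butlast[of f i m'] by (simp only: M_def)
  assume "zz (EE v) p0 (sg f i m')" "even (length (butlast (sg f i m'))) = even (m' - i)"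
  hence "zz (EE v) p0 (M @ f m' # B2)"
   unfolding zz_append[of "EE v" p0 M "f m'" B2] using zB ev mm M by (simp add: M_def[symmetric])
  thus ?thesis using M by simp
 qed
 have "zz (EE v) True (A1 @ sg f i m' @ B2)"
 proof -
  obtain M where M: "sg f i m' = f i # M" using sg_Cons by blast
  thus ?thesis using zA zz_append[of "EE v" True A1 "f i" "M @ B2"] z' by (simp add: p0_def)
 qed
 moreover have "odd (length (A1 @ sg f i m' @ B2))"
 proof -
  have "even (nat \<bar>m' - i\<bar>) = even (nat \<bar>m - i\<bar>)" using ev by (simp add: even_nat_iff)
  thus ?thesis using z S by (simp add: zo_def)
 qed
 ultimately have "zo (EE v) (nf (A1 @ sg f i m' @ B2))" by (intro zo_nf[OF EE_irrefl[OF v]]) (simp add: zo_def)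
 moreover have "nf (A1 @ sg f i m' @ B2) = SS (cand k') v"
 proof -
  have "U' = sg g 0 (m - k) @ B2" using U' sg_shift[of g f k 0 "m - k"] k(1) by (simp add: Lam_def)
  hence U'': "U' = sg f k' m' @ B2" using sg_shift[of g f k' 0 "m - k"] k(3) by (simp add: Lam_def m'_def algebra_simps)
  have "SS (cand k') v = nf (A1 @ sg f i 0 @ sg f 0 k' @ sg f k' m' @ B2)"
  proof -
   have "SS (cand k') v = nf (U @ sg f 0 k' @ U')" by (simp add: SS_cand U_def U'_def)
   thus ?thesis using d(2) c U'' by simp
  qed
  thus ?thesis by (simp add: nf_sg_trans)
 qed
 ultimately show ?thesis by simp
qed

lemma far_pos:
 assumes "wft t" "k : Lam" "16 * int nn <= k" "k' : Lam" "even (k - k')" "passes t (cand k)"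
 shows "passes t (cand k')"
 using assms far_arc far_eps far_zig by (cases t) (auto simp: wft_def)

lemma odd_cand: "k : Lam ==> odd (length (cand k)) <-> even (int (flips T1) + k + int (flips T2))"
proof -
 assume k: "k : Lam"
 have "f k = g 0" using k Lam_0 by auto
 hence "flips (T1 @ sg f 0 k @ T2) = flips T1 + (nat \<bar>k\<bar> + flips T2)"
  using T1 T2 flips_join[of T1 "sg f 0 k @ T2"] flips_join[of "sg f 0 k" T2] flips_red[OF red_sg[OF bired_f], of 0 k]
  by (simp add: hd_append)
 moreover have "even (length (cand k)) <-> odd (flips (T1 @ sg f 0 k @ T2))"
  unfolding cand_def using T1 by (intro even_length_nf) simp
 moreover have "even (nat \<bar>k\<bar>) = even k" by (simp add: even_nat_iff)
 ultimately show ?thesis by (cases "even k"; cases "even (flips T1)"; cases "even (flips T2)") simp_all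
qed

lemma LamE_even: "k : LamE ==> k' : Lam ==> k' : LamE <-> even (k - k')"
 using odd_cand by (auto simp: LamE_def)

lemma Lam_torsor: "k1 : Lam ==> k2 : Lam ==> k3 : Lam ==> k1 - k2 + k3 : Lam"
 unfolding Lam_def
proof clarify
 fix i assume a: "ALL i. g i = f (i + k1)" "ALL i. g i = f (i + k2)" "ALL i. g i = f (i + k3)"
 have "f (i + k3) = g (i + k3 - k2)" using a(2)[rule_format, of "i + k3 - k2"] by simp
 also have "\<dots> = f (i + k3 - k2 + k1)" using a(1) by blast
 finally show "g i = f (i + (k1 - k2 + k3))" using a(3)[rule_format, of i] by (simp add: algebra_simps)
qed

text \<open>The tails in the middle cancel, and \<open>k1 - k2\<close> is a period of
  \<open>f\<close>, by which the remaining segment is shifted into place.\<close>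

lemma cand_torsor:
 assumes "k1 : Lam" "k2 : Lam" "k3 : Lam"
 shows "nf (cand k1 @ rev (cand k2) @ cand k3) = cand (k1 - k2 + k3)"
proof -
 have fk: "f k1 = g 0" "f k2 = g 0" "f k3 = g 0" using assms Lam_0 by auto
 have sh: "f i = f (i + (k1 - k2))" for i
 proof -
  have "g (i - k2) = f (i - k2 + k1)" "g (i - k2) = f (i - k2 + k2)" using assms unfolding Lam_def by blast+
  thus ?thesis by (simp add: algebra_simps)
 qed
 have s: "sg f k2 k3 = sg f k1 (k1 - k2 + k3)" using sg_shift[of f f "k1 - k2" k2 k3] sh by (simp add: algebra_simps)
 have "nf (cand k1 @ rev (cand k2) @ cand k3) =
   nf ((T1 @ sg f 0 k1) @ T2 @ rev T2 @ (sg f k2 0 @ rev T1 @ T1 @ sg f 0 k3 @ T2))"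
  using nf_append_nf[of "(T1 @ sg f 0 k1 @ T2) @ rev T2 @ sg f k2 0 @ rev T1" "T1 @ sg f 0 k3 @ T2"]
  by (simp add: cand_def nf_rev[symmetric] rev_sg)
 also have "\<dots> = nf ((T1 @ sg f 0 k1 @ sg f k2 0) @ rev T1 @ T1 @ (sg f 0 k3 @ T2))"
  using nf_cancel_L[of T2 "T1 @ sg f 0 k1"] T2 fk by simp
 also have "\<dots> = nf ((T1 @ sg f 0 k1) @ sg f k2 0 @ sg f 0 k3 @ T2)"
  using nf_cancel'_R[of T1 "sg f 0 k3 @ T2" "T1 @ sg f 0 k1 @ sg f k2 0"] T1 by simp
 also have "\<dots> = nf (T1 @ sg f 0 k1 @ sg f k1 (k1 - k2 + k3) @ T2)" using nf_sg_trans[of "T1 @ sg f 0 k1" f k2 0 k3 T2] s by simp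
 also have "\<dots> = cand (k1 - k2 + k3)" using nf_sg_trans[of T1 f 0 k1 "k1 - k2 + k3" T2] by (simp only: cand_def)
 finally show ?thesis .
qed

lemma LamE_torsor: "k1 : LamE ==> k2 : LamE ==> k3 : LamE ==> k1 - k2 + k3 : LamE"
 using Lam_torsor[of k1 k2 k3] LamE_even[of k3 "k1 - k2 + k3"] LamE_even[of k1 k2] by (auto simp: LamE_def)

lemma LamE_L: "k : LamE ==> k + 2 * L : LamE"
proof -
 assume k: "k : LamE"
 have "f (i + k + 2 * L) = f (i + k)" for i using per_mult[OF per_f, of "i + k" 2] by simp
 hence "k + 2 * L : Lam" using k by (auto simp: LamE_def Lam_def add.assoc)
 thus ?thesis using LamE_even[OF k] by simp
qed

lemma LamE_L': "k : LamE ==> k - 2 * L : LamE"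
 using LamE_torsor[of k "k + 2 * L" k] LamE_L[of k] by simp

lemma passes_progression:
 assumes "wft t" "k1 : LamE" "k2 : LamE" "passes t (cand k1)" "passes t (cand k2)"
 shows "k1 + int m * (k2 - k1) : LamE & passes t (cand (k1 + int m * (k2 - k1)))"
proof (induction m)
 case (Suc m)
 let ?k = "k1 + int m * (k2 - k1)"
 have e: "k1 + int (Suc m) * (k2 - k1) = ?k - k1 + k2" by (simp add: algebra_simps)
 have "passes t (nf (cand ?k @ rev (cand k1) @ cand k2))"
  using Suc assms base_cand by (intro passes_torsor) auto
 moreover have "nf (cand ?k @ rev (cand k1) @ cand k2) = cand (?k - k1 + k2)"
  using cand_torsor[of ?k k1 k2] Suc assms by (simp only: LamE_def mem_Collect_eq)
 moreover have "?k - k1 + k2 : LamE" using LamE_torsor Suc assms by blast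
 ultimately show ?case unfolding e by simp
qed (use assms in simp)

text \<open>Reversing both axes turns negative slides into positive ones, so the estimates for far
  candidates are made for one sign only.\<close>

lemma axis0_flip: "axis0 G H al be2 q up (%i. f (- i)) (%i. g (- i)) T1 T2 L nn"
proof unfold_locales
 show "bired (%i. f (- i))" "bired (%i. g (- i))"
 proof -
  have "f (- i) ~= f (- (i + 1)) & f (- i) ~= f (- (i + 2))" if "bired f" for f :: "int => 'b" and i
   using that[unfolded bired_def, THEN spec, of "- i - 1"] that[unfolded bired_def, THEN spec, of "- i - 2"] by auto
  thus "bired (%i. f (- i))" "bired (%i. g (- i))" using bired_f bired_g unfolding bired_def by blast+
 qed
 show "per (%i. f (- i)) L"
  unfolding per_def
 proof
  fix i show "f (- (i + L)) = f (- i)" using per_f[unfolded per_def, THEN spec, of "- i - L"] by simp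
 qed
qed (use L T1 T2 up_len in auto)

lemma far:
 assumes "wft t" "k : LamE" "16 * int nn <= \<bar>k\<bar>" "k' : LamE" "passes t (cand k)"
 shows "passes t (cand k')"
proof -
 have ev: "k : Lam" "k' : Lam" "even (k - k')" using assms LamE_even by (auto simp: LamE_def)
 show ?thesis
 proof (cases "0 <= k")
  case True thus ?thesis using far_pos[OF assms(1) ev(1) _ ev(2,3) assms(5)] assms(3) by simp
 next
  case False
  interpret fl: axis0 G H al be2 q up "%i. f (- i)" "%i. g (- i)" T1 T2 L nn by (rule axis0_flip)
  have c: "fl.cand (- k) = cand k" for k by (simp add: fl.cand_def cand_def sg_neg)
  have l: "- k : fl.Lam" if "k : Lam" for k
   unfolding fl.Lam_def
  proof (intro CollectI allI)
   fix i
   have "g (- i) = f (- i + k)" using that unfolding Lam_def by blast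
   thus "g (- i) = f (- (i + - k))" by simp
  qed
  show ?thesis using fl.far_pos[OF assms(1) l[OF ev(1)] _ l[OF ev(2)]] c ev(3) assms(3,5) False by simp
 qed
qed

text \<open>Two passing candidates generate a progression of passing ones, which leaves the window;
  but a passing candidate outside the window makes all pass, contrary to \<open>k0\<close>.\<close>

lemma passes_unique:
 assumes "wft t" "k0 : LamE" "~ passes t (cand k0)" "k : LamE" "passes t (cand k)"
 shows "\<bar>k\<bar> < 16 * int nn" "k' : LamE ==> passes t (cand k') ==> k' = k"
proof -
 show "\<bar>k\<bar> < 16 * int nn" using far[OF assms(1,4) _ assms(2,5)] assms(3) by force
 assume k': "k' : LamE" "passes t (cand k')"
 show "k' = k"
 proof (rule ccontr)
  assume ne: "k' ~= k"
  \<comment> \<open>Every step of the progression moves by at least one, so \<open>m\<close> steps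
    from \<open>k\<close> lead out of the window.\<close>
  define m where "m = 16 * nn + nat \<bar>k\<bar>"
  have "int m <= int m * \<bar>k' - k\<bar>" using ne mult_left_mono[of 1 "\<bar>k' - k\<bar>" "int m"] by simp
  hence "16 * int nn <= \<bar>k + int m * (k' - k)\<bar>" unfolding abs_mult[of "int m", simplified, symmetric] m_def by linarith
  thus False
   using passes_progression[OF assms(1,4) k'(1) assms(5) k'(2), of m] far[OF assms(1) _ _ assms(2)] assms(3) by blast
 qed
qed

lemma Real_cand_iff: "Real (cand k) <-> (ALL t:tests. passes t (cand k))"
 using Real_iff_tests[OF base_cand] .

lemma Real_unique:
 assumes "k0 : LamE" "~ Real (cand k0)" "k : LamE" "Real (cand k)" "k' : LamE" "Real (cand k')"
 shows "k' = k"
proof -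
 obtain t where "t : tests" "~ passes t (cand k0)" using assms Real_cand_iff by blast
 thus ?thesis using passes_unique(2)[OF wft_tests] assms Real_cand_iff by blast
qed

text \<open>\<open>LamE\<close> is closed under \<open>k1 - k2 + k3\<close>, hence a coset of a
  subgroup of the integers, which is generated by the gap between two neighbors.\<close>

lemma LamE_progression:
 assumes "ka : LamE" "kb : LamE" "ka < kb" "!!k. ka < k ==> k < kb ==> k ~: LamE"
 shows "LamE = range (%n::int. ka + n * (kb - ka))"
proof -
 define d where "d = kb - ka"
 have d: "0 < d" using assms by (simp add: d_def)
 have st: "k + d : LamE" "k - d : LamE" if "k : LamE" for k
  using LamE_torsor[OF that assms(1,2)] LamE_torsor[OF that assms(2,1)] by (simp_all add: d_def algebra_simps)
 have all: "k + n * d : LamE" if "k : LamE" for k n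
 proof (induction n rule: int_induct[of _ 0])
  case (step1 i) thus ?case using st(1)[of "k + i * d"] by (simp add: algebra_simps)
 next
  case (step2 i) thus ?case using st(2)[of "k + i * d"] by (simp add: algebra_simps)
 qed (use that in simp)
 have "EX n. k = ka + n * d" if "k : LamE" for k
 proof -
  define r where "r = ka + (k - ka) mod d"
  have "k = r + (k - ka) div d * d" by (simp add: r_def)
  moreover have "r : LamE" using all[OF that, of "- ((k - ka) div d)"] by (simp add: r_def algebra_simps minus_mult_div_eq_mod[symmetric])
  moreover have "ka <= r" "r < kb" using d by (simp_all add: r_def) (simp add: d_def algebra_simps, metis pos_mod_bound d d_def add.commute diff_add_cancel add_less_cancel_left)
  ultimately have "r = ka" using assms(4)[of r] by force
  thus ?thesis using \<open>k = r + (k - ka) div d * d\<close> by blast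
 qed
 thus ?thesis using all[OF assms(1)] unfolding d_def by blast
qed

end

context axis0
begin

text \<open>Without its tails the candidate is the segment. Its length gives the absolute value of
  the slide and its second vertex the sign, as \<open>f\<close> does not backtrack at 0. For
  \<open>k\<close> only the matching endpoint is assumed, which a program can check.\<close>

lemma cand_inj:
 assumes "f k = g 0" "k' : Lam" "cand k = cand k'"
 shows "k = k'"
proof -
 have c: "nf (rev T1 @ cand k @ rev T2) = sg f 0 k" if "f k = g 0" for k
 proof -
  have "nf (rev T1 @ cand k @ rev T2) = nf (rev T1 @ T1 @ sg f 0 k @ T2 @ rev T2)" by (simp add: cand_def)
  also have "\<dots> = sg f 0 k"
   using nf_cancel'_R[of T1 "sg f 0 k @ T2 @ rev T2" "[]"] nf_cancel_L[of T2 "sg f 0 k" "[]"] T1 T2 that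
    red_sg[OF bired_f] by simp
  finally show ?thesis .
 qed
 have e: "sg f 0 k = sg f 0 k'" using c[OF assms(1)] c[OF Lam_0[OF assms(2)]] assms(3) by simp
 hence l: "\<bar>k\<bar> = \<bar>k'\<bar>" using length_sg[of f 0 k] length_sg[of f 0 k'] unfolding e by simp
 show ?thesis
 proof (rule ccontr)
  assume "k ~= k'"
  hence kk: "k' = - k" "k ~= 0" using l by auto
  have ends: "sg f 0 m ! 1 = f 1" if "0 < m" for m using that nth_sg[of 0 m 1 f] by simp
  have ends': "sg f 0 (- m) ! 1 = f (- 1)" if "0 < m" for m
   using that nth_sg[of 0 m 1 "%t. f (- t)"] sg_neg[of f 0 m] by simp
  have "f (- 1) ~= f (- 1 + 2)" using bired_f unfolding bired_def by blast
  hence "f (- 1) ~= f 1" by simp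
  thus False using e kk ends ends' by (cases "0 < k") (metis, metis add.inverse_inverse neg_0_less_iff_less linorder_neqE_linordered_idom)
 qed
qed

lemma vl_steps_append:
 assumes "R ~= []" "hd R = a" "last R = a"
 shows "nf (vl a (steps R @ w)) = nf (R @ vl a w)"
proof -
 have "vl a (steps R @ w) = R @ map snd w" using vl_steps[of R] assms by (simp add: vl_append)
 moreover have "nf (R @ vl a w) = nf (R @ map snd w)"
  unfolding vl_def using nf_join[of R a "[]" "map snd w"] assms by simp
 ultimately show ?thesis by simp
qed

lemma walk_inverse_steps: "walk_inverse (steps xs) = steps (rev xs)"
proof (induction xs rule: induct_list012)
 case (3 x y zs)
 have st: "steps (xs @ [a, b]) = steps (xs @ [a]) @ [(a, b)]" for xs :: "'c list" and a b
  by (induction xs rule: induct_list012) (auto simp: steps_def)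
 have "walk_inverse (steps (x # y # zs)) = walk_inverse (steps (y # zs)) @ [(y, x)]"
  by (simp add: walk_inverse_def steps_def)
 also have "\<dots> = steps (rev zs @ [y, x])" using 3 st[of "rev zs" y x] by simp
 finally show ?case by simp
qed (auto simp: walk_inverse_def steps_def)

lemma nf_power:
 assumes "base P" "!!n::int. base (c n)" "c 0 = P" "R ~= []" "hd R = al q" "last R = al q"
  "!!n. nf (R @ c n) = c (n + 1)" "!!n. nf (rev R @ c n) = c (n - 1)"
 shows "nf (vl (al q) (walk_power (steps R) n @ steps P)) = c n &
  pcas (al q) (walk_power (steps R) n @ steps P) (be2 q)"
proof -
 have P: "pcas (al q) (steps P) (be2 q)" "vl (al q) (steps P) = P" "red P"
  using assms(1) pcas_steps[of P] vl_steps[of P] by (auto simp: base_def)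
 have main: "nf (vl (al q) (concat (replicate m (steps R)) @ steps P)) = d m &
   pcas (al q) (concat (replicate m (steps R)) @ steps P) (be2 q)"
  if "R ~= []" "hd R = al q" "last R = al q" "d 0 = P" "!!m. nf (R @ d m) = d (Suc m)" for m d R
 proof (induction m)
  case (Suc m)
  let ?w = "concat (replicate m (steps R)) @ steps P"
  have IH: "nf (vl (al q) ?w) = d m" "pcas (al q) ?w (be2 q)" using Suc by blast+
  have "nf (vl (al q) (steps R @ ?w)) = nf (R @ vl (al q) ?w)" by (rule vl_steps_append[OF that(1-3)])
  also have "\<dots> = nf (R @ d m)" by (subst nf_append_nf[symmetric], subst IH(1), rule refl)
  also have "\<dots> = d (Suc m)" by (rule that(5))
  finally have "nf (vl (al q) (steps R @ ?w)) = d (Suc m)" .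
  moreover have "last (vl (al q) (steps R)) = al q" "pcas (al q) (steps R) (al q)"
   using pcas_steps[OF that(1)] vl_steps[OF that(1)] unfolding that(2,3) by (simp_all add: that(3))
  hence "pcas (al q) (steps R @ ?w) (be2 q)"
   unfolding pcas_append[of _ "steps R"] using IH(2) by simp
  ultimately show ?case by (simp only: replicate.simps concat.simps append_assoc)
 qed (use P that in \<open>simp_all\<close>)
 show ?thesis
 proof (cases "0 <= n")
  case True
  have "nf (R @ c (int m)) = c (int (Suc m))" for m
  proof -
   have "int (Suc m) = int m + 1" by simp
   thus ?thesis using assms(7)[of "int m"] by metis
  qed
  thus ?thesis using main[of R "%m. c (int m)" "nat n"] assms(3-6) True by (simp add: walk_power_def)
 next
  case False
  have "nf (rev R @ c (- int m)) = c (- int (Suc m))" for m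
  proof -
   have "- int (Suc m) = - int m - 1" by simp
   thus ?thesis using assms(8)[of "- int m"] by metis
  qed
  thus ?thesis using main[of "rev R" "%m. c (- int m)" "nat (- n)"] assms(3-6) False
   by (simp add: walk_power_def walk_inverse_steps hd_rev last_rev)
 qed
qed

lemma pi_hom_zo:
 assumes "zo (EE q) xs" "red xs" "hd xs = al q"
 shows "steps xs : pi_hom H (al q) (last xs)"
 using assms zz_adjH[OF q] zo_nonempty[OF assms(1)] hom_al q
 by (subst pi_hom_steps) (auto simp: zo_def digraph_hom_def)

lemma Real_zo: "Real Q ==> zo (EE q) Q"
 using Real_iff[OF Real_base] SS_q[OF Real_base] q by metis

text \<open>If some candidate were not realizable, at most one would be; so two realizable neighbors
  make all of them realizable. \<open>R\<close> takes each candidate to the next.\<close>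

lemma case3:
 assumes k: "ka : LamE" "kb : LamE" "ka < kb" "!!k. ka < k ==> k < kb ==> k ~: LamE"
  and r: "Real (cand ka)" "Real (cand kb)" and ex: "!!Q. Real Q ==> EX k:LamE. Q = cand k"
 defines "R \<equiv> nf (cand kb @ rev (cand ka))" and "P \<equiv> cand ka"
 shows "steps R : pi_hom H (al q) (al q)" "steps P : pi_hom H (al q) (be2 q)"
  "realizable_walks G H al be2 q = power_walks H (al q) (be2 q) (steps R) (steps P)"
proof -
 have b: "base (cand k)" for k by (rule base_cand)
 have zo: "zo (EE q) (cand ka)" "zo (EE q) (cand kb)" using r Real_zo by auto
 have zR: "zo (EE q) R" unfolding R_def
  using b by (intro zo_join[OF EE_irrefl[OF q] zo(2) zo_rev[OF zo(1)]]) (auto simp: base_def hd_rev)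
 have R: "R ~= []" "hd R = al q" "last R = al q" "red R"
  using b[of ka] b[of kb] by (auto simp: R_def base_def last_rev)
 show "steps R : pi_hom H (al q) (al q)" using pi_hom_zo[OF zR] R by simp
 have P: "base P" "zo (EE q) P" using b zo by (auto simp: P_def)
 thus "steps P : pi_hom H (al q) (be2 q)" using pi_hom_zo[of P] by (auto simp: base_def)
 have all: "Real (cand k)" if "k : LamE" for k
  using Real_unique[OF that _ k(1) r(1) k(2) r(2)] k(3) by auto
 define c where "c n = cand (ka + n * (kb - ka))" for n
 have cl: "ka + n * (kb - ka) : LamE" for n using LamE_progression[OF k] by blast
 have Lm: "k : Lam" if "k : LamE" for k using that by (simp add: LamE_def)
 have c1: "nf (R @ c n) = c (n + 1)" for n
  using cand_torsor[OF Lm[OF k(2)] Lm[OF k(1)] Lm[OF cl[of n]]] by (simp add: R_def c_def algebra_simps)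
 have "rev R = nf (cand ka @ rev (cand kb))" by (simp add: R_def nf_rev[symmetric])
 hence c2: "nf (rev R @ c n) = c (n - 1)" for n
  using cand_torsor[OF Lm[OF k(1)] Lm[OF k(2)] Lm[OF cl[of n]]] by (simp add: c_def algebra_simps)
 have pw: "nf (vl (al q) (walk_power (steps R) n @ steps P)) = c n &
   pcas (al q) (walk_power (steps R) n @ steps P) (be2 q)" for n
  using R c1 c2 b by (intro nf_power P(1)) (auto simp: c_def P_def)
 have RealS: "{Q. Real Q} = range c"
 proof -
  have "{Q. Real Q} = cand ` LamE" using ex all by blast
  also have "\<dots> = cand ` range (%n. ka + n * (kb - ka))" using LamE_progression[OF k] by metis
  also have "\<dots> = range c" by (simp add: image_image c_def)
  finally show ?thesis .
 qed
 have "power_walks H (al q) (be2 q) (steps R) (steps P) = steps ` range c"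
 proof (intro set_eqI iffI)
  fix w assume "w : power_walks H (al q) (be2 q) (steps R) (steps P)"
  then obtain n where w: "w : pi_hom H (al q) (be2 q)" "same_reduction w (walk_power (steps R) n @ steps P)"
   by (auto simp: power_walks_def)
  obtain xs where xs: "w = steps xs" "red xs" "xs = vl (al q) w" "pcas (al q) w (be2 q)" by (rule pi_homE[OF w(1)]) blast
  have "nf (vl (al q) w) = c n" using same_reduction_iff[OF xs(4)] w(2) pw[of n] by metis
  hence "xs = c n" using xs(2,3) nf_red by metis
  thus "w : steps ` range c" using xs(1) by blast
 next
  fix w assume "w : steps ` range c"
  then obtain n where w: "w = steps (c n)" by auto
  have cn: "base (c n)" "Real (c n)" using b all cl by (auto simp: c_def)
  have pc: "pcas (al q) w (be2 q)" "vl (al q) w = c n" using pcas_steps[of "c n"] vl_steps[of "c n"] cn w by (auto simp: base_def)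
  have "w : pi_hom H (al q) (be2 q)" using pi_hom_zo[OF Real_zo[OF cn(2)]] cn(1) w by (auto simp: base_def)
  moreover have "same_reduction w (walk_power (steps R) n @ steps P)"
   using same_reduction_iff[OF pc(1)] pw[of n] pc(2) cn(1) by (metis base_def nf_red)
  ultimately show "w : power_walks H (al q) (be2 q) (steps R) (steps P)" by (auto simp: power_walks_def)
 qed
 thus "realizable_walks G H al be2 q = power_walks H (al q) (be2 q) (steps R) (steps P)"
  using realizable_walks_eq RealS by simp
qed

lemma LamE_mult: "k : LamE ==> k + n * (2 * L) : LamE"
proof (induction n rule: int_induct[of _ 0])
 case (step1 i) thus ?case using LamE_L[of "k + i * (2 * L)"] by (simp add: algebra_simps)
next
 case (step2 i) thus ?case using LamE_L'[of "k + i * (2 * L)"] by (simp add: algebra_simps)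
qed simp

lemma LamE_window:
 assumes "k : LamE" "16 * int nn <= z"
 shows "EX k1:LamE. EX k2:LamE. - z <= k1 & k1 < k2 & k2 <= z"
proof -
 \<comment> \<open>The representative of \<open>k\<close> modulo \<open>2 * L\<close> that comes
   first from \<open>- z\<close> on.\<close>
 define r where "r = (k + z) mod (2 * L) - z"
 have rk: "r = k + (- ((k + z) div (2 * L))) * (2 * L)"
  using minus_mult_div_eq_mod[of "k + z" "2 * L"] by (simp add: r_def algebra_simps)
 have "r : LamE" unfolding rk by (rule LamE_mult[OF assms(1)])
 moreover have "- z <= r" "r < 2 * L - z" using L pos_mod_bound[of "2 * L" "k + z"] by (auto simp: r_def)
 ultimately show ?thesis using LamE_L[of r] L assms(2)
  by (intro bexI[of _ r] bexI[of _ "r + 2 * L"]) auto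
qed

end

text \<open>The \<open>al\<close>-image of the cycle runs along \<open>T1\<close> to the axis, one
  period along it, and back; likewise the \<open>be2\<close>-image with \<open>T2\<close>.\<close>

locale axis = axis0 +
 fixes L' :: int and u0 v0 :: 'a
 assumes arc0: "(u0, v0) : parcs G" and per_g: "per g L'" and L': "0 < L'"
  and xe: "nf (map al (cyc u0 v0)) = nf (T1 @ sg f 0 L @ rev T1)"
  and ye: "nf (map be2 (cyc u0 v0)) = nf (rev T2 @ sg g 0 L' @ T2)"
begin

lemma V0: "u0 : pverts G" "v0 : pverts G" using parcs_V arc0 by auto

lemma fL: "f (n * L) = f 0" "g (n * L') = g 0"
 using per_mult[OF per_f, of 0 n] per_mult[OF per_g, of 0 n] by simp_all

lemma arc_axis:
 assumes "base Q"
 shows "arcT u0 v0 Q <-> nf (sg f 0 L @ rev T1 @ Q @ rev T2) = nf (rev T1 @ Q @ rev T2 @ sg g 0 L')"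
proof -
 define X Y where "X = map al (cyc u0 v0)" and "Y = map be2 (cyc u0 v0)"
 have Q: "Q ~= []" "hd Q = al q" "last Q = be2 q" using assms by (auto simp: base_def)
 have g0: "g L' = g 0" "f L = f 0" using fL[of 1] by auto
 have "arcT u0 v0 Q <-> nf (X @ Q) = nf (Q @ Y)" using arcT_iff[OF assms V0] by (simp add: X_def Y_def)
 also have "nf (X @ Q) = nf (T1 @ sg f 0 L @ rev T1 @ Q)"
  using nf_nf_append[of X Q] nf_nf_append[of "T1 @ sg f 0 L @ rev T1" Q] xe by (simp add: X_def)
 also have "nf (Q @ Y) = nf (Q @ rev T2 @ sg g 0 L' @ T2)"
  using nf_append_nf[of Q Y] nf_append_nf[of Q "rev T2 @ sg g 0 L' @ T2"] ye by (simp add: Y_def)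
 also have "nf (T1 @ sg f 0 L @ rev T1 @ Q) = nf (Q @ rev T2 @ sg g 0 L' @ T2) <->
   nf (sg f 0 L @ rev T1 @ Q @ rev T2) = nf (rev T1 @ Q @ rev T2 @ sg g 0 L')" (is "?a <-> ?b")
 proof
  assume a: ?a
  have "nf (sg f 0 L @ rev T1 @ Q @ rev T2) = nf (rev T1 @ (T1 @ sg f 0 L @ rev T1 @ Q) @ rev T2)"
   using nf_cancel'_R[of T1 "sg f 0 L @ rev T1 @ Q @ rev T2" "[]"] T1 by simp
  also have "\<dots> = nf (rev T1 @ (Q @ rev T2 @ sg g 0 L' @ T2) @ rev T2)" by (rule nf_cong[OF a])
  also have "\<dots> = nf (rev T1 @ Q @ rev T2 @ sg g 0 L')"
   using nf_cancel_L[of T2 "rev T1 @ Q @ rev T2 @ sg g 0 L'" "[]"] T2 g0 by simp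
  finally show ?b .
 next
  assume b: ?b
  have "nf (T1 @ sg f 0 L @ rev T1 @ Q) = nf (T1 @ (sg f 0 L @ rev T1 @ Q @ rev T2) @ T2)"
   using nf_cancel'_L[of T2 "T1 @ sg f 0 L @ rev T1 @ Q" "[]"] T2 Q by simp
  also have "\<dots> = nf (T1 @ (rev T1 @ Q @ rev T2 @ sg g 0 L') @ T2)" by (rule nf_cong[OF b])
  also have "\<dots> = nf (Q @ rev T2 @ sg g 0 L' @ T2)"
   using nf_cancel_R[of T1 "Q @ rev T2 @ sg g 0 L' @ T2" "[]"] T1 Q by simp
  finally show ?a .
 qed
 finally show ?thesis .
qed

lemma axis_iterate:
 assumes "base Q" "arcT u0 v0 Q"
 shows "nf (sg f 0 (int n * L) @ rev T1 @ Q @ rev T2) = nf (rev T1 @ Q @ rev T2 @ sg g 0 (int n * L'))"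
proof (induction n)
 case 0
 have "nf (f 0 # rev T1 @ Q @ rev T2) = nf (rev T1 @ Q @ rev T2)"
  using nf_join'[of "rev T1" "f 0" "[]" "Q @ rev T2"] T1 by (simp add: hd_rev)
 moreover have "nf (rev T1 @ Q @ rev T2 @ [g 0]) = nf (rev T1 @ Q @ rev T2)"
  using nf_join[of "rev T2" "g 0" "rev T1 @ Q" "[]"] T2 by (simp add: last_rev)
 ultimately show ?case by simp
next
 case (Suc n)
 define Z where "Z = rev T1 @ Q @ rev T2"
 have e: "nf (sg f 0 L @ Z) = nf (Z @ sg g 0 L')" using arc_axis[OF assms(1)] assms(2) by (simp add: Z_def)
 have s1: "sg f (int n * L) (int (Suc n) * L) = sg f 0 L"
  using sg_shift[of f f "int n * L" 0 L] per_mult[OF per_f, of _ "int n"] by (simp add: algebra_simps)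
 have s2: "sg g (int n * L') (int (Suc n) * L') = sg g 0 L'"
  using sg_shift[of g g "int n * L'" 0 L'] per_mult[OF per_g, of _ "int n"] by (simp add: algebra_simps)
 have IH: "nf (sg f 0 (int n * L) @ Z) = nf (Z @ sg g 0 (int n * L'))" using Suc by (simp add: Z_def)
 have "nf (sg f 0 (int (Suc n) * L) @ Z) = nf (sg f 0 (int n * L) @ sg f 0 L @ Z)"
  using nf_sg_trans[of "[]" f 0 "int n * L" "int (Suc n) * L" Z] s1 by simp
 also have "\<dots> = nf (sg f 0 (int n * L) @ Z @ sg g 0 L')" using nf_cong_r[OF e] by simp
 also have "\<dots> = nf (Z @ sg g 0 (int n * L') @ sg g 0 L')" using nf_cong_l[OF IH, of "sg g 0 L'"] by simp
 also have "\<dots> = nf (Z @ sg g 0 (int (Suc n) * L'))"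
  using nf_sg_trans[of Z g 0 "int n * L'" "int (Suc n) * L'" "[]"] s2 by simp
 finally show ?case by (simp add: Z_def)
qed

text \<open>Conjugation by the fixed walk \<open>Z\<close> changes a length by at most twice the
  length of \<open>Z\<close>, whereas the \<open>n\<close>-th powers have \<open>n * L\<close> and
  \<open>n * L'\<close> steps.\<close>

lemma L_eq:
 assumes "base Q" "arcT u0 v0 Q"
 shows "L = L'"
proof -
 define Z where "Z = rev T1 @ Q @ rev T2"
 have Z: "Z ~= []" "hd Z = f 0" "last Z = g 0" using T1 T2 by (auto simp: Z_def hd_rev last_rev)
 have e: "nf (sg f 0 (int n * L) @ Z) = nf (Z @ sg g 0 (int n * L'))" for n
  using axis_iterate[OF assms] by (simp add: Z_def)
 have nn: "0 <= int n * L" "0 <= int n * L'" for n using L L' by simp_all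
 have 1: "int n * L <= int n * L' + 2 * int (length Z)" for n
 proof -
  have "sg f 0 (int n * L) = nf (sg f 0 (int n * L) @ Z @ rev Z)"
   using nf_cancel_L[of Z "sg f 0 (int n * L)" "[]"] Z fL red_sg[OF bired_f] by simp
  also have "\<dots> = nf (Z @ sg g 0 (int n * L') @ rev Z)" using nf_cong_l[OF e, of n "rev Z"] by simp
  finally have "length (sg f 0 (int n * L)) <= length (Z @ sg g 0 (int n * L') @ rev Z)" using length_nf by metis
  thus ?thesis unfolding length_append length_rev length_sg using nn[of n] by linarith
 qed
 have 2: "int n * L' <= int n * L + 2 * int (length Z)" for n
 proof -
  have "sg g 0 (int n * L') = nf (rev Z @ Z @ sg g 0 (int n * L'))"
   using nf_cancel'_R[of Z "sg g 0 (int n * L')" "[]"] Z fL red_sg[OF bired_g] by simp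
  also have "\<dots> = nf (rev Z @ sg f 0 (int n * L) @ Z)" using nf_cong_r[OF e, of "rev Z" n] by simp
  finally have "length (sg g 0 (int n * L')) <= length (rev Z @ sg f 0 (int n * L) @ Z)" using length_nf by metis
  thus ?thesis unfolding length_append length_rev length_sg using nn[of n] by linarith
 qed
 \<comment> \<open>With this \<open>n\<close>, periods that differ by one would already exceed the
   slack \<open>2 * length Z\<close>.\<close>
 define n where "n = 2 * length Z + 1"
 show ?thesis
 proof (rule ccontr)
  assume "L ~= L'"
  hence "1 <= \<bar>L - L'\<bar>" by linarith
  hence "int n <= int n * \<bar>L - L'\<bar>" using mult_left_mono[of 1 "\<bar>L - L'\<bar>" "int n"] by simp
  also have "\<dots> = \<bar>int n * L - int n * L'\<bar>" by (simp add: abs_mult right_diff_distrib[symmetric])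
  finally show False using 1[of n] 2[of n] by (simp add: n_def)
 qed
qed

text \<open>Iterating the arc equation makes it long enough for \<open>axis_lemma\<close>, which
  forces the walk stripped of its tails to be a segment of \<open>f\<close>.\<close>

lemma cand_ex:
 assumes "base Q" "arcT u0 v0 Q"
 shows "EX k:Lam. Q = cand k"
proof -
 define Z0 Z where "Z0 = rev T1 @ Q @ rev T2" and "Z = nf Z0"
 have Z: "Z ~= []" "hd Z = f 0" "last Z = g 0" "red Z" using T1 T2 by (auto simp: Z_def Z0_def hd_rev last_rev)
 have pg: "per g L" using per_g L_eq[OF assms] by simp
 \<comment> \<open>Long enough for \<open>axis_lemma\<close>, and a multiple of the period so that
   \<open>f N = f 0\<close>.\<close>
 define N where "N = int (2 * length Z + 1) * L"
 have e: "nf (Z @ sg g 0 N) = nf (sg f 0 N @ Z)"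
  using axis_iterate[OF assms, of "2 * length Z + 1"] L_eq[OF assms] by (simp add: Z_def Z0_def N_def)
 have "2 * int (length Z) <= 2 * int (length Z) * L" using L mult_left_mono[of 1 L "2 * int (length Z)"] by simp
 hence "int (length Z) + int (length Z) + L <= N" by (simp add: N_def algebra_simps)
 moreover have "hd Z = f N" using Z fL by (simp add: N_def del: of_nat_add of_nat_mult)
 ultimately obtain k where k: "Z = sg f 0 k" "ALL i. g i = f (i + k)"
  using axis_lemma[OF bired_f bired_g per_f pg L(1) Z(4,4,1,1,3) _ _ e] by blast
 have "cand k = nf (T1 @ nf Z0 @ T2)" using k(1) by (simp only: cand_def Z_def)
 also have "\<dots> = nf (T1 @ rev T1 @ Q @ rev T2 @ T2)" unfolding nf_append_nf2 by (simp add: Z0_def)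
 also have "\<dots> = Q"
  using nf_cancel_R[of T1 "Q @ rev T2 @ T2" "[]"] nf_cancel'_L[of T2 Q "[]"] T1 T2 assms(1) by (simp add: base_def)
 finally show ?thesis using k(2) by (auto simp: Lam_def)
qed

text \<open>\<open>LamE\<close> in a form that is testable in linear time per candidate: one
  comparison of vertices, one arc test and a parity. As soon as it is nonempty it coincides with
  \<open>LamE\<close>.\<close>

definition LamP :: "int set" where
 "LamP = {k. f k = g 0 & arcT u0 v0 (cand k) & odd (length (cand k))}"

lemma LamP_LamE: "k : LamP ==> k : LamE"
 using cand_ex[OF base_cand, of k] cand_inj[of k] by (auto simp: LamP_def LamE_def)

lemma LamE_LamP: "k1 : LamP ==> k : LamE ==> k : LamP"
proof -
 assume k1: "k1 : LamP" and k: "k : LamE"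
 have LL: "L' = L" using L_eq[OF base_cand] k1 by (auto simp: LamP_def)
 have kl: "k : Lam" using k by (simp add: LamE_def)
 have Zk: "nf (rev T1 @ cand k @ rev T2) = nf (sg f 0 k)"
 proof -
  have "nf (rev T1 @ cand k @ rev T2) = nf (rev T1 @ T1 @ sg f 0 k @ T2 @ rev T2)" by (simp add: cand_def)
  thus ?thesis
   using nf_cancel'_R[of T1 "sg f 0 k @ T2 @ rev T2" "[]"] nf_cancel_L[of T2 "sg f 0 k" "[]"] T1 T2 Lam_0[OF kl] by simp
 qed
 have s1: "sg f 0 k = sg f L (L + k)" using sg_shift[of f f L 0 k] per_f by (simp add: per_def add.commute)
 have s2: "sg g 0 L = sg f k (L + k)" using sg_shift[of g f k 0 L] kl by (simp add: Lam_def)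
 have "nf (sg f 0 L @ rev T1 @ cand k @ rev T2) = nf (sg f 0 L @ sg f 0 k)" using nf_cong_r[OF Zk] by simp
 also have "\<dots> = nf (sg f 0 (L + k))" using s1 by (simp add: nf_sg_trans0)
 also have "\<dots> = nf (sg f 0 k @ sg g 0 L)" using s2 by (simp add: nf_sg_trans0)
 also have "\<dots> = nf (rev T1 @ cand k @ rev T2 @ sg g 0 L)" using nf_cong_l[OF Zk] by simp
 finally have "arcT u0 v0 (cand k)" using arc_axis[OF base_cand] LL by simp
 thus "k : LamP" using k Lam_0[OF kl] by (simp add: LamP_def LamE_def)
qed

lemma Real_LamP: "Real Q ==> EX k:LamP. Q = cand k"
proof -
 assume r: "Real Q"
 have b: "base Q" using Real_base r .
 have a: "arcT u0 v0 Q" using Real_iff[OF b] r arc0 by blast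
 obtain k where k: "k : Lam" "Q = cand k" using cand_ex[OF b a] by blast
 hence "k : LamP" using a Lam_0 Real_zo[OF r] by (auto simp: LamP_def zo_def)
 thus ?thesis using k by blast
qed

end

section \<open>Programs\<close>

text \<open>Only an upper bound on the time is kept, so that costs can be rounded up to simple
  expressions at any point.\<close>

definition runs :: "com => nat => ram_state => ram_state => bool" where
 "runs c T s s' <-> (EX t<=T. exec c s t s')"

lemma runs_mono: "runs c T s s' ==> T <= T' ==> runs c T' s s'"
 by (auto simp: runs_def intro: order_trans)

lemma runs_Seq: "runs c T s s' ==> runs d T' s' s'' ==> runs (Seq c d) (T + T') s s''"
 unfolding runs_def using exec.Seq add_mono by blast

lemma runs_Assign: "runs (Assign x e) 1 s (s\<lparr>regs := (regs s)(x := aval e s)\<rparr>)"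
 unfolding runs_def using exec.Assign by blast

lemma runs_Skip: "runs Skip 1 s s"
 unfolding runs_def using exec.Skip by blast

lemma runs_CondTrue: "bval b s ==> runs c T s s' ==> runs (Cond b c d) (Suc T) s s'"
 unfolding runs_def using exec.CondTrue Suc_le_mono by blast

lemma runs_CondFalse: "~ bval b s ==> runs d T s s' ==> runs (Cond b c d) (Suc T) s s'"
 unfolding runs_def using exec.CondFalse Suc_le_mono by blast

primrec wR :: "com => string set" where
 "wR Skip = {}"
| "wR (Assign x e) = {x}"
| "wR (Store A i e) = {}"
| "wR (Seq c d) = wR c Un wR d"
| "wR (Cond b c d) = wR c Un wR d"
| "wR (While b c) = wR c"

primrec wA :: "com => string set" where
 "wA Skip = {}"
| "wA (Assign x e) = {}"
| "wA (Store A i e) = {A}"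
| "wA (Seq c d) = wA c Un wA d"
| "wA (Cond b c d) = wA c Un wA d"
| "wA (While b c) = wA c"

text \<open>Frame conditions are read off the syntax through \<open>wR\<close> and
  \<open>wA\<close>; they carry invariants across subprograms.\<close>

definition fr :: "string set => string set => ram_state => ram_state => bool" where
 "fr R A s s' <-> (ALL x. x ~: R --> regs s' x = regs s x) & (ALL a. a ~: A --> arrs s' a = arrs s a)"

lemma fr_reg: "fr R A s s' ==> x ~: R ==> regs s' x = regs s x"
 and fr_arr: "fr R A s s' ==> a ~: A ==> arrs s' a = arrs s a"
 by (auto simp: fr_def)

lemma fr_refl[simp]: "fr R A s s" by (simp add: fr_def)

lemma fr_trans: "fr R A s s' ==> fr R' A' s' s'' ==> fr (R Un R') (A Un A') s s''"
 by (auto simp: fr_def)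

lemma fr_mono: "fr R A s s' ==> R <= R' ==> A <= A' ==> fr R' A' s s'"
 by (auto simp: fr_def)

lemma fr_trans_same: "fr R A s s' ==> fr R A s' s'' ==> fr R A s s''"
 by (auto simp: fr_def)

lemma exec_fr: "exec c s t s' ==> fr (wR c) (wA c) s s'"
 by (induction rule: exec.induct) (auto simp: fr_def)

lemma runs_fr: "runs c T s s' ==> fr (wR c) (wA c) s s'"
 by (auto simp: runs_def exec_fr)

text \<open>Programs without loops are evaluated symbolically.\<close>

primrec lf :: "com => bool" where
 "lf Skip <-> True"
| "lf (Assign x e) <-> True"
| "lf (Store A i e) <-> True"
| "lf (Seq c d) <-> lf c & lf d"
| "lf (Cond b c d) <-> lf c & lf d"
| "lf (While b c) <-> False"

primrec tm :: "com => nat" where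
 "tm Skip = 1"
| "tm (Assign x e) = 1"
| "tm (Store A i e) = 1"
| "tm (Seq c d) = tm c + tm d"
| "tm (Cond b c d) = 1 + tm c + tm d"
| "tm (While b c) = 0"

primrec ev :: "com => ram_state => ram_state" where
 "ev Skip s = s"
| "ev (Assign x e) s = s\<lparr>regs := (regs s)(x := aval e s)\<rparr>"
| "ev (Store A i e) s = s\<lparr>arrs := (arrs s)(A := (arrs s A)(aval i s := aval e s))\<rparr>"
| "ev (Seq c d) s = ev d (ev c s)"
| "ev (Cond b c d) s = (if bval b s then ev c s else ev d s)"
| "ev (While b c) s = s"

lemma runs_ev: "lf c ==> runs c (tm c) s (ev c s)"
proof (induction c arbitrary: s)
 case (Store A i e) thus ?case unfolding runs_def using exec.Store by auto
next
 case (Cond b c d)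
 show ?case
 proof (cases "bval b s")
  case True
  have "runs c (tm c + tm d) s (ev c s)" by (rule runs_mono[of _ "tm c"]) (use Cond in auto)
  thus ?thesis using runs_CondTrue[OF True, of c "tm c + tm d" "ev c s" d] True by simp
 next
  case False
  have "runs d (tm c + tm d) s (ev d s)" by (rule runs_mono[of _ "tm d"]) (use Cond in auto)
  thus ?thesis using runs_CondFalse[OF False, of d "tm c + tm d" "ev d s" c] False by simp
 qed
qed (auto intro: runs_Skip[simplified] runs_Assign[simplified] runs_Seq)

lemmas run_ev = runs_mono[OF runs_ev]

definition For :: "string => aexp => com => com" where
 "For i n c = Seq (Assign i (Const 0)) (While (Less (Reg i) n) (Seq c (Assign i (Add (Reg i) (Const 1)))))"

lemma wR_For[simp]: "wR (For i n c) = insert i (wR c)" and wA_For[simp]: "wA (For i n c) = wA c"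
 by (auto simp: For_def)

abbreviation frl :: "string => com => ram_state => ram_state => bool" where
 "frl i c == fr (insert i (wR c)) (wA c)"

text \<open>The bound is evaluated anew before every iteration, hence the first premise. An
  iteration costs two units besides the body, for the test and the counter; \<open>ins\<close> lets
  the invariant survive the update of the counter.\<close>

lemma For_rule:
 assumes n: "!!s. frl i c s0 s ==> aval n s = N"
  and i: "i ~: wR c" and I0: "I 0 s0"
  and ins: "!!k s v. I k s ==> I k (s\<lparr>regs := (regs s)(i := v)\<rparr>)"
  and step: "!!k s. k < N ==> frl i c s0 s ==> regs s i = k ==> I k s ==>
    EX s'. runs c T s s' & I (Suc k) s'"
 shows "EX s'. runs (For i n c) (N * (T + 2) + 2) s0 s' & I N s' & frl i c s0 s'"
proof -
 let ?c = "Seq c (Assign i (Add (Reg i) (Const 1)))" and ?F = "frl i c s0"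
 have loop: "EX s'. runs (While (Less (Reg i) n) ?c) ((N - k) * (T + 2) + 1) s s' & I N s' & ?F s'"
  if "k <= N" "?F s" "regs s i = k" "I k s" for k s
  using that
 proof (induction "N - k" arbitrary: k s)
  case 0
  hence "k = N" by simp
  hence "exec (While (Less (Reg i) n) ?c) s 1 s" using 0 n[of s] by (intro exec.WhileFalse) auto
  hence "runs (While (Less (Reg i) n) ?c) ((N - k) * (T + 2) + 1) s s" by (auto simp: runs_def)
  thus ?case using 0 \<open>k = N\<close> by blast
 next
  case (Suc m)
  hence k: "k < N" by simp
  obtain s1 where s1: "runs c T s s1" "I (Suc k) s1" using step[OF k] Suc by blast
  define s2 where "s2 = s1\<lparr>regs := (regs s1)(i := Suc k)\<rparr>"
  have f1: "fr (wR c) (wA c) s s1" using runs_fr s1 by blast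
  have "regs s1 i = k" using fr_reg[OF f1 i] Suc by simp
  hence "runs ?c (T + 1) s s2" using runs_Seq[OF s1(1) runs_Assign, of i "Add (Reg i) (Const 1)"] by (simp add: s2_def)
  then obtain t where t: "t <= T + 1" "exec ?c s t s2" by (auto simp: runs_def)
  have F2: "?F s2" using Suc.prems(2) f1 by (auto simp: fr_def s2_def)
  have I2: "I (Suc k) s2" using ins s1 by (simp add: s2_def)
  have r2: "regs s2 i = Suc k" by (simp add: s2_def)
  have e: "m = N - Suc k" using Suc.hyps(2) by simp
  have "EX s'. runs (While (Less (Reg i) n) ?c) ((N - Suc k) * (T + 2) + 1) s2 s' & I N s' & ?F s'"
   by (rule Suc.hyps(1)[OF e _ F2 r2 I2]) (use k in simp)
  then obtain s' where s': "runs (While (Less (Reg i) n) ?c) ((N - Suc k) * (T + 2) + 1) s2 s'" "I N s'" "?F s'"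
   by blast
  then obtain t' where t': "t' <= (N - Suc k) * (T + 2) + 1" "exec (While (Less (Reg i) n) ?c) s2 t' s'"
   by (auto simp: runs_def)
  have "exec (While (Less (Reg i) n) ?c) s (Suc (t + t')) s'"
   using t(2) t'(2) Suc.prems k n[OF Suc.prems(2)] by (intro exec.WhileTrue) auto
  moreover have "Suc (t + t') <= (N - k) * (T + 2) + 1"
  proof -
   have "N - k = Suc (N - Suc k)" using k by simp
   hence "(N - k) * (T + 2) = (N - Suc k) * (T + 2) + (T + 2)" by (metis add.commute mult_Suc)
   thus ?thesis using t(1) t'(1) by linarith
  qed
  ultimately show ?case using s' unfolding runs_def by blast
 qed
 define s1 where "s1 = s0\<lparr>regs := (regs s0)(i := 0)\<rparr>"
 have r1: "runs (Assign i (Const 0)) 1 s0 s1" using runs_Assign[of i "Const 0" s0] by (simp add: s1_def)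
 obtain s' where s': "runs (While (Less (Reg i) n) ?c) ((N - 0) * (T + 2) + 1) s1 s'" "I N s'" "?F s'"
  using loop[of 0 s1] ins I0 by (auto simp: s1_def fr_def)
 have "runs (For i n c) (N * (T + 2) + 2) s0 s'" unfolding For_def
  by (rule runs_mono[OF runs_Seq[OF r1 s'(1)]]) simp
 thus ?thesis using s' by blast
qed

section \<open>Writing and reducing words on the machine\<close>

definition seg :: "ram_state => string => nat => nat list" where
 "seg s A n = map (arrs s A) [0..<n]"

lemma length_seg[simp]: "length (seg s A n) = n" by (simp add: seg_def)

lemma nth_seg[simp]: "i < n ==> seg s A n ! i = arrs s A i" by (simp add: seg_def)

lemma seg_0[simp]: "seg s A 0 = []" by (simp add: seg_def)

lemma seg_Suc: "seg s A (Suc n) = seg s A n @ [arrs s A n]" by (simp add: seg_def)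

lemma seg_take: "k <= n ==> seg s A k = take k (seg s A n)"
 by (simp add: seg_def take_map)

lemma seg_regs[simp]: "seg (s\<lparr>regs := r\<rparr>) A n = seg s A n"
 by (simp add: seg_def)

lemma seg_push[simp]: "seg (s\<lparr>regs := r, arrs := (arrs s)(A := (arrs s A)(n := v))\<rparr>) A (Suc n) = seg s A n @ [v]"
 "seg (s\<lparr>arrs := (arrs s)(A := (arrs s A)(n := v))\<rparr>) A (Suc n) = seg s A n @ [v]"
 by (simp_all add: seg_def)

abbreviation "eqe a b \<equiv> Conj (Neg (Less a b)) (Neg (Less b a))"

text \<open>One \<open>push\<close> on the array \<open>S\<close>, whose top is at position
  \<open>sl - 1\<close>; a pop merely lowers \<open>sl\<close>.\<close>

definition pushc :: com where
 "pushc = Seq (Assign ''x'' (Read ''B'' (Reg ''k'')))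
  (Cond (Conj (Less (Const 0) (Reg ''sl'')) (eqe (Read ''S'' (Sub (Reg ''sl'') (Const 1))) (Reg ''x''))) Skip
  (Cond (Conj (Less (Const 1) (Reg ''sl'')) (eqe (Read ''S'' (Sub (Reg ''sl'') (Const 2))) (Reg ''x'')))
   (Assign ''sl'' (Sub (Reg ''sl'') (Const 1)))
   (Seq (Store ''S'' (Reg ''sl'') (Reg ''x'')) (Assign ''sl'' (Add (Reg ''sl'') (Const 1))))))"

lemma pushc_ev:
 assumes "seg s ''S'' (regs s ''sl'') = rev st"
 shows "seg (ev pushc s) ''S'' (regs (ev pushc s) ''sl'') = rev (push (arrs s ''B'' (regs s ''k'')) st)"
proof -
 define x where "x = arrs s ''B'' (regs s ''k'')"
 define l where "l = regs s ''sl''"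
 have l: "l = length st" using arg_cong[OF assms, of length] by (simp add: l_def)
 have S: "regs s ''sl'' = l" by (simp add: l_def)
 have X: "arrs s ''B'' (regs s ''k'') = x" by (simp add: x_def)
 have seg: "seg s ''S'' l = rev st" using assms by (simp add: S)
 show ?thesis
 proof (cases "(x, st)" rule: push.cases)
  case (1 x')
  thus ?thesis using l S X by (simp add: pushc_def)
 next
  case (2 x' y)
  have y: "arrs s ''S'' 0 = y" using seg l 2 by (simp add: seg_def)
  show ?thesis
  proof (cases "y = x")
   case True thus ?thesis using l S X 2 y seg by (simp add: pushc_def)
  next
   case False
   hence "y < x | x < y" by linarith
   thus ?thesis using l S X 2 y seg by (auto simp: pushc_def)
  qed
 next
  case (3 x' y z zs)
  note e = 3
  define m where "m = length zs"
  have lm: "l = Suc (Suc m)" using l 3 by (simp add: m_def)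
  have "seg s ''S'' m @ [arrs s ''S'' m, arrs s ''S'' (Suc m)] = rev zs @ [z, y]"
   using seg lm 3 by (simp add: seg_Suc)
  hence yz: "arrs s ''S'' (Suc m) = y" "arrs s ''S'' m = z" "seg s ''S'' m = rev zs"
   by (simp_all add: m_def)
  have app': "seg s ''S'' (Suc m) = rev zs @ [z]" "seg s ''S'' (Suc (Suc m)) = rev zs @ [z, y]"
   using yz by (simp_all add: seg_Suc)
  consider "x = y" | "x ~= y" "x = z" | "x < y | y < x" "x < z | z < x" by linarith
  thus ?thesis
  proof cases
   case 1 thus ?thesis using S X 3 yz lm app' by (simp add: pushc_def)
  next
   case 2
   hence "x < y | y < x" by linarith
   thus ?thesis using 2 S X 3 yz lm app' by (auto simp: pushc_def)
  next
   case 3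
   thus ?thesis using S X e yz lm app' by (auto simp: pushc_def)
  qed
 qed
qed

definition norm_c :: com where
 "norm_c = Seq (Assign ''sl'' (Const 0)) (For ''k'' (Reg ''bl'') pushc)"

lemma wR_norm_c[simp]: "wR norm_c = {''sl'', ''k'', ''x''}" and wA_norm_c[simp]: "wA norm_c = {''S''}"
 by (auto simp: norm_c_def pushc_def)

lemma norm_c_spec:
 "EX s'. runs norm_c (regs s ''bl'' * 12 + 3) s s' & seg s' ''S'' (regs s' ''sl'') = nf (seg s ''B'' (regs s ''bl''))"
proof -
 define s1 where "s1 = s\<lparr>regs := (regs s)(''sl'' := 0)\<rparr>"
 define N where "N = regs s ''bl''"
 have r1: "runs (Assign ''sl'' (Const 0)) 1 s s1" using runs_Assign[of "''sl''" "Const 0" s] by (simp add: s1_def)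
 have wr: "wR pushc = {''x'', ''sl''}" "wA pushc = {''S''}" by (auto simp: pushc_def)
 have "EX s'. runs (For ''k'' (Reg ''bl'') pushc) (N * (10 + 2) + 2) s1 s' &
   (seg s' ''S'' (regs s' ''sl'') = rev (fold push (take N (seg s ''B'' N)) [])) &
   frl ''k'' pushc s1 s'"
 proof (rule For_rule[where I = "%k s'. seg s' ''S'' (regs s' ''sl'') = rev (fold push (take k (seg s ''B'' N)) [])"])
  fix s' assume "frl ''k'' pushc s1 s'"
  thus "aval (Reg ''bl'') s' = N" by (simp add: wr fr_reg s1_def N_def)
 next
  fix k s' assume k: "k < N" "frl ''k'' pushc s1 s'" "regs s' ''k'' = k"
   "seg s' ''S'' (regs s' ''sl'') = rev (fold push (take k (seg s ''B'' N)) [])"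
  have "arrs s' ''B'' = arrs s ''B''" using fr_arr[OF k(2), of "''B''"] by (simp add: wr s1_def)
  hence "seg (ev pushc s') ''S'' (regs (ev pushc s') ''sl'') =
    rev (fold push (take (Suc k) (seg s ''B'' N)) [])"
   using pushc_ev[OF k(4)] k(1,3) by (simp add: take_Suc_conv_app_nth)
  moreover have "runs pushc 10 s' (ev pushc s')"
   by (rule run_ev) (simp_all add: pushc_def)
  ultimately show "EX s''. runs pushc 10 s' s'' &
    seg s'' ''S'' (regs s'' ''sl'') = rev (fold push (take (Suc k) (seg s ''B'' N)) [])" by blast
 qed (auto simp: wr s1_def seg_def)
 then obtain s' where s': "runs (For ''k'' (Reg ''bl'') pushc) (N * (10 + 2) + 2) s1 s'"
  "seg s' ''S'' (regs s' ''sl'') = nf (seg s ''B'' N)" by (auto simp: nf_def)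
 show ?thesis using runs_Seq[OF r1 s'(1)] s'(2)
  by (intro exI[of _ s'] conjI) (auto simp: norm_c_def N_def elim: runs_mono)
qed

definition eloop :: "string => string => string => aexp => aexp => com" where
 "eloop D dl i e n = For i n (Seq (Store D (Reg dl) e) (Assign dl (Add (Reg dl) (Const 1))))"

lemma wR_eloop[simp]: "wR (eloop D dl i e n) = {i, dl}" and wA_eloop[simp]: "wA (eloop D dl i e n) = {D}"
 by (auto simp: eloop_def)

lemma eloop_spec:
 assumes "i ~= dl" and n: "!!s. fr {i, dl} {D} s0 s ==> aval n s = N"
  and e: "!!k s. fr {i, dl} {D} s0 s ==> k < N ==> regs s i = k ==> aval e s = h k"
 shows "EX s'. runs (eloop D dl i e n) (N * 4 + 2) s0 s' &
  seg s' D (regs s' dl) = seg s0 D (regs s0 dl) @ map h [0..<N] & regs s' dl = regs s0 dl + N"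
proof -
 let ?c = "Seq (Store D (Reg dl) e) (Assign dl (Add (Reg dl) (Const 1)))"
 let ?I = "%k s'. seg s' D (regs s' dl) = seg s0 D (regs s0 dl) @ map h [0..<k] & regs s' dl = regs s0 dl + k"
 have wr: "insert i (wR ?c) = {i, dl}" "wA ?c = {D}" by auto
 have "EX s'. runs (For i n ?c) (N * (2 + 2) + 2) s0 s' & ?I N s' & frl i ?c s0 s'"
 proof (rule For_rule)
  fix s assume "frl i ?c s0 s"
  thus "aval n s = N" using n wr by simp
 next
  fix k s' assume k: "k < N" "frl i ?c s0 s'" "regs s' i = k" "?I k s'"
  have "aval e s' = h k" using e[of s' k] k wr by simp
  hence "?I (Suc k) (ev ?c s')" using k(4) by auto
  moreover have "runs ?c 2 s' (ev ?c s')" by (rule run_ev) simp_all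
  ultimately show "EX s''. runs ?c 2 s' s'' & ?I (Suc k) s''" by blast
 qed (use assms(1) in \<open>auto simp: seg_def\<close>)
 thus ?thesis by (auto simp: eloop_def)
qed

primrec emits :: "(aexp \<times> aexp) list => com" where
 "emits [] = Skip"
| "emits (p # r) = Seq (eloop ''B'' ''bl'' ''j'' (fst p) (snd p)) (emits r)"

lemma wR_emits: "wR (emits es) <= {''j'', ''bl''}" and wA_emits: "wA (emits es) <= {''B''}"
 by (induction es) auto

text \<open>The segment \<open>h 0, \<dots>, h (N - 1)\<close> is the value of the pair \<open>(e, n)\<close> of expressions.\<close>

definition emitted :: "ram_state => aexp \<times> aexp => nat list => bool" where
 "emitted s0 p xs <-> (ALL s. fr {''j'', ''bl''} {''B''} s0 s --> aval (snd p) s = length xs &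
   (ALL k<length xs. regs s ''j'' = k --> aval (fst p) s = xs ! k))"

lemma emits_spec:
 assumes "list_all2 (emitted s0) es xss" "fr {''j'', ''bl''} {''B''} s0 s"
 shows "EX s'. runs (emits es) (length (concat xss) * 4 + length es * 2 + 1) s s' &
  seg s' ''B'' (regs s' ''bl'') = seg s ''B'' (regs s ''bl'') @ concat xss & fr {''j'', ''bl''} {''B''} s0 s'"
 using assms
proof (induction es xss arbitrary: s rule: list_all2_induct)
 case Nil thus ?case using runs_Skip by auto
next
 case (Cons p es xs xss)
 have "EX s'. runs (eloop ''B'' ''bl'' ''j'' (fst p) (snd p)) (length xs * 4 + 2) s s' &
   seg s' ''B'' (regs s' ''bl'') = seg s ''B'' (regs s ''bl'') @ map ((!) xs) [0..<length xs] &
   regs s' ''bl'' = regs s ''bl'' + length xs"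
 proof (rule eloop_spec)
  fix s' assume "fr {''j'', ''bl''} {''B''} s s'"
  hence f: "fr {''j'', ''bl''} {''B''} s0 s'" using fr_trans_same[OF Cons.prems] by simp
  show "aval (snd p) s' = length xs" using f Cons.hyps(1) by (auto simp: emitted_def)
  fix k assume "k < length xs" "regs s' ''j'' = k"
  thus "aval (fst p) s' = xs ! k" using f Cons.hyps(1) by (auto simp: emitted_def)
 qed simp
 then obtain s1 where s1: "runs (eloop ''B'' ''bl'' ''j'' (fst p) (snd p)) (length xs * 4 + 2) s s1"
  "seg s1 ''B'' (regs s1 ''bl'') = seg s ''B'' (regs s ''bl'') @ xs" by (auto simp: map_nth)
 have "fr {''j'', ''bl''} {''B''} s0 s1" using fr_trans_same[OF Cons.prems] runs_fr[OF s1(1)] by simp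
 then obtain s2 where s2: "runs (emits es) (length (concat xss) * 4 + length es * 2 + 1) s1 s2"
  "seg s2 ''B'' (regs s2 ''bl'') = seg s1 ''B'' (regs s1 ''bl'') @ concat xss" "fr {''j'', ''bl''} {''B''} s0 s2"
  using Cons.IH by blast
 show ?case using runs_Seq[OF s1(1) s2(1)] s1(2) s2(2,3)
  by (intro exI[of _ s2] conjI) (auto elim: runs_mono)
qed

text \<open>All reduced words of the programs arise in this way: the pieces are written one after
  another into \<open>B\<close> and then reduced into \<open>S\<close>.\<close>

definition word :: "(aexp \<times> aexp) list => com" where
 "word es = Seq (Assign ''bl'' (Const 0)) (Seq (emits es) norm_c)"

abbreviation "wordR \<equiv> {''bl'', ''j'', ''sl'', ''k'', ''x''}"
abbreviation "wordA \<equiv> {''B'', ''S''}"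

lemma wR_word: "wR (word es) <= wordR" and wA_word: "wA (word es) <= wordA"
 using wR_emits[of es] wA_emits[of es] by (auto simp: word_def)

lemma word_spec:
 assumes "list_all2 (emitted s) es xss" "length (concat xss) <= M" "length es <= 10"
 shows "EX s'. runs (word es) (M * 16 + 25) s s' & seg s' ''S'' (regs s' ''sl'') = nf (concat xss) & fr wordR wordA s s'"
proof -
 define s1 where "s1 = s\<lparr>regs := (regs s)(''bl'' := 0)\<rparr>"
 have r1: "runs (Assign ''bl'' (Const 0)) 1 s s1" using runs_Assign[of "''bl''" "Const 0" s] by (simp add: s1_def)
 have f1: "fr {''j'', ''bl''} {''B''} s s1" by (simp add: fr_def s1_def)
 obtain s2 where s2: "runs (emits es) (length (concat xss) * 4 + length es * 2 + 1) s1 s2"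
  "seg s2 ''B'' (regs s2 ''bl'') = concat xss"
  using emits_spec[OF assms(1) f1] by (auto simp: s1_def)
 have bl: "regs s2 ''bl'' = length (concat xss)" using arg_cong[OF s2(2), of length] by simp
 obtain s3 where s3: "runs norm_c (regs s2 ''bl'' * 12 + 3) s2 s3"
  "seg s3 ''S'' (regs s3 ''sl'') = nf (seg s2 ''B'' (regs s2 ''bl''))" using norm_c_spec by blast
 have r: "runs (word es) (1 + ((length (concat xss) * 4 + length es * 2 + 1) + (regs s2 ''bl'' * 12 + 3))) s s3"
  unfolding word_def by (intro runs_Seq[OF r1] runs_Seq[OF s2(1) s3(1)])
 have "fr wordR wordA s s3" by (rule fr_mono[OF runs_fr[OF r] wR_word wA_word])
 moreover have "runs (word es) (M * 16 + 25) s s3" by (rule runs_mono[OF r]) (use bl assms in simp)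
 ultimately show ?thesis using s3(2) s2(2) by metis
qed

section \<open>Running a test\<close>

definition okz :: "('b => 'b => bool) => 'b list => nat => bool" where
 "okz E xs t <-> (if even t then E (xs ! t) (xs ! Suc t) else E (xs ! Suc t) (xs ! t))"

text \<open>\<open>k\<close> counts the vertices of the longest zigzag prefix. One number answers
  both questions asked of a word: whether all of it is zigzag, and where it first fails.\<close>

definition zlen :: "('b => 'b => bool) => 'b list => nat => bool" where
 "zlen E xs k <-> 1 <= k & k <= length xs & (ALL t. Suc t < k --> okz E xs t) &
   (k < length xs --> ~ okz E xs (k - 1))"

lemma zlen_zz: "zlen E xs k ==> k = length xs <-> zz E True xs"
proof -
 assume z: "zlen E xs k"
 have "zz E True xs <-> (ALL t. Suc t < length xs --> okz E xs t)" by (simp add: zz_nth okz_def)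
 moreover have "~ okz E xs (k - 1) & Suc (k - 1) < length xs" if "k < length xs"
  using z that by (auto simp: zlen_def)
 ultimately show ?thesis using z unfolding zlen_def by (metis le_neq_implies_less)
qed

lemma pre_take:
 assumes "1 <= k" "k <= length xs" "!!t. Suc t < k ==> B (xs ! t) (xs ! Suc t)"
  "k < length xs ==> ~ B (xs ! (k - 1)) (xs ! k)"
 shows "pre B xs = take k xs"
 using assms
proof (induction B xs arbitrary: k rule: pre.induct)
 case (1 B x y r)
 show ?case
 proof (cases "k = 1")
  case True thus ?thesis using "1.prems"(4) by simp
 next
  case False
  then obtain k' where k: "k = Suc (Suc k')" using "1.prems"(1) by (metis One_nat_def Suc_le_D not0_implies_Suc)
  have "B x y" using "1.prems"(3)[of 0] k by simp
  moreover have "pre B (y # r) = take (Suc k') (y # r)"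
   using "1.prems" k by (intro "1.IH"[OF \<open>B x y\<close>]) (auto, force)
  ultimately show ?thesis using k by simp
 qed
qed (auto simp: le_Suc_eq)

lemma zlen_pre:
 assumes "zlen B xs k" "!!x y. B x y ==> B y x"
 shows "pre B xs = take k xs"
proof (rule pre_take)
 have ok: "okz B xs t <-> B (xs ! t) (xs ! Suc t)" for t using assms(2) by (auto simp: okz_def)
 show "B (xs ! t) (xs ! Suc t)" if "Suc t < k" for t using assms(1) ok that by (simp add: zlen_def)
 show "~ B (xs ! (k - 1)) (xs ! k)" if "k < length xs" using assms(1) ok that by (auto simp: zlen_def)
qed (use assms in \<open>auto simp: zlen_def\<close>)

definition eUp :: "string => string => aexp \<times> aexp" where
 "eUp a r = (Read a (Read ''UP'' (Add (Read ''rG'' (Reg r)) (Reg ''j''))), Reg ''n1'')"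

text \<open>A row of \<open>UP\<close> has entries 0 to \<open>n\<close>, so entry \<open>j\<close>
  of its reversal is entry \<open>n - j\<close>.\<close>

definition eDn :: "string => string => aexp \<times> aexp" where
 "eDn a r = (Read a (Read ''UP'' (Add (Read ''rG'' (Reg r)) (Sub (Reg ''nG'') (Reg ''j'')))), Reg ''n1'')"

definition eSeg :: "string => string => aexp \<times> aexp" where
 "eSeg A l = (Read A (Reg ''j''), Reg l)"

definition eRev :: "string => string => aexp \<times> aexp" where
 "eRev A l = (Read A (Sub (Sub (Reg l) (Const 1)) (Reg ''j'')), Reg l)"

lemma emitted_eSeg:
 "A ~= ''B'' ==> l ~: {''j'', ''bl''} ==> emitted s (eSeg A l) (seg s A (regs s l))"
 by (auto simp: emitted_def eSeg_def fr_reg fr_arr)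

lemma emitted_eRev:
 "A ~= ''B'' ==> l ~: {''j'', ''bl''} ==> emitted s (eRev A l) (rev (seg s A (regs s l)))"
 by (auto simp: emitted_def eRev_def fr_reg fr_arr rev_nth)

definition cpy :: "string => string => string => string => com" where
 "cpy D dl A l = Seq (Assign dl (Const 0)) (eloop D dl ''j'' (Read A (Reg ''j'')) (Reg l))"

lemma wR_cpy[simp]: "wR (cpy D dl A l) = {dl, ''j''}" and wA_cpy[simp]: "wA (cpy D dl A l) = {D}"
 by (auto simp: cpy_def)

lemma cpy_spec:
 assumes "D ~= A" "dl ~= l" "dl ~= ''j''" "l ~= ''j''" "regs s l <= M"
 shows "EX s'. runs (cpy D dl A l) (M * 4 + 3) s s' & seg s' D (regs s' dl) = seg s A (regs s l) & fr {dl, ''j''} {D} s s'"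
proof -
 define s1 where "s1 = s\<lparr>regs := (regs s)(dl := 0)\<rparr>"
 have r1: "runs (Assign dl (Const 0)) 1 s s1" using runs_Assign[of dl "Const 0" s] by (simp add: s1_def)
 obtain s2 where s2: "runs (eloop D dl ''j'' (Read A (Reg ''j'')) (Reg l)) (regs s l * 4 + 2) s1 s2"
  "seg s2 D (regs s2 dl) = seg s1 D (regs s1 dl) @ map (%k. arrs s A k) [0..<regs s l]"
  using eloop_spec[of "''j''" dl D s1 "Reg l" "regs s l" "Read A (Reg ''j'')" "%k. arrs s A k"] assms
  by (auto simp: s1_def fr_reg fr_arr)
 have r: "runs (cpy D dl A l) (1 + (regs s l * 4 + 2)) s s2" unfolding cpy_def by (rule runs_Seq[OF r1 s2(1)])
 show ?thesis
  using runs_fr[OF r] s2(2) assms by (intro exI[of _ s2] conjI runs_mono[OF r]) (auto simp: s1_def seg_def)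
qed

text \<open>\<open>p\<close> is the parity of \<open>i2\<close>, toggled because the machine has no
  division. Consecutive offsets tell whether a vertex of \<open>G\<close> has arcs of a given
  direction, and a matrix tells the arcs of \<open>H\<close>.\<close>

definition zbody :: com where
 "zbody = Seq (Cond (Less (Reg ''p'') (Const 1))
   (Seq (Assign ''a'' (Read ''S'' (Reg ''i2''))) (Assign ''b'' (Read ''S'' (Add (Reg ''i2'') (Const 1)))))
   (Seq (Assign ''a'' (Read ''S'' (Add (Reg ''i2'') (Const 1)))) (Assign ''b'' (Read ''S'' (Reg ''i2'')))))
  (Seq (Cond (Conj (eqe (Reg ''zk'') (Add (Reg ''i2'') (Const 1)))
     (Conj (Neg (Conj (Less (Read ''G_out_off'' (Reg ''zv'')) (Read ''G_out_off'' (Add (Reg ''zv'') (Const 1))))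
         (Neg (Less (Const 0) (Read ''HM'' (Add (Read ''rH'' (Reg ''a'')) (Reg ''b'')))))))
        (Neg (Conj (Less (Read ''G_in_off'' (Reg ''zv'')) (Read ''G_in_off'' (Add (Reg ''zv'') (Const 1))))
         (Neg (Less (Const 0) (Read ''HM'' (Add (Read ''rH'' (Reg ''b'')) (Reg ''a'')))))))))
    (Assign ''zk'' (Add (Reg ''i2'') (Const 2))) Skip)
   (Assign ''p'' (Sub (Const 1) (Reg ''p''))))"

definition zigt :: com where
 "zigt = Seq (Assign ''zk'' (Const 1)) (Seq (Assign ''p'' (Const 0)) (For ''i2'' (Sub (Reg ''sl'') (Const 1)) zbody))"

definition zigc :: com where
 "zigc = Seq zigt (Cond (Conj (eqe (Reg ''zk'') (Reg ''sl'')) (Less (Reg ''p'') (Const 1)))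
   (Assign ''zo'' (Const 1)) (Assign ''zo'' (Const 0)))"

lemma wR_zbody[simp]: "wR zbody = {''a'', ''b'', ''zk'', ''p''}" and wA_zbody[simp]: "wA zbody = {}"
 and wR_zigt[simp]: "wR zigt = {''a'', ''b'', ''zk'', ''p'', ''i2''}" and wA_zigt[simp]: "wA zigt = {}"
 and wR_zigc[simp]: "wR zigc = {''a'', ''b'', ''zk'', ''p'', ''i2'', ''zo''}" and wA_zigc[simp]: "wA zigc = {}"
 by (auto simp: zbody_def zigt_def zigc_def)

text \<open>Triviality test: a nonempty reduced word is trivial iff it is a single vertex.\<close>

definition len1 :: com where
 "len1 = Cond (Less (Reg ''sl'') (Const 2)) (Assign ''zo'' (Const 1)) (Assign ''zo'' (Const 0))"

definition arcw :: com where
 "arcw = word [eRev ''Q'' ''Qn'', eDn ''alpha'' ''u'', eUp ''alpha'' ''v'', eSeg ''Q'' ''Qn'',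
        eDn ''beta'' ''v'', eUp ''beta'' ''u'']"

definition zigw :: com where
 "zigw = word [eUp ''alpha'' ''zv'', eSeg ''Q'' ''Qn'', eDn ''beta'' ''zv'']"

text \<open>\<open>tk\<close> is the kind of the test: 1 for an arc, 2 for zigzag, 3 for a vertex of
  a tight walk; \<open>ti\<close> is the arc or vertex concerned.\<close>

definition tst :: com where
 "tst = Cond (Less (Reg ''tk'') (Const 2))
   (Seq (Assign ''u'' (Read ''EU'' (Reg ''ti''))) (Seq (Assign ''v'' (Read ''G_out'' (Reg ''ti''))) (Seq arcw len1)))
   (Seq (Assign ''zv'' (Reg ''ti'')) (Seq zigw (Cond (Less (Reg ''tk'') (Const 3)) zigc len1)))"

abbreviation "tstR \<equiv> {''bl'', ''j'', ''sl'', ''k'', ''x'', ''u'', ''v'', ''zv'', ''a'', ''b'', ''zk'', ''p'', ''i2'', ''zo''}"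

lemma wR_len1[simp]: "wR len1 = {''zo''}" and wA_len1[simp]: "wA len1 = {}"
 by (auto simp: len1_def)

lemma wR_arcw: "wR arcw <= wordR" and wA_arcw: "wA arcw <= wordA"
 and wR_zigw: "wR zigw <= wordR" and wA_zigw: "wA zigw <= wordA"
 unfolding arcw_def zigw_def by (rule wR_word wA_word)+

lemma wR_tst: "wR tst <= tstR"
proof -
 have "wR tst = {''u''} Un ({''v''} Un (wR arcw Un {''zo''})) Un
   ({''zv''} Un (wR zigw Un ({''a'', ''b'', ''zk'', ''p'', ''i2'', ''zo''} Un {''zo''})))"
  unfolding tst_def by simp
 moreover have "wR arcw <= tstR" by (rule order.trans[OF wR_arcw]) simp
 moreover have "wR zigw <= tstR" by (rule order.trans[OF wR_zigw]) simp
 ultimately show ?thesis by (simp only: Un_subset_iff) simp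
qed

lemma wA_tst: "wA tst <= wordA"
 unfolding tst_def using wA_arcw wA_zigw by simp

text \<open>\<open>AL\<close> lists the arcs in the order of the adjacency array, so that a position
  in \<open>G_out\<close> also serves as the name of an arc.\<close>

locale prg = hom_pair_based G H al be2 q up
 for G H :: "nat pair_pre_digraph" and al be2 :: "nat => nat" and q :: nat and up :: "nat => nat list" +
 fixes n nH m :: nat and AL :: "(nat \<times> nat) list"
 assumes VG: "pverts G = {..<n}" and VH: "pverts H = {..<nH}" and AL: "set AL = parcs G" "length AL = m"
  and up_length: "!!v. v < n ==> length (up v) = n + 1" and up_V: "!!v. v < n ==> set (up v) <= {..<n}"
begin

abbreviation np where "np == n + 1"

definition env :: "ram_state => bool" where
 "env s <-> regs s ''nG'' = n & regs s ''n1'' = n + 1 & regs s ''m'' = m &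
  (ALL v<n. arrs s ''alpha'' v = al v & arrs s ''beta'' v = be2 v & arrs s ''rG'' v = v * np &
    (ALL i<=n. arrs s ''UP'' (v * np + i) = up v ! i) &
    (arrs s ''G_out_off'' v < arrs s ''G_out_off'' (Suc v) <-> (EX u. (v, u) : parcs G)) &
    (arrs s ''G_in_off'' v < arrs s ''G_in_off'' (Suc v) <-> (EX u. (u, v) : parcs G))) &
  (ALL j<m. arrs s ''EU'' j = fst (AL ! j) & arrs s ''G_out'' j = snd (AL ! j)) &
  (ALL a<nH. ALL b<nH. 0 < arrs s ''HM'' (arrs s ''rH'' a + b) <-> (a, b) : parcs H)"

abbreviation "envR \<equiv> {''nG'', ''n1'', ''m''}"
abbreviation "envA \<equiv> {''alpha'', ''beta'', ''rG'', ''UP'', ''G_out_off'', ''G_in_off'', ''EU'', ''G_out'', ''HM'', ''rH''}"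

lemma env_fr:
 assumes "env s" "fr R A s s'" "R Int envR = {}" "A Int envA = {}"
 shows "env s'"
proof -
 have r: "regs s' x = regs s x" if "x : envR" for x using fr_reg[OF assms(2)] assms(3) that by blast
 have a: "arrs s' x = arrs s x" if "x : envA" for x using fr_arr[OF assms(2)] assms(4) that by blast
 show ?thesis using assms(1) unfolding env_def by (simp add: r a)
qed

lemma env_UP: "env s ==> v < n ==> i <= n ==> arrs s ''UP'' (arrs s ''rG'' v + i) = up v ! i"
 and env_nG: "env s ==> regs s ''nG'' = n" and env_n1: "env s ==> regs s ''n1'' = n + 1" and env_m: "env s ==> regs s ''m'' = m"
 unfolding env_def by metis+

lemma alpha_nH: "v < n ==> al v < nH" and beta_nH: "v < n ==> be2 v < nH"
 using hom_al hom_be2 VG VH by (auto simp: digraph_hom_def)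

lemma up_nth: "v < n ==> i <= n ==> up v ! i < n"
 using up_V[of v] up_length[of v] nth_mem[of i "up v"] by fastforce

definition colors :: "string => (nat => nat) => bool" where
 "colors a f <-> a = ''alpha'' & f = al | a = ''beta'' & f = be2"

lemma emitted_eUp:
 assumes "env s" "colors a f" "regs s r < n" "r ~: {''j'', ''bl''}"
 shows "emitted s (eUp a r) (map f (up (regs s r)))"
 unfolding emitted_def
proof (intro allI impI conjI)
 fix s' assume F: "fr {''j'', ''bl''} {''B''} s s'"
 have e: "env s'" by (rule env_fr[OF assms(1) F]) auto
 show "aval (snd (eUp a r)) s' = length (map f (up (regs s r)))"
  using e up_length[OF assms(3)] by (simp add: eUp_def env_def)
 fix k assume k: "k < length (map f (up (regs s r)))" "regs s' ''j'' = k"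
 hence "k <= n" using up_length[OF assms(3)] by simp
 moreover have "regs s' r = regs s r" using fr_reg[OF F assms(4)] .
 moreover have "arrs s' a v = f v" if "v < n" for v using e that assms(2) by (auto simp: colors_def env_def)
 ultimately show "aval (fst (eUp a r)) s' = map f (up (regs s r)) ! k"
  using k assms(3) up_nth[OF assms(3), of k] by (simp add: eUp_def env_UP[OF e])
qed

lemma emitted_eDn:
 assumes "env s" "colors a f" "regs s r < n" "r ~: {''j'', ''bl''}"
 shows "emitted s (eDn a r) (map f (rev (up (regs s r))))"
 unfolding emitted_def
proof (intro allI impI conjI)
 fix s' assume F: "fr {''j'', ''bl''} {''B''} s s'"
 have e: "env s'" by (rule env_fr[OF assms(1) F]) auto
 show "aval (snd (eDn a r)) s' = length (map f (rev (up (regs s r))))"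
  using e up_length[OF assms(3)] by (simp add: eDn_def env_def)
 fix k assume k: "k < length (map f (rev (up (regs s r))))" "regs s' ''j'' = k"
 hence "k <= n" using up_length[OF assms(3)] by simp
 moreover have "regs s' r = regs s r" using fr_reg[OF F assms(4)] .
 moreover have "arrs s' a v = f v" if "v < n" for v using e that assms(2) by (auto simp: colors_def env_def)
 ultimately show "aval (fst (eDn a r)) s' = map f (rev (up (regs s r))) ! k"
  using k assms(3) up_nth[OF assms(3), of "n - k"] up_length[OF assms(3)]
   env_UP[OF e assms(3), of "n - k"] by (simp add: eDn_def env_nG[OF e] rev_nth)
qed

lemma colors_simps[simp]: "colors ''alpha'' al" "colors ''beta'' be2" by (auto simp: colors_def)

definition Qs :: "ram_state => nat list" where
 "Qs s = seg s ''Q'' (regs s ''Qn'')"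

text \<open>\<open>60 * np\<close> bounds every candidate that is ever tested, even before its
  reduction.\<close>

lemma arcw_spec:
 assumes "env s" "regs s ''u'' = u" "regs s ''v'' = v" "u < n" "v < n" "regs s ''Qn'' <= 60 * np"
 shows "EX s'. runs arcw (2100 * np) s s' & fr wordR wordA s s' &
  seg s' ''S'' (regs s' ''sl'') = nf (rev (Qs s) @ map al (cyc u v) @ Qs s @ map be2 (rev (cyc u v)))"
proof -
 let ?xss = "[rev (Qs s), map al (rev (up u)), map al (up v), Qs s, map be2 (rev (up v)), map be2 (up u)]"
 have e: "list_all2 (emitted s) [eRev ''Q'' ''Qn'', eDn ''alpha'' ''u'', eUp ''alpha'' ''v'', eSeg ''Q'' ''Qn'',
        eDn ''beta'' ''v'', eUp ''beta'' ''u''] ?xss"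
  using emitted_eRev[of "''Q''" "''Qn''" s] emitted_eSeg[of "''Q''" "''Qn''" s]
   emitted_eDn[OF assms(1), of "''alpha''" al "''u''"] emitted_eUp[OF assms(1), of "''alpha''" al "''v''"]
   emitted_eDn[OF assms(1), of "''beta''" be2 "''v''"] emitted_eUp[OF assms(1), of "''beta''" be2 "''u''"] assms
  by (simp add: Qs_def)
 have "length (concat ?xss) <= 124 * np" using assms up_length by (simp add: Qs_def)
 from word_spec[OF e this] obtain s' where s': "runs arcw (124 * np * 16 + 25) s s'"
  "seg s' ''S'' (regs s' ''sl'') = nf (concat ?xss)" "fr wordR wordA s s'" by (auto simp: arcw_def)
 show ?thesis using s' by (intro exI[of _ s'] conjI runs_mono[OF s'(1)]) (auto simp: cyc_def)
qed

lemma zigw_spec: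
 assumes "env s" "regs s ''zv'' = v" "v < n" "regs s ''Qn'' <= 60 * np"
 shows "EX s'. runs zigw (1100 * np) s s' & fr wordR wordA s s' &
  seg s' ''S'' (regs s' ''sl'') = SS (Qs s) v"
proof -
 let ?xss = "[map al (up v), Qs s, map be2 (rev (up v))]"
 have e: "list_all2 (emitted s) [eUp ''alpha'' ''zv'', eSeg ''Q'' ''Qn'', eDn ''beta'' ''zv''] ?xss"
  using emitted_eSeg[of "''Q''" "''Qn''" s]
   emitted_eUp[OF assms(1), of "''alpha''" al "''zv''"] emitted_eDn[OF assms(1), of "''beta''" be2 "''zv''"] assms
  by (simp add: Qs_def)
 have "length (concat ?xss) <= 62 * np" using assms up_length by (simp add: Qs_def)
 from word_spec[OF e this] obtain s' where s': "runs zigw (62 * np * 16 + 25) s s'"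
  "seg s' ''S'' (regs s' ''sl'') = nf (concat ?xss)" "fr wordR wordA s s'" by (auto simp: zigw_def)
 show ?thesis using s' by (intro exI[of _ s'] conjI runs_mono[OF s'(1)]) (auto simp: SS_def)
qed

lemma zigt_spec:
 assumes "env s" "regs s ''zv'' = v" "v < n" "set (seg s ''S'' (regs s ''sl'')) <= {..<nH}" "0 < regs s ''sl''" "regs s ''sl'' <= M"
 shows "EX s'. runs zigt (M * 12 + 4) s s' & zlen (EE v) (seg s ''S'' (regs s ''sl'')) (regs s' ''zk'') &
   regs s' ''p'' = (if odd (regs s ''sl'') then 0 else 1) & fr {''a'', ''b'', ''zk'', ''p'', ''i2''} {} s s'"
proof -
 define xs where "xs = seg s ''S'' (regs s ''sl'')"
 define l where "l = regs s ''sl''"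
 have lx: "length xs = l" "0 < l" using assms(5) by (simp_all add: xs_def l_def)
 define s1 where "s1 = s\<lparr>regs := (regs s)(''zk'' := 1, ''p'' := 0)\<rparr>"
 have r1: "runs (Assign ''zk'' (Const 1)) 1 s (s\<lparr>regs := (regs s)(''zk'' := 1)\<rparr>)"
  using runs_Assign[of "''zk''" "Const 1" s] by simp
 have r2: "runs (Assign ''p'' (Const 0)) 1 (s\<lparr>regs := (regs s)(''zk'' := 1)\<rparr>) s1"
  using runs_Assign[of "''p''" "Const 0" "s\<lparr>regs := (regs s)(''zk'' := 1)\<rparr>"] by (simp add: s1_def)
 let ?I = "%i s'. regs s' ''p'' = i mod 2 & 1 <= regs s' ''zk'' & regs s' ''zk'' <= Suc i &
   (ALL t. Suc t < regs s' ''zk'' --> okz (EE v) xs t) & (regs s' ''zk'' < Suc i --> ~ okz (EE v) xs (regs s' ''zk'' - 1))"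
 let ?F = "frl ''i2'' zbody"
 have "EX s'. runs (For ''i2'' (Sub (Reg ''sl'') (Const 1)) zbody) ((l - 1) * (10 + 2) + 2) s1 s' & ?I (l - 1) s' & ?F s1 s'"
 proof (rule For_rule[where I = ?I and N = "l - 1" and T = 10])
  fix s' assume F: "?F s1 s'"
  show "aval (Sub (Reg ''sl'') (Const 1)) s' = l - 1" using fr_reg[OF F, of "''sl''"] by (simp add: s1_def l_def)
 next
  fix i s' assume i: "i < l - 1" and F: "?F s1 s'" and ri: "regs s' ''i2'' = i" and I: "?I i s'"
  have e: "env s'"
  proof -
   have "fr ({''zk'', ''p''}) {} s s1" by (simp add: fr_def s1_def)
   from fr_trans[OF this F] show ?thesis by (rule env_fr[OF assms(1)]) auto
  qed
  have zv: "regs s' ''zv'' = v" using fr_reg[OF F, of "''zv''"] assms(2) by (simp add: s1_def)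
  have S: "arrs s' ''S'' t = xs ! t" if "t < l" for t using fr_arr[OF F, of "''S''"] that by (simp add: s1_def xs_def l_def)
  have il: "i < length xs" "Suc i < length xs" using i lx by auto
  have b: "xs ! i < nH" "xs ! Suc i < nH"
   using assms(4) nth_mem[OF il(1)] nth_mem[OF il(2)] unfolding xs_def[symmetric] by blast+
  have HM: "0 < arrs s' ''HM'' (arrs s' ''rH'' a + b) <-> (a, b) : parcs H" if "a < nH" "b < nH" for a b
   using e that by (simp add: env_def)
  note H1 = HM[OF b] and H2 = HM[OF b(2,1)]
  have S1: "arrs s' ''S'' i = xs ! i" "arrs s' ''S'' (Suc i) = xs ! Suc i" using S il lx by auto
  have deg: "arrs s' ''G_out_off'' v < arrs s' ''G_out_off'' (Suc v) <-> (EX u. (v, u) : parcs G)"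
   "arrs s' ''G_in_off'' v < arrs s' ''G_in_off'' (Suc v) <-> (EX u. (u, v) : parcs G)"
   using e assms(3) by (simp_all add: env_def)
  have r: "runs zbody 10 s' (ev zbody s')" by (rule run_ev) (simp_all add: zbody_def)
  have P: "regs (ev zbody s') ''p'' = Suc i mod 2"
   using I by (auto simp: zbody_def) (simp_all add: mod_Suc)
  have ZK: "regs (ev zbody s') ''zk'' = (if regs s' ''zk'' = Suc i & okz (EE v) xs i then Suc (Suc i) else regs s' ''zk'')"
  proof (cases "even i")
   case True
   hence p: "regs s' ''p'' = 0" using I by auto
   have "okz (EE v) xs i <-> EE v (xs ! i) (xs ! Suc i)" using True by (simp add: okz_def)
   thus ?thesis
    by (simp add: zbody_def p ri zv S1 H1 H2 deg EE_def)
  next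
   case False
   hence p: "regs s' ''p'' = 1" using I by (auto simp: odd_iff_mod_2_eq_one)
   have "okz (EE v) xs i <-> EE v (xs ! Suc i) (xs ! i)" using False by (simp add: okz_def)
   thus ?thesis
    by (simp add: zbody_def p ri zv S1 H1 H2 deg EE_def)
  qed
  have "?I (Suc i) (ev zbody s')"
  proof (cases "regs s' ''zk'' = Suc i & okz (EE v) xs i")
   case True
   thus ?thesis using I P ZK by (auto simp: less_Suc_eq)
  next
   case False
   thus ?thesis using I P ZK by (auto simp: less_Suc_eq)
  qed
  thus "EX s''. runs zbody 10 s' s'' & ?I (Suc i) s''" using r by blast
 qed (auto simp: s1_def)
 then obtain s' where s': "runs (For ''i2'' (Sub (Reg ''sl'') (Const 1)) zbody) ((l - 1) * (10 + 2) + 2) s1 s'" "?I (l - 1) s'"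
  by blast
 have r: "runs zigt (1 + (1 + ((l - 1) * (10 + 2) + 2))) s s'"
  unfolding zigt_def by (intro runs_Seq[OF r1] runs_Seq[OF r2 s'(1)])
 have p: "(l - 1) mod 2 = (if odd l then 0 else 1)" using lx(2) by (cases l) (auto simp: mod_2_eq_odd)
 have Z: "zlen (EE v) xs (regs s' ''zk'')" using s'(2) lx by (auto simp: zlen_def)
 have P: "regs s' ''p'' = (if odd l then 0 else 1)" using s'(2) p by simp
 have F: "fr {''a'', ''b'', ''zk'', ''p'', ''i2''} {} s s'" using runs_fr[OF r] by simp
 have "runs zigt (M * 12 + 4) s s'" by (rule runs_mono[OF r]) (use lx assms(6) in \<open>simp add: l_def\<close>)
 thus ?thesis using Z P F unfolding xs_def l_def by blast
qed

definition tdec :: "nat => nat => nat test" where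
 "tdec k i = (if k = 1 then TArc (fst (AL ! i)) (snd (AL ! i)) else if k = 2 then TZig i else TEps i)"

definition tvalid :: "nat => nat => bool" where
 "tvalid k i <-> k = 1 & i < m | (k = 2 | k = 3) & i < n"

lemma AL_nth: "j < m ==> fst (AL ! j) < n & snd (AL ! j) < n & AL ! j : parcs G"
 using AL nth_mem[of j AL] parcs_V[of "fst (AL ! j)" "snd (AL ! j)"] VG by auto

lemma SS_nH: "v < n ==> set Q <= {..<nH} ==> set (SS Q v) <= {..<nH}"
proof -
 assume v: "v < n" "set Q <= {..<nH}"
 have "al ` set (up v) <= {..<nH}" "be2 ` set (up v) <= {..<nH}"
  using up_V[OF v(1)] alpha_nH beta_nH by (auto dest!: subsetD)
 hence "set (map al (up v) @ Q @ map be2 (rev (up v))) <= {..<nH}" using v(2) by simp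
 thus ?thesis unfolding SS_def using set_nf by (rule order.trans[rotated])
qed

lemma SS_len: "v < n ==> length Q <= 60 * np ==> length (SS Q v) <= 62 * np"
 using length_nf[of "map al (up v) @ Q @ map be2 (rev (up v))"] up_length[of v] by (simp add: SS_def)

lemma len1_spec: "EX s'. runs len1 3 s s' & regs s' ''zo'' = (if regs s ''sl'' < 2 then 1 else 0) & fr {''zo''} {} s s'"
 using runs_ev[of len1 s] by (intro exI[of _ "ev len1 s"]) (auto simp: len1_def fr_def numeral_3_eq_3)

lemma tst_spec:
 assumes "env s" "tvalid (regs s ''tk'') (regs s ''ti'')" "base (Qs s)" "set (Qs s) <= {..<nH}" "regs s ''Qn'' <= 60 * np"
 shows "EX s'. runs tst (2200 * np) s s' & fr tstR wordA s s' &
  regs s' ''zo'' = (if passes (tdec (regs s ''tk'') (regs s ''ti'')) (Qs s) then 1 else 0) &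
  (regs s ''tk'' ~= 1 --> seg s' ''S'' (regs s' ''sl'') = SS (Qs s) (regs s ''ti''))"
proof (cases "regs s ''tk'' = 1")
 case True
 define j where "j = regs s ''ti''"
 have j: "j < m" using assms(2) True by (auto simp: tvalid_def j_def)
 define u v where "u = fst (AL ! j)" and "v = snd (AL ! j)"
 have uv: "u < n" "v < n" using AL_nth[OF j] by (auto simp: u_def v_def)
 define s1 where "s1 = s\<lparr>regs := (regs s)(''u'' := u)\<rparr>"
 define s2 where "s2 = s1\<lparr>regs := (regs s1)(''v'' := v)\<rparr>"
 have r1: "runs (Assign ''u'' (Read ''EU'' (Reg ''ti''))) 1 s s1"
  using runs_Assign[of "''u''" "Read ''EU'' (Reg ''ti'')" s] assms(1) j by (simp add: s1_def u_def env_def j_def)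
 have r2: "runs (Assign ''v'' (Read ''G_out'' (Reg ''ti''))) 1 s1 s2"
  using runs_Assign[of "''v''" "Read ''G_out'' (Reg ''ti'')" s1] assms(1) j by (simp add: s1_def s2_def v_def env_def j_def)
 have f2: "fr {''u'', ''v''} {} s s2" by (simp add: fr_def s1_def s2_def)
 have e2: "env s2" by (rule env_fr[OF assms(1) f2]) auto
 have Q2: "Qs s2 = Qs s" by (simp add: Qs_def s2_def s1_def)
 obtain s3 where s3: "runs arcw (2100 * np) s2 s3" "fr wordR wordA s2 s3"
  "seg s3 ''S'' (regs s3 ''sl'') = nf (rev (Qs s) @ map al (cyc u v) @ Qs s @ map be2 (rev (cyc u v)))"
  using arcw_spec[OF e2, of u v] uv assms(5) Q2 by (auto simp: s2_def s1_def)
 obtain s4 where s4: "runs len1 3 s3 s4" "regs s4 ''zo'' = (if regs s3 ''sl'' < 2 then 1 else 0)" "fr {''zo''} {} s3 s4"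
  using len1_spec by blast
 have r: "runs tst (Suc (1 + (1 + (2100 * np + 3)))) s s4"
  unfolding tst_def using True by (intro runs_CondTrue runs_Seq[OF r1] runs_Seq[OF r2] runs_Seq[OF s3(1) s4(1)]) simp
 define W where "W = rev (Qs s) @ map al (cyc u v) @ Qs s @ map be2 (rev (cyc u v))"
 have sl: "regs s3 ''sl'' = length (nf W)" using arg_cong[OF s3(3), of length] by (simp add: W_def)
 have "W ~= []" "hd W = be2 q" using assms(3) by (auto simp: W_def base_def hd_rev hd_append)
 hence "0 < length (nf W)" "length (nf W) = 1 <-> nf W = [be2 q]" using length_nf_1[of W] by auto
 hence "regs s3 ''sl'' < 2 <-> arcT u v (Qs s)" using sl unfolding arcT_def W_def[symmetric] by linarith
 hence "regs s4 ''zo'' = (if passes (tdec (regs s ''tk'') (regs s ''ti'')) (Qs s) then 1 else 0)"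
  using s4(2) True by (simp add: tdec_def u_def v_def j_def)
 moreover have "runs tst (2200 * np) s s4" by (rule runs_mono[OF r]) simp
 moreover have "fr tstR wordA s s4" by (rule fr_mono[OF runs_fr[OF r] wR_tst wA_tst])
 ultimately show ?thesis using True by blast
next
 case False
 define v where "v = regs s ''ti''"
 have v: "v < n" "regs s ''tk'' = 2 | regs s ''tk'' = 3" using assms(2) False by (auto simp: tvalid_def v_def)
 define s1 where "s1 = s\<lparr>regs := (regs s)(''zv'' := v)\<rparr>"
 have r1: "runs (Assign ''zv'' (Reg ''ti'')) 1 s s1"
  using runs_Assign[of "''zv''" "Reg ''ti''" s] by (simp add: s1_def v_def)
 have f1: "fr {''zv''} {} s s1" by (simp add: fr_def s1_def)
 have e1: "env s1" by (rule env_fr[OF assms(1) f1]) auto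
 have Q1: "Qs s1 = Qs s" by (simp add: Qs_def s1_def)
 obtain s2 where s2: "runs zigw (1100 * np) s1 s2" "fr wordR wordA s1 s2" "seg s2 ''S'' (regs s2 ''sl'') = SS (Qs s) v"
  using zigw_spec[OF e1, of v] v assms(5) Q1 by (auto simp: s1_def)
 have e2: "env s2" by (rule env_fr[OF e1 s2(2)]) auto
 have zv2: "regs s2 ''zv'' = v" "regs s2 ''tk'' = regs s ''tk''" using s2(2) by (simp_all add: fr_reg s1_def)
 define X where "X = SS (Qs s) v"
 have X: "X ~= []" "hd X = al v" "set X <= {..<nH}" "length X <= 62 * np"
  using SS_ends[OF assms(3)] v VG SS_nH[OF v(1) assms(4)] SS_len[OF v(1), of "Qs s"] assms(5) by (auto simp: X_def Qs_def)
 have sl: "regs s2 ''sl'' = length X" using arg_cong[OF s2(3), of length] by (simp add: X_def)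
 have "EX s3. runs (Cond (Less (Reg ''tk'') (Const 3)) zigc len1) (800 * np) s2 s3 &
  regs s3 ''zo'' = (if passes (tdec (regs s ''tk'') v) (Qs s) then 1 else 0) & seg s3 ''S'' (regs s3 ''sl'') = X"
 proof (cases "regs s ''tk'' = 2")
  case True
  obtain s3 where s3: "runs zigt (length X * 12 + 4) s2 s3" "zlen (EE v) X (regs s3 ''zk'')"
   "regs s3 ''p'' = (if odd (length X) then 0 else 1)" "fr {''a'', ''b'', ''zk'', ''p'', ''i2''} {} s2 s3"
   using zigt_spec[OF e2 zv2(1) v(1), of "length X"] s2(3) X sl by (auto simp: X_def[symmetric])
  have s3': "regs s3 ''sl'' = length X" "arrs s3 = arrs s2" using s3(4) sl by (auto simp: fr_def)
  define s4 where "s4 = ev (Cond (Conj (eqe (Reg ''zk'') (Reg ''sl'')) (Less (Reg ''p'') (Const 1)))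
   (Assign ''zo'' (Const 1)) (Assign ''zo'' (Const 0))) s3"
  have r: "runs zigc (length X * 12 + 4 + 3) s2 s4" unfolding zigc_def s4_def
   by (rule runs_Seq[OF s3(1)]) (rule run_ev, simp_all)
  have "regs s3 ''zk'' = length X <-> zz (EE v) True X" using zlen_zz[OF s3(2)] .
  hence "regs s4 ''zo'' = (if zo (EE v) X then 1 else 0)" using s3(3) s3' by (auto simp: s4_def zo_def)
  moreover have "seg s4 ''S'' (regs s4 ''sl'') = X" using s2(3) s3' sl by (auto simp: s4_def seg_def X_def)
  moreover have "runs (Cond (Less (Reg ''tk'') (Const 3)) zigc len1) (Suc (length X * 12 + 4 + 3)) s2 s4"
   using True zv2(2) by (intro runs_CondTrue r) simp
  ultimately show ?thesis using True X(4)
   by (intro exI[of _ s4] conjI) (auto simp: tdec_def X_def elim: runs_mono)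
 next
  case False
  hence 3: "regs s ''tk'' = 3" using v by simp
  obtain s3 where s3: "runs len1 3 s2 s3" "regs s3 ''zo'' = (if regs s2 ''sl'' < 2 then 1 else 0)" "fr {''zo''} {} s2 s3"
   using len1_spec by blast
  have "regs s2 ''sl'' < 2 <-> X = [al v]" using sl X by (cases X) auto
  moreover have "seg s3 ''S'' (regs s3 ''sl'') = X" using s2(3) s3(3) by (auto simp: fr_def seg_def X_def)
  moreover have "runs (Cond (Less (Reg ''tk'') (Const 3)) zigc len1) (Suc 3) s2 s3"
   using 3 zv2(2) by (intro runs_CondFalse s3(1)) simp
  ultimately show ?thesis using 3 s3(2)
   by (intro exI[of _ s3] conjI) (auto simp: tdec_def X_def elim: runs_mono)
 qed
 then obtain s3 where s3: "runs (Cond (Less (Reg ''tk'') (Const 3)) zigc len1) (800 * np) s2 s3"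
  "regs s3 ''zo'' = (if passes (tdec (regs s ''tk'') v) (Qs s) then 1 else 0)" "seg s3 ''S'' (regs s3 ''sl'') = X" by blast
 have r: "runs tst (Suc (1 + (1100 * np + 800 * np))) s s3"
  unfolding tst_def using v(2) by (intro runs_CondFalse runs_Seq[OF r1] runs_Seq[OF s2(1) s3(1)]) auto
 moreover have "runs tst (2200 * np) s s3" by (rule runs_mono[OF r]) simp
 moreover have "fr tstR wordA s s3" by (rule fr_mono[OF runs_fr[OF r] wR_tst wA_tst])
 ultimately show ?thesis using s3 by (auto simp: v_def X_def)
qed

end

section \<open>Verifying a candidate\<close>

text \<open>A chain that is still decreasing at step \<open>card U\<close> has decreased at every
  earlier step, more often than \<open>U\<close> has elements.\<close>

lemma decreasing_stable:
 assumes "finite U" "!!i. X (Suc i) = F (X i)" "!!i. X (Suc i) <= X i" "X 0 <= U"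
 shows "X (Suc (card U)) = X (card U)"
proof (rule ccontr)
 assume ne: "X (Suc (card U)) ~= X (card U)"
 have XU: "finite (X i)" for i
  by (induction i) (auto intro: finite_subset[OF assms(4,1)] finite_subset[OF assms(3)])
 have st: "X (Suc i) ~= X i" if "i <= card U" for i
 proof
  assume "X (Suc i) = X i"
  hence "X (i + k) = X i" for k using assms(2) by (induction k) auto
  from this[of "card U - i"] this[of "Suc (card U) - i"] that ne show False by (simp add: Suc_diff_le)
 qed
 have "card (X i) + i <= card U" if "i <= Suc (card U)" for i
  using that
 proof (induction i)
  case 0 thus ?case using card_mono[OF assms(1,4)] by simp
 next
  case (Suc i)
  have "X (Suc i) \<subset> X i" using assms(3)[of i] st[of i] Suc.prems by auto
  hence "card (X (Suc i)) < card (X i)" using psubset_card_mono XU by blast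
  thus ?case using Suc by simp
 qed
 from this[of "Suc (card U)"] show False by simp
qed

definition vtest :: "nat => string => com" where
 "vtest c i = Seq (Assign ''tk'' (Const c)) (Seq (Assign ''ti'' (Reg i)) (Seq tst
   (Cond (Less (Reg ''zo'') (Const 1)) (Seq (Assign ''kd'' (Const c)) (Assign ''ix'' (Reg i))) Skip)))"

definition vloop1 :: com where
 "vloop1 = For ''j1'' (Reg ''m'') (vtest 1 ''j1'')"

definition vloop2 :: com where
 "vloop2 = For ''i1'' (Reg ''nG'') (Seq (vtest 2 ''i1'')
   (Seq (Store ''se'' (Reg ''i1'') (Reg ''sl'')) (Store ''sec'' (Reg ''i1'') (Read ''S'' (Const 1)))))"

text \<open>Marks \<open>u\<close> if the surviving vertex \<open>v\<close> blocks it, and remembers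
  \<open>v\<close> as a blocker of \<open>u\<close>.\<close>

definition half :: "string => string => com" where
 "half u v = Cond (Conj (Less (Const 1) (Read ''se'' (Reg u)))
   (Conj (Neg (eqe (Read ''alpha'' (Reg v)) (Read ''sec'' (Reg u)))) (Less (Const 0) (Read ''al'' (Reg v)))))
  (Seq (Store ''nal'' (Reg u) (Const 1)) (Store ''nx'' (Reg u) (Reg v))) Skip"

definition pbody :: com where
 "pbody = Seq (Assign ''pu'' (Read ''EU'' (Reg ''j1''))) (Seq (Assign ''pv'' (Read ''G_out'' (Reg ''j1'')))
   (Seq (half ''pu'' ''pv'') (half ''pv'' ''pu'')))"

definition fillc :: "string => aexp => com" where
 "fillc A e = For ''i1'' (Reg ''nG'') (Store A (Reg ''i1'') e)"

definition roundc :: com where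
 "roundc = Seq (fillc ''nal'' (Const 0)) (Seq (For ''j1'' (Reg ''m'') pbody) (fillc ''al'' (Read ''nal'' (Reg ''i1''))))"

text \<open>Sets of vertices are stable after \<open>n\<close> rounds; the additional round makes
  the recorded blockers \<open>nx\<close> lie in the stable set themselves.\<close>

definition peelc :: com where
 "peelc = Seq (fillc ''al'' (Const 1)) (For ''r1'' (Reg ''n1'') roundc)"

definition pickc :: com where
 "pickc = Seq (Assign ''fv'' (Const 0)) (For ''i1'' (Reg ''nG'')
   (Cond (Less (Const 0) (Read ''al'' (Reg ''i1''))) (Assign ''fv'' (Add (Reg ''i1'') (Const 1))) Skip))"

text \<open>\<open>fv\<close> is a survivor plus one, or 0. Following recorded blockers for
  \<open>n\<close> steps leads from any survivor onto a cycle, hence onto a tight walk, and the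
  vertex reached is reported as a failed test.\<close>

definition finc :: com where
 "finc = Cond (Conj (Less (Const 0) (Reg ''fv'')) (Less (Reg ''kd'') (Const 1)))
   (Seq (Assign ''x1'' (Sub (Reg ''fv'') (Const 1)))
    (Seq (For ''i1'' (Reg ''nG'') (Assign ''x1'' (Read ''nx'' (Reg ''x1''))))
    (Seq (Assign ''kd'' (Const 3)) (Assign ''ix'' (Reg ''x1''))))) Skip"

definition verify :: com where
 "verify = Seq (Assign ''kd'' (Const 0)) (Seq vloop1 (Seq vloop2 (Seq peelc (Seq pickc finc))))"

abbreviation "vtR \<equiv> {''bl'', ''j'', ''sl'', ''k'', ''x'', ''u'', ''v'', ''zv'', ''a'', ''b'', ''zk'', ''p'', ''i2'', ''zo'',
  ''tk'', ''ti'', ''kd'', ''ix''}"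
abbreviation "verR \<equiv> vtR Un {''i1'', ''j1'', ''r1'', ''pu'', ''pv'', ''fv'', ''x1''}"
abbreviation "verA \<equiv> {''B'', ''S'', ''se'', ''sec'', ''al'', ''nal'', ''nx''}"

lemma wR_vtest: "wR (vtest c i) <= vtR" and wA_vtest: "wA (vtest c i) <= wordA"
proof -
 have "wR tst <= vtR" by (rule order.trans[OF wR_tst]) simp
 thus "wR (vtest c i) <= vtR" unfolding vtest_def by simp
 show "wA (vtest c i) <= wordA" unfolding vtest_def using wA_tst by simp
qed

lemma wR_pbody[simp]: "wR pbody = {''pu'', ''pv''}" and wA_pbody[simp]: "wA pbody = {''nal'', ''nx''}"
 and wR_fillc[simp]: "wR (fillc A e) = {''i1''}" and wA_fillc[simp]: "wA (fillc A e) = {A}"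
 and wR_roundc[simp]: "wR roundc = {''i1'', ''j1'', ''pu'', ''pv''}" and wA_roundc[simp]: "wA roundc = {''nal'', ''nx'', ''al''}"
 and wR_peelc[simp]: "wR peelc = {''i1'', ''r1'', ''j1'', ''pu'', ''pv''}" and wA_peelc[simp]: "wA peelc = {''al'', ''nal'', ''nx''}"
 and wR_pickc[simp]: "wR pickc = {''fv'', ''i1''}" and wA_pickc[simp]: "wA pickc = {}"
 and wR_finc[simp]: "wR finc = {''x1'', ''i1'', ''kd'', ''ix''}" and wA_finc[simp]: "wA finc = {}"
 unfolding peelc_def roundc_def fillc_def pbody_def half_def pickc_def finc_def by auto

lemma wR_verify: "wR verify <= verR" and wA_verify: "wA verify <= verA"
proof -
 have t: "wR (vtest c i) <= verR" "wA (vtest c i) <= verA" for c i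
  by (rule order.trans[OF wR_vtest], simp, rule order.trans[OF wA_vtest], simp)
 thus "wR verify <= verR" "wA verify <= verA"
  unfolding verify_def vloop1_def vloop2_def by simp_all
qed

lemma fillc_spec:
 assumes "regs s ''nG'' = N" "!!k s'. fr {''i1''} {A} s s' ==> regs s' ''i1'' = k ==> k < N ==> aval e s' = h k"
 shows "EX s'. runs (fillc A e) (N * 3 + 2) s s' & (ALL k<N. arrs s' A k = h k)"
proof -
 let ?I = "%j s'. ALL k<j. arrs s' A k = h k"
 have "EX s'. runs (For ''i1'' (Reg ''nG'') (Store A (Reg ''i1'') e)) (N * (1 + 2) + 2) s s' & ?I N s' &
   fr (insert ''i1'' (wR (Store A (Reg ''i1'') e))) (wA (Store A (Reg ''i1'') e)) s s'"
 proof (rule For_rule[where I = ?I])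
  fix s' assume "fr (insert ''i1'' (wR (Store A (Reg ''i1'') e))) (wA (Store A (Reg ''i1'') e)) s s'"
  thus "aval (Reg ''nG'') s' = N" using assms(1) by (simp add: fr_reg)
 next
  fix k s' assume k: "k < N" "fr (insert ''i1'' (wR (Store A (Reg ''i1'') e))) (wA (Store A (Reg ''i1'') e)) s s'"
   "regs s' ''i1'' = k" "?I k s'"
  have "aval e s' = h k" using assms(2)[of s' k] k by simp
  hence "?I (Suc k) (ev (Store A (Reg ''i1'') e) s')" using k by (simp add: less_Suc_eq)
  thus "EX s''. runs (Store A (Reg ''i1'') e) 1 s' s'' & ?I (Suc k) s''"
   using runs_ev[of "Store A (Reg ''i1'') e" s'] by auto
 qed simp_all
 then obtain s' where s': "runs (For ''i1'' (Reg ''nG'') (Store A (Reg ''i1'') e)) (N * (1 + 2) + 2) s s'" "?I N s'" by blast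
 thus ?thesis unfolding fillc_def by (intro exI[of _ s'] conjI runs_mono[OF s'(1)]) auto
qed

section \<open>Correctness of the verification\<close>

context prg
begin

definition ctx :: "nat list => ram_state => bool" where
 "ctx Q s <-> env s & Qs s = Q"

lemma ctx_fr:
 assumes "ctx Q s" "fr R A s s'" "R Int insert ''Qn'' envR = {}" "A Int insert ''Q'' envA = {}"
 shows "ctx Q s'"
proof -
 have "env s'" using assms unfolding ctx_def by (intro env_fr[OF _ assms(2)]) auto
 moreover have "regs s' ''Qn'' = regs s ''Qn''" "arrs s' ''Q'' = arrs s ''Q''"
  using assms by (auto simp: fr_reg fr_arr)
 ultimately show ?thesis using assms(1) by (simp add: ctx_def Qs_def seg_def)
qed

definition goodQ :: "nat list => bool" where
 "goodQ Q <-> base Q & set Q <= {..<nH} & length Q <= 60 * np"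

definition bad :: "nat list => nat => nat => bool" where
 "bad Q k i <-> k ~= 0 & tvalid k i & tdec k i : tests & ~ passes (tdec k i) Q"

lemma ctx_Qn: "ctx Q s ==> regs s ''Qn'' = length Q"
 by (auto simp: ctx_def Qs_def)

lemma vtest_spec:
 assumes "ctx Q s" "goodQ Q" "c = 1 | c = 2" "tvalid c k" "regs s i = k" "i ~: vtR" "tdec c k : tests"
 shows "EX s'. runs (vtest c i) (2210 * np) s s' & ctx Q s' &
  (if passes (tdec c k) Q then regs s' ''kd'' = regs s ''kd'' & regs s' ''ix'' = regs s ''ix''
   else bad Q (regs s' ''kd'') (regs s' ''ix'')) &
  (c = 2 --> seg s' ''S'' (regs s' ''sl'') = SS Q k)"
proof -
 have i: "i ~= ''tk''" "i ~= ''kd''" "i ~: tstR" using assms(6) by auto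
 define s1 where "s1 = s\<lparr>regs := (regs s)(''tk'' := c)\<rparr>"
 define s2 where "s2 = s1\<lparr>regs := (regs s1)(''ti'' := k)\<rparr>"
 have r1: "runs (Assign ''tk'' (Const c)) 1 s s1" using runs_Assign[of "''tk''" "Const c" s] by (simp add: s1_def)
 have r2: "runs (Assign ''ti'' (Reg i)) 1 s1 s2"
  using runs_Assign[of "''ti''" "Reg i" s1] assms(5) i by (simp add: s1_def s2_def)
 have f2: "fr {''tk'', ''ti''} {} s s2" by (simp add: fr_def s1_def s2_def)
 have c2: "ctx Q s2" by (rule ctx_fr[OF assms(1) f2]) auto
 have t2: "regs s2 ''tk'' = c" "regs s2 ''ti'' = k" by (simp_all add: s2_def s1_def)
 obtain s3 where s3: "runs tst (2200 * np) s2 s3" "fr tstR wordA s2 s3"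
  "regs s3 ''zo'' = (if passes (tdec c k) Q then 1 else 0)" "c ~= 1 --> seg s3 ''S'' (regs s3 ''sl'') = SS Q k"
  using tst_spec[of s2] c2 t2 assms(2,4) ctx_Qn[OF c2] unfolding ctx_def goodQ_def by auto
 have c3: "ctx Q s3" by (rule ctx_fr[OF c2 s3(2)]) auto
 have i3: "regs s3 i = k" using fr_reg[OF s3(2) i(3)] assms(5) i assms(6) by (simp add: s2_def s1_def)
 have k3: "regs s3 ''kd'' = regs s ''kd''" "regs s3 ''ix'' = regs s ''ix''"
  using s3(2) by (simp_all add: fr_reg s2_def s1_def)
 define c4 where "c4 = Cond (Less (Reg ''zo'') (Const 1)) (Seq (Assign ''kd'' (Const c)) (Assign ''ix'' (Reg i))) Skip"
 define s4 where "s4 = ev c4 s3"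
 have r4: "runs c4 5 s3 s4" unfolding s4_def by (rule run_ev) (simp_all add: c4_def)
 have f4: "fr {''kd'', ''ix''} {} s3 s4" using runs_fr[OF r4] by (rule fr_mono) (simp_all add: c4_def)
 have c4': "ctx Q s4" by (rule ctx_fr[OF c3 f4]) auto
 have r: "runs (vtest c i) (1 + (1 + (2200 * np + 5))) s s4"
  unfolding vtest_def c4_def[symmetric] by (intro runs_Seq[OF r1] runs_Seq[OF r2] runs_Seq[OF s3(1) r4])
 have k4: "if passes (tdec c k) Q then regs s4 ''kd'' = regs s ''kd'' & regs s4 ''ix'' = regs s ''ix''
   else bad Q (regs s4 ''kd'') (regs s4 ''ix'')"
  using s3(3) k3 i3 i assms(3,4,7) by (auto simp: s4_def c4_def bad_def)
 have "seg s4 ''S'' (regs s4 ''sl'') = seg s3 ''S'' (regs s3 ''sl'')" using f4 by (simp add: fr_reg fr_arr seg_def)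
 hence "c = 2 --> seg s4 ''S'' (regs s4 ''sl'') = SS Q k" using s3(4) by auto
 moreover have "runs (vtest c i) (2210 * np) s s4" by (rule runs_mono[OF r]) simp
 ultimately show ?thesis using c4' k4 by blast
qed

lemma arc_test: "j < m ==> tvalid 1 j & tdec 1 j : tests"
 using AL_nth[of j] by (auto simp: tvalid_def tdec_def tests_def)

lemma zig_test: "v < n ==> tvalid 2 v & tdec 2 v : tests"
 using VG by (auto simp: tvalid_def tdec_def tests_def)

lemma vloop1_spec:
 assumes "ctx Q s" "goodQ Q" "regs s ''kd'' = 0"
 shows "EX s'. runs vloop1 (m * (2210 * np + 2) + 2) s s' & ctx Q s' &
  (regs s' ''kd'' = 0 & (ALL j<m. passes (tdec 1 j) Q) | bad Q (regs s' ''kd'') (regs s' ''ix''))"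
proof -
 let ?c = "vtest 1 ''j1''"
 let ?I = "%k s'. ctx Q s' &
  (regs s' ''kd'' = 0 & (ALL j<k. passes (tdec 1 j) Q) | bad Q (regs s' ''kd'') (regs s' ''ix''))"
 have nw: "''j1'' ~: wR ?c" using wR_vtest[of 1 "''j1''"] by (rule contra_subsetD) simp
 have "EX s'. runs (For ''j1'' (Reg ''m'') ?c) (m * (2210 * np + 2) + 2) s s' & ?I m s' &
   frl ''j1'' ?c s s'"
 proof (rule For_rule[where I = ?I])
  fix s' assume F: "frl ''j1'' ?c s s'"
  have "fr (insert ''j1'' vtR) wordA s s'" by (rule fr_mono[OF F insert_mono[OF wR_vtest] wA_vtest])
  hence "ctx Q s'" by (rule ctx_fr[OF assms(1)]) auto
  thus "aval (Reg ''m'') s' = m" by (simp add: ctx_def env_m)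
 next
  fix k s' assume k: "k < m" "regs s' ''j1'' = k" "?I k s'"
  obtain s'' where s'': "runs ?c (2210 * np) s' s''" "ctx Q s''"
   "if passes (tdec 1 k) Q then regs s'' ''kd'' = regs s' ''kd'' & regs s'' ''ix'' = regs s' ''ix''
    else bad Q (regs s'' ''kd'') (regs s'' ''ix'')"
   using vtest_spec[of Q s' 1 k "''j1''"] k arc_test[OF k(1)] assms(2) by auto
  hence "?I (Suc k) s''" using k(3) by (auto simp: less_Suc_eq split: if_splits)
  thus "EX s''. runs ?c (2210 * np) s' s'' & ?I (Suc k) s''" using s''(1) by blast
 next
  fix k s' v assume "?I k s'"
  moreover have "ctx Q (s'\<lparr>regs := (regs s')(''j1'' := v)\<rparr>)" if "ctx Q s'"
   by (rule ctx_fr[OF that, of "{''j1''}" "{}"]) (auto simp: fr_def)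
  ultimately show "?I k (s'\<lparr>regs := (regs s')(''j1'' := v)\<rparr>)" by simp
 qed (use nw assms in auto)
 thus ?thesis unfolding vloop1_def by blast
qed

definition rows :: "nat list => ram_state => nat => bool" where
 "rows Q s k <-> (ALL v<k. arrs s ''se'' v = length (SS Q v) & (1 < length (SS Q v) --> arrs s ''sec'' v = SS Q v ! 1))"

lemma vloop2_spec:
 assumes "ctx Q s" "goodQ Q" "regs s ''kd'' = 0 & A1 | bad Q (regs s ''kd'') (regs s ''ix'')"
 shows "EX s'. runs vloop2 (n * (2212 * np + 2) + 2) s s' & ctx Q s' & rows Q s' n &
  (regs s' ''kd'' = 0 & A1 & (ALL v<n. passes (tdec 2 v) Q) | bad Q (regs s' ''kd'') (regs s' ''ix''))"
proof -
 let ?d = "Seq (Store ''se'' (Reg ''i1'') (Reg ''sl'')) (Store ''sec'' (Reg ''i1'') (Read ''S'' (Const 1)))"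
 let ?c = "Seq (vtest 2 ''i1'') ?d"
 let ?I = "%k s'. ctx Q s' & rows Q s' k &
  (regs s' ''kd'' = 0 & A1 & (ALL v<k. passes (tdec 2 v) Q) | bad Q (regs s' ''kd'') (regs s' ''ix''))"
 have wR: "wR ?c <= vtR" using wR_vtest by simp
 have wA: "wA ?c <= {''B'', ''S'', ''se'', ''sec''}"
 proof -
  have "wA (vtest 2 ''i1'') <= {''B'', ''S'', ''se'', ''sec''}" by (rule order.trans[OF wA_vtest]) simp
  thus ?thesis by simp
 qed
 have nw: "''i1'' ~: wR ?c" using wR by (rule contra_subsetD) simp
 have "EX s'. runs (For ''i1'' (Reg ''nG'') ?c) (n * (2212 * np + 2) + 2) s s' & ?I n s' &
   frl ''i1'' ?c s s'"
 proof (rule For_rule[where I = ?I])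
  fix s' assume F: "frl ''i1'' ?c s s'"
  have "fr (insert ''i1'' vtR) {''B'', ''S'', ''se'', ''sec''} s s'" by (rule fr_mono[OF F insert_mono[OF wR] wA])
  hence "ctx Q s'" by (rule ctx_fr[OF assms(1)]) auto
  thus "aval (Reg ''nG'') s' = n" by (simp add: ctx_def env_nG)
 next
  fix k s' assume k: "k < n" "regs s' ''i1'' = k" "?I k s'"
  obtain s1 where s1: "runs (vtest 2 ''i1'') (2210 * np) s' s1" "ctx Q s1"
   "if passes (tdec 2 k) Q then regs s1 ''kd'' = regs s' ''kd'' & regs s1 ''ix'' = regs s' ''ix''
    else bad Q (regs s1 ''kd'') (regs s1 ''ix'')" "seg s1 ''S'' (regs s1 ''sl'') = SS Q k"
   using vtest_spec[of Q s' 2 k "''i1''"] k zig_test[OF k(1)] assms(2) by auto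
  have F1: "fr vtR wordA s' s1" by (rule fr_mono[OF runs_fr[OF s1(1)] wR_vtest wA_vtest])
  have i1: "regs s1 ''i1'' = k" using fr_reg[OF F1, of "''i1''"] k by simp
  have rw: "rows Q s1 k" using k(3) fr_arr[OF F1, of "''se''"] fr_arr[OF F1, of "''sec''"] by (simp add: rows_def)
  define s2 where "s2 = ev ?d s1"
  have r2: "runs ?d 2 s1 s2" unfolding s2_def by (rule run_ev) simp_all
  have sl: "regs s1 ''sl'' = length (SS Q k)" using arg_cong[OF s1(4), of length] by simp
  have sec: "arrs s1 ''S'' 1 = SS Q k ! 1" if "1 < length (SS Q k)"
   using that sl s1(4) by (metis nth_seg)
  have "rows Q s2 (Suc k)" using rw sl sec i1 by (simp add: s2_def rows_def less_Suc_eq)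
  moreover have "ctx Q s2"
  proof -
   have "fr {} {''se'', ''sec''} s1 s2" by (rule fr_mono[OF runs_fr[OF r2]]) auto
   thus ?thesis by (rule ctx_fr[OF s1(2)]) auto
  qed
  moreover have "regs s2 = regs s1" by (simp add: s2_def)
  ultimately have "?I (Suc k) s2" using k(3) s1(3) by (auto simp: less_Suc_eq split: if_splits)
  moreover have "runs ?c (2212 * np) s' s2" by (rule runs_mono[OF runs_Seq[OF s1(1) r2]]) simp
  ultimately show "EX s''. runs ?c (2212 * np) s' s'' & ?I (Suc k) s''" by blast
 next
  fix k s' v assume "?I k s'"
  moreover have "ctx Q (s'\<lparr>regs := (regs s')(''i1'' := v)\<rparr>)" if "ctx Q s'"
   by (rule ctx_fr[OF that, of "{''i1''}" "{}"]) (auto simp: fr_def)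
  ultimately show "?I k (s'\<lparr>regs := (regs s')(''i1'' := v)\<rparr>)" by (simp add: rows_def)
 qed (use nw assms in \<open>auto simp: rows_def\<close>)
 thus ?thesis unfolding vloop2_def by blast
qed

text \<open>For adjacent vertices: \<open>v\<close> blocks \<open>u\<close>.\<close>

definition rel :: "nat list => nat => nat => bool" where
 "rel Q u v <-> 1 < length (SS Q u) & al v ~= SS Q u ! 1"

definition FX :: "nat list => nat set => nat set" where
 "FX Q X = {u : {..<n}. EX v:X. adj v u & rel Q u v}"

text \<open>\<open>D\<close> describes the ordered pairs treated so far in the current round. Marks
  are sound at any time, and complete with respect to \<open>D\<close>.\<close>

definition nalI :: "nat list => nat set => (nat \<times> nat => bool) => ram_state => bool" where
 "nalI Q X D s <-> (ALL u<n. (0 < arrs s ''nal'' u --> arrs s ''nx'' u : X & adj (arrs s ''nx'' u) u & rel Q u (arrs s ''nx'' u)) &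
   ((EX v. D (u, v) & v : X & rel Q u v) --> 0 < arrs s ''nal'' u))"

definition aliveX :: "ram_state => nat set" where
 "aliveX s = {v. v < n & 0 < arrs s ''al'' v}"

lemma rows_regs[simp]: "rows Q (s\<lparr>regs := r\<rparr>) k = rows Q s k"
 and aliveX_regs[simp]: "aliveX (s\<lparr>regs := r\<rparr>) = aliveX s"
 and nalI_regs[simp]: "nalI Q X D (s\<lparr>regs := r\<rparr>) = nalI Q X D s"
 by (simp_all add: rows_def aliveX_def nalI_def)

lemma half_ev:
 assumes "env s" "rows Q s n" "regs s u = U" "regs s v = W" "U < n" "W < n" "adj W U" "nalI Q (aliveX s) D s"
 shows "nalI Q (aliveX s) (%e. D e | e = (U, W)) (ev (half u v) s)"
proof -
 have a: "arrs s ''alpha'' W = al W" using assms(1,6) by (simp add: env_def)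
 have r: "arrs s ''se'' U = length (SS Q U)" "1 < length (SS Q U) --> arrs s ''sec'' U = SS Q U ! 1"
  using assms(2,5) by (auto simp: rows_def)
 define g where "g <-> W : aliveX s & rel Q U W"
 have e: "ev (half u v) s = (if g then s\<lparr>arrs := (arrs s)(''nal'' := (arrs s ''nal'')(U := 1), ''nx'' := (arrs s ''nx'')(U := W))\<rparr> else s)"
  using r assms(3,4,6) by (auto simp: half_def g_def rel_def aliveX_def a)
 show ?thesis
 proof (cases g)
  case True
  thus ?thesis using assms(7,8) e unfolding nalI_def g_def by auto
 next
  case False
  thus ?thesis using assms(8) e unfolding nalI_def g_def by auto
 qed
qed

lemma fr_half: "fr {} {''nal'', ''nx''} s (ev (half u v) s)"
 by (rule fr_mono[OF runs_fr[OF runs_ev]]) (simp_all add: half_def)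

lemma pbody_spec:
 assumes "env s" "rows Q s n" "regs s ''j1'' = j" "j < m" "aliveX s = X" "nalI Q X (%e. EX i<j. AL ! i = e | AL ! i = prod.swap e) s"
 shows "EX s'. runs pbody 12 s s' & env s' & rows Q s' n & aliveX s' = X &
  nalI Q X (%e. EX i<Suc j. AL ! i = e | AL ! i = prod.swap e) s'"
proof -
 define u v where "u = fst (AL ! j)" and "v = snd (AL ! j)"
 have uv: "u < n" "v < n" "adj u v" "adj v u" "AL ! j = (u, v)"
  using AL_nth[OF assms(4)] by (auto simp: u_def v_def adj_def)
 define s1 where "s1 = s\<lparr>regs := (regs s)(''pu'' := u, ''pv'' := v)\<rparr>"
 have e1: "ev (Assign ''pv'' (Read ''G_out'' (Reg ''j1''))) (ev (Assign ''pu'' (Read ''EU'' (Reg ''j1''))) s) = s1"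
  using assms(1,3,4) by (simp add: s1_def env_def u_def v_def)
 have st: "env s' & rows Q s' n & aliveX s' = X" if "fr {''pu'', ''pv''} {''nal'', ''nx''} s s'" for s'
 proof -
  have "env s'" by (rule env_fr[OF assms(1) that]) auto
  thus ?thesis using assms(2,5) that by (auto simp: rows_def aliveX_def fr_arr)
 qed
 have f1: "fr {''pu'', ''pv''} {''nal'', ''nx''} s s1" by (simp add: fr_def s1_def)
 note c1 = st[OF f1]
 define s2 where "s2 = ev (half ''pu'' ''pv'') s1"
 have f12: "fr {} {''nal'', ''nx''} s1 s2" unfolding s2_def by (rule fr_half)
 have f2: "fr {''pu'', ''pv''} {''nal'', ''nx''} s s2" by (rule fr_mono[OF fr_trans[OF f1 f12]]) auto
 note c2 = st[OF f2]
 define s3 where "s3 = ev (half ''pv'' ''pu'') s2"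
 have f23: "fr {} {''nal'', ''nx''} s2 s3" unfolding s3_def by (rule fr_half)
 have f3: "fr {''pu'', ''pv''} {''nal'', ''nx''} s s3" by (rule fr_mono[OF fr_trans[OF f2 f23]]) auto
 let ?D = "%e. EX i<j. AL ! i = e | AL ! i = prod.swap e"
 have n1: "nalI Q X ?D s1" using assms(6) by (simp add: nalI_def s1_def)
 have n2: "nalI Q X (%e. ?D e | e = (u, v)) s2"
  using half_ev[of s1 Q "''pu''" u "''pv''" v ?D] c1 uv n1 by (simp add: s2_def s1_def)
 have "regs s2 ''pu'' = u" "regs s2 ''pv'' = v" using f12 by (simp_all add: fr_reg s1_def)
 hence n3: "nalI Q X (%e. (?D e | e = (u, v)) | e = (v, u)) s3"
  using half_ev[of s2 Q "''pv''" v "''pu''" u "%e. ?D e | e = (u, v)"] c2 uv n2 by (simp add: s3_def)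
 have D: "(%e. EX i<Suc j. AL ! i = e | AL ! i = prod.swap e) = (%e. (?D e | e = (u, v)) | e = (v, u))"
  using uv(5) by (auto simp: fun_eq_iff less_Suc_eq prod.swap_def)
 have "ev pbody s = s3" using e1 by (simp add: pbody_def s3_def s2_def del: ev.simps(2))
 moreover have "runs pbody 12 s (ev pbody s)" by (rule run_ev) (simp_all add: pbody_def half_def)
 ultimately have "runs pbody 12 s s3" by simp
 thus ?thesis using n3 st[OF f3] unfolding D by blast
qed

lemma roundc_spec:
 assumes "env s" "rows Q s n"
 shows "EX s'. runs roundc (m * 14 + n * 6 + 10) s s' & env s' & rows Q s' n & aliveX s' = FX Q (aliveX s) &
  (ALL u:aliveX s'. arrs s' ''nx'' u : aliveX s & adj (arrs s' ''nx'' u) u & rel Q u (arrs s' ''nx'' u))"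
proof -
 define X where "X = aliveX s"
 obtain s1 where s1: "runs (fillc ''nal'' (Const 0)) (n * 3 + 2) s s1" "ALL k<n. arrs s1 ''nal'' k = 0"
  using fillc_spec[of s n "''nal''" "Const 0" "%_. 0"] assms env_nG by auto
 have f1: "fr {''i1''} {''nal''} s s1" using runs_fr[OF s1(1)] by simp
 have e1: "env s1" by (rule env_fr[OF assms(1) f1]) auto
 have rw1: "rows Q s1 n" "aliveX s1 = X" using assms(2) f1 by (auto simp: rows_def aliveX_def fr_arr X_def)
 let ?D = "%j e. EX i<j. AL ! i = e | AL ! i = prod.swap e"
 let ?I = "%j s'. env s' & rows Q s' n & aliveX s' = X & nalI Q X (?D j) s'"
 have I0: "?I 0 s1" using e1 rw1 s1(2) by (auto simp: nalI_def)
 have "EX s'. runs (For ''j1'' (Reg ''m'') pbody) (m * (12 + 2) + 2) s1 s' & ?I m s' & frl ''j1'' pbody s1 s'"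
 proof (rule For_rule[where I = ?I, OF _ _ I0])
  fix s' assume F: "frl ''j1'' pbody s1 s'"
  have "env s'" by (rule env_fr[OF e1 F]) auto
  thus "aval (Reg ''m'') s' = m" by (simp add: env_m)
 next
  fix j s' assume "j < m" "regs s' ''j1'' = j" "?I j s'"
  thus "EX s''. runs pbody 12 s' s'' & ?I (Suc j) s''" using pbody_spec[of s' Q j X] by blast
 next
  fix j s' v assume i: "?I j s'"
  have "env (s'\<lparr>regs := (regs s')(''j1'' := v)\<rparr>)"
   by (rule env_fr[of s' "{''j1''}" "{}"]) (use i in \<open>auto simp: fr_def\<close>)
  thus "?I j (s'\<lparr>regs := (regs s')(''j1'' := v)\<rparr>)" using i by (simp add: rows_def aliveX_def nalI_def)
 qed simp
 then obtain s2 where s2: "runs (For ''j1'' (Reg ''m'') pbody) (m * (12 + 2) + 2) s1 s2" "env s2" "rows Q s2 n" "aliveX s2 = X"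
  "nalI Q X (?D m) s2" by blast
 obtain s3 where s3: "runs (fillc ''al'' (Read ''nal'' (Reg ''i1''))) (n * 3 + 2) s2 s3" "ALL k<n. arrs s3 ''al'' k = arrs s2 ''nal'' k"
  using fillc_spec[of s2 n "''al''" "Read ''nal'' (Reg ''i1'')" "arrs s2 ''nal''"] env_nG[OF s2(2)] by (auto simp: fr_arr)
 have f3: "fr {''i1''} {''al''} s2 s3" using runs_fr[OF s3(1)] by simp
 have e3: "env s3" by (rule env_fr[OF s2(2) f3]) auto
 have rw3: "rows Q s3 n" "arrs s3 ''nx'' = arrs s2 ''nx''" using s2(3) f3 by (auto simp: rows_def fr_arr)
 have al3: "u : aliveX s3 <-> u < n & 0 < arrs s2 ''nal'' u" for u using s3(2) by (auto simp: aliveX_def)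
 have D: "?D m (u, v)" if "adj v u" for u v
 proof -
  have "(u, v) : set AL | (v, u) : set AL" using that AL(1) by (auto simp: adj_def)
  thus ?thesis unfolding in_set_conv_nth AL(2) by (auto simp: prod.swap_def)
 qed
 have "aliveX s3 = FX Q X"
 proof (rule set_eqI)
  fix u show "u : aliveX s3 <-> u : FX Q X"
   using s2(5) D unfolding al3 nalI_def FX_def by blast
 qed
 moreover have "ALL u:aliveX s3. arrs s3 ''nx'' u : X & adj (arrs s3 ''nx'' u) u & rel Q u (arrs s3 ''nx'' u)"
  using s2(5) al3 rw3(2) unfolding nalI_def by auto
 moreover have "runs roundc (m * 14 + n * 6 + 10) s s3"
  unfolding roundc_def by (rule runs_mono[OF runs_Seq[OF s1(1) runs_Seq[OF s2(1) s3(1)]]]) simp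
 ultimately show ?thesis using e3 rw3(1) unfolding X_def by blast
qed

lemma peelc_spec:
 assumes "env s" "rows Q s n"
 shows "EX s'. runs peelc (np * (m * 14 + n * 6 + 12) + n * 3 + 4) s s' & env s' & aliveX s' = (FX Q ^^ Suc n) {..<n} &
  (ALL u:aliveX s'. arrs s' ''nx'' u : (FX Q ^^ n) {..<n} & adj (arrs s' ''nx'' u) u & rel Q u (arrs s' ''nx'' u))"
proof -
 obtain s1 where s1: "runs (fillc ''al'' (Const 1)) (n * 3 + 2) s s1" "ALL k<n. arrs s1 ''al'' k = 1"
  using fillc_spec[of s n "''al''" "Const 1" "%_. 1"] assms env_nG by auto
 have f1: "fr {''i1''} {''al''} s s1" using runs_fr[OF s1(1)] by simp
 have e1: "env s1" by (rule env_fr[OF assms(1) f1]) auto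
 have rw1: "rows Q s1 n" "aliveX s1 = {..<n}" using assms(2) f1 s1(2) by (auto simp: rows_def aliveX_def fr_arr)
 let ?I = "%r s'. env s' & rows Q s' n & aliveX s' = (FX Q ^^ r) {..<n} &
  (ALL r'. r = Suc r' --> (ALL u:aliveX s'. arrs s' ''nx'' u : (FX Q ^^ r') {..<n} & adj (arrs s' ''nx'' u) u & rel Q u (arrs s' ''nx'' u)))"
 have "EX s'. runs (For ''r1'' (Reg ''n1'') roundc) (np * ((m * 14 + n * 6 + 10) + 2) + 2) s1 s' & ?I np s' &
   frl ''r1'' roundc s1 s'"
 proof (rule For_rule[where I = ?I])
  fix s' assume F: "frl ''r1'' roundc s1 s'"
  have "env s'" by (rule env_fr[OF e1 F]) auto
  thus "aval (Reg ''n1'') s' = n + 1" by (simp add: env_n1)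
 next
  fix r s' assume i: "?I r s'"
  then obtain s'' where s'': "runs roundc (m * 14 + n * 6 + 10) s' s''" "env s''" "rows Q s'' n" "aliveX s'' = FX Q (aliveX s')"
   "ALL u:aliveX s''. arrs s'' ''nx'' u : aliveX s' & adj (arrs s'' ''nx'' u) u & rel Q u (arrs s'' ''nx'' u)"
   using roundc_spec[of s' Q] by blast
  hence "?I (Suc r) s''" using i by simp
  thus "EX s''. runs roundc (m * 14 + n * 6 + 10) s' s'' & ?I (Suc r) s''" using s''(1) by blast
 next
  fix j s' v assume i: "?I j s'"
  have "env (s'\<lparr>regs := (regs s')(''r1'' := v)\<rparr>)"
   by (rule env_fr[of s' "{''r1''}" "{}"]) (use i in \<open>auto simp: fr_def\<close>)
  thus "?I j (s'\<lparr>regs := (regs s')(''r1'' := v)\<rparr>)" using i by simp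
 qed (use e1 rw1 in auto)
 then obtain s2 where s2: "runs (For ''r1'' (Reg ''n1'') roundc) (np * ((m * 14 + n * 6 + 10) + 2) + 2) s1 s2" "?I np s2" by blast
 have "runs peelc (np * (m * 14 + n * 6 + 12) + n * 3 + 4) s s2"
  unfolding peelc_def by (rule runs_mono[OF runs_Seq[OF s1(1) s2(1)]]) simp
 thus ?thesis using s2(2) by auto
qed

lemma FX_stable: "(FX Q ^^ Suc n) {..<n} = (FX Q ^^ n) {..<n}"
proof -
 have mono: "FX Q X <= FX Q Y" if "X <= Y" for X Y using that by (auto simp: FX_def)
 have "(FX Q ^^ Suc i) {..<n} <= (FX Q ^^ i) {..<n}" for i
 proof (induction i)
  case 0 thus ?case by (auto simp: FX_def)
 next
  case (Suc i) thus ?case using mono[OF Suc] by simp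
 qed
 thus ?thesis using decreasing_stable[of "{..<n}" "%i. (FX Q ^^ i) {..<n}" "FX Q"] by simp
qed

lemma psys_tests:
 "goodQ Q ==> ALL j<m. passes (tdec 1 j) Q ==> ALL v<n. passes (tdec 2 v) Q ==> psys al be2 (SS Q)"
proof -
 assume g: "goodQ Q" and a: "ALL j<m. passes (tdec 1 j) Q" and z: "ALL v<n. passes (tdec 2 v) Q"
 have "arcT u v Q" if "(u, v) : parcs G" for u v
 proof -
  have "(u, v) : set AL" using that AL(1) by simp
  then obtain j where j: "j < m" "AL ! j = (u, v)" unfolding in_set_conv_nth AL(2) by blast
  hence "passes (tdec 1 j) Q" using a by blast
  thus ?thesis using j(2) by (simp add: tdec_def)
 qed
 thus ?thesis using psys_iff[of Q] g z VG by (auto simp: goodQ_def tdec_def)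
qed

definition verdict :: "nat list => ram_state => bool" where
 "verdict Q s <-> (regs s ''kd'' = 0 <-> Real Q) & (regs s ''kd'' ~= 0 --> bad Q (regs s ''kd'') (regs s ''ix''))"

text \<open>The arc and zigzag tests together provide a system of walks. Given that, survivors of
  the peeling exist iff some test at a tight walk fails, and following blockers finds one.\<close>

lemma verify_spec:
 assumes "ctx Q s" "goodQ Q"
 shows "EX s'. runs verify (3000 * (m * np + n * np + n + 1)) s s' & ctx Q s' & fr verR verA s s' & verdict Q s'"
proof -
 define s0 where "s0 = s\<lparr>regs := (regs s)(''kd'' := 0)\<rparr>"
 have r0: "runs (Assign ''kd'' (Const 0)) 1 s s0" using runs_Assign[of "''kd''" "Const 0" s] by (simp add: s0_def)
 have c0: "ctx Q s0" by (rule ctx_fr[OF assms(1), of "{''kd''}" "{}"]) (auto simp: fr_def s0_def)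
 obtain s1 where s1: "runs vloop1 (m * (2210 * np + 2) + 2) s0 s1" "ctx Q s1"
  "regs s1 ''kd'' = 0 & (ALL j<m. passes (tdec 1 j) Q) | bad Q (regs s1 ''kd'') (regs s1 ''ix'')"
  using vloop1_spec[OF c0 assms(2)] by (auto simp: s0_def)
 obtain s2 where s2: "runs vloop2 (n * (2212 * np + 2) + 2) s1 s2" "ctx Q s2" "rows Q s2 n"
  "regs s2 ''kd'' = 0 & (ALL j<m. passes (tdec 1 j) Q) & (ALL v<n. passes (tdec 2 v) Q) | bad Q (regs s2 ''kd'') (regs s2 ''ix'')"
  using vloop2_spec[OF s1(2) assms(2) s1(3)] by blast
 obtain s3 where s3: "runs peelc (np * (m * 14 + n * 6 + 12) + n * 3 + 4) s2 s3" "env s3" "aliveX s3 = (FX Q ^^ Suc n) {..<n}"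
  "ALL u:aliveX s3. arrs s3 ''nx'' u : (FX Q ^^ n) {..<n} & adj (arrs s3 ''nx'' u) u & rel Q u (arrs s3 ''nx'' u)"
  using peelc_spec[OF _ s2(3)] s2(2) by (auto simp: ctx_def)
 have f3: "fr {''i1'', ''r1'', ''j1'', ''pu'', ''pv''} {''al'', ''nal'', ''nx''} s2 s3" using runs_fr[OF s3(1)] by simp
 have c3: "ctx Q s3" by (rule ctx_fr[OF s2(2) f3]) auto
 have k3: "regs s3 ''kd'' = regs s2 ''kd''" "regs s3 ''ix'' = regs s2 ''ix''" using f3 by (simp_all add: fr_reg)
 define U where "U = aliveX s3"
 define nx where "nx = arrs s3 ''nx''"
 have nxU: "nx u : U & adj (nx u) u & rel Q u (nx u)" if "u : U" for u
  using s3(3,4) FX_stable that by (auto simp: U_def nx_def)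
 define s3' where "s3' = s3\<lparr>regs := (regs s3)(''fv'' := 0)\<rparr>"
 have r3': "runs (Assign ''fv'' (Const 0)) 1 s3 s3'" using runs_Assign[of "''fv''" "Const 0" s3] by (simp add: s3'_def)
 let ?c = "Cond (Less (Const 0) (Read ''al'' (Reg ''i1''))) (Assign ''fv'' (Add (Reg ''i1'') (Const 1))) Skip"
 let ?I = "%k s'. (regs s' ''fv'' = 0 & (ALL u<k. u ~: U)) | (0 < regs s' ''fv'' & regs s' ''fv'' - 1 : U)"
 have "EX s'. runs (For ''i1'' (Reg ''nG'') ?c) (n * (3 + 2) + 2) s3' s' & ?I n s' & frl ''i1'' ?c s3' s'"
 proof (rule For_rule[where I = ?I])
  fix s' assume F: "frl ''i1'' ?c s3' s'"
  thus "aval (Reg ''nG'') s' = n" using env_nG[OF s3(2)] by (simp add: fr_reg s3'_def)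
 next
  fix k s' assume k: "k < n" "frl ''i1'' ?c s3' s'" "regs s' ''i1'' = k" "?I k s'"
  have "arrs s' ''al'' = arrs s3 ''al''" using fr_arr[OF k(2)] by (simp add: s3'_def)
  hence "k : U <-> 0 < arrs s' ''al'' k" using k(1) by (simp add: U_def aliveX_def)
  hence "?I (Suc k) (ev ?c s')" using k(3,4) by (auto simp: less_Suc_eq)
  moreover have "runs ?c 3 s' (ev ?c s')" by (rule run_ev) simp_all
  ultimately show "EX s''. runs ?c 3 s' s'' & ?I (Suc k) s''" by blast
 qed (auto simp: s3'_def)
 then obtain s4 where s4: "runs (For ''i1'' (Reg ''nG'') ?c) (n * (3 + 2) + 2) s3' s4" "?I n s4" by blast
 have r4: "runs pickc (1 + (n * (3 + 2) + 2)) s3 s4" unfolding pickc_def by (rule runs_Seq[OF r3' s4(1)])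
 have f4: "fr {''fv'', ''i1''} {} s3 s4" using runs_fr[OF r4] by simp
 have c4: "ctx Q s4" by (rule ctx_fr[OF c3 f4]) auto
 have k4: "regs s4 ''kd'' = regs s2 ''kd''" "regs s4 ''ix'' = regs s2 ''ix''" "arrs s4 ''nx'' = nx"
  using f4 k3 by (simp_all add: fr_reg fr_arr nx_def)
 have fv: "0 < regs s4 ''fv'' <-> U ~= {}" "0 < regs s4 ''fv'' ==> regs s4 ''fv'' - 1 : U"
  using s4(2) by (auto simp: U_def aliveX_def)
 have bQ: "base Q" using assms(2) by (simp add: goodQ_def)
 have nbad: "~ Real Q" if "bad Q k i" for k i using that Real_iff_tests[OF bQ] by (auto simp: bad_def)
 have fin: "EX s5. runs finc (n * 3 + 10) s4 s5 & verdict Q s5"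
 proof (cases "regs s2 ''kd'' = 0 & U ~= {}")
  case False
  have r: "runs finc (Suc 1) s4 s4" unfolding finc_def
   by (rule runs_CondFalse[OF _ runs_Skip]) (use False k4(1) fv in auto)
  have "regs s4 ''kd'' = 0 <-> Real Q"
  proof (cases "regs s2 ''kd'' = 0")
   case True
   hence U: "U = {}" and p: "ALL j<m. passes (tdec 1 j) Q" "ALL v<n. passes (tdec 2 v) Q"
    using False s2(4) by (auto simp: bad_def)
   note ps = psys_tests[OF assms(2) p]
   \<comment> \<open>A violation would start an infinite chain of blockers, all members of which
     survive every round.\<close>
   have "SS Q (w i) = [al (w i)]" if t: "tight al w" for w i
   proof (rule ccontr)
    assume ne: "SS Q (w i) ~= [al (w i)]"
    have "SS Q (w i) ~= []" "hd (SS Q (w i)) = al (w i)" using SS_ends[OF bQ tight_V[OF t]] by auto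
    hence "1 < length (SS Q (w i))" using ne by (cases "SS Q (w i)"; cases "tl (SS Q (w i))") auto
    from tight_chain[OF ps hom_al t this] obtain x where
     x: "!!n. 1 < length (SS Q (x n)) & adj (x (Suc n)) (x n) & al (x (Suc n)) ~= SS Q (x n) ! 1" by blast
    have xn: "x i < n" for i using x[of i] adj_V VG by auto
    have "x i : (FX Q ^^ r) {..<n}" for i r
    proof (induction r arbitrary: i)
     case (Suc r)
     thus ?case using x[of i] xn[of i] by (auto simp: FX_def rel_def)
    qed (use xn in simp)
    have m: "x 0 : (FX Q ^^ np) {..<n}" by fact
    have "U = (FX Q ^^ np) {..<n}" using s3(3) by (simp only: U_def Suc_eq_plus1)
    with m U show False by simp
   qed
   hence "Real Q" using Real_iff[OF bQ] psys_iff[OF bQ] ps by blast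
   thus ?thesis using k4(1) True by simp
  next
   case F: False
   thus ?thesis using s2(4) nbad k4(1) by auto
  qed
  moreover have "regs s4 ''kd'' ~= 0 --> bad Q (regs s4 ''kd'') (regs s4 ''ix'')" using s2(4) k4 by auto
  ultimately have "verdict Q s4" by (simp add: verdict_def)
  thus ?thesis by (intro exI[of _ s4] conjI runs_mono[OF r]) simp_all
 next
  case True
  define w0 where "w0 = regs s4 ''fv'' - 1"
  have w0: "w0 : U" "0 < regs s4 ''fv''" using fv True by (auto simp: w0_def)
  define s5 where "s5 = s4\<lparr>regs := (regs s4)(''x1'' := w0)\<rparr>"
  have r5: "runs (Assign ''x1'' (Sub (Reg ''fv'') (Const 1))) 1 s4 s5"
   using runs_Assign[of "''x1''" "Sub (Reg ''fv'') (Const 1)" s4] by (simp add: s5_def w0_def)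
  let ?b = "Assign ''x1'' (Read ''nx'' (Reg ''x1''))"
  let ?J = "%k s'. regs s' ''x1'' = (nx ^^ k) w0"
  have "EX s'. runs (For ''i1'' (Reg ''nG'') ?b) (n * (1 + 2) + 2) s5 s' & ?J n s' & frl ''i1'' ?b s5 s'"
  proof (rule For_rule[where I = ?J])
   fix s' assume F: "frl ''i1'' ?b s5 s'"
   thus "aval (Reg ''nG'') s' = n" using c4 by (simp add: fr_reg s5_def ctx_def env_nG)
  next
   fix k s' assume k: "frl ''i1'' ?b s5 s'" "?J k s'"
   have "arrs s' ''nx'' = nx" using fr_arr[OF k(1)] k4(3) by (simp add: s5_def)
   hence "?J (Suc k) (ev ?b s')" using k(2) by simp
   moreover have "runs ?b 1 s' (ev ?b s')" by (rule run_ev) simp_all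
   ultimately show "EX s''. runs ?b 1 s' s'' & ?J (Suc k) s''" by blast
  qed (auto simp: s5_def)
  then obtain s6 where s6: "runs (For ''i1'' (Reg ''nG'') ?b) (n * (1 + 2) + 2) s5 s6" "?J n s6" by blast
  let ?d = "Seq (Assign ''kd'' (Const 3)) (Assign ''ix'' (Reg ''x1''))"
  define s7 where "s7 = ev ?d s6"
  have r7: "runs ?d 2 s6 s7" unfolding s7_def by (rule run_ev) simp_all
  have k7: "regs s7 ''kd'' = 3" "regs s7 ''ix'' = (nx ^^ n) w0" using s6(2) by (simp_all add: s7_def)
  have p: "ALL j<m. passes (tdec 1 j) Q" "ALL v<n. passes (tdec 2 v) Q"
   using True s2(4) by (auto simp: bad_def)
  note ps = psys_tests[OF assms(2) p]
  have UV: "U <= {v : pverts G. 1 < length (SS Q v)}" using nxU VG by (auto simp: U_def aliveX_def rel_def)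
  have "card U <= n" using card_mono[of "{..<n}" U] by (auto simp: U_def aliveX_def)
  then obtain w where w: "tight al w" "w 0 = (nx ^^ n) w0"
   using orbit_tight[OF ps hom_al UV w0(1), of n nx] nxU by (auto simp: rel_def)
  have "(nx ^^ k) w0 : U" for k by (induction k) (use w0 nxU in auto)
  hence wU: "(nx ^^ n) w0 : U" .
  \<comment> \<open>The vertex reached after \<open>n\<close> steps lies on the cycle of
    \<open>nx\<close>, which \<open>orbit_tight\<close> turns into a tight walk; as a survivor it
    has a nontrivial walk.\<close>
  have "bad Q 3 ((nx ^^ n) w0)"
   unfolding bad_def
  proof (intro conjI)
   show "tvalid 3 ((nx ^^ n) w0)" using wU by (simp add: tvalid_def U_def aliveX_def)
   show "tdec 3 ((nx ^^ n) w0) : tests" using w by (auto simp: tdec_def tests_def) (metis w(2))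
   show "~ passes (tdec 3 ((nx ^^ n) w0)) Q" using wU UV by (auto simp: tdec_def)
  qed simp
  hence A: "verdict Q s7" using k7 nbad by (auto simp: verdict_def)
  have "runs finc (Suc (1 + ((n * (1 + 2) + 2) + 2))) s4 s7" unfolding finc_def
   by (rule runs_CondTrue[OF _ runs_Seq[OF r5 runs_Seq[OF s6(1) r7]]]) (use True w0 k4(1) in auto)
  hence "runs finc (n * 3 + 10) s4 s7" by (rule runs_mono) simp
  with A show ?thesis by blast
 qed
 then obtain s5 where s5: "runs finc (n * 3 + 10) s4 s5" "verdict Q s5" by blast
 have r: "runs verify (1 + ((m * (2210 * np + 2) + 2) + ((n * (2212 * np + 2) + 2) +
   ((np * (m * 14 + n * 6 + 12) + n * 3 + 4) + ((1 + (n * (3 + 2) + 2)) + (n * 3 + 10)))))) s s5"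
  unfolding verify_def by (intro runs_Seq[OF r0] runs_Seq[OF s1(1)] runs_Seq[OF s2(1)] runs_Seq[OF s3(1)] runs_Seq[OF r4 s5(1)])
 have f: "fr verR verA s s5" by (rule fr_mono[OF runs_fr[OF r] wR_verify wA_verify])
 have "ctx Q s5" by (rule ctx_fr[OF assms(1) f]) auto
 moreover have "runs verify (3000 * (m * np + n * np + n + 1)) s s5"
  by (rule runs_mono[OF r]) (simp add: algebra_simps)
 ultimately show ?thesis using f s5(2) by blast
qed

end

section \<open>Trivial cycles: the program\<close>

lemma steps_map: "steps xs = map (%i. (xs ! i, xs ! Suc i)) [0..<length xs - 1]"
 by (rule nth_equalityI) (auto simp: steps_def nth_tl)

lemma output_steps:
 assumes "seg s X l = xs" "xs ~= []" "regs s X = l - 1"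
 shows "output_walk s X = steps xs"
proof -
 have l: "l = length xs" using arg_cong[OF assms(1), of length] by simp
 have "arrs s X i = xs ! i" if "i < length xs" for i using nth_seg[of i l s X] that assms(1) l by metis
 thus ?thesis unfolding output_walk_def steps_map assms(3) l by simp
qed

definition eOff :: "string => string => string => aexp \<times> aexp" where
 "eOff A a l = (Read A (Add (Reg a) (Reg ''j'')), Reg l)"

definition eBack :: "string => string => string => aexp \<times> aexp" where
 "eBack A z l = (Read A (Sub (Reg z) (Reg ''j'')), Reg l)"

lemma emitted_eOff:
 "A ~= ''B'' ==> l ~: {''j'', ''bl''} ==> a ~: {''j'', ''bl''} ==>
  emitted s (eOff A a l) (map (%j. arrs s A (regs s a + j)) [0..<regs s l])"
 by (auto simp: emitted_def eOff_def fr_reg fr_arr)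

lemma emitted_eBack:
 "A ~= ''B'' ==> l ~: {''j'', ''bl''} ==> a ~: {''j'', ''bl''} ==>
  emitted s (eBack A a l) (map (%j. arrs s A (regs s a - j)) [0..<regs s l])"
 by (auto simp: emitted_def eBack_def fr_reg fr_arr)

text \<open>Reduces the image of the tree path read from the root and measures its zigzag prefix. At
  a vertex with arcs in both directions this prefix is \<open>pre BB\<close>.\<close>

definition dnz :: "string => com" where
 "dnz a = Seq (word [eDn a ''zv'']) zigt"

abbreviation "dnzR \<equiv> {''bl'', ''j'', ''sl'', ''k'', ''x'', ''a'', ''b'', ''zk'', ''p'', ''i2''}"

lemma wR_dnz: "wR (dnz a) <= dnzR" and wA_dnz: "wA (dnz a) <= wordA"
proof -
 have "wR (word [eDn a ''zv'']) <= dnzR" by (rule order.trans[OF wR_word]) simp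
 thus "wR (dnz a) <= dnzR" by (simp add: dnz_def)
 show "wA (dnz a) <= wordA" using wA_word by (simp add: dnz_def)
qed

text \<open>\<open>bd\<close> holds the offending vertex plus one, so that 0 means that there is
  none.\<close>

definition chk :: "string => com" where
 "chk a = Seq (dnz a) (Cond (Less (Reg ''zk'') (Reg ''sl'')) (Assign ''bd'' (Add (Reg ''zv'') (Const 1))) Skip)"

definition abody :: com where
 "abody = Cond (Conj (Less (Read ''G_out_off'' (Reg ''i3'')) (Read ''G_out_off'' (Add (Reg ''i3'') (Const 1))))
           (Less (Read ''G_in_off'' (Reg ''i3'')) (Read ''G_in_off'' (Add (Reg ''i3'') (Const 1)))))
   (Seq (Assign ''zv'' (Reg ''i3'')) (Seq (chk ''alpha'') (chk ''beta''))) Skip"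

abbreviation "loadQ A l \<equiv> cpy ''Q'' ''Qn'' A l"

definition fin2 :: com where
 "fin2 = Cond (Less (Reg ''kd'') (Const 1))
   (Seq (Assign ''Q'' (Sub (Reg ''Qn'') (Const 1))) (Assign ''case'' (Const 2))) (Assign ''case'' (Const 1))"

text \<open>An offending vertex leaves only the candidate of \<open>Real_bad\<close>, which is
  assembled from the two prefixes and verified.\<close>

definition caseA :: com where
 "caseA = Seq (Assign ''bd'' (Const 0)) (Seq (For ''i3'' (Reg ''nG'') abody)
   (Cond (Less (Reg ''bd'') (Const 1)) (Assign ''case'' (Const 4))
    (Seq (Assign ''zv'' (Sub (Reg ''bd'') (Const 1)))
    (Seq (dnz ''alpha'') (Seq (cpy ''P1'' ''p1'' ''S'' ''zk'')
    (Seq (dnz ''beta'') (Seq (cpy ''P2'' ''p2'' ''S'' ''zk'')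
    (Seq (word [eSeg ''P1'' ''p1'', eRev ''P2'' ''p2'']) (Seq (loadQ ''S'' ''sl'') (Seq verify fin2))))))))))"

section \<open>Correctness for trivial cycles\<close>

context prg
begin

definition outcome :: "ram_state => bool" where
 "outcome s <-> (let W = realizable_walks G H al be2 q in
   regs s ''case'' = 1 & W = {} |
   regs s ''case'' = 2 & W = {output_walk s ''Q''} |
   regs s ''case'' = 3 & output_walk s ''R'' : pi_hom H (al q) (al q) & output_walk s ''P'' : pi_hom H (al q) (be2 q) &
    W = power_walks H (al q) (be2 q) (output_walk s ''R'') (output_walk s ''P'') |
   regs s ''case'' = 4 & zigzag_walks G H al be2 q <= W)"

definition Vb :: nat where "Vb = 3000 * (m * np + n * np + n + 1)"

lemma outcome_1: "regs s ''case'' = 1 ==> (!!Q. ~ Real Q) ==> outcome s"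
 by (simp add: outcome_def realizable_walks_eq)

lemma outcome_2:
 assumes "regs s ''case'' = 2" "Real (Qs s)" "regs s ''Q'' = regs s ''Qn'' - 1" "!!Q. Real Q ==> Q = Qs s"
 shows "outcome s"
proof -
 have "Qs s ~= []" using Real_base[OF assms(2)] by (simp add: base_def)
 hence "output_walk s ''Q'' = steps (Qs s)" using output_steps[of s "''Q''" "regs s ''Qn''" "Qs s"] assms(3) by (simp add: Qs_def)
 moreover have "{Q. Real Q} = {Qs s}" using assms(2,4) by blast
 ultimately show ?thesis using assms(1) by (simp add: outcome_def realizable_walks_eq)
qed

text \<open>Once a candidate is known to be the only one, its verification decides between the first two cases.\<close>

lemma fin2_spec:
 assumes "ctx Q s" "goodQ Q" "!!Q'. Real Q' ==> Q' = Q"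
 shows "EX s'. runs (Seq verify fin2) (Vb + 5) s s' & outcome s'"
proof -
 obtain s1 where s1: "runs verify Vb s s1" "ctx Q s1" "verdict Q s1"
  using verify_spec[OF assms(1,2)] unfolding Vb_def by blast
 have v1: "regs s1 ''kd'' = 0 <-> Real Q" using s1(3) by (simp add: verdict_def)
 define s2 where "s2 = ev fin2 s1"
 have r2: "runs fin2 5 s1 s2" unfolding s2_def by (rule run_ev) (simp_all add: fin2_def)
 have "outcome s2"
 proof (cases "Real Q")
  case True
  have "Qs s2 = Q" "regs s2 ''case'' = 2" "regs s2 ''Q'' = regs s2 ''Qn'' - 1"
   using s1(2) v1 True by (simp_all add: s2_def fin2_def ctx_def Qs_def)
  thus ?thesis using True by (intro outcome_2) (simp_all, rule assms(3))
 next
  case False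
  have "regs s2 ''case'' = 1" using v1 False by (simp add: s2_def fin2_def)
  thus ?thesis using outcome_1[of s2] assms(3) False by blast
 qed
 thus ?thesis using runs_Seq[OF s1(1) r2] by blast
qed

lemma dnz_spec:
 assumes "env s" "colors a f" "regs s ''zv'' = v" "v < n"
 shows "EX s'. runs (dnz a) (60 * np) s s' & fr dnzR wordA s s' & seg s' ''S'' (regs s' ''sl'') = down f v &
  zlen (EE v) (down f v) (regs s' ''zk'')"
proof -
 have e: "list_all2 (emitted s) [eDn a ''zv''] [map f (rev (up v))]"
  using emitted_eDn[OF assms(1,2), of "''zv''"] assms(3,4) by simp
 have l: "length (concat [map f (rev (up v))]) <= n + 1" using up_length[OF assms(4)] by simp
 obtain s1 where s1: "runs (word [eDn a ''zv'']) (np * 16 + 25) s s1" "seg s1 ''S'' (regs s1 ''sl'') = down f v" "fr wordR wordA s s1"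
  using word_spec[OF e l] by (auto simp: down_def)
 have e1: "env s1" by (rule env_fr[OF assms(1) s1(3)]) auto
 have d: "down f v ~= []" using down_props[of v f] assms(4) VG by simp
 have sl: "regs s1 ''sl'' = length (down f v)" using arg_cong[OF s1(2), of length] by simp
 have dl: "length (down f v) <= n + 1" using length_nf[of "map f (rev (up v))"] up_length[OF assms(4)] by (simp add: down_def)
 have "set (down f v) <= set (map f (rev (up v)))" unfolding down_def by (rule set_nf)
 also have "\<dots> <= {..<nH}" using up_V[OF assms(4)] alpha_nH beta_nH assms(2) by (auto simp: colors_def dest!: subsetD)
 finally have dH: "set (down f v) <= {..<nH}" .
 have zv: "regs s1 ''zv'' = v" using s1(3) assms(3) by (simp add: fr_reg)
 obtain s2 where s2: "runs zigt (np * 12 + 4) s1 s2" "zlen (EE v) (down f v) (regs s2 ''zk'')" "fr {''a'', ''b'', ''zk'', ''p'', ''i2''} {} s1 s2"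
  using zigt_spec[OF e1 zv assms(4), of "n + 1"] s1(2) dH d dl sl by auto
 have r: "runs (dnz a) ((np * 16 + 25) + (np * 12 + 4)) s s2" unfolding dnz_def by (rule runs_Seq[OF s1(1) s2(1)])
 have "seg s2 ''S'' (regs s2 ''sl'') = down f v" using s1(2) s2(3) by (simp add: fr_reg fr_arr seg_def)
 thus ?thesis using s2(2) fr_mono[OF runs_fr[OF r] wR_dnz wA_dnz]
  by (intro exI[of _ s2] conjI runs_mono[OF r]) auto
qed

lemma zlen_bi:
 assumes "bi v" "zlen (EE v) xs k"
 shows "k = length xs <-> successively BB xs" "pre BB xs = take k xs" "k <= length xs"
 using zlen_zz[OF assms(2)] zlen_pre[of BB xs k] assms(2) zz_sym[of BB] BB_sym unfolding EE_bi[OF assms(1)]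
 by (auto simp: zlen_def)

lemma chk_spec:
 assumes "env s" "colors a f" "regs s ''zv'' = v" "v < n" "bi v"
 shows "EX s'. runs (chk a) (70 * np) s s' & fr (insert ''bd'' dnzR) wordA s s' &
  regs s' ''bd'' = (if successively BB (down f v) then regs s ''bd'' else v + 1)"
proof -
 obtain s1 where s1: "runs (dnz a) (60 * np) s s1" "fr dnzR wordA s s1" "seg s1 ''S'' (regs s1 ''sl'') = down f v"
  "zlen (EE v) (down f v) (regs s1 ''zk'')" using dnz_spec[OF assms(1-4)] by blast
 have sl: "regs s1 ''sl'' = length (down f v)" using arg_cong[OF s1(3), of length] by simp
 have k: "regs s1 ''zv'' = v" "regs s1 ''bd'' = regs s ''bd''" using s1(2) assms(3) by (simp_all add: fr_reg)
 let ?c = "Cond (Less (Reg ''zk'') (Reg ''sl'')) (Assign ''bd'' (Add (Reg ''zv'') (Const 1))) Skip"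
 have r2: "runs ?c 3 s1 (ev ?c s1)" by (rule run_ev) simp_all
 have r: "runs (chk a) (60 * np + 3) s (ev ?c s1)" unfolding chk_def by (rule runs_Seq[OF s1(1) r2])
 have f2: "fr {''bd''} {} s1 (ev ?c s1)" using runs_fr[OF r2] by simp
 have "fr (insert ''bd'' dnzR) wordA s (ev ?c s1)" by (rule fr_mono[OF fr_trans[OF s1(2) f2]]) auto
 moreover have "regs (ev ?c s1) ''bd'' = (if successively BB (down f v) then regs s ''bd'' else v + 1)"
  using zlen_bi[OF assms(5) s1(4)] sl k by auto
 ultimately show ?thesis by (intro exI[of _ "ev ?c s1"] conjI runs_mono[OF r]) auto
qed

definition okv :: "nat => bool" where
 "okv v <-> (bi v --> successively BB (down al v) & successively BB (down be2 v))"

lemma aloop_spec: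
 assumes "env s" "regs s ''bd'' = 0"
 shows "EX s'. runs (For ''i3'' (Reg ''nG'') abody) (n * (150 * np) + 2) s s' & env s' &
  (regs s' ''bd'' = 0 & (ALL v<n. okv v) | 0 < regs s' ''bd'' & regs s' ''bd'' - 1 < n & ~ okv (regs s' ''bd'' - 1))"
proof -
 let ?I = "%k s'. env s' & (regs s' ''bd'' = 0 & (ALL v<k. okv v) |
   0 < regs s' ''bd'' & regs s' ''bd'' - 1 < n & ~ okv (regs s' ''bd'' - 1))"
 have wc: "wR (chk a) <= insert ''bd'' dnzR" "wA (chk a) <= wordA" for a
 proof -
  have "wR (dnz a) <= insert ''bd'' dnzR" by (rule order.trans[OF wR_dnz]) auto
  thus "wR (chk a) <= insert ''bd'' dnzR" by (simp add: chk_def)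
  show "wA (chk a) <= wordA" using wA_dnz by (simp add: chk_def)
 qed
 have wR: "wR abody <= insert ''zv'' (insert ''bd'' dnzR)" "wA abody <= wordA"
 proof -
  have "wR (chk a) <= insert ''zv'' (insert ''bd'' dnzR)" for a by (rule order.trans[OF wc(1)]) auto
  thus "wR abody <= insert ''zv'' (insert ''bd'' dnzR)" by (simp add: abody_def)
  show "wA abody <= wordA" using wc(2) by (simp add: abody_def)
 qed
 have nw: "''i3'' ~: wR abody" using wR(1) by (rule contra_subsetD) simp
 have "EX s'. runs (For ''i3'' (Reg ''nG'') abody) (n * (145 * np + 2) + 2) s s' & ?I n s' & frl ''i3'' abody s s'"
 proof (rule For_rule[where I = ?I])
  fix s' assume F: "frl ''i3'' abody s s'"
  have "env s'" by (rule env_fr[OF assms(1) fr_mono[OF F insert_mono[OF wR(1)] wR(2)]]) auto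
  thus "aval (Reg ''nG'') s' = n" by (simp add: env_nG)
 next
  fix k s' assume k: "k < n" "regs s' ''i3'' = k" "?I k s'"
  have b: "bval (Conj (Less (Read ''G_out_off'' (Reg ''i3'')) (Read ''G_out_off'' (Add (Reg ''i3'') (Const 1))))
           (Less (Read ''G_in_off'' (Reg ''i3'')) (Read ''G_in_off'' (Add (Reg ''i3'') (Const 1))))) s' <-> bi k"
   using k by (auto simp: bi_def env_def)
  show "EX s''. runs abody (145 * np) s' s'' & ?I (Suc k) s''"
  proof (cases "bi k")
   case False
   have "runs abody (Suc 1) s' s'" unfolding abody_def using b False by (intro runs_CondFalse runs_Skip) simp
   moreover have "?I (Suc k) s'" using k(3) False by (auto simp: less_Suc_eq okv_def)
   ultimately show ?thesis by (auto intro!: exI[of _ s'] elim: runs_mono)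
  next
   case True
   define s1 where "s1 = s'\<lparr>regs := (regs s')(''zv'' := k)\<rparr>"
   have r1: "runs (Assign ''zv'' (Reg ''i3'')) 1 s' s1" using runs_Assign[of "''zv''" "Reg ''i3''" s'] k by (simp add: s1_def)
   have e1: "env s1" by (rule env_fr[of s' "{''zv''}" "{}"]) (use k in \<open>auto simp: fr_def s1_def\<close>)
   have k1: "regs s1 ''zv'' = k" "regs s1 ''bd'' = regs s' ''bd''" by (simp_all add: s1_def)
   obtain s2 where s2: "runs (chk ''alpha'') (70 * np) s1 s2" "fr (insert ''bd'' dnzR) wordA s1 s2"
    "regs s2 ''bd'' = (if successively BB (down al k) then regs s1 ''bd'' else k + 1)"
    using chk_spec[OF e1 colors_simps(1) k1(1) k(1) True] by blast
   have e2: "env s2" by (rule env_fr[OF e1 s2(2)]) auto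
   have k2: "regs s2 ''zv'' = k" using s2(2) k1 by (simp add: fr_reg)
   obtain s3 where s3: "runs (chk ''beta'') (70 * np) s2 s3" "fr (insert ''bd'' dnzR) wordA s2 s3"
    "regs s3 ''bd'' = (if successively BB (down be2 k) then regs s2 ''bd'' else k + 1)"
    using chk_spec[OF e2 colors_simps(2) k2 k(1) True] by blast
   have e3: "env s3" by (rule env_fr[OF e2 s3(2)]) auto
   have r: "runs abody (Suc (1 + (70 * np + 70 * np))) s' s3"
    unfolding abody_def using b True by (intro runs_CondTrue runs_Seq[OF r1] runs_Seq[OF s2(1) s3(1)]) simp
   have "?I (Suc k) s3"
    using k(1,3) e3 s3(3) s2(3) k1(2) True
    by (cases "successively BB (down al k)"; cases "successively BB (down be2 k)") (auto simp: less_Suc_eq okv_def)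
   thus ?thesis by (intro exI[of _ s3] conjI runs_mono[OF r]) auto
  qed
 next
  fix j s' v assume i: "?I j s'"
  have "env (s'\<lparr>regs := (regs s')(''i3'' := v)\<rparr>)"
   by (rule env_fr[of s' "{''i3''}" "{}"]) (use i in \<open>auto simp: fr_def\<close>)
  thus "?I j (s'\<lparr>regs := (regs s')(''i3'' := v)\<rparr>)" using i by simp
 qed (use nw assms in auto)
 then obtain s' where s': "runs (For ''i3'' (Reg ''nG'') abody) (n * (145 * np + 2) + 2) s s'" "?I n s'" by blast
 have "n * (145 * np + 2) + 2 <= n * (150 * np) + 2" by simp
 thus ?thesis using s'(2) runs_mono[OF s'(1)] by blast
qed

text \<open>Step \<open>i\<close> joins positions \<open>i\<close> and \<open>i + 1\<close> of the
  vertex list, so the two orientations required by \<open>zigzag\<close> are the two halves of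
  \<open>EE\<close>.\<close>

lemma zigzag_walks_steps:
 assumes "w : zigzag_walks G H al be2 q"
 shows "EX Q. w = steps Q & base Q & zo (EE q) Q"
proof -
 have w: "w : pi_hom H (al q) (be2 q)" "even (length w)" "zigzag G H q w" using assms by (auto simp: zigzag_walks_def)
 obtain xs where xs: "w = steps xs" "xs ~= []" "hd xs = al q" "last xs = be2 q" "red xs" "xs = vl (al q) w"
  by (rule pi_homE[OF w(1)]) blast
 have l: "length w = length xs - 1" using xs(1) by (simp add: steps_map)
 have nth: "w ! i = (xs ! i, xs ! Suc i)" if "Suc i < length xs" for i
 proof -
  have "i < length xs - 1" using that by simp
  thus ?thesis by (simp add: xs(1) steps_map)
 qed
 have "okz (EE q) xs i" if "Suc i < length xs" for i
 proof -
  have "i < length w" using that l by simp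
  thus ?thesis using w(3) nth[OF that] unfolding zigzag_def okz_def EE_def by (auto split: if_splits)
 qed
 hence "zz (EE q) True xs" by (simp add: zz_nth okz_def)
 moreover have "odd (length xs)" using w(2) l xs(2) by (cases xs) auto
 ultimately show ?thesis using xs(1-5) by (auto simp: zo_def base_def)
qed

lemma caseA_spec:
 assumes "env s" "trivial_arcs al" "trivial_arcs be2" "!!v. bi v ==> bi q"
 shows "EX s'. runs caseA (Vb + 160 * n * np + 300 * np) s s' & outcome s'"
proof -
 define s0 where "s0 = s\<lparr>regs := (regs s)(''bd'' := 0)\<rparr>"
 have r0: "runs (Assign ''bd'' (Const 0)) 1 s s0" using runs_Assign[of "''bd''" "Const 0" s] by (simp add: s0_def)
 have e0: "env s0" by (rule env_fr[OF assms(1), of "{''bd''}" "{}"]) (auto simp: fr_def s0_def)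
 obtain s1 where s1: "runs (For ''i3'' (Reg ''nG'') abody) (n * (150 * np) + 2) s0 s1" "env s1"
  "regs s1 ''bd'' = 0 & (ALL v<n. okv v) | 0 < regs s1 ''bd'' & regs s1 ''bd'' - 1 < n & ~ okv (regs s1 ''bd'' - 1)"
  using aloop_spec[OF e0] by (auto simp: s0_def)
 show ?thesis
 proof (cases "regs s1 ''bd'' = 0")
  case True
  let ?c = "Assign ''case'' (Const 4)"
  define s2 where "s2 = s1\<lparr>regs := (regs s1)(''case'' := 4)\<rparr>"
  have r2: "runs ?c 1 s1 s2" using runs_Assign[of "''case''" "Const 4" s1] by (simp add: s2_def)
  have r: "runs caseA (1 + ((n * (150 * np) + 2) + Suc 1)) s s2"
   unfolding caseA_def by (rule runs_Seq[OF r0 runs_Seq[OF s1(1) runs_CondTrue[OF _ r2]]]) (use True in simp)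
  have ok: "ALL v<n. okv v" using s1(3) True by auto
  have "zigzag_walks G H al be2 q <= steps ` {Q. Real Q}"
  proof
   fix w assume "w : zigzag_walks G H al be2 q"
   then obtain Q where Q: "w = steps Q" "base Q" "zo (EE q) Q" using zigzag_walks_steps by blast
   have "Real Q" by (rule all_zigzag[OF Q(2,3) assms(2-4)]) (use ok VG in \<open>auto simp: okv_def\<close>)
   thus "w : steps ` {Q. Real Q}" using Q(1) by blast
  qed
  hence "outcome s2" by (simp add: outcome_def realizable_walks_eq s2_def)
  thus ?thesis by (intro exI[of _ s2] conjI runs_mono[OF r]) (simp_all add: algebra_simps)
 next
  case False
  define v where "v = regs s1 ''bd'' - 1"
  have v: "v < n" "~ okv v" using s1(3) False by (auto simp: v_def)
  hence bv: "bi v" and bad: "~ (successively BB (down al v) & successively BB (down be2 v))" by (auto simp: okv_def)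
  have vV: "v : pverts G" using v VG by simp
  define s2 where "s2 = s1\<lparr>regs := (regs s1)(''zv'' := v)\<rparr>"
  have r2: "runs (Assign ''zv'' (Sub (Reg ''bd'') (Const 1))) 1 s1 s2"
   using runs_Assign[of "''zv''" "Sub (Reg ''bd'') (Const 1)" s1] by (simp add: s2_def v_def)
  have e2: "env s2" by (rule env_fr[OF s1(2), of "{''zv''}" "{}"]) (auto simp: fr_def s2_def)
  have z2: "regs s2 ''zv'' = v" by (simp add: s2_def)
  obtain s3 where s3: "runs (dnz ''alpha'') (60 * np) s2 s3" "fr dnzR wordA s2 s3" "seg s3 ''S'' (regs s3 ''sl'') = down al v"
   "zlen (EE v) (down al v) (regs s3 ''zk'')" using dnz_spec[OF e2 colors_simps(1) z2 v(1)] by blast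
  have dl: "length (down f v) <= n + 1" for f
   using length_nf[of "map f (rev (up v))"] up_length[OF v(1)] by (simp add: down_def)
  have segk: "seg t ''S'' (regs t ''zk'') = pre BB (down f v)" "regs t ''zk'' <= n + 1"
   if "seg t ''S'' (regs t ''sl'') = down f v" "zlen (EE v) (down f v) (regs t ''zk'')" for t f
  proof -
   have a: "regs t ''sl'' = length (down f v)" using arg_cong[OF that(1), of length] by simp
   have b: "regs t ''zk'' <= regs t ''sl''" using zlen_bi(3)[OF bv that(2)] a by simp
   have "seg t ''S'' (regs t ''zk'') = take (regs t ''zk'') (seg t ''S'' (regs t ''sl''))" by (rule seg_take[OF b])
   thus "seg t ''S'' (regs t ''zk'') = pre BB (down f v)" using that(1) zlen_bi(2)[OF bv that(2)] by (simp only:)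
   show "regs t ''zk'' <= n + 1" using b a dl[of f] by simp
  qed
  obtain s4 where s4: "runs (cpy ''P1'' ''p1'' ''S'' ''zk'') (np * 4 + 3) s3 s4"
   "seg s4 ''P1'' (regs s4 ''p1'') = pre BB (down al v)" "fr {''p1'', ''j''} {''P1''} s3 s4"
   using cpy_spec[of "''P1''" "''S''" "''p1''" "''zk''" s3 "n + 1"] segk[OF s3(3,4)] by auto
  have f24: "fr (insert ''p1'' dnzR) (insert ''P1'' wordA) s2 s4" by (rule fr_mono[OF fr_trans[OF s3(2) s4(3)]]) auto
  have e4: "env s4" by (rule env_fr[OF e2 f24]) auto
  have z4: "regs s4 ''zv'' = v" using f24 z2 by (simp add: fr_reg)
  obtain s5 where s5: "runs (dnz ''beta'') (60 * np) s4 s5" "fr dnzR wordA s4 s5" "seg s5 ''S'' (regs s5 ''sl'') = down be2 v"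
   "zlen (EE v) (down be2 v) (regs s5 ''zk'')" using dnz_spec[OF e4 colors_simps(2) z4 v(1)] by blast
  obtain s6 where s6: "runs (cpy ''P2'' ''p2'' ''S'' ''zk'') (np * 4 + 3) s5 s6"
   "seg s6 ''P2'' (regs s6 ''p2'') = pre BB (down be2 v)" "fr {''p2'', ''j''} {''P2''} s5 s6"
   using cpy_spec[of "''P2''" "''S''" "''p2''" "''zk''" s5 "n + 1"] segk[OF s5(3,4)] by auto
  have f46: "fr (insert ''p2'' dnzR) (insert ''P2'' wordA) s4 s6" by (rule fr_mono[OF fr_trans[OF s5(2) s6(3)]]) auto
  have e6: "env s6" by (rule env_fr[OF e4 f46]) auto
  have P1: "seg s6 ''P1'' (regs s6 ''p1'') = pre BB (down al v)" using s4(2) f46 by (simp add: fr_reg fr_arr seg_def)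
  define A B where "A = pre BB (down al v)" and "B = pre BB (down be2 v)"
  have AB: "A ~= []" "B ~= []" "hd A = al q" "hd B = be2 q" "length A <= n + 1" "length B <= n + 1"
   using down_props[OF vV] segk[OF s3(3,4)] segk[OF s5(3,4)] length_seg unfolding A_def B_def by (simp_all, metis+)
  have em: "list_all2 (emitted s6) [eSeg ''P1'' ''p1'', eRev ''P2'' ''p2''] [A, rev B]"
   using emitted_eSeg[of "''P1''" "''p1''" s6] emitted_eRev[of "''P2''" "''p2''" s6] P1 s6(2) by (simp add: A_def B_def)
  obtain s7 where s7: "runs (word [eSeg ''P1'' ''p1'', eRev ''P2'' ''p2'']) ((2 * np) * 16 + 25) s6 s7"
   "seg s7 ''S'' (regs s7 ''sl'') = nf (A @ rev B)" "fr wordR wordA s6 s7"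
   using word_spec[OF em, of "2 * np"] AB by auto
  have e7: "env s7" by (rule env_fr[OF e6 s7(3)]) auto
  define Q where "Q = nf (A @ rev B)"
  have Ql: "length Q <= 2 * np" using length_nf[of "A @ rev B"] AB by (simp add: Q_def)
  have sl7: "regs s7 ''sl'' = length Q" using arg_cong[OF s7(2), of length] by (simp add: Q_def)
  obtain s8 where s8: "runs (loadQ ''S'' ''sl'') ((2 * np) * 4 + 3) s7 s8" "seg s8 ''Q'' (regs s8 ''Qn'') = Q" "fr {''Qn'', ''j''} {''Q''} s7 s8"
   using cpy_spec[of "''Q''" "''S''" "''Qn''" "''sl''" s7 "2 * np"] s7(2) sl7 Ql by (auto simp: Q_def)
  have e8: "env s8" by (rule env_fr[OF e7 s8(3)]) auto
  have c8: "ctx Q s8" using e8 s8(2) by (simp add: ctx_def Qs_def)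
  have pH: "set (pre BB (down f v)) <= {..<nH}" if "colors f' f" for f f'
  proof -
   obtain ys where "down f v = pre BB (down f v) @ ys" using pre_prefix by blast
   hence "set (pre BB (down f v)) <= set (down f v)" by (metis set_append Un_upper1)
   also have "\<dots> <= set (map f (rev (up v)))" unfolding down_def by (rule set_nf)
   also have "\<dots> <= {..<nH}" using up_V[OF v(1)] alpha_nH beta_nH that by (auto simp: colors_def dest!: subsetD)
   finally show ?thesis .
  qed
  have "set Q <= set (A @ rev B)" unfolding Q_def by (rule set_nf)
  also have "\<dots> <= {..<nH}" using pH[OF colors_simps(1)] pH[OF colors_simps(2)] by (simp add: A_def B_def)
  finally have g: "goodQ Q" using Ql AB by (simp add: goodQ_def base_def Q_def last_rev)
  have "Q' = Q" if "Real Q'" for Q'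
   using Real_bad[OF that assms(4)[OF bv] bv vV bad] by (simp add: Q_def A_def B_def)
  then obtain s9 where s9: "runs (Seq verify fin2) (Vb + 5) s8 s9" "outcome s9" using fin2_spec[OF c8 g] by blast
  have r: "runs caseA (1 + ((n * (150 * np) + 2) + Suc (1 + (60 * np + ((np * 4 + 3) + (60 * np + ((np * 4 + 3) +
    (((2 * np) * 16 + 25) + (((2 * np) * 4 + 3) + (Vb + 5)))))))))) s s9"
   unfolding caseA_def
   by (rule runs_Seq[OF r0 runs_Seq[OF s1(1) runs_CondFalse[OF _ runs_Seq[OF r2 runs_Seq[OF s3(1) runs_Seq[OF s4(1)
    runs_Seq[OF s5(1) runs_Seq[OF s6(1) runs_Seq[OF s7(1) runs_Seq[OF s8(1) s9(1)]]]]]]]]]]) (use False in simp)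
  show ?thesis by (intro exI[of _ s9] conjI s9(2) runs_mono[OF r]) (simp add: algebra_simps)
 qed
qed

end

section \<open>Candidates along an axis: the program\<close>

lemma sg_back: "map (%j. f (- int j)) [0..<Suc z] = sg f 0 (- int z)"
proof (rule nth_equalityI)
 fix t assume "t < length (map (%j. f (- int j)) [0..<Suc z])"
 hence t: "t <= z" by simp
 have "sg f 0 (- int z) ! t = rev (sg f (- int z) 0) ! t" by (simp add: rev_sg)
 also have "\<dots> = sg f (- int z) 0 ! (z - t)" using t by (subst rev_nth) simp_all
 also have "\<dots> = f (- int z + int (z - t))" by (rule nth_sg) (use t in simp_all)
 also have "- int z + int (z - t) = - int t" using t by simp
 finally show "map (%j. f (- int j)) [0..<Suc z] ! t = sg f 0 (- int z) ! t" using t by (simp del: upt_Suc)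
qed simp

lemma sg_fwd: "map (%j. f (int j - int z)) [0..<Suc c] = sg f (- int z) (int c - int z)"
proof (rule nth_equalityI)
 fix t assume "t < length (map (%j. f (int j - int z)) [0..<Suc c])"
 hence t: "t <= c" by simp
 have "sg f (- int z) (int c - int z) ! t = f (- int z + int t)" by (rule nth_sg) (use t in simp_all)
 thus "map (%j. f (int j - int z)) [0..<Suc c] ! t = sg f (- int z) (int c - int z) ! t"
  using t by (simp del: upt_Suc)
qed simp

abbreviation "tst_at k i \<equiv> Seq (Assign ''tk'' k) (Seq (Assign ''ti'' i) tst)"

lemma sub_disj: "A <= B ==> B Int C = {} ==> A Int C = {}"
 by blast

definition parc :: com where
 "parc = Seq (Assign ''po'' (Const 0)) (For ''i4'' (Reg ''Qn'') (Assign ''po'' (Sub (Const 1) (Reg ''po''))))"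

lemma parc_spec:
 assumes "regs s ''Qn'' <= M"
 shows "EX s'. runs parc (M * 3 + 3) s s' & regs s' ''po'' = (if odd (regs s ''Qn'') then 1 else 0) & fr {''po'', ''i4''} {} s s'"
proof -
 let ?c = "Assign ''po'' (Sub (Const 1) (Reg ''po''))"
 define s1 where "s1 = s\<lparr>regs := (regs s)(''po'' := 0)\<rparr>"
 have r1: "runs (Assign ''po'' (Const 0)) 1 s s1" using runs_Assign[of "''po''" "Const 0" s] by (simp add: s1_def)
 let ?I = "%(k :: nat) (s' :: ram_state). regs s' ''po'' = (if odd k then 1 else 0 :: nat)"
 have "EX s'. runs (For ''i4'' (Reg ''Qn'') ?c) (regs s ''Qn'' * (1 + 2) + 2) s1 s' & ?I (regs s ''Qn'') s' & frl ''i4'' ?c s1 s'"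
 proof (rule For_rule[where I = ?I])
  fix s' assume "frl ''i4'' ?c s1 s'"
  thus "aval (Reg ''Qn'') s' = regs s ''Qn''" by (simp add: fr_reg s1_def)
 next
  fix k s' assume k: "?I k s'"
  have "?I (Suc k) (ev ?c s')" using k by simp
  moreover have "runs ?c 1 s' (ev ?c s')" by (rule run_ev) simp_all
  ultimately show "EX s''. runs ?c 1 s' s'' & ?I (Suc k) s''" by blast
 qed (auto simp: s1_def)
 then obtain s2 where s2: "runs (For ''i4'' (Reg ''Qn'') ?c) (regs s ''Qn'' * (1 + 2) + 2) s1 s2" "?I (regs s ''Qn'') s2" by blast
 have r: "runs parc (1 + (regs s ''Qn'' * (1 + 2) + 2)) s s2" unfolding parc_def by (rule runs_Seq[OF r1 s2(1)])
 have "wR parc = {''po'', ''i4''}" "wA parc = {}" by (auto simp: parc_def)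
 hence "fr {''po'', ''i4''} {} s s2" using runs_fr[OF r] by simp
 thus ?thesis using s2(2) assms by (intro exI[of _ s2] conjI runs_mono[OF r]) auto
qed

text \<open>Registers hold natural numbers, so the slide \<open>c3 - z\<close> is stored as
  \<open>c3\<close>. The word goes from index 0 back to \<open>- z\<close> and then forward to
  \<open>c3 - z\<close>; reduction removes the detour, and no distinction by sign is made.\<close>

definition candw :: com where
 "candw = Seq (Assign ''cc'' (Add (Reg ''c3'') (Const 1)))
   (word [eSeg ''X0'' ''t1c'', eBack ''F'' ''zr'' ''zc'', eSeg ''F'' ''cc'', eOff ''Y0'' ''yo'' ''t2c''])"

definition ilc :: com where
 "ilc = Cond (Conj (eqe (Read ''F'' (Reg ''c3'')) (Read ''Y0'' (Reg ''yo''))) (Conj (Less (Const 0) (Reg ''zo'')) (Less (Const 0) (Reg ''po''))))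
   (Assign ''il'' (Const 1)) (Assign ''il'' (Const 0))"

definition inLam :: com where
 "inLam = Seq candw (Seq (loadQ ''S'' ''sl'') (Seq parc (Seq (tst_at (Const 1) (Reg ''ej'')) ilc)))"

abbreviation "inR \<equiv> insert ''tk'' (insert ''ti'' tstR) Un {''cc'', ''Qn'', ''po'', ''i4'', ''il''}"
abbreviation "inA \<equiv> {''B'', ''S'', ''Q''}"

lemma wR_inLam: "wR inLam <= inR" and wA_inLam: "wA inLam <= inA"
proof -
 have t: "wR tst <= inR" by (rule order.trans[OF wR_tst]) auto
 have w: "wR (word es) <= inR" for es by (rule order.trans[OF wR_word]) auto
 have t': "wA tst <= inA" by (rule order.trans[OF wA_tst]) auto
 have w': "wA (word es) <= inA" for es by (rule order.trans[OF wA_word]) auto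
 show "wR inLam <= inR" using t w[of "[eSeg ''X0'' ''t1c'', eBack ''F'' ''zr'' ''zc'', eSeg ''F'' ''cc'', eOff ''Y0'' ''yo'' ''t2c'']"]
  by (simp add: inLam_def candw_def ilc_def parc_def)
 show "wA inLam <= inA" using t' w'[of "[eSeg ''X0'' ''t1c'', eBack ''F'' ''zr'' ''zc'', eSeg ''F'' ''cc'', eOff ''Y0'' ''yo'' ''t2c'']"]
  by (simp add: inLam_def candw_def ilc_def parc_def)
qed

definition sact :: "com => com" where
 "sact c = Seq inLam (Cond (Less (Const 0) (Reg ''il'')) c Skip)"

text \<open>Keeps the first two admissible candidates. A length of 0 means that none is stored yet,
  since candidates are nonempty lists.\<close>

definition act1 :: com where
 "act1 = Cond (Less (Reg ''an'') (Const 1)) (cpy ''QA'' ''an'' ''Q'' ''Qn'')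
   (Cond (Less (Reg ''bn'') (Const 1)) (cpy ''QB'' ''bn'' ''Q'' ''Qn'') Skip)"

text \<open>\<open>k0\<close> and \<open>i0\<close> name the test that the first candidate failed.
  At most one admissible candidate passes it, so overwriting \<open>QC\<close> loses
  nothing.\<close>

definition act2 :: com where
 "act2 = Seq (tst_at (Reg ''k0'') (Reg ''i0'')) (Cond (Less (Const 0) (Reg ''zo'')) (cpy ''QC'' ''cn'' ''Q'' ''Qn'') Skip)"

abbreviation "scan c \<equiv> For ''c3'' (Reg ''zz'') (sact c)"

definition out3 :: com where
 "out3 = Seq (word [eSeg ''QB'' ''bn'', eRev ''QA'' ''an'']) (Seq (cpy ''R'' ''ol'' ''S'' ''sl'')
   (Seq (Assign ''R'' (Sub (Reg ''ol'') (Const 1))) (Seq (cpy ''P'' ''ol'' ''QA'' ''an'')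
   (Seq (Assign ''P'' (Sub (Reg ''an'') (Const 1))) (Assign ''case'' (Const 3))))))"

definition caseB2 :: com where
 "caseB2 = Seq (loadQ ''QB'' ''bn'') (Seq verify (Cond (Less (Reg ''kd'') (Const 1)) out3
   (Seq (loadQ ''QA'' ''an'') (Seq (Assign ''Q'' (Sub (Reg ''Qn'') (Const 1))) (Assign ''case'' (Const 2))))))"

definition caseB1 :: com where
 "caseB1 = Seq (Seq (Assign ''k0'' (Reg ''kd'')) (Seq (Assign ''i0'' (Reg ''ix'')) (Assign ''cn'' (Const 0))))
   (Seq (scan act2) (Cond (Less (Reg ''cn'') (Const 1)) (Assign ''case'' (Const 1)) (Seq (loadQ ''QC'' ''cn'') (Seq verify fin2))))"

text \<open>At most two verifications: of the first candidate, and then either of the second one or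
  of the only one that passes the test failed by the first.\<close>

definition caseB :: com where
 "caseB = Seq (Seq (Assign ''an'' (Const 0)) (Assign ''bn'' (Const 0))) (Seq (scan act1)
   (Cond (Less (Reg ''bn'') (Const 1)) (Assign ''case'' (Const 1))
    (Seq (loadQ ''QA'' ''an'') (Seq verify (Cond (Less (Reg ''kd'') (Const 1)) caseB2 caseB1)))))"

text \<open>\<open>z\<close> is half the width of the window: large enough for the estimates on far
  candidates, and rounded up by at most one period, which is bounded by
  \<open>2 * (n + 1)\<close>.\<close>

locale prgB = prg G H al be2 q up n nH m AL + axis G H al be2 q up f g T1 T2 L "n + 1" L' u0 v0
 for G H :: "nat pair_pre_digraph" and al be2 :: "nat => nat" and q :: nat and up :: "nat => nat list"
  and n nH m :: nat and AL :: "(nat \<times> nat) list" and f g :: "int => nat" and T1 T2 :: "nat list" and L L' :: int and u0 v0 :: nat +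
 fixes z j0 :: nat
 assumes z: "16 * (n + 1) <= z" "z <= 18 * (n + 1)" and j0: "j0 < m" "AL ! j0 = (u0, v0)"
  and fH: "!!i. f i < nH" and TH: "set T1 <= {..<nH}" "set T2 <= {..<nH}"
begin

definition bctx :: "ram_state => bool" where
 "bctx s <-> env s & regs s ''t1c'' = length T1 & seg s ''X0'' (length T1) = T1 &
  (ALL j<=2 * z. arrs s ''F'' j = f (int j - int z)) & regs s ''t2c'' = length T2 &
  (ALL j<length T2. arrs s ''Y0'' (regs s ''yo'' + j) = T2 ! j) &
  regs s ''zr'' = z & regs s ''zc'' = z + 1 & regs s ''zz'' = 2 * z + 1 & regs s ''ej'' = j0"

abbreviation "bR \<equiv> {''t1c'', ''t2c'', ''yo'', ''zr'', ''zc'', ''zz'', ''ej''} Un envR"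
abbreviation "bA \<equiv> {''X0'', ''F'', ''Y0''} Un envA"

lemma bctx_fr:
 assumes "bctx s" "fr R A s s'" "R Int bR = {}" "A Int bA = {}"
 shows "bctx s'"
proof -
 have r: "regs s' x = regs s x" if "x : bR" for x using fr_reg[OF assms(2)] assms(3) that by blast
 have a: "arrs s' x = arrs s x" if "x : bA" for x using fr_arr[OF assms(2)] assms(4) that by blast
 have "env s'" using assms unfolding bctx_def by (intro env_fr[OF _ assms(2)]) auto
 thus ?thesis using assms(1) unfolding bctx_def by (simp add: r a seg_def)
qed

abbreviation kk :: "nat => int" where "kk c \<equiv> int c - int z"

lemma T_len: "length T1 <= 2 * np" "length T2 <= 2 * np"
 using T1(4) T2(4) by auto

lemma candw_spec:
 assumes "bctx s" "regs s ''c3'' = c" "c < 2 * z + 1"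
 shows "EX s'. runs candw (1000 * np) s s' & seg s' ''S'' (regs s' ''sl'') = cand (kk c) &
  fr (insert ''cc'' wordR) wordA s s'"
proof -
 define s1 where "s1 = s\<lparr>regs := (regs s)(''cc'' := c + 1)\<rparr>"
 have r1: "runs (Assign ''cc'' (Add (Reg ''c3'') (Const 1))) 1 s s1"
  using runs_Assign[of "''cc''" "Add (Reg ''c3'') (Const 1)" s] assms(2) by (simp add: s1_def)
 have f1: "fr {''cc''} {} s s1" by (simp add: fr_def s1_def)
 have b1: "bctx s1" by (rule bctx_fr[OF assms(1) f1]) auto
 let ?es = "[eSeg ''X0'' ''t1c'', eBack ''F'' ''zr'' ''zc'', eSeg ''F'' ''cc'', eOff ''Y0'' ''yo'' ''t2c'']"
 have x1: "seg s1 ''X0'' (regs s1 ''t1c'') = T1" using b1 by (simp add: bctx_def)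
 have "map (%j. arrs s1 ''F'' (regs s1 ''zr'' - j)) [0..<regs s1 ''zc''] = map (%j. f (- int j)) [0..<Suc z]"
  using b1 by (intro map_cong) (auto simp: bctx_def)
 hence x2: "map (%j. arrs s1 ''F'' (regs s1 ''zr'' - j)) [0..<regs s1 ''zc''] = sg f 0 (- int z)" by (simp only: sg_back)
 have "seg s1 ''F'' (regs s1 ''cc'') = map (%j. f (int j - int z)) [0..<Suc c]"
  using b1 assms(3) unfolding seg_def by (intro map_cong) (auto simp: bctx_def s1_def)
 hence x3: "seg s1 ''F'' (regs s1 ''cc'') = sg f (- int z) (kk c)" by (simp only: sg_fwd)
 have x4: "map (%j. arrs s1 ''Y0'' (regs s1 ''yo'' + j)) [0..<regs s1 ''t2c''] = T2"
  by (rule nth_equalityI) (use b1 in \<open>auto simp: bctx_def\<close>)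
 let ?xs = "[T1, sg f 0 (- int z), sg f (- int z) (kk c), T2]"
 have em: "list_all2 (emitted s1) ?es ?xs"
  using emitted_eSeg[of "''X0''" "''t1c''" s1] emitted_eBack[of "''F''" "''zc''" "''zr''" s1] emitted_eSeg[of "''F''" "''cc''" s1]
   emitted_eOff[of "''Y0''" "''t2c''" "''yo''" s1] unfolding x1 x2 x3 x4 by simp
 have "nat \<bar>kk c - - int z\<bar> = c" "nat \<bar>- int z - 0\<bar> = z" by simp_all
 hence "length (concat ?xs) = length T1 + (Suc z + (Suc c + length T2))" by simp
 \<comment> \<open>The tails have at most \<open>4 * np\<close> vertices together, the detour on the
   axis at most \<open>3 * z + 2\<close> with \<open>z <= 18 * np\<close>.\<close>
 hence l: "length (concat ?xs) <= 60 * np" using T_len z assms(3) by simp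
 obtain s2 where s2: "runs (word ?es) (60 * np * 16 + 25) s1 s2" "seg s2 ''S'' (regs s2 ''sl'') = nf (concat ?xs)" "fr wordR wordA s1 s2"
  using word_spec[OF em l] by auto
 have "nf (concat ?xs) = cand (kk c)" using nf_sg_trans[of T1 f 0 "- int z" "kk c" T2] by (simp add: cand_def)
 moreover have "fr (insert ''cc'' wordR) wordA s s2" by (rule fr_mono[OF fr_trans[OF f1 s2(3)]]) auto
 moreover have "runs candw (1 + (60 * np * 16 + 25)) s s2" unfolding candw_def by (rule runs_Seq[OF r1 s2(1)])
 hence "runs candw (1000 * np) s s2" by (rule runs_mono) simp
 ultimately show ?thesis using s2(2) by metis
qed

lemma good_cand: "c < 2 * z + 1 ==> goodQ (cand (kk c))"
proof -
 assume c: "c < 2 * z + 1"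
 have "cand (kk c) = nf (T1 @ sg f 0 (kk c) @ T2)" by (rule cand_def)
 hence l: "length (cand (kk c)) <= length (T1 @ sg f 0 (kk c) @ T2)" using length_nf by metis
 have "\<bar>kk c\<bar> <= int z" using c by simp
 hence "length (sg f 0 (kk c)) <= Suc z" by simp
 hence l: "length (cand (kk c)) <= 60 * np" using l T_len z by simp
 have "set (cand (kk c)) <= set (T1 @ sg f 0 (kk c) @ T2)" unfolding cand_def by (rule set_nf)
 also have "\<dots> <= {..<nH}" using TH fH by (auto simp: sg_def)
 finally show ?thesis using l base_cand by (simp add: goodQ_def)
qed

lemma tst_at_spec:
 assumes "ctx Q s" "goodQ Q" "aval ke s = k" "aval ie (s\<lparr>regs := (regs s)(''tk'' := k)\<rparr>) = i" "tvalid k i"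
 shows "EX s'. runs (tst_at ke ie) (2200 * np + 2) s s' & fr (insert ''tk'' (insert ''ti'' tstR)) wordA s s' &
  regs s' ''zo'' = (if passes (tdec k i) Q then 1 else 0)"
proof -
 define s1 where "s1 = s\<lparr>regs := (regs s)(''tk'' := k)\<rparr>"
 define s2 where "s2 = s1\<lparr>regs := (regs s1)(''ti'' := i)\<rparr>"
 have r1: "runs (Assign ''tk'' ke) 1 s s1" using runs_Assign[of "''tk''" ke s] assms(3) by (simp add: s1_def)
 have r2: "runs (Assign ''ti'' ie) 1 s1 s2" using runs_Assign[of "''ti''" ie s1] assms(4) by (simp add: s2_def s1_def)
 have f2: "fr {''tk'', ''ti''} {} s s2" by (simp add: fr_def s1_def s2_def)
 have c2: "ctx Q s2" by (rule ctx_fr[OF assms(1) f2]) auto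
 have k2: "regs s2 ''tk'' = k" "regs s2 ''ti'' = i" by (simp_all add: s1_def s2_def)
 have Q2: "Qs s2 = Q" and e2: "env s2" using c2 by (simp_all add: ctx_def)
 have "EX s'. runs tst (2200 * np) s2 s' & fr tstR wordA s2 s' &
  regs s' ''zo'' = (if passes (tdec (regs s2 ''tk'') (regs s2 ''ti'')) (Qs s2) then 1 else 0) &
  (regs s2 ''tk'' ~= 1 --> seg s' ''S'' (regs s' ''sl'') = SS (Qs s2) (regs s2 ''ti''))"
  by (rule tst_spec[OF e2]) (use assms(2,5) k2 Q2 ctx_Qn[OF c2] in \<open>simp_all add: goodQ_def\<close>)
 then obtain s3 where s3: "runs tst (2200 * np) s2 s3" "fr tstR wordA s2 s3" "regs s3 ''zo'' = (if passes (tdec k i) Q then 1 else 0)"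
  unfolding k2 Q2 by blast
 have r: "runs (tst_at ke ie) (1 + (1 + 2200 * np)) s s3" by (rule runs_Seq[OF r1 runs_Seq[OF r2 s3(1)]])
 have F: "fr (insert ''tk'' (insert ''ti'' tstR)) wordA s s3" by (rule fr_mono[OF fr_trans[OF f2 s3(2)]]) auto
 show ?thesis by (intro exI[of _ s3] conjI runs_mono[OF r] F s3(3)) simp
qed

lemma inLam_spec:
 assumes "bctx s" "regs s ''c3'' = c" "c < 2 * z + 1"
 shows "EX s'. runs inLam (3700 * np) s s' & bctx s' & Qs s' = cand (kk c) & (0 < regs s' ''il'' <-> kk c : LamP) & fr inR inA s s'"
proof -
 obtain s1 where s1: "runs candw (1000 * np) s s1" "seg s1 ''S'' (regs s1 ''sl'') = cand (kk c)" "fr (insert ''cc'' wordR) wordA s s1"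
  using candw_spec[OF assms] by blast
 have b1: "bctx s1" by (rule bctx_fr[OF assms(1) s1(3)]) auto
 note g = good_cand[OF assms(3)]
 have sl: "regs s1 ''sl'' = length (cand (kk c))" using arg_cong[OF s1(2), of length] by simp
 hence sl60: "regs s1 ''sl'' <= 60 * np" using g by (simp add: goodQ_def)
 obtain s2 where s2: "runs (loadQ ''S'' ''sl'') (60 * np * 4 + 3) s1 s2" "seg s2 ''Q'' (regs s2 ''Qn'') = seg s1 ''S'' (regs s1 ''sl'')"
  "fr {''Qn'', ''j''} {''Q''} s1 s2"
  using cpy_spec[of "''Q''" "''S''" "''Qn''" "''sl''" s1 "60 * np"] sl60 by auto
 have b2: "bctx s2" by (rule bctx_fr[OF b1 s2(3)]) auto
 have Q2: "Qs s2 = cand (kk c)" using s2(2) s1(2) by (simp add: Qs_def)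
 have c2: "ctx (cand (kk c)) s2" using b2 Q2 by (simp add: ctx_def bctx_def)
 have qn: "regs s2 ''Qn'' = length (cand (kk c))" by (rule ctx_Qn[OF c2])
 obtain s3 where s3: "runs parc (60 * np * 3 + 3) s2 s3" "regs s3 ''po'' = (if odd (length (cand (kk c))) then 1 else 0)" "fr {''po'', ''i4''} {} s2 s3"
  using parc_spec[of s2 "60 * np"] qn sl sl60 by auto
 have b3: "bctx s3" by (rule bctx_fr[OF b2 s3(3)]) auto
 have c3: "ctx (cand (kk c)) s3" by (rule ctx_fr[OF c2 s3(3)]) auto
 have ej: "regs s3 ''ej'' = j0" using b3 by (simp add: bctx_def)
 obtain s4 where s4: "runs (tst_at (Const 1) (Reg ''ej'')) (2200 * np + 2) s3 s4" "fr (insert ''tk'' (insert ''ti'' tstR)) wordA s3 s4"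
  "regs s4 ''zo'' = (if passes (tdec 1 j0) (cand (kk c)) then 1 else 0)"
  using tst_at_spec[OF c3 g, of "Const 1" 1 "Reg ''ej''" j0] ej j0(1) by (auto simp: tvalid_def)
 have b4: "bctx s4" by (rule bctx_fr[OF b3 s4(2)]) auto
 have po: "regs s4 ''po'' = regs s3 ''po''" using s4(2) by (simp add: fr_reg)
 have "fr inR inA s s4"
 proof -
  have "fr (((insert ''cc'' wordR Un {''Qn'', ''j''}) Un {''po'', ''i4''}) Un insert ''tk'' (insert ''ti'' tstR)) (((wordA Un {''Q''}) Un {}) Un wordA) s s4"
   by (rule fr_trans[OF fr_trans[OF fr_trans[OF s1(3) s2(3)] s3(3)] s4(2)])
  thus ?thesis by (rule fr_mono) auto
 qed
 hence c4: "regs s4 ''c3'' = c" using assms(2) by (simp add: fr_reg)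
 define s5 where "s5 = ev ilc s4"
 have r5: "runs ilc 3 s4 s5" unfolding s5_def by (rule run_ev) (simp_all add: ilc_def)
 have f5: "fr {''il''} {} s4 s5" using runs_fr[OF r5] by (simp add: ilc_def)
 have b5: "bctx s5" by (rule bctx_fr[OF b4 f5]) auto
 have F4: "arrs s4 ''F'' c = f (kk c)" using b4 assms(3) by (simp add: bctx_def)
 have "arrs s4 ''Y0'' (regs s4 ''yo'' + 0) = T2 ! 0" using b4 T2(1) unfolding bctx_def by blast
 hence Y4: "arrs s4 ''Y0'' (regs s4 ''yo'') = g 0" using T2(1,2) by (simp add: hd_conv_nth)
 have td: "passes (tdec 1 j0) (cand (kk c)) <-> arcT u0 v0 (cand (kk c))" by (simp add: tdec_def j0)
 have il: "0 < regs s5 ''il'' <-> kk c : LamP"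
  using s4(3)[unfolded td] s3(2) unfolding s5_def ilc_def LamP_def by (auto simp: c4 F4 Y4 po)
 have r: "runs inLam (1000 * np + ((60 * np * 4 + 3) + ((60 * np * 3 + 3) + ((2200 * np + 2) + 3)))) s s5"
  unfolding inLam_def by (rule runs_Seq[OF s1(1) runs_Seq[OF s2(1) runs_Seq[OF s3(1) runs_Seq[OF s4(1) r5]]]])
 have q: "Qs s5 = cand (kk c)" using c3 s4(2) f5 by (simp add: ctx_def Qs_def fr_reg fr_arr seg_def)
 show ?thesis by (intro exI[of _ s5] conjI b5 q il fr_mono[OF runs_fr[OF r] wR_inLam wA_inLam] runs_mono[OF r]) simp
qed

text \<open>One pass over all candidates in the window; \<open>I\<close> only depends on the registers in \<open>R\<close> and the arrays in \<open>A\<close>.\<close>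

lemma scan_spec:
 assumes b: "bctx s" and I0: "I 0 s"
  and fr: "!!k t t'. I k t ==> fr (insert ''c3'' inR) inA t t' ==> I k t'"
  and w: "wR c Int insert ''c3'' bR = {}" "wA c Int bA = {}"
  and skip: "!!k t. k < 2 * z + 1 ==> I k t ==> kk k ~: LamP ==> I (Suc k) t"
  and step: "!!k t. k < 2 * z + 1 ==> I k t ==> kk k : LamP ==> ctx (cand (kk k)) t ==> goodQ (cand (kk k)) ==>
    EX t'. runs c (2500 * np) t t' & I (Suc k) t'"
 shows "EX s'. runs (scan c) (37 * np * (6300 * np)) s s' & bctx s' & I (2 * z + 1) s'"
proof -
 have wi: "wR inLam Int insert ''c3'' bR = {}" "wA inLam Int bA = {}"
  by (rule sub_disj[OF wR_inLam], simp, rule sub_disj[OF wA_inLam], simp)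
 have ws: "insert ''c3'' (wR (sact c)) Int bR = {}" "wA (sact c) Int bA = {}" "''c3'' ~: wR (sact c)"
  using wi w by (auto simp: sact_def)
 have "EX s'. runs (scan c) ((2 * z + 1) * (6203 * np + 2) + 2) s s' & I (2 * z + 1) s' &
   frl ''c3'' (sact c) s s'"
 proof (rule For_rule[where I = I])
  fix s' assume "frl ''c3'' (sact c) s s'"
  hence "bctx s'" using bctx_fr[OF b _ ws(1,2)] by simp
  thus "aval (Reg ''zz'') s' = 2 * z + 1" by (simp add: bctx_def)
 next
  fix k t v assume "I k t"
  thus "I k (t\<lparr>regs := (regs t)(''c3'' := v)\<rparr>)" by (rule fr) (simp add: fr_def)
 next
  fix k t assume k: "k < 2 * z + 1" "frl ''c3'' (sact c) s t" "regs t ''c3'' = k" "I k t"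
  have bt: "bctx t" using bctx_fr[OF b k(2) ws(1,2)] .
  obtain t1 where t1: "runs inLam (3700 * np) t t1" "bctx t1" "Qs t1 = cand (kk k)" "0 < regs t1 ''il'' <-> kk k : LamP" "fr inR inA t t1"
   using inLam_spec[OF bt k(3,1)] by (elim exE conjE) (rule that; assumption)
  have "fr (insert ''c3'' inR) inA t t1" by (rule fr_mono[OF t1(5)]) auto
  hence i1: "I k t1" by (rule fr[OF k(4)])
  show "EX t'. runs (sact c) (6203 * np) t t' & I (Suc k) t'"
  proof (cases "kk k : LamP")
   case True
   have "ctx (cand (kk k)) t1" using t1(2,3) by (simp add: ctx_def bctx_def)
   from step[OF k(1) i1 True this good_cand[OF k(1)]] obtain t2 where t2: "runs c (2500 * np) t1 t2" "I (Suc k) t2" by blast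
   have "runs (sact c) (3700 * np + Suc (2500 * np)) t t2" unfolding sact_def
    by (rule runs_Seq[OF t1(1) runs_CondTrue[OF _ t2(1)]]) (use t1(4) True in simp)
   hence "runs (sact c) (6203 * np) t t2" by (rule runs_mono) simp
   thus ?thesis using t2(2) by blast
  next
   case False
   have "runs (sact c) (3700 * np + Suc 1) t t1" unfolding sact_def
    by (rule runs_Seq[OF t1(1) runs_CondFalse[OF _ runs_Skip]]) (use t1(4) False in simp)
   hence "runs (sact c) (6203 * np) t t1" by (rule runs_mono) simp
   thus ?thesis using skip[OF k(1) i1 False] by blast
  qed
 qed (use ws I0 in simp_all)
 then obtain s' where s': "runs (scan c) ((2 * z + 1) * (6203 * np + 2) + 2) s s'" "I (2 * z + 1) s'"
   "frl ''c3'' (sact c) s s'" by blast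
 \<comment> \<open>The window has \<open>2 * z + 1\<close> candidates, at most
   \<open>36 * np + 1\<close>.\<close>
 have "(2 * z + 1) * (6203 * np + 2) + 2 <= 37 * np * (6203 * np + 2) + 2"
  using z by (intro add_mono mult_mono) auto
 also have "\<dots> <= 37 * np * (6300 * np)" by (simp add: algebra_simps)
 finally have "runs (scan c) (37 * np * (6300 * np)) s s'" by (rule runs_mono[OF s'(1)])
 thus ?thesis using s'(2) bctx_fr[OF b s'(3) ws(1,2)] by blast
qed

definition is_first :: "nat => bool" where
 "is_first a <-> kk a : LamP & (ALL c<a. kk c ~: LamP)"

definition is_second :: "nat => nat => bool" where
 "is_second a b <-> a < b & kk b : LamP & (ALL c. a < c & c < b --> kk c ~: LamP)"

definition J1 :: "nat => ram_state => bool" where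
 "J1 k t <-> regs t ''an'' = 0 & regs t ''bn'' = 0 & (ALL c<k. kk c ~: LamP) |
   (EX a<k. is_first a & seg t ''QA'' (regs t ''an'') = cand (kk a) &
    (regs t ''bn'' = 0 & (ALL c. a < c & c < k --> kk c ~: LamP) |
    (EX b<k. is_second a b & seg t ''QB'' (regs t ''bn'') = cand (kk b))))"

lemma cand_pos: "seg t X l = cand k ==> 0 < l"
 using base_cand[of k] by (cases l) (auto simp: base_def)

lemma scan1_spec:
 assumes "bctx s" "regs s ''an'' = 0" "regs s ''bn'' = 0"
 shows "EX s'. runs (scan act1) (37 * np * (6300 * np)) s s' & bctx s' & J1 (2 * z + 1) s'"
proof (rule scan_spec[where I = J1, OF assms(1)])
 show "J1 0 s" using assms by (simp add: J1_def)
next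
 fix k t t' assume "J1 k t" "fr (insert ''c3'' inR) inA t t'"
 thus "J1 k t'" by (simp add: J1_def fr_reg fr_arr seg_def)
next
 show "wR act1 Int insert ''c3'' bR = {}" "wA act1 Int bA = {}" by (simp_all add: act1_def)
next
 fix k t assume k: "J1 k t" "kk k ~: LamP"
 from k(1)[unfolded J1_def] show "J1 (Suc k) t"
 proof (elim disjE)
  assume "regs t ''an'' = 0 & regs t ''bn'' = 0 & (ALL c<k. kk c ~: LamP)"
  thus ?thesis using k(2) by (auto simp: J1_def less_Suc_eq)
 next
  assume "EX a<k. is_first a & seg t ''QA'' (regs t ''an'') = cand (kk a) &
    (regs t ''bn'' = 0 & (ALL c. a < c & c < k --> kk c ~: LamP) | (EX b<k. is_second a b & seg t ''QB'' (regs t ''bn'') = cand (kk b)))"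
  thus ?thesis using k(2) unfolding J1_def by (metis less_Suc_eq)
 qed
next
 fix k t assume k: "J1 k t" "kk k : LamP" "ctx (cand (kk k)) t" "goodQ (cand (kk k))"
 have q: "seg t ''Q'' (regs t ''Qn'') = cand (kk k)" and qn: "regs t ''Qn'' <= 60 * np"
  using k(3,4) ctx_Qn[OF k(3)] by (auto simp: ctx_def Qs_def goodQ_def)
 consider (none) "regs t ''an'' = 0" "regs t ''bn'' = 0" "ALL c<k. kk c ~: LamP"
  | (one) a where "a < k" "is_first a" "seg t ''QA'' (regs t ''an'') = cand (kk a)" "regs t ''bn'' = 0" "ALL c. a < c & c < k --> kk c ~: LamP"
  | (two) a b where "a < k" "is_first a" "seg t ''QA'' (regs t ''an'') = cand (kk a)" "b < k" "is_second a b" "seg t ''QB'' (regs t ''bn'') = cand (kk b)"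
  using k(1)[unfolded J1_def]
  by (elim disjE exE conjE) ((rule that(1); assumption) | (rule that(2); assumption) | (rule that(3); assumption))+
 thus "EX t'. runs act1 (2500 * np) t t' & J1 (Suc k) t'"
 proof cases
  case none
  obtain t' where t': "runs (cpy ''QA'' ''an'' ''Q'' ''Qn'') (60 * np * 4 + 3) t t'" "seg t' ''QA'' (regs t' ''an'') = cand (kk k)" "fr {''an'', ''j''} {''QA''} t t'"
   using cpy_spec[of "''QA''" "''Q''" "''an''" "''Qn''" t "60 * np"] q qn by auto
  have r: "runs act1 (Suc (60 * np * 4 + 3)) t t'" unfolding act1_def by (rule runs_CondTrue[OF _ t'(1)]) (simp add: none)
  have bn: "regs t' ''bn'' = 0" using t'(3) none by (simp add: fr_reg)
  have fi: "is_first k" using k(2) none(3) by (simp add: is_first_def)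
  have "J1 (Suc k) t'" unfolding J1_def by (rule disjI2, rule exI[of _ k], intro conjI lessI fi t'(2) disjI1 bn) auto
  thus ?thesis by (intro exI[of _ t'] conjI runs_mono[OF r]) simp_all
 next
  case one
  obtain t' where t': "runs (cpy ''QB'' ''bn'' ''Q'' ''Qn'') (60 * np * 4 + 3) t t'" "seg t' ''QB'' (regs t' ''bn'') = cand (kk k)" "fr {''bn'', ''j''} {''QB''} t t'"
   using cpy_spec[of "''QB''" "''Q''" "''bn''" "''Qn''" t "60 * np"] q qn by auto
  have r: "runs act1 (Suc (Suc (60 * np * 4 + 3))) t t'" unfolding act1_def
   by (rule runs_CondFalse[OF _ runs_CondTrue[OF _ t'(1)]]) (use cand_pos[OF one(3)] one(4) in simp_all)
  have a: "seg t' ''QA'' (regs t' ''an'') = cand (kk a)" using t'(3) one(3) by (simp add: fr_reg fr_arr seg_def)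
  have se: "is_second a k" using k(2) one(1,5) by (simp add: is_second_def)
  have "J1 (Suc k) t'" unfolding J1_def
   by (rule disjI2, rule exI[of _ a], intro conjI one(2) a, rule less_SucI, rule one(1),
     rule disjI2, rule exI[of _ k], intro conjI lessI se t'(2))
  thus ?thesis by (intro exI[of _ t'] conjI runs_mono[OF r]) simp_all
 next
  case two
  have r: "runs act1 (Suc (Suc 1)) t t" unfolding act1_def
   by (rule runs_CondFalse[OF _ runs_CondFalse[OF _ runs_Skip]]) (use cand_pos[OF two(3)] cand_pos[OF two(6)] in simp_all)
  have "J1 (Suc k) t" unfolding J1_def
   by (rule disjI2, rule exI[of _ a], intro conjI two(2,3), rule less_SucI, rule two(1),
     rule disjI2, rule exI[of _ b], intro conjI two(5,6), rule less_SucI, rule two(4))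
  thus ?thesis by (intro exI[of _ t] conjI runs_mono[OF r]) simp_all
 qed
qed

definition J2 :: "nat => nat => nat => ram_state => bool" where
 "J2 kd ix k t <-> regs t ''k0'' = kd & regs t ''i0'' = ix &
   (regs t ''cn'' = 0 & (ALL c<k. kk c : LamP --> ~ passes (tdec kd ix) (cand (kk c))) |
   (EX a<k. kk a : LamP & passes (tdec kd ix) (cand (kk a)) & seg t ''QC'' (regs t ''cn'') = cand (kk a)))"

lemma scan2_spec:
 assumes "bctx s" "regs s ''k0'' = kd" "regs s ''i0'' = ix" "regs s ''cn'' = 0" "tvalid kd ix"
 shows "EX s'. runs (scan act2) (37 * np * (6300 * np)) s s' & bctx s' & J2 kd ix (2 * z + 1) s'"
proof (rule scan_spec[where I = "J2 kd ix", OF assms(1)])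
 show "J2 kd ix 0 s" using assms by (simp add: J2_def)
next
 fix k t t' assume "J2 kd ix k t" "fr (insert ''c3'' inR) inA t t'"
 thus "J2 kd ix k t'" by (simp add: J2_def fr_reg fr_arr seg_def)
next
 show "wR act2 Int insert ''c3'' bR = {}" "wA act2 Int bA = {}"
 proof -
  have "wR tst <= insert ''cn'' inR" by (rule order.trans[OF wR_tst]) auto
  hence "wR act2 <= insert ''cn'' inR" by (simp add: act2_def)
  thus "wR act2 Int insert ''c3'' bR = {}" by (rule sub_disj) simp
  have "wA tst <= insert ''QC'' inA" by (rule order.trans[OF wA_tst]) auto
  hence "wA act2 <= insert ''QC'' inA" by (simp add: act2_def)
  thus "wA act2 Int bA = {}" by (rule sub_disj) simp
 qed
next
 fix k t assume k: "J2 kd ix k t" "kk k ~: LamP"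
 thus "J2 kd ix (Suc k) t" unfolding J2_def by (metis less_Suc_eq)
next
 fix k t assume k: "J2 kd ix k t" "kk k : LamP" "ctx (cand (kk k)) t" "goodQ (cand (kk k))"
 have qn: "regs t ''Qn'' <= 60 * np" using k(4) ctx_Qn[OF k(3)] by (auto simp: goodQ_def)
 have ki: "regs t ''k0'' = kd" "regs t ''i0'' = ix" using k(1) by (simp_all add: J2_def)
 obtain t1 where t1: "runs (tst_at (Reg ''k0'') (Reg ''i0'')) (2200 * np + 2) t t1" "fr (insert ''tk'' (insert ''ti'' tstR)) wordA t t1"
  "regs t1 ''zo'' = (if passes (tdec kd ix) (cand (kk k)) then 1 else 0)"
  using tst_at_spec[OF k(3,4), of "Reg ''k0''" kd "Reg ''i0''" ix] ki assms(5) by auto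
 have q1: "seg t1 ''Q'' (regs t1 ''Qn'') = cand (kk k)" "regs t1 ''Qn'' <= 60 * np"
  using k(3) t1(2) qn by (simp_all add: ctx_def Qs_def fr_reg fr_arr seg_def)
 have j1: "J2 kd ix k t1" using k(1) t1(2) by (simp add: J2_def fr_reg fr_arr seg_def)
 show "EX t'. runs act2 (2500 * np) t t' & J2 kd ix (Suc k) t'"
 proof (cases "passes (tdec kd ix) (cand (kk k))")
  case True
  obtain t2 where t2: "runs (cpy ''QC'' ''cn'' ''Q'' ''Qn'') (60 * np * 4 + 3) t1 t2" "seg t2 ''QC'' (regs t2 ''cn'') = cand (kk k)" "fr {''cn'', ''j''} {''QC''} t1 t2"
   using cpy_spec[of "''QC''" "''Q''" "''cn''" "''Qn''" t1 "60 * np"] q1 by auto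
  have r: "runs act2 ((2200 * np + 2) + Suc (60 * np * 4 + 3)) t t2" unfolding act2_def
   by (rule runs_Seq[OF t1(1) runs_CondTrue[OF _ t2(1)]]) (simp add: t1(3) True)
  have e: "regs t2 ''k0'' = kd" "regs t2 ''i0'' = ix" using t2(3) j1 by (simp_all add: J2_def fr_reg)
  have "J2 kd ix (Suc k) t2" unfolding J2_def
   by (intro conjI e disjI2 exI[of _ k] True k(2) t2(2)) simp
  thus ?thesis by (intro exI[of _ t2] conjI runs_mono[OF r]) simp_all
 next
  case False
  have r: "runs act2 ((2200 * np + 2) + Suc 1) t t1" unfolding act2_def
   by (rule runs_Seq[OF t1(1) runs_CondFalse[OF _ runs_Skip]]) (simp add: t1(3) False)
  have "J2 kd ix (Suc k) t1" using j1 False unfolding J2_def by (metis less_Suc_eq)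
  thus ?thesis by (intro exI[of _ t1] conjI runs_mono[OF r]) simp_all
 qed
qed

lemma Real_cand: "Real Q ==> EX k:LamE. Q = cand k"
 using Real_LamP LamP_LamE by blast

lemma z_int: "16 * int np <= int z"
proof -
 have "int (16 * np) <= int z" using z(1) by (simp only: of_nat_le_iff)
 thus ?thesis by (simp only: of_nat_mult of_nat_numeral)
qed

text \<open>\<open>LamE\<close> is invariant under \<open>2 * L\<close>, and \<open>L\<close> is
  small against \<open>z\<close>. So an admissible candidate anywhere forces two in the window, and
  finding fewer than two proves that there is none at all.\<close>

lemma LamP_window:
 assumes "k : LamP"
 shows "EX a b. a < b & b < 2 * z + 1 & kk a : LamP & kk b : LamP"
proof -
 have "16 * int np <= int z" by (rule z_int)
 then obtain k1 k2 where k: "k1 : LamE" "k2 : LamE" "- int z <= k1" "k1 < k2" "k2 <= int z"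
  using LamE_window[OF LamP_LamE[OF assms]] by blast
 have "kk (nat (k1 + int z)) = k1" "kk (nat (k2 + int z)) = k2" using k by simp_all
 thus ?thesis using k LamE_LamP[OF assms] by (intro exI[of _ "nat (k1 + int z)"] exI[of _ "nat (k2 + int z)"]) auto
qed

lemma second_LamE:
 assumes "is_first a" "is_second a b"
 shows "kk a : LamE" "kk b : LamE" "kk a < kk b" "!!k. kk a < k ==> k < kk b ==> k ~: LamE"
proof -
 have p: "kk a : LamP" using assms(1) by (simp add: is_first_def)
 show "kk a : LamE" "kk b : LamE" "kk a < kk b" using assms LamP_LamE by (auto simp: is_first_def is_second_def)
 fix k assume k: "kk a < k" "k < kk b"
 show "k ~: LamE"
 proof
  assume "k : LamE"
  hence "k : LamP" by (rule LamE_LamP[OF p])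
  moreover have "kk (nat (k + int z)) = k" using k by simp
  moreover have "a < nat (k + int z)" "nat (k + int z) < b" using k by auto
  ultimately show False using assms(2) unfolding is_second_def by metis
 qed
qed

definition mid :: "nat => nat => ram_state => bool" where
 "mid a b t <-> bctx t & seg t ''QA'' (regs t ''an'') = cand (kk a) & seg t ''QB'' (regs t ''bn'') = cand (kk b)"

lemma mid_fr:
 assumes "mid a b s" "fr R A s s'" "R Int ({''an'', ''bn''} Un bR) = {}" "A Int ({''QA'', ''QB''} Un bA) = {}"
 shows "mid a b s'"
proof -
 have "bctx s'" using assms(1,3,4) unfolding mid_def by (intro bctx_fr[OF _ assms(2)]) auto
 moreover have "regs s' ''an'' = regs s ''an''" "regs s' ''bn'' = regs s ''bn''" "arrs s' ''QA'' = arrs s ''QA''" "arrs s' ''QB'' = arrs s ''QB''"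
  using assms(2-4) by (auto simp: fr_reg fr_arr)
 ultimately show ?thesis using assms(1) by (simp add: mid_def seg_def)
qed

lemma load_verify:
 assumes "bctx s" "seg s A (regs s l) = cand (kk c)" "c < 2 * z + 1" "A ~= ''Q''" "l ~= ''Qn''" "l ~= ''j''"
 shows "EX s1. runs (loadQ A l) (243 * np) s s1 & ctx (cand (kk c)) s1 & fr {''Qn'', ''j''} {''Q''} s s1 &
  (EX s2. runs verify Vb s1 s2 & ctx (cand (kk c)) s2 & fr (insert ''Qn'' verR) (insert ''Q'' verA) s s2 &
   verdict (cand (kk c)) s2)"
proof -
 note g = good_cand[OF assms(3)]
 have "regs s l = length (cand (kk c))" using arg_cong[OF assms(2), of length] by simp
 hence l: "regs s l <= 60 * np" using g by (simp add: goodQ_def)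
 obtain s1 where s1: "runs (loadQ A l) (60 * np * 4 + 3) s s1" "seg s1 ''Q'' (regs s1 ''Qn'') = seg s A (regs s l)" "fr {''Qn'', ''j''} {''Q''} s s1"
  using cpy_spec[of "''Q''" A "''Qn''" l s "60 * np"] assms(4-6) l by auto
 have "bctx s1" by (rule bctx_fr[OF assms(1) s1(3)]) auto
 hence c1: "ctx (cand (kk c)) s1" using s1(2) assms(2) by (simp add: ctx_def Qs_def bctx_def)
 obtain s2 where s2: "runs verify Vb s1 s2" "ctx (cand (kk c)) s2" "fr verR verA s1 s2"
   "verdict (cand (kk c)) s2"
  using verify_spec[OF c1 g] unfolding Vb_def by blast
 have f: "fr (insert ''Qn'' verR) (insert ''Q'' verA) s s2" by (rule fr_mono[OF fr_trans[OF s1(3) s2(3)]]) auto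
 have r: "runs (loadQ A l) (243 * np) s s1" by (rule runs_mono[OF s1(1)]) simp
 show ?thesis by (intro exI[of _ s1] conjI r c1 s1(3) exI[of _ s2] s2(1,2,4) f)
qed

text \<open>Realizable candidates pass the failed test \<open>t\<close>. Hence they lie in the
  window and there is at most one, which a scan with \<open>t\<close> alone finds.\<close>

lemma caseB1_spec:
 assumes "bctx s" "bad (cand k) (regs s ''kd'') (regs s ''ix'')" "k : LamP"
 shows "EX s'. runs caseB1 (37 * np * (6300 * np) + Vb + 260 * np) s s' & outcome s'"
proof -
 define kd where "kd = regs s ''kd''"
 define ix where "ix = regs s ''ix''"
 define t where "t = tdec kd ix"
 have bad: "tvalid kd ix" "t : tests" "~ passes t (cand k)" using assms(2) by (simp_all add: bad_def kd_def ix_def t_def)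
 have wt: "wft t" by (rule wft_tests[OF bad(2)])
 note uniq = passes_unique[OF wt LamP_LamE[OF assms(3)] bad(3)]
 let ?c = "Seq (Assign ''k0'' (Reg ''kd'')) (Seq (Assign ''i0'' (Reg ''ix'')) (Assign ''cn'' (Const 0)))"
 define s1 where "s1 = ev ?c s"
 have r1: "runs ?c 3 s s1" unfolding s1_def by (rule run_ev) simp_all
 have k1: "regs s1 ''k0'' = kd" "regs s1 ''i0'' = ix" "regs s1 ''cn'' = 0" by (simp_all add: s1_def kd_def ix_def)
 have b1: "bctx s1" by (rule bctx_fr[OF assms(1) runs_fr[OF r1]]) auto
 obtain s2 where s2: "runs (scan act2) (37 * np * (6300 * np)) s1 s2" "bctx s2" "J2 kd ix (2 * z + 1) s2"
  using scan2_spec[OF b1 k1 bad(1)] by blast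
 have Rp: "EX c<2 * z + 1. kk c : LamP & passes t (cand (kk c)) & Q = cand (kk c)" if R: "Real Q" for Q
 proof -
  obtain k' where k': "k' : LamP" "Q = cand k'" using Real_LamP[OF R] by blast
  have p: "passes t (cand k')" using R k'(2) bad(2) Real_cand_iff by blast
  have "\<bar>k'\<bar> < 16 * int np" by (rule uniq(1)[OF LamP_LamE[OF k'(1)] p])
  moreover have "16 * int np <= int z" by (rule z_int)
  ultimately have "\<bar>k'\<bar> < int z" by linarith
  hence "kk (nat (k' + int z)) = k'" "nat (k' + int z) < 2 * z + 1" by auto
  thus ?thesis using k' p by (intro exI[of _ "nat (k' + int z)"]) simp
 qed
 from s2(3)[unfolded J2_def, folded t_def] consider (none) "regs s2 ''cn'' = 0" "ALL c<2 * z + 1. kk c : LamP --> ~ passes t (cand (kk c))"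
  | (one) a where "a < 2 * z + 1" "kk a : LamP" "passes t (cand (kk a))" "seg s2 ''QC'' (regs s2 ''cn'') = cand (kk a)"
  by (elim disjE exE conjE) ((rule that(1); assumption) | (rule that(2); assumption))+
 thus ?thesis
 proof cases
  case none
  let ?d = "Assign ''case'' (Const 1)"
  define s3 where "s3 = ev ?d s2"
  have r3: "runs ?d 1 s2 s3" unfolding s3_def by (rule run_ev) simp_all
  have r: "runs caseB1 (3 + (37 * np * (6300 * np) + Suc 1)) s s3" unfolding caseB1_def
   by (rule runs_Seq[OF r1 runs_Seq[OF s2(1) runs_CondTrue[OF _ r3]]]) (simp add: none)
  have c3: "regs s3 ''case'' = 1" by (simp add: s3_def)
  have "outcome s3" by (rule outcome_1[OF c3]) (use Rp none(2) in blast)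
  thus ?thesis by (intro exI[of _ s3] conjI runs_mono[OF r]) simp_all
 next
  case one
  obtain s3 where s3: "runs (loadQ ''QC'' ''cn'') (243 * np) s2 s3" "ctx (cand (kk a)) s3"
   using load_verify[OF s2(2) one(4,1)] by auto
  have "Q' = cand (kk a)" if Q': "Real Q'" for Q'
  proof -
   obtain c where c: "kk c : LamP" "passes t (cand (kk c))" "Q' = cand (kk c)" using Rp[OF Q'] by blast
   have "kk c = kk a" by (rule uniq(2)[OF LamP_LamE[OF one(2)] one(3) LamP_LamE[OF c(1)] c(2)])
   thus ?thesis using c(3) by simp
  qed
  then obtain s4 where s4: "runs (Seq verify fin2) (Vb + 5) s3 s4" "outcome s4"
   using fin2_spec[OF s3(2) good_cand[OF one(1)]] by blast
  have r: "runs caseB1 (3 + (37 * np * (6300 * np) + Suc (243 * np + (Vb + 5)))) s s4" unfolding caseB1_def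
   by (rule runs_Seq[OF r1 runs_Seq[OF s2(1) runs_CondFalse[OF _ runs_Seq[OF s3(1) s4(1)]]]]) (use cand_pos[OF one(4)] in simp)
  show ?thesis by (intro exI[of _ s4] conjI runs_mono[OF r] s4(2)) simp
 qed
qed

lemma out3_spec:
 assumes "mid a b s" "a < 2 * z + 1" "b < 2 * z + 1"
 shows "EX s'. runs out3 (3000 * np) s s' & regs s' ''case'' = 3 &
  output_walk s' ''R'' = steps (nf (cand (kk b) @ rev (cand (kk a)))) & output_walk s' ''P'' = steps (cand (kk a))"
proof -
 note ga = good_cand[OF assms(2)] and gb = good_cand[OF assms(3)]
 define A B where "A = cand (kk a)" and "B = cand (kk b)"
 have ne: "A ~= []" "B ~= []" using base_cand by (auto simp: base_def A_def B_def)
 have sA: "seg s ''QA'' (regs s ''an'') = A" and sB: "seg s ''QB'' (regs s ''bn'') = B" using assms(1) by (simp_all add: mid_def A_def B_def)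
 have len: "length A <= 60 * np" "length B <= 60 * np" using ga gb by (simp_all add: goodQ_def A_def B_def)
 let ?es = "[eSeg ''QB'' ''bn'', eRev ''QA'' ''an'']"
 have em: "list_all2 (emitted s) ?es [B, rev A]"
  using emitted_eSeg[of "''QB''" "''bn''" s] emitted_eRev[of "''QA''" "''an''" s] unfolding sA sB by simp
 have l1: "length (concat [B, rev A]) <= 120 * np" using len by simp
 obtain s1 where s1: "runs (word ?es) (120 * np * 16 + 25) s s1" "seg s1 ''S'' (regs s1 ''sl'') = nf (B @ rev A)" "fr wordR wordA s s1"
  using word_spec[OF em l1] by auto
 define N where "N = nf (B @ rev A)"
 have Nl: "length N <= 120 * np" using length_nf[of "B @ rev A"] len by (simp add: N_def)
 have Nn: "N ~= []" using ne by (simp add: N_def)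
 have sl: "regs s1 ''sl'' = length N" using arg_cong[OF s1(2), of length] by (simp add: N_def)
 obtain s2 where s2: "runs (cpy ''R'' ''ol'' ''S'' ''sl'') (120 * np * 4 + 3) s1 s2" "seg s2 ''R'' (regs s2 ''ol'') = N" "fr {''ol'', ''j''} {''R''} s1 s2"
  using cpy_spec[of "''R''" "''S''" "''ol''" "''sl''" s1 "120 * np"] sl Nl s1(2) by (auto simp: N_def)
 have ol: "regs s2 ''ol'' = length N" using arg_cong[OF s2(2), of length] by simp
 let ?a = "Assign ''R'' (Sub (Reg ''ol'') (Const 1))"
 define s3 where "s3 = ev ?a s2"
 have r3: "runs ?a 1 s2 s3" unfolding s3_def by (rule run_ev) simp_all
 have f3: "fr {''R''} {} s2 s3" using runs_fr[OF r3] by simp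
 have R3: "regs s3 ''R'' = length N - 1" by (simp add: s3_def ol)
 have f03: "fr (wordR Un {''ol'', ''R''}) (wordA Un {''R''}) s s3"
  by (rule fr_mono[OF fr_trans[OF s1(3) fr_trans[OF s2(3) f3]]]) auto
 have A3: "seg s3 ''QA'' (regs s3 ''an'') = A" using f03 sA by (simp add: fr_reg fr_arr seg_def)
 have an: "regs s3 ''an'' = length A" using arg_cong[OF A3, of length] by simp
 obtain s4 where s4: "runs (cpy ''P'' ''ol'' ''QA'' ''an'') (60 * np * 4 + 3) s3 s4" "seg s4 ''P'' (regs s4 ''ol'') = A" "fr {''ol'', ''j''} {''P''} s3 s4"
  using cpy_spec[of "''P''" "''QA''" "''ol''" "''an''" s3 "60 * np"] an len A3 by auto
 let ?b = "Seq (Assign ''P'' (Sub (Reg ''an'') (Const 1))) (Assign ''case'' (Const 3))"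
 define s5 where "s5 = ev ?b s4"
 have r5: "runs ?b 2 s4 s5" unfolding s5_def by (rule run_ev) simp_all
 have f5: "fr {''P'', ''case''} {} s4 s5" by (rule fr_mono[OF runs_fr[OF r5]]) auto
 have an4: "regs s4 ''an'' = length A" using s4(3) an by (simp add: fr_reg)
 have ol4: "regs s4 ''ol'' = length A" using arg_cong[OF s4(2), of length] by simp
 have P5: "regs s5 ''P'' = length A - 1" "regs s5 ''case'' = 3" by (simp_all add: s5_def an4)
 have pa: "seg s5 ''P'' (length A) = A" using s4(2) f5 by (simp add: ol4 fr_arr seg_def)
 have R5: "regs s5 ''R'' = length N - 1" using R3 s4(3) f5 by (simp add: fr_reg)
 have "arrs s5 ''R'' = arrs s2 ''R''" using f3 s4(3) f5 by (simp add: fr_arr)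
 hence ra: "seg s5 ''R'' (length N) = N" using s2(2) ol by (simp add: seg_def)
 have r: "runs out3 ((120 * np * 16 + 25) + ((120 * np * 4 + 3) + (1 + ((60 * np * 4 + 3) + 2)))) s s5"
  unfolding out3_def by (rule runs_Seq[OF s1(1) runs_Seq[OF s2(1) runs_Seq[OF r3 runs_Seq[OF s4(1) r5]]]])
 show ?thesis
  using output_steps[OF ra Nn R5] output_steps[OF pa ne(1) P5(1)] P5(2)
  by (intro exI[of _ s5] conjI runs_mono[OF r]) (simp_all add: N_def A_def B_def)
qed

text \<open>If the second candidate is rejected, the first is the only realizable one, since a
  second realizable candidate would make all of them realizable.\<close>

lemma caseB2_spec:
 assumes "mid a b s" "a < 2 * z + 1" "b < 2 * z + 1" "is_first a" "is_second a b" "Real (cand (kk a))"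
 shows "EX s'. runs caseB2 (Vb + 3300 * np) s s' & outcome s'"
proof -
 have b0: "bctx s" and sB: "seg s ''QB'' (regs s ''bn'') = cand (kk b)" using assms(1) by (simp_all add: mid_def)
 obtain s1 s2 where s1: "runs (loadQ ''QB'' ''bn'') (243 * np) s s1" "runs verify Vb s1 s2" "fr (insert ''Qn'' verR) (insert ''Q'' verA) s s2"
   "verdict (cand (kk b)) s2"
  using load_verify[OF b0 sB assms(3)] by auto
 have v2: "regs s2 ''kd'' = 0 <-> Real (cand (kk b))" using s1(4) by (simp add: verdict_def)
 have m2: "mid a b s2" by (rule mid_fr[OF assms(1) s1(3)]) auto
 note se = second_LamE[OF assms(4,5)]
 show ?thesis
 proof (cases "Real (cand (kk b))")
  case True
  obtain s3 where s3: "runs out3 (3000 * np) s2 s3" "regs s3 ''case'' = 3"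
    "output_walk s3 ''R'' = steps (nf (cand (kk b) @ rev (cand (kk a))))" "output_walk s3 ''P'' = steps (cand (kk a))"
   using out3_spec[OF m2 assms(2,3)] by blast
  have r: "runs caseB2 (243 * np + (Vb + Suc (3000 * np))) s s3" unfolding caseB2_def
   by (rule runs_Seq[OF s1(1) runs_Seq[OF s1(2) runs_CondTrue[OF _ s3(1)]]]) (use v2 True in simp)
  have "outcome s3" unfolding outcome_def Let_def s3
   using case3[OF se assms(6) True Real_cand] by simp
  thus ?thesis by (intro exI[of _ s3] conjI runs_mono[OF r]) simp_all
 next
  case False
  have b2: "bctx s2" and sA: "seg s2 ''QA'' (regs s2 ''an'') = cand (kk a)" using m2 by (simp_all add: mid_def)
  obtain s3 where s3: "runs (loadQ ''QA'' ''an'') (243 * np) s2 s3" "ctx (cand (kk a)) s3"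
   using load_verify[OF b2 sA assms(2)] by auto
  let ?d = "Seq (Assign ''Q'' (Sub (Reg ''Qn'') (Const 1))) (Assign ''case'' (Const 2))"
  define s4 where "s4 = ev ?d s3"
  have r4: "runs ?d 2 s3 s4" unfolding s4_def by (rule run_ev) simp_all
  have k4: "regs s4 ''case'' = 2" "regs s4 ''Q'' = regs s4 ''Qn'' - 1" "Qs s4 = cand (kk a)"
   using s3(2) by (simp_all add: s4_def ctx_def Qs_def)
  have u: "Q = cand (kk a)" if R: "Real Q" for Q
  proof -
   obtain k where k: "k : LamE" "Q = cand k" using Real_cand[OF R] by blast
   have "k = kk a" by (rule Real_unique[OF se(2) False se(1) assms(6) k(1)]) (use R k in simp)
   thus ?thesis using k by simp
  qed
  have "outcome s4" by (rule outcome_2[OF k4(1) _ k4(2)]) (simp add: k4(3) assms(6), simp add: k4(3), rule u)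
  moreover have r: "runs caseB2 (243 * np + (Vb + Suc (243 * np + 2))) s s4" unfolding caseB2_def
   by (rule runs_Seq[OF s1(1) runs_Seq[OF s1(2) runs_CondFalse[OF _ runs_Seq[OF s3(1) r4]]]]) (use v2 False in simp)
  ultimately show ?thesis by (intro exI[of _ s4] conjI runs_mono[OF r]) simp_all
 qed
qed

lemma caseB_spec:
 assumes "bctx s"
 shows "EX s'. runs caseB (2 * (37 * np * (6300 * np)) + 2 * Vb + 4000 * np) s s' & outcome s'"
proof -
 let ?c = "Seq (Assign ''an'' (Const 0)) (Assign ''bn'' (Const 0))"
 define s1 where "s1 = ev ?c s"
 have r1: "runs ?c 2 s s1" unfolding s1_def by (rule run_ev) simp_all
 have k1: "regs s1 ''an'' = 0" "regs s1 ''bn'' = 0" by (simp_all add: s1_def)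
 have b1: "bctx s1" by (rule bctx_fr[OF assms(1) runs_fr[OF r1]]) auto
 obtain s2 where s2: "runs (scan act1) (37 * np * (6300 * np)) s1 s2" "bctx s2" "J1 (2 * z + 1) s2"
  using scan1_spec[OF b1 k1] by blast
 show ?thesis
 proof (cases "regs s2 ''bn'' = 0")
  case True
  let ?d = "Assign ''case'' (Const 1)"
  define s3 where "s3 = ev ?d s2"
  have r3: "runs ?d 1 s2 s3" unfolding s3_def by (rule run_ev) simp_all
  have r: "runs caseB (2 + (37 * np * (6300 * np) + Suc 1)) s s3" unfolding caseB_def
   by (rule runs_Seq[OF r1 runs_Seq[OF s2(1) runs_CondTrue[OF _ r3]]]) (simp add: True)
  have nb: "seg s2 ''QB'' (regs s2 ''bn'') ~= cand k" for k using cand_pos True by fastforce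
  have nR: "~ Real Q" for Q
  proof
   assume "Real Q"
   then obtain k where "k : LamP" using Real_LamP by blast
   from LamP_window[OF this] obtain a b where ab: "a < b" "b < 2 * z + 1" "kk a : LamP" "kk b : LamP" by blast
   from s2(3)[unfolded J1_def] show False
   proof (elim disjE)
    assume "regs s2 ''an'' = 0 & regs s2 ''bn'' = 0 & (ALL c<2 * z + 1. kk c ~: LamP)"
    thus False using ab by blast
   next
    assume "EX a<2 * z + 1. is_first a & seg s2 ''QA'' (regs s2 ''an'') = cand (kk a) &
     (regs s2 ''bn'' = 0 & (ALL c. a < c & c < 2 * z + 1 --> kk c ~: LamP) |
      (EX b<2 * z + 1. is_second a b & seg s2 ''QB'' (regs s2 ''bn'') = cand (kk b)))"
    then obtain a' where a': "is_first a'" "ALL c. a' < c & c < 2 * z + 1 --> kk c ~: LamP"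
     by (elim disjE exE conjE) ((rule that; assumption) | (rule notE[OF nb], assumption))+
    have "~ a < a'" using a'(1) ab(3) unfolding is_first_def by blast
    hence "a' < b" using ab(1) by simp
    thus False using a'(2) ab(2,4) by blast
   qed
  qed
  have "outcome s3" by (rule outcome_1[OF _ nR]) (simp add: s3_def)
  thus ?thesis by (intro exI[of _ s3] conjI runs_mono[OF r]) simp_all
 next
  case False
  from s2(3)[unfolded J1_def] obtain a b where ab: "a < 2 * z + 1" "is_first a" "seg s2 ''QA'' (regs s2 ''an'') = cand (kk a)"
   "b < 2 * z + 1" "is_second a b" "seg s2 ''QB'' (regs s2 ''bn'') = cand (kk b)"
   by (elim disjE exE conjE) ((rule notE[OF False], assumption) | (rule that; assumption))+
  have m2: "mid a b s2" using s2(2) ab by (simp add: mid_def)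
  obtain s3 s4 where s4: "runs (loadQ ''QA'' ''an'') (243 * np) s2 s3" "runs verify Vb s3 s4" "fr (insert ''Qn'' verR) (insert ''Q'' verA) s2 s4"
    "verdict (cand (kk a)) s4"
   using load_verify[OF s2(2) ab(3,1)] by auto
  note v4 = s4(4)[unfolded verdict_def]
  have m4: "mid a b s4" by (rule mid_fr[OF m2 s4(3)]) auto
  show ?thesis
  proof (cases "Real (cand (kk a))")
   case True
   obtain s5 where s5: "runs caseB2 (Vb + 3300 * np) s4 s5" "outcome s5"
    using caseB2_spec[OF m4 ab(1,4,2,5) True] by blast
   have r: "runs caseB (2 + (37 * np * (6300 * np) + Suc (243 * np + (Vb + Suc (Vb + 3300 * np))))) s s5" unfolding caseB_def
    by (rule runs_Seq[OF r1 runs_Seq[OF s2(1) runs_CondFalse[OF _ runs_Seq[OF s4(1) runs_Seq[OF s4(2) runs_CondTrue[OF _ s5(1)]]]]]])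
     (use False v4 True in simp_all)
   show ?thesis by (intro exI[of _ s5] conjI runs_mono[OF r] s5(2)) simp
  next
   case F: False
   have b4: "bctx s4" using m4 by (simp add: mid_def)
   have "bad (cand (kk a)) (regs s4 ''kd'') (regs s4 ''ix'')" using v4 F by simp
   moreover have "kk a : LamP" using ab(2) by (simp add: is_first_def)
   ultimately obtain s5 where s5: "runs caseB1 (37 * np * (6300 * np) + Vb + 260 * np) s4 s5" "outcome s5"
    using caseB1_spec[OF b4] by blast
   have r: "runs caseB (2 + (37 * np * (6300 * np) + Suc (243 * np + (Vb + Suc (37 * np * (6300 * np) + Vb + 260 * np))))) s s5" unfolding caseB_def
    by (rule runs_Seq[OF r1 runs_Seq[OF s2(1) runs_CondFalse[OF _ runs_Seq[OF s4(1) runs_Seq[OF s4(2) runs_CondFalse[OF _ s5(1)]]]]]])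
     (use False v4 F in simp_all)
   show ?thesis by (intro exI[of _ s5] conjI runs_mono[OF r] s5(2)) simp
  qed
 qed
qed

end

section \<open>The axis of a closed walk\<close>

text \<open>The closed walk consists of a tail of \<open>t\<close> steps, a cyclically reduced core,
  and the tail backwards; the last assumption makes the tail maximal.\<close>

locale cwalk =
 fixes xs :: "'b list" and t :: nat
 assumes xs: "red xs" "1 < length xs" "hd xs = last xs"
  and t1: "!!i. i < t ==> xs ! Suc i = xs ! (length xs - 2 - i)"
  and t2: "xs ! Suc t ~= xs ! (length xs - 2 - t)"
begin

lemma ends: "i < Suc t ==> xs ! i = xs ! (length xs - 1 - i)"
proof (cases i)
 case 0
 thus ?thesis using xs by (simp add: hd_conv_nth last_conv_nth) (metis hd_conv_nth last_conv_nth One_nat_def list.size(3) not_less_zero)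
next
 case (Suc j)
 assume "i < Suc t"
 thus ?thesis using t1[of j] Suc by (simp add: numeral_2_eq_2)
qed

text \<open>The two ends cannot meet: a closed walk that retraces itself up to its middle has a
  stutter or a backtrack there. So the core keeps at least three steps.\<close>

lemma short: "i <= t ==> 2 * i + 3 < length xs"
proof (induction i)
 case 0
 have "length xs ~= 2"
 proof
  assume l: "length xs = 2"
  have "xs ! 0 ~= xs ! Suc 0" using xs(1) l unfolding red_iff by auto
  thus False using ends[of 0] l by simp
 qed
 moreover have "length xs ~= 3"
 proof
  assume l: "length xs = 3"
  have "xs ! 0 ~= xs ! Suc (Suc 0)" using xs(1) l unfolding red_iff by auto
  thus False using ends[of 0] l by (simp add: numeral_2_eq_2)
 qed
 ultimately show ?case using xs(2) by simp
next
 case (Suc i)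
 hence l: "2 * i + 3 < length xs" by simp
 have e: "xs ! Suc i = xs ! (length xs - 1 - Suc i)" using ends[of "Suc i"] Suc.prems by simp
 have "length xs ~= 2 * i + 4"
 proof
  assume k: "length xs = 2 * i + 4"
  have a: "length xs - 1 - Suc i = Suc (Suc i)" using k by simp
  have "xs ! Suc i ~= xs ! Suc (Suc i)" using xs(1) k unfolding red_iff by simp
  thus False using e unfolding a by simp
 qed
 moreover have "length xs ~= 2 * i + 5"
 proof
  assume k: "length xs = 2 * i + 5"
  have a: "length xs - 1 - Suc i = Suc (Suc (Suc i))" using k by simp
  have "xs ! Suc i ~= xs ! Suc (Suc (Suc i))" using xs(1) k unfolding red_iff by simp
  thus False using e unfolding a by simp
 qed
 ultimately show ?case using l by simp
qed

definition cl :: nat where "cl = length xs - 1 - 2 * t"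

lemma cl: "2 < cl" "length xs = 2 * t + cl + 1"
 using short[of t] by (simp_all add: cl_def)

definition ax :: "int => 'b" where "ax i = xs ! (t + nat (i mod int cl))"

definition ctl :: "'b list" where "ctl = take (Suc t) xs"

lemma ax_per: "per ax (int cl)" by (simp add: per_def ax_def)

lemma ax_nat: "j <= cl ==> ax (int j) = xs ! (t + j)"
proof (cases "j = cl")
 case True
 have "length xs - 1 - t = t + cl" using cl by simp
 thus ?thesis using ends[of t] True by (simp add: ax_def)
next
 case False
 assume "j <= cl"
 thus ?thesis using False by (simp add: ax_def)
qed

text \<open>Within one turn of the core this is reducedness of \<open>xs\<close>; across the
  junction of two turns it is the maximality of the tail.\<close>

lemma bired_ax: "bired ax"
 unfolding bired_def
proof (intro allI conjI)
 fix i :: int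
 define r where "r = nat (i mod int cl)"
 have r: "r < cl" "int r = i mod int cl" using cl(1) by (simp_all add: r_def nat_less_iff)
 have sh: "ax (i + int k) = ax (int (r + k))" for k
  unfolding ax_def by (simp add: r(2) mod_add_left_eq)
 have "ax (i + int 0) = xs ! (t + r)" unfolding sh using ax_nat[of r] r(1) by simp
 hence a0: "ax i = xs ! (t + r)" by simp
 have "ax (i + int 1) = xs ! (t + r + 1)" unfolding sh using ax_nat[of "r + 1"] r(1) by simp
 hence a1: "ax (i + 1) = xs ! (t + r + 1)" by simp
 have "xs ! (t + r) ~= xs ! Suc (t + r)" using xs(1) r(1) cl(2) unfolding red_iff by auto
 thus "ax i ~= ax (i + 1)" using a0 a1 by simp
 show "ax i ~= ax (i + 2)"
 proof (cases "r + 2 <= cl")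
  case True
  have "ax (i + int 2) = xs ! (t + r + 2)" unfolding sh using ax_nat[OF True] by (simp add: add.assoc)
  moreover have "xs ! (t + r) ~= xs ! Suc (Suc (t + r))" using xs(1) True cl(2) unfolding red_iff by auto
  ultimately show ?thesis using a0 by (simp add: numeral_2_eq_2)
 next
  case False
  hence r1: "r + 1 = cl" using r(1) by simp
  have "ax (i + int 2) = ax (int 1 + int cl)" unfolding sh using r1 by (metis of_nat_add add.assoc add.commute one_add_one)
  hence "ax (i + 2) = ax (int 1)" using ax_per by (simp add: per_def)
  also have "\<dots> = xs ! (t + 1)" using ax_nat[of 1] cl(1) by simp
  finally have "ax (i + 2) = xs ! Suc t" by simp
  moreover have "t + r = length xs - 2 - t" using r1 cl(2) by simp
  ultimately show ?thesis using a0 t2 by simp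
 qed
qed

lemma ctl: "ctl ~= []" "hd ctl = hd xs" "last ctl = ax 0" "length ctl = Suc t" "set ctl <= set xs"
proof -
 have l: "Suc t <= length xs" using cl by simp
 show "length ctl = Suc t" using l by (simp add: ctl_def)
 thus ne: "ctl ~= []" by auto
 show "hd ctl = hd xs" by (simp add: ctl_def)
 have "last ctl = ctl ! t" using ne \<open>length ctl = Suc t\<close> by (simp add: last_conv_nth)
 also have "\<dots> = xs ! t" by (simp add: ctl_def)
 also have "\<dots> = ax 0" using ax_nat[of 0] by simp
 finally show "last ctl = ax 0" .
 show "set ctl <= set xs" by (simp add: ctl_def set_take_subset)
qed

lemma ax_set: "ax i : set xs"
proof -
 have "nat (i mod int cl) < cl" using cl(1) by (simp add: nat_less_iff)
 thus ?thesis unfolding ax_def using cl(2) by (intro nth_mem) simp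
qed

lemma rev_ctl: "j <= t ==> rev ctl ! j = xs ! (length xs - 1 - t + j)"
proof -
 assume j: "j <= t"
 have "rev ctl ! j = ctl ! (t - j)" using j ctl(4) by (simp add: rev_nth)
 also have "\<dots> = xs ! (t - j)" by (simp add: ctl_def)
 also have "\<dots> = xs ! (length xs - 1 - (t - j))" by (rule ends) simp
 also have "length xs - 1 - (t - j) = length xs - 1 - t + j" using j cl by simp
 finally show ?thesis .
qed

lemma xs_decomp: "nf xs = nf (ctl @ sg ax 0 (int cl) @ rev ctl)"
proof -
 let ?s = "sg ax 0 (int cl)"
 have s: "?s = take (Suc cl) (drop t xs)"
 proof (rule nth_equalityI)
  show "length ?s = length (take (Suc cl) (drop t xs))" using cl by simp
  fix i assume "i < length ?s"
  hence i: "i <= cl" by simp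
  have "?s ! i = ax (0 + int i)" by (rule nth_sg) (use i in simp_all)
  thus "?s ! i = take (Suc cl) (drop t xs) ! i" using ax_nat[OF i] i cl by simp
 qed
 have d: "rev ctl = drop (t + cl) xs"
 proof (rule nth_equalityI)
  show "length (rev ctl) = length (drop (t + cl) xs)" using cl ctl(4) by simp
  fix i assume "i < length (rev ctl)"
  hence i: "i <= t" using ctl(4) by simp
  have "length xs - 1 - t = t + cl" using cl by simp
  thus "rev ctl ! i = drop (t + cl) xs ! i" using rev_ctl[OF i] cl by simp
 qed
 have "xs ! t = ax 0" using ax_nat[of 0] by simp
 hence c: "ctl = take t xs @ [ax 0]" using cl by (simp add: ctl_def take_Suc_conv_app_nth)
 have "xs ! (t + cl) = ax (int cl)" using ax_nat[of cl] by simp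
 hence d': "drop (t + cl) xs = ax (int cl) # drop (Suc (t + cl)) xs" using cl Cons_nth_drop_Suc[of "t + cl" xs] by simp
 have "ctl @ ?s @ rev ctl = take t xs @ ax 0 # ?s @ ax (int cl) # drop (Suc (t + cl)) xs"
  by (simp add: d d') (simp add: c)
 hence "nf (ctl @ ?s @ rev ctl) = nf (take t xs @ ?s @ ax (int cl) # drop (Suc (t + cl)) xs)"
  using nf_join'[of "?s @ ax (int cl) # drop (Suc (t + cl)) xs" "ax 0" "take t xs" "[]"] by simp
 also have "\<dots> = nf (take t xs @ ?s @ drop (Suc (t + cl)) xs)" by (rule nf_join) simp_all
 also have "take t xs @ ?s @ drop (Suc (t + cl)) xs = xs"
  unfolding s by (metis add.commute add_Suc append_assoc append_take_drop_id drop_drop)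
 finally show ?thesis by simp
qed

end

text \<open>The loop runs over the whole list, but \<open>t\<close> advances only while it equals
  the counter, so it stays at the first mismatch.\<close>

definition tlc :: "string => string => string => com" where
 "tlc X xn t = Seq (Assign t (Const 0)) (For ''i5'' (Reg xn)
   (Cond (Conj (eqe (Reg t) (Reg ''i5'')) (eqe (Read X (Add (Reg ''i5'') (Const 1))) (Read X (Sub (Sub (Reg xn) (Const 2)) (Reg ''i5'')))))
    (Assign t (Add (Reg ''i5'') (Const 1))) Skip))"

lemma tlc_spec:
 assumes "seg s X (regs s xn) = xs" "red xs" "1 < length xs" "hd xs = last xs" "t ~= ''i5''" "xn ~= ''i5''" "t ~= xn" "length xs <= M"
 shows "EX s'. runs (tlc X xn t) (M * 5 + 3) s s' & cwalk xs (regs s' t) & fr {t, ''i5''} {} s s'"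
proof -
 define N where "N = length xs"
 have N: "regs s xn = N" using arg_cong[OF assms(1), of length] by (simp add: N_def)
 have X: "arrs s X i = xs ! i" if "i < N" for i using nth_seg[of i N s X] assms(1) N that by metis
 define s1 where "s1 = s\<lparr>regs := (regs s)(t := 0)\<rparr>"
 have r1: "runs (Assign t (Const 0)) 1 s s1" using runs_Assign[of t "Const 0" s] by (simp add: s1_def)
 define ok where "ok i <-> arrs s X (i + 1) = arrs s X (N - 2 - i)" for i
 let ?c = "Cond (Conj (eqe (Reg t) (Reg ''i5'')) (eqe (Read X (Add (Reg ''i5'') (Const 1))) (Read X (Sub (Sub (Reg xn) (Const 2)) (Reg ''i5'')))))
    (Assign t (Add (Reg ''i5'') (Const 1))) Skip"
 let ?I = "%k s'. (ALL i<regs s' t. ok i) & regs s' t <= k & (regs s' t < k --> ~ ok (regs s' t))"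
 have "EX s'. runs (For ''i5'' (Reg xn) ?c) (N * (3 + 2) + 2) s1 s' & ?I N s' & frl ''i5'' ?c s1 s'"
 proof (rule For_rule[where I = ?I])
  fix s' assume F: "frl ''i5'' ?c s1 s'"
  have "regs s' xn = regs s1 xn" by (rule fr_reg[OF F]) (use assms(5-7) in auto)
  thus "aval (Reg xn) s' = N" using N assms(7) by (simp add: s1_def)
 next
  fix k s' assume k: "frl ''i5'' ?c s1 s'" "regs s' ''i5'' = k" "?I k s'"
  have xn: "regs s' xn = N" using fr_reg[OF k(1), of xn] N assms(5-7) by (auto simp: s1_def)
  have ar: "arrs s' X = arrs s X" using fr_arr[OF k(1), of X] by (simp add: s1_def)
  have b: "bval (Conj (eqe (Reg t) (Reg ''i5'')) (eqe (Read X (Add (Reg ''i5'') (Const 1))) (Read X (Sub (Sub (Reg xn) (Const 2)) (Reg ''i5''))))) s'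
   <-> regs s' t = k & ok k" using k(2) xn ar by (auto simp: ok_def)
  have t': "regs (ev ?c s') t = (if regs s' t = k & ok k then k + 1 else regs s' t)"
   unfolding ev.simps b by (simp add: k(2))
  have "?I (Suc k) (ev ?c s')" unfolding t' using k(3) by (auto simp: less_Suc_eq)
  moreover have "runs ?c 3 s' (ev ?c s')" by (rule run_ev) simp_all
  ultimately show "EX s''. runs ?c 3 s' s'' & ?I (Suc k) s''" by blast
 qed (use assms(5) in \<open>auto simp: s1_def\<close>)
 then obtain s2 where s2: "runs (For ''i5'' (Reg xn) ?c) (N * (3 + 2) + 2) s1 s2" "?I N s2" by blast
 have r: "runs (tlc X xn t) (1 + (N * (3 + 2) + 2)) s s2" unfolding tlc_def by (rule runs_Seq[OF r1 s2(1)])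
 have cw: "xs ! Suc i = xs ! (length xs - 2 - i)" if "i < regs s2 t" "2 * i + 3 < N" for i
 proof -
  have "ok i" using s2(2) that by blast
  thus ?thesis using X[of "i + 1"] X[of "N - 2 - i"] that by (simp add: ok_def N_def)
 qed
 \<comment> \<open>The first mismatch occurs before the middle of the list, where the truncated
   subtractions of the program are exact.\<close>
 have sh: "2 * i + 3 < N" if "i <= regs s2 t" for i
  using that
 proof (induction i)
  case (Suc j)
  have IH: "2 * i + 3 < N" if "i <= j" for i using that Suc by simp
  hence "xs ! Suc i = xs ! (length xs - 2 - i)" if "i < Suc j" for i using cw[of i] that Suc.prems IH[of i] by simp
  hence e: "xs ! Suc i = xs ! (length xs - 2 - i)" if "i < Suc j" for i using that by blast
  have l: "2 * j + 3 < N" using IH by simp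
  have ee: "xs ! Suc j = xs ! (N - 2 - j)" using e[of j] by (simp add: N_def)
  have "N ~= 2 * j + 4"
  proof
   assume k: "N = 2 * j + 4"
   have a: "N - 2 - j = Suc (Suc j)" using k by simp
   have "xs ! Suc j ~= xs ! Suc (Suc j)" using assms(2) k unfolding red_iff N_def by simp
   thus False using ee unfolding a by simp
  qed
  moreover have "N ~= 2 * j + 5"
  proof
   assume k: "N = 2 * j + 5"
   have a: "N - 2 - j = Suc (Suc (Suc j))" using k by simp
   have "xs ! Suc j ~= xs ! Suc (Suc (Suc j))" using assms(2) k unfolding red_iff N_def by simp
   thus False using ee unfolding a by simp
  qed
  ultimately show ?case using l by simp
 next
  case 0
  have e: "xs ! 0 = xs ! (N - 1)" using assms(3,4) by (cases xs) (auto simp: hd_conv_nth last_conv_nth N_def)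
  have "N ~= 2"
  proof
   assume k: "N = 2"
   thus False using e assms(2) unfolding red_iff N_def by auto
  qed
  moreover have "N ~= 3"
  proof
   assume k: "N = 3"
   hence a: "N - 1 = Suc (Suc 0)" by simp
   have "xs ! 0 ~= xs ! Suc (Suc 0)" using assms(2) k unfolding red_iff N_def by simp
   thus False using e unfolding a by simp
  qed
  ultimately show ?case using assms(3) by (simp add: N_def)
 qed
 have tN: "2 * regs s2 t + 3 < N" using sh by simp
 hence "~ ok (regs s2 t)" using s2(2) by simp
 hence n2: "xs ! Suc (regs s2 t) ~= xs ! (length xs - 2 - regs s2 t)"
  using X[of "regs s2 t + 1"] X[of "N - 2 - regs s2 t"] tN by (simp add: ok_def N_def)
 have n1: "xs ! Suc i = xs ! (length xs - 2 - i)" if "i < regs s2 t" for i using cw[OF that] sh[of i] that by simp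
 have "cwalk xs (regs s2 t)" by (unfold_locales; (rule assms | rule n1 | rule n2); assumption?)
 moreover have "wR (tlc X xn t) = {t, ''i5''}" "wA (tlc X xn t) = {}" by (auto simp: tlc_def)
 hence "fr {t, ''i5''} {} s s2" using runs_fr[OF r] by simp
 moreover have "runs (tlc X xn t) (M * 5 + 3) s s2" by (rule runs_mono[OF r]) (use assms(8) in \<open>simp add: N_def\<close>)
 ultimately show ?thesis by blast
qed

section \<open>Preprocessing of the input\<close>

text \<open>Recovers the source of every arc by merging positions with offsets: each iteration
  either records the current vertex for one position or advances to the next vertex, so the number
  of vertices plus the number of arcs suffices.\<close>

definition ptrc :: "string => string => aexp => com" where
 "ptrc off D e = Seq (Seq (Assign ''a'' (Const 0)) (Assign ''p'' (Const 0))) (For ''i5'' e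
   (Cond (Less (Reg ''p'') (Read off (Add (Reg ''a'') (Const 1))))
    (Seq (Store D (Reg ''p'') (Reg ''a'')) (Assign ''p'' (Add (Reg ''p'') (Const 1))))
    (Assign ''a'' (Add (Reg ''a'') (Const 1)))))"

lemma wR_ptrc[simp]: "wR (ptrc off D e) = {''a'', ''p'', ''i5''}" and wA_ptrc[simp]: "wA (ptrc off D e) = {D}"
 by (auto simp: ptrc_def)

lemma ptrc_spec:
 fixes ofs :: "nat => nat"
 assumes ofs: "!!v. v <= N ==> arrs s off v = ofs v" "ofs 0 = 0" "ofs N = M" "!!v. v < N ==> ofs v <= ofs (Suc v)"
  and src: "!!v j. v < N ==> ofs v <= j ==> j < ofs (Suc v) ==> src j = v"
  and e: "!!s'. fr {''a'', ''p'', ''i5''} {D} s s' ==> aval e s' = N + M" and "D ~= off" "0 < N"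
 shows "EX s'. runs (ptrc off D e) ((N + M) * 6 + 4) s s' & (ALL j<M. arrs s' D j = src j) & fr {''a'', ''p'', ''i5''} {D} s s'"
proof -
 let ?i = "Seq (Assign ''a'' (Const 0)) (Assign ''p'' (Const 0))"
 let ?c = "Cond (Less (Reg ''p'') (Read off (Add (Reg ''a'') (Const 1))))
    (Seq (Store D (Reg ''p'') (Reg ''a'')) (Assign ''p'' (Add (Reg ''p'') (Const 1))))
    (Assign ''a'' (Add (Reg ''a'') (Const 1)))"
 have le: "ofs v <= M" if "v <= N" for v
  using that by (induction rule: inc_induct) (use ofs(3,4) order_trans in blast)+
 define s1 where "s1 = ev ?i s"
 have r1: "runs ?i 2 s s1" unfolding s1_def by (rule run_ev) simp_all
 have f1: "fr {''a'', ''p'', ''i5''} {D} s s1" by (rule fr_mono[OF runs_fr[OF r1]]) simp_all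
 let ?I = "%k s'. regs s' ''a'' + regs s' ''p'' = k & regs s' ''a'' <= N & (regs s' ''a'' < N --> ofs (regs s' ''a'') <= regs s' ''p'' & regs s' ''p'' <= ofs (Suc (regs s' ''a''))) &
   (regs s' ''a'' = N --> regs s' ''p'' = M) & (ALL j<regs s' ''p''. arrs s' D j = src j)"
 have w: "insert ''i5'' (wR ?c) = {''a'', ''p'', ''i5''}" "wA ?c = {D}" by auto
 have "EX s'. runs (For ''i5'' e ?c) ((N + M) * (4 + 2) + 2) s1 s' & ?I (N + M) s' & frl ''i5'' ?c s1 s'"
 proof (rule For_rule[where I = ?I])
  fix s' assume "frl ''i5'' ?c s1 s'"
  hence "fr {''a'', ''p'', ''i5''} {D} s1 s'" unfolding w .
  from fr_trans_same[OF f1 this] show "aval e s' = N + M" by (rule e)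
 next
  fix k s' assume k: "k < N + M" "frl ''i5'' ?c s1 s'" "?I k s'"
  define a p where "a = regs s' ''a''" and "p = regs s' ''p''"
  have i: "a + p = k" "a <= N" "a < N ==> ofs a <= p & p <= ofs (Suc a)" "a = N ==> p = M" "ALL j<p. arrs s' D j = src j"
   using k(3) by (simp_all add: a_def p_def)
  have aN: "a < N" using i(1,2,4) k(1) by (cases "a = N") auto
  have "arrs s' off = arrs s1 off" using fr_arr[OF k(2)] assms(7) by simp
  moreover have "arrs s1 off = arrs s off" by (simp add: s1_def)
  ultimately have o: "arrs s' off (a + 1) = ofs (Suc a)" using ofs(1)[of "a + 1"] aN by simp
  have "?I (Suc k) (ev ?c s')"
  proof (cases "p < ofs (Suc a)")
   case True
   have b: "bval (Less (Reg ''p'') (Read off (Add (Reg ''a'') (Const 1)))) s'" using True o by (simp add: a_def p_def)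
   have e': "regs (ev ?c s') ''a'' = a" "regs (ev ?c s') ''p'' = p + 1" "arrs (ev ?c s') D = (arrs s' D)(p := a)"
    unfolding ev.simps if_P[OF b] by (simp_all add: a_def p_def)
   have "src p = a" using src[OF aN _ True] i(3)[OF aN] by simp
   thus ?thesis unfolding e' using i aN True by (auto simp: less_Suc_eq)
  next
   case False
   have b: "~ bval (Less (Reg ''p'') (Read off (Add (Reg ''a'') (Const 1)))) s'" using False o by (simp add: a_def p_def)
   have e': "regs (ev ?c s') ''a'' = a + 1" "regs (ev ?c s') ''p'' = p" "arrs (ev ?c s') D = arrs s' D"
    unfolding ev.simps if_not_P[OF b] by (simp_all add: a_def p_def)
   have pe: "p = ofs (Suc a)" using False i(3)[OF aN] by simp
   thus ?thesis unfolding e' using i aN ofs(3) ofs(4)[of "Suc a"] by (cases "Suc a = N") auto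
  qed
  moreover have "runs ?c 4 s' (ev ?c s')" by (rule run_ev) simp_all
  ultimately show "EX s''. runs ?c 4 s' s'' & ?I (Suc k) s''" by blast
 next
  show "''i5'' ~: wR ?c" by simp
  show "?I 0 s1" using ofs(2) ofs(4)[of 0] assms(8) by (simp add: s1_def)
 qed auto
 then obtain s2 where s2: "runs (For ''i5'' e ?c) ((N + M) * (4 + 2) + 2) s1 s2" "?I (N + M) s2" "frl ''i5'' ?c s1 s2" by blast
 have pM: "regs s2 ''p'' = M"
 proof (cases "regs s2 ''a'' = N")
  case False
  hence "regs s2 ''p'' <= ofs (Suc (regs s2 ''a''))" using s2(2) by simp
  also have "\<dots> <= M" using False s2(2) by (intro le) simp
  finally show ?thesis using s2(2) False by simp
 qed (use s2(2) in simp)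
 have D: "ALL j<M. arrs s2 D j = src j" using s2(2) unfolding pM by blast
 have r: "runs (ptrc off D e) (2 + ((N + M) * (4 + 2) + 2)) s s2" unfolding ptrc_def by (rule runs_Seq[OF r1 s2(1)])
 have "fr {''a'', ''p'', ''i5''} {D} s s2" using runs_fr[OF r] by simp
 thus ?thesis using D by (intro exI[of _ s2] conjI runs_mono[OF r]) simp_all
qed

text \<open>The matrix has quadratically many cells, but only one store per arc is made; all other
  cells are 0 from the start. The beginnings of rows come from repeated addition, as the machine
  does not multiply.\<close>

definition hmc :: com where
 "hmc = Seq (Seq (Assign ''p'' (Const 0)) (For ''i5'' (Reg ''nH'') (Seq (Store ''rH'' (Reg ''i5'') (Reg ''p'')) (Assign ''p'' (Add (Reg ''p'') (Reg ''nH''))))))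
   (For ''i5'' (Reg ''mH'') (Store ''HM'' (Add (Read ''rH'' (Read ''HU'' (Reg ''i5''))) (Read ''H_out'' (Reg ''i5''))) (Const 1)))"

lemma wR_hmc[simp]: "wR hmc = {''p'', ''i5''}" and wA_hmc[simp]: "wA hmc = {''rH'', ''HM''}"
 by (auto simp: hmc_def)

lemma hmc_spec:
 assumes "regs s ''nH'' = nH" "regs s ''mH'' = mH" "length BL = mH" "set BL <= {..<nH} \<times> {..<nH}"
  "!!j. j < mH ==> arrs s ''HU'' j = fst (BL ! j) & arrs s ''H_out'' j = snd (BL ! j)" "arrs s ''HM'' = (%_. 0)"
 shows "EX s'. runs hmc (nH * 4 + mH * 3 + 5) s s' &
  (ALL a<nH. ALL b<nH. 0 < arrs s' ''HM'' (arrs s' ''rH'' a + b) <-> (a, b) : set BL) & fr {''p'', ''i5''} {''rH'', ''HM''} s s'"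
proof -
 let ?c = "Seq (Store ''rH'' (Reg ''i5'') (Reg ''p'')) (Assign ''p'' (Add (Reg ''p'') (Reg ''nH'')))"
 let ?d = "Store ''HM'' (Add (Read ''rH'' (Read ''HU'' (Reg ''i5''))) (Read ''H_out'' (Reg ''i5''))) (Const 1)"
 define s1 where "s1 = s\<lparr>regs := (regs s)(''p'' := 0)\<rparr>"
 have r1: "runs (Assign ''p'' (Const 0)) 1 s s1" using runs_Assign[of "''p''" "Const 0" s] by (simp add: s1_def)
 let ?I = "%k s'. regs s' ''p'' = k * nH & (ALL a<k. arrs s' ''rH'' a = a * nH)"
 have "EX s'. runs (For ''i5'' (Reg ''nH'') ?c) (nH * (2 + 2) + 2) s1 s' & ?I nH s' & frl ''i5'' ?c s1 s'"
 proof (rule For_rule[where I = ?I])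
  fix s' assume "frl ''i5'' ?c s1 s'"
  thus "aval (Reg ''nH'') s' = nH" using assms(1) by (simp add: fr_reg s1_def)
 next
  fix k s' assume k: "frl ''i5'' ?c s1 s'" "regs s' ''i5'' = k" "?I k s'"
  have "regs s' ''nH'' = nH" using k(1) assms(1) by (simp add: fr_reg s1_def)
  hence "?I (Suc k) (ev ?c s')" using k(2,3) by (simp add: less_Suc_eq)
  moreover have "runs ?c 2 s' (ev ?c s')" by (rule run_ev) simp_all
  ultimately show "EX s''. runs ?c 2 s' s'' & ?I (Suc k) s''" by blast
 qed (auto simp: s1_def)
 then obtain s2 where s2: "runs (For ''i5'' (Reg ''nH'') ?c) (nH * (2 + 2) + 2) s1 s2" "?I nH s2" "frl ''i5'' ?c s1 s2" by blast
 have f2: "regs s2 ''mH'' = mH" "arrs s2 ''HU'' = arrs s ''HU''" "arrs s2 ''H_out'' = arrs s ''H_out''" "arrs s2 ''HM'' = (%_. 0)"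
  using s2(3) assms(2,6) by (simp_all add: fr_reg fr_arr s1_def)
 define cd where "cd p = fst p * nH + snd p" for p :: "nat \<times> nat"
 let ?J = "%k s'. arrs s' ''HM'' = (%x. if x : cd ` set (take k BL) then 1 else 0)"
 have "EX s'. runs (For ''i5'' (Reg ''mH'') ?d) (mH * (1 + 2) + 2) s2 s' & ?J mH s' & frl ''i5'' ?d s2 s'"
 proof (rule For_rule[where I = ?J])
  fix s' assume "frl ''i5'' ?d s2 s'"
  thus "aval (Reg ''mH'') s' = mH" using f2(1) by (simp add: fr_reg)
 next
  fix k s' assume k: "k < mH" "frl ''i5'' ?d s2 s'" "regs s' ''i5'' = k" "?J k s'"
  have ar: "arrs s' ''HU'' = arrs s ''HU''" "arrs s' ''H_out'' = arrs s ''H_out''" "arrs s' ''rH'' = arrs s2 ''rH''"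
   using k(2) f2 by (simp_all add: fr_arr)
  have B: "BL ! k : {..<nH} \<times> {..<nH}" using nth_mem[of k BL] assms(3,4) k(1) by auto
  have "arrs s' ''rH'' (fst (BL ! k)) = fst (BL ! k) * nH" using B s2(2) ar(3) by (auto simp: mem_Times_iff)
  hence hm: "arrs (ev ?d s') ''HM'' = (arrs s' ''HM'')(cd (BL ! k) := 1)"
   using assms(5)[OF k(1)] k(3) ar by (simp add: cd_def)
  have st: "set (take (Suc k) BL) = insert (BL ! k) (set (take k BL))"
   using k(1) assms(3) by (simp add: take_Suc_conv_app_nth)
  have "?J (Suc k) (ev ?d s')" unfolding hm st k(4) by (simp add: fun_eq_iff)
  moreover have "runs ?d 1 s' (ev ?d s')" by (rule run_ev) simp_all
  ultimately show "EX s''. runs ?d 1 s' s'' & ?J (Suc k) s''" by blast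
 qed (use f2 in simp_all)
 then obtain s3 where s3: "runs (For ''i5'' (Reg ''mH'') ?d) (mH * (1 + 2) + 2) s2 s3" "?J mH s3" "frl ''i5'' ?d s2 s3" by blast
 have r: "runs hmc ((1 + (nH * (2 + 2) + 2)) + (mH * (1 + 2) + 2)) s s3" unfolding hmc_def by (rule runs_Seq[OF runs_Seq[OF r1 s2(1)] s3(1)])
 have inj: "(a, b) = p" if "cd p = a * nH + b" "b < nH" "p : {..<nH} \<times> {..<nH}" for a b p
 proof -
  have "snd p < nH" using that(3) by auto
  have "(fst p * nH + snd p) div nH = (a * nH + b) div nH" "(fst p * nH + snd p) mod nH = (a * nH + b) mod nH"
   using that(1) by (simp_all add: cd_def)
  hence "fst p = a" "snd p = b" using \<open>snd p < nH\<close> that(2) by simp_all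
  thus ?thesis by auto
 qed
 have fin: "0 < arrs s3 ''HM'' (arrs s3 ''rH'' a + b) <-> (a, b) : set BL" if ab: "a < nH" "b < nH" for a b
 proof -
  have "arrs s3 ''rH'' a = a * nH" using s3(3) s2(2) ab(1) by (simp add: fr_arr)
  hence "0 < arrs s3 ''HM'' (arrs s3 ''rH'' a + b) <-> a * nH + b : cd ` set BL" using s3(2) assms(3) by simp
  also have "\<dots> <-> (a, b) : set BL"
  proof
   assume "a * nH + b : cd ` set BL"
   then obtain p where p: "p : set BL" "cd p = a * nH + b" by auto
   hence "(a, b) = p" using inj[OF p(2) ab(2)] assms(4) by blast
   thus "(a, b) : set BL" using p(1) by simp
  next
   assume "(a, b) : set BL"
   thus "a * nH + b : cd ` set BL" by (rule rev_image_eqI) (simp add: cd_def)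
  qed
  finally show ?thesis .
 qed
 have "fr {''p'', ''i5''} {''rH'', ''HM''} s s3" using runs_fr[OF r] by simp
 thus ?thesis using fin by (intro exI[of _ s3] conjI runs_mono[OF r]) auto
qed

section \<open>Spanning trees\<close>

lemma funpow_fixpoint: "f x = x ==> (f ^^ n) x = x"
 by (induction n) auto

text \<open>\<open>vis\<close> is the depth plus one, with 0 for an unvisited vertex. An arc may
  extend the tree in either direction.\<close>

definition bfsb :: com where
 "bfsb = Seq (Seq (Assign ''u'' (Read ''EU'' (Reg ''i5''))) (Assign ''v'' (Read ''G_out'' (Reg ''i5''))))
  (Cond (Less (Const 0) (Read ''vis'' (Reg ''u'')))
   (Cond (Less (Read ''vis'' (Reg ''v'')) (Const 1))
    (Seq (Store ''vis'' (Reg ''v'') (Add (Read ''vis'' (Reg ''u'')) (Const 1))) (Store ''par'' (Reg ''v'') (Reg ''u''))) Skip)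
   (Cond (Less (Const 0) (Read ''vis'' (Reg ''v'')))
    (Seq (Store ''vis'' (Reg ''u'') (Add (Read ''vis'' (Reg ''v'')) (Const 1))) (Store ''par'' (Reg ''u'') (Reg ''v''))) Skip))"

text \<open>No queue is kept: the time bound allows one pass over all arcs per vertex.\<close>

definition bfsc :: com where
 "bfsc = Seq (Seq (Store ''vis'' (Reg ''q'') (Const 1)) (Store ''par'' (Reg ''q'') (Reg ''q'')))
   (For ''i6'' (Reg ''nG'') (For ''i5'' (Reg ''m'') bfsb))"

lemma wR_bfsb[simp]: "wR bfsb = {''u'', ''v''}" and wA_bfsb[simp]: "wA bfsb = {''vis'', ''par''}"
 by (auto simp: bfsb_def)

lemma wR_bfsc[simp]: "wR bfsc = {''u'', ''v'', ''i5'', ''i6''}" and wA_bfsc[simp]: "wA bfsc = {''vis'', ''par''}"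
 by (auto simp: bfsc_def)

text \<open>Row \<open>v\<close> lists the iterated parents of \<open>v\<close>. The root is its own
  parent, which pads every row with the root to \<open>n + 1\<close> entries.\<close>

definition upc :: com where
 "upc = Seq (Assign ''p'' (Const 0)) (For ''i5'' (Reg ''nG'')
   (Seq (Seq (Store ''rG'' (Reg ''i5'') (Reg ''p'')) (Assign ''x'' (Reg ''i5'')))
    (For ''i6'' (Reg ''n1'') (Seq (Store ''UP'' (Reg ''p'') (Reg ''x'')) (Seq (Assign ''p'' (Add (Reg ''p'') (Const 1))) (Assign ''x'' (Read ''par'' (Reg ''x''))))))))"

lemma wR_upc[simp]: "wR upc = {''p'', ''i5'', ''i6'', ''x''}" and wA_upc[simp]: "wA upc = {''rG'', ''UP''}"
 by (auto simp: upc_def)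

lemma upc_spec:
 fixes n :: nat
 assumes "regs s ''nG'' = n" "regs s ''n1'' = n + 1" "par = arrs s ''par''"
 shows "EX s'. runs upc (n * ((n + 1) * 5 + 6) + 3) s s' & (ALL v<n. arrs s' ''rG'' v = v * (n + 1)) &
  (ALL v<n. ALL i<=n. arrs s' ''UP'' (v * (n + 1) + i) = (par ^^ i) v) & fr {''p'', ''i5'', ''i6'', ''x''} {''rG'', ''UP''} s s'"
proof -
 let ?b = "Seq (Store ''UP'' (Reg ''p'') (Reg ''x'')) (Seq (Assign ''p'' (Add (Reg ''p'') (Const 1))) (Assign ''x'' (Read ''par'' (Reg ''x''))))"
 let ?a = "Seq (Store ''rG'' (Reg ''i5'') (Reg ''p'')) (Assign ''x'' (Reg ''i5''))"
 let ?c = "Seq ?a (For ''i6'' (Reg ''n1'') ?b)"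
 define U where "U x = (par ^^ (x mod (n + 1))) (x div (n + 1))" for x
 define s1 where "s1 = s\<lparr>regs := (regs s)(''p'' := 0)\<rparr>"
 have r1: "runs (Assign ''p'' (Const 0)) 1 s s1" using runs_Assign[of "''p''" "Const 0" s] by (simp add: s1_def)
 let ?I = "%k s'. regs s' ''p'' = k * (n + 1) & (ALL x<k * (n + 1). arrs s' ''UP'' x = U x) & (ALL v<k. arrs s' ''rG'' v = v * (n + 1))"
 have "EX s'. runs (For ''i5'' (Reg ''nG'') ?c) (n * (((n + 1) * 5 + 4) + 2) + 2) s1 s' & ?I n s' & frl ''i5'' ?c s1 s'"
 proof (rule For_rule[where I = ?I])
  fix s' assume "frl ''i5'' ?c s1 s'"
  thus "aval (Reg ''nG'') s' = n" using assms(1) by (simp add: fr_reg s1_def)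
 next
  fix k s' assume k: "frl ''i5'' ?c s1 s'" "regs s' ''i5'' = k" "?I k s'"
  define s2 where "s2 = ev ?a s'"
  have r2: "runs ?a 2 s' s2" unfolding s2_def by (rule run_ev) simp_all
  have e: "regs s' ''n1'' = n + 1" "arrs s' ''par'' = par" using k(1) assms(2,3) by (simp_all add: fr_reg fr_arr s1_def)
  have e2: "regs s2 ''n1'' = n + 1" "arrs s2 ''par'' = par" "regs s2 ''p'' = k * (n + 1)" "regs s2 ''x'' = k"
   "arrs s2 ''UP'' = arrs s' ''UP''" "ALL v<Suc k. arrs s2 ''rG'' v = v * (n + 1)"
   using e k(2,3) by (simp_all add: s2_def less_Suc_eq)
  let ?J = "%i s'. regs s' ''p'' = k * (n + 1) + i & regs s' ''x'' = (par ^^ i) k & (ALL x<k * (n + 1) + i. arrs s' ''UP'' x = U x)"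
  have "EX s'. runs (For ''i6'' (Reg ''n1'') ?b) ((n + 1) * (3 + 2) + 2) s2 s' & ?J (n + 1) s' & frl ''i6'' ?b s2 s'"
  proof (rule For_rule[where I = ?J])
   fix t assume "frl ''i6'' ?b s2 t"
   thus "aval (Reg ''n1'') t = n + 1" using e2(1) by (simp add: fr_reg)
  next
   fix i t assume i: "i < n + 1" "frl ''i6'' ?b s2 t" "?J i t"
   have p: "arrs t ''par'' = par" using i(2) e2(2) by (simp add: fr_arr)
   have "U (k * (n + 1) + i) = (par ^^ i) k"
   proof -
    have "(k * (n + 1) + i) mod (n + 1) = i" using i(1) by (simp only: mod_mult_self3 mod_less)
    moreover have "(k * (n + 1) + i) div (n + 1) = k" using i(1) by (simp only: div_mult_self3 div_less)
    ultimately show ?thesis by (simp only: U_def)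
   qed
   moreover have E: "regs (ev ?b t) ''p'' = k * (n + 1) + i + 1" "regs (ev ?b t) ''x'' = par ((par ^^ i) k)"
    "arrs (ev ?b t) ''UP'' = (arrs t ''UP'')(k * (n + 1) + i := (par ^^ i) k)" using i(3) p by simp_all
   ultimately have "?J (Suc i) (ev ?b t)" using i(3) unfolding E by (auto simp: less_Suc_eq)
   moreover have "runs ?b 3 t (ev ?b t)" by (rule run_ev) simp_all
   ultimately show "EX t'. runs ?b 3 t t' & ?J (Suc i) t'" by blast
  qed (use e2 k(3) in auto)
  then obtain s3 where s3: "runs (For ''i6'' (Reg ''n1'') ?b) ((n + 1) * (3 + 2) + 2) s2 s3" "?J (n + 1) s3" "frl ''i6'' ?b s2 s3" by blast
  have g: "arrs s3 ''rG'' = arrs s2 ''rG''" using s3(3) by (simp add: fr_arr)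
  have "k * (n + 1) + (n + 1) = Suc k * (n + 1)" by simp
  hence "?I (Suc k) s3" using s3(2) e2(6) unfolding g by (simp only:) blast
  moreover have "runs ?c (((n + 1) * 5 + 4)) s' s3" by (rule runs_mono[OF runs_Seq[OF r2 s3(1)]]) simp
  ultimately show "EX t'. runs ?c (((n + 1) * 5 + 4)) s' t' & ?I (Suc k) t'" by blast
 qed (auto simp: s1_def)
 then obtain s4 where s4: "runs (For ''i5'' (Reg ''nG'') ?c) (n * (((n + 1) * 5 + 4) + 2) + 2) s1 s4" "?I n s4" by blast
 have r: "runs upc (1 + (n * (((n + 1) * 5 + 4) + 2) + 2)) s s4" unfolding upc_def by (rule runs_Seq[OF r1 s4(1)])
 have "arrs s4 ''UP'' (v * (n + 1) + i) = (par ^^ i) v" if v: "v < n" "i <= n" for v i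
 proof -
  have "v * (n + 1) + i < Suc v * (n + 1)" using v(2) by simp
  also have "\<dots> <= n * (n + 1)" using v(1) by (intro mult_right_mono) simp_all
  finally have "arrs s4 ''UP'' (v * (n + 1) + i) = U (v * (n + 1) + i)" using s4(2) by blast
  moreover have "(v * (n + 1) + i) mod (n + 1) = i" using v(2) by (simp only: mod_mult_self3 mod_less less_Suc_eq_le flip: Suc_eq_plus1)
  moreover have "(v * (n + 1) + i) div (n + 1) = v" using v(2) by (simp only: div_mult_self3 div_less less_Suc_eq_le flip: Suc_eq_plus1)
  ultimately show ?thesis by (simp only: U_def)
 qed
 moreover have "fr {''p'', ''i5'', ''i6'', ''x''} {''rG'', ''UP''} s s4" using runs_fr[OF r] by simp
 ultimately show ?thesis using s4(2) by (intro exI[of _ s4] conjI runs_mono[OF r]) auto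
qed

locale bfs = hom_pair G H for G H :: "nat pair_pre_digraph" +
 fixes n m :: nat and AL :: "(nat \<times> nat) list" and q :: nat
 assumes V: "pverts G = {..<n}" and AL: "set AL = parcs G" "length AL = m" and qn: "q < n"
begin

text \<open>Depths need not be distances; the bound by the number of visited vertices keeps them
  below \<open>n\<close>, so that \<open>n\<close> parent steps always reach the root.\<close>

definition tree :: "(nat => nat) => (nat => nat) => bool" where
 "tree vis par <-> vis q = 1 & par q = q & (ALL v. 0 < vis v --> v < n & vis v <= card {u. 0 < vis u} &
   (v = q | adj v (par v) & 0 < vis (par v) & vis v = vis (par v) + 1))"

lemma tree_add:
 assumes "tree vis par" "adj u v" "0 < vis u" "vis v = 0"
 shows "tree (vis(v := vis u + 1)) (par(v := u))" "{x. 0 < (vis(v := vis u + 1)) x} = insert v {x. 0 < vis x}"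
proof -
 show e: "{x. 0 < (vis(v := vis u + 1)) x} = insert v {x. 0 < vis x}" by auto
 have "{x. 0 < vis x} <= {..<n}" using assms(1) unfolding tree_def by blast
 hence "finite {x. 0 < vis x}" by (rule finite_subset) simp
 hence c: "card {x. 0 < (vis(v := vis u + 1)) x} = card {x. 0 < vis x} + 1" unfolding e using assms(4) by simp
 have v: "v < n" "v ~= q" "v ~= u" using adj_V[OF assms(2)] V assms by (auto simp: tree_def)
 have old: "vis x <= card {x. 0 < vis x} & x < n & (x = q | adj x (par x) & 0 < vis (par x) & vis x = vis (par x) + 1)"
  if "0 < vis x" for x using assms(1) that by (auto simp: tree_def)
 have pv: "par x ~= v" if "0 < vis x" "x ~= q" for x using old[OF that(1)] that(2) assms(4) by auto
 show "tree (vis(v := vis u + 1)) (par(v := u))"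
  unfolding tree_def c
 proof (intro conjI allI impI)
  fix x assume x: "0 < (vis(v := vis u + 1)) x"
  show "x < n" using x v old[of x] by (cases "x = v") auto
  show "(vis(v := vis u + 1)) x <= card {x. 0 < vis x} + 1" using x old[of x] old[OF assms(3)] by (cases "x = v") auto
  show "x = q | adj x ((par(v := u)) x) & 0 < (vis(v := vis u + 1)) ((par(v := u)) x) &
    (vis(v := vis u + 1)) x = (vis(v := vis u + 1)) ((par(v := u)) x) + 1"
  proof (cases "x = v")
   case True
   thus ?thesis using assms(2,3) v adj_sym by auto
  next
   case False
   thus ?thesis using old[of x] pv[of x] x by auto
  qed
 qed (use assms(1) v in \<open>auto simp: tree_def\<close>)
qed

lemma tree_par:
 assumes "tree vis par" "0 < vis v"
 shows "(par ^^ (vis v - 1)) v = q"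
 using assms(2)
proof (induction "vis v" arbitrary: v)
 case (Suc k)
 show ?case
 proof (cases "v = q")
  case True thus ?thesis using assms(1) by (simp add: tree_def)
 next
  case False
  hence p: "0 < vis (par v)" "vis v = vis (par v) + 1" using assms(1) Suc.prems by (auto simp: tree_def)
  have "(par ^^ (vis (par v) - 1)) (par v) = q" using Suc.hyps p by simp
  hence "(par ^^ Suc (vis (par v) - 1)) v = q" by (simp only: funpow_Suc_right comp_def)
  moreover have "Suc (vis (par v) - 1) = vis v - 1" using p by simp
  ultimately show ?thesis by metis
 qed
qed simp

lemma tree_n:
 assumes "tree vis par" "0 < vis v"
 shows "(par ^^ n) v = q"
proof -
 have "card {u. 0 < vis u} <= card {..<n}" using assms(1) by (intro card_mono) (auto simp: tree_def)
 moreover have "vis v <= card {u. 0 < vis u}" using assms unfolding tree_def by blast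
 ultimately have "vis v <= n" by simp
 hence "n = (n - (vis v - 1)) + (vis v - 1)" by simp
 hence "(par ^^ n) v = (par ^^ (n - (vis v - 1))) ((par ^^ (vis v - 1)) v)" by (metis comp_apply funpow_add)
 also have "\<dots> = (par ^^ (n - (vis v - 1))) q" using tree_par[OF assms] by simp
 also have "\<dots> = q" by (rule funpow_fixpoint) (use assms(1) in \<open>simp add: tree_def\<close>)
 finally show ?thesis .
qed

abbreviation "vs s \<equiv> {v. 0 < arrs s ''vis'' v}"
abbreviation "tr s \<equiv> tree (arrs s ''vis'') (arrs s ''par'')"

lemma bfsb_spec:
 assumes "tr s" "regs s ''i5'' = j" "j < m" "arrs s ''EU'' j = fst (AL ! j)" "arrs s ''G_out'' j = snd (AL ! j)"
 shows "tr (ev bfsb s)" "vs s <= vs (ev bfsb s)" "fst (AL ! j) : vs s ==> snd (AL ! j) : vs (ev bfsb s)"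
  "snd (AL ! j) : vs s ==> fst (AL ! j) : vs (ev bfsb s)"
proof -
 define u v where "u = fst (AL ! j)" and "v = snd (AL ! j)"
 have "AL ! j : parcs G" using AL nth_mem[of j AL] assms(3) by simp
 hence a: "adj u v" "adj v u" by (auto simp: adj_def u_def v_def)
 have uv: "fst (AL ! j) = u" "snd (AL ! j) = v" by (simp_all add: u_def v_def)
 let ?vis = "arrs s ''vis''" and ?par = "arrs s ''par''"
 have E: "arrs (ev bfsb s) ''vis'' = (if 0 < ?vis u then if ?vis v < 1 then ?vis(v := ?vis u + 1) else ?vis
    else if 0 < ?vis v then ?vis(u := ?vis v + 1) else ?vis)"
  "arrs (ev bfsb s) ''par'' = (if 0 < ?vis u then if ?vis v < 1 then ?par(v := u) else ?par
    else if 0 < ?vis v then ?par(u := v) else ?par)"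
  using assms(2,4,5) unfolding uv by (simp_all add: bfsb_def)
 consider (a) "0 < ?vis u" "?vis v = 0" | (b) "?vis u = 0" "0 < ?vis v" | (c) "0 < ?vis u" "0 < ?vis v" | (d) "?vis u = 0" "?vis v = 0" by auto
 thus "tr (ev bfsb s)" "vs s <= vs (ev bfsb s)" "fst (AL ! j) : vs s ==> snd (AL ! j) : vs (ev bfsb s)"
  "snd (AL ! j) : vs s ==> fst (AL ! j) : vs (ev bfsb s)"
  unfolding E uv
  by (cases; use assms(1) tree_add(1)[OF assms(1) a(1)] tree_add(1)[OF assms(1) a(2)] in auto)+
qed

text \<open>If a pass visits nothing new, the visited set is closed under adjacency, and by
  connectedness it is everything.\<close>

lemma inner_spec:
 assumes "tr s" "regs s ''m'' = m" "!!j. j < m ==> arrs s ''EU'' j = fst (AL ! j) & arrs s ''G_out'' j = snd (AL ! j)"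
 shows "EX s'. runs (For ''i5'' (Reg ''m'') bfsb) (m * 13 + 2) s s' & tr s' & (vs s' = {..<n} | card (vs s) < card (vs s')) &
  card (vs s) <= card (vs s') & fr {''u'', ''v'', ''i5''} {''vis'', ''par''} s s'"
proof -
 let ?I = "%k s'. tr s' & vs s <= vs s' & (ALL j<k. (fst (AL ! j) : vs s --> snd (AL ! j) : vs s') & (snd (AL ! j) : vs s --> fst (AL ! j) : vs s'))"
 have "EX s'. runs (For ''i5'' (Reg ''m'') bfsb) (m * (11 + 2) + 2) s s' & ?I m s' & frl ''i5'' bfsb s s'"
 proof (rule For_rule[where I = ?I])
  fix s' assume "frl ''i5'' bfsb s s'"
  thus "aval (Reg ''m'') s' = m" using assms(2) by (simp add: fr_reg)
 next
  fix k t assume k: "k < m" "frl ''i5'' bfsb s t" "regs t ''i5'' = k" "?I k t"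
  have ar: "arrs t ''EU'' k = fst (AL ! k)" "arrs t ''G_out'' k = snd (AL ! k)" using assms(3)[OF k(1)] k(2) by (simp_all add: fr_arr)
  have t: "tr t" using k(4) by blast
  note b = bfsb_spec[OF t k(3,1) ar]
  have "?I (Suc k) (ev bfsb t)"
  proof (intro conjI allI impI)
   show "vs s <= vs (ev bfsb t)" using k(4) b(2) by (meson order_trans)
   fix j assume j: "j < Suc k"
   { assume s: "fst (AL ! j) : vs s"
    show "snd (AL ! j) : vs (ev bfsb t)"
    proof (cases "j = k")
     case True thus ?thesis using b(3) k(4) s by (meson subsetD)
    next
     case False thus ?thesis using b(2) k(4) s j by (meson subsetD less_SucE)
    qed }
   { assume s: "snd (AL ! j) : vs s"
    show "fst (AL ! j) : vs (ev bfsb t)"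
    proof (cases "j = k")
     case True thus ?thesis using b(4) k(4) s by (meson subsetD)
    next
     case False thus ?thesis using b(2) k(4) s j by (meson subsetD less_SucE)
    qed }
  qed (rule b(1))
  moreover have "runs bfsb 11 t (ev bfsb t)" by (rule run_ev) (simp_all add: bfsb_def)
  ultimately show "EX t'. runs bfsb 11 t t' & ?I (Suc k) t'" by blast
 qed (use assms(1) in simp_all)
 then obtain s' where s': "runs (For ''i5'' (Reg ''m'') bfsb) (m * (11 + 2) + 2) s s'" "?I m s'" "frl ''i5'' bfsb s s'" by blast
 have sub: "vs s' <= {..<n}" using s'(2) by (auto simp: tree_def)
 have fin: "finite (vs s')" using sub finite_subset by blast
 have le: "card (vs s) <= card (vs s')" using s'(2) fin by (intro card_mono) blast+
 have "vs s' = {..<n} | card (vs s) < card (vs s')"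
 proof (rule disjCI)
  assume "~ card (vs s) < card (vs s')"
  hence eq: "vs s = vs s'" using s'(2) fin le by (intro card_subset_eq) auto
  have cl: "y : vs s" if "adj x y" "x : vs s" for x y
  proof -
   from that(1) consider "(x, y) : set AL" | "(y, x) : set AL" unfolding adj_def AL(1) by blast
   thus ?thesis
   proof cases
    case 1
    then obtain j where "j < m" "AL ! j = (x, y)" using AL(2) by (metis in_set_conv_nth)
    thus ?thesis using s'(2) that(2) eq by (metis fst_conv snd_conv)
   next
    case 2
    then obtain j where "j < m" "AL ! j = (y, x)" using AL(2) by (metis in_set_conv_nth)
    thus ?thesis using s'(2) that(2) eq by (metis fst_conv snd_conv)
   qed
  qed
  have "q : vs s" using assms(1) by (simp add: tree_def)
  hence "v : vs s" if "v < n" for v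
   using conn_induct[of q v "%x. x : vs s"] cl V qn that by blast
  thus "vs s' = {..<n}" using eq sub by blast
 qed
 moreover have "fr {''u'', ''v'', ''i5''} {''vis'', ''par''} s s'" by (rule fr_mono[OF s'(3)]) auto
 ultimately show ?thesis using s'(2) le by (intro exI[of _ s'] conjI runs_mono[OF s'(1)]) auto
qed

lemma bfsc_spec:
 assumes "regs s ''nG'' = n" "regs s ''q'' = q" "regs s ''m'' = m" "arrs s ''vis'' = (%_. 0)"
  "!!j. j < m ==> arrs s ''EU'' j = fst (AL ! j) & arrs s ''G_out'' j = snd (AL ! j)"
 shows "EX s'. runs bfsc (n * (m * 13 + 4) + 4) s s' & tr s' & vs s' = {..<n} & fr {''u'', ''v'', ''i5'', ''i6''} {''vis'', ''par''} s s'"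
proof -
 let ?a = "Seq (Store ''vis'' (Reg ''q'') (Const 1)) (Store ''par'' (Reg ''q'') (Reg ''q''))"
 let ?c = "For ''i5'' (Reg ''m'') bfsb"
 define s1 where "s1 = ev ?a s"
 have r1: "runs ?a 2 s s1" unfolding s1_def by (rule run_ev) simp_all
 have e1: "arrs s1 ''vis'' = (%_. 0)(q := 1)" "arrs s1 ''par'' q = q" using assms(2,4) by (simp_all add: s1_def)
 have v1: "vs s1 = {q}" unfolding e1 by auto
 have t1: "tr s1" unfolding tree_def v1 using e1 qn by simp
 have s1: "regs s1 = regs s" "arrs s1 ''EU'' = arrs s ''EU''" "arrs s1 ''G_out'' = arrs s ''G_out''" by (simp_all add: s1_def)
 let ?I = "%k s'. tr s' & (vs s' = {..<n} | Suc k <= card (vs s'))"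
 have "EX s'. runs (For ''i6'' (Reg ''nG'') ?c) (n * ((m * 13 + 2) + 2) + 2) s1 s' & ?I n s' & frl ''i6'' ?c s1 s'"
 proof (rule For_rule[where I = ?I])
  fix s' assume "frl ''i6'' ?c s1 s'"
  thus "aval (Reg ''nG'') s' = n" using assms(1) s1(1) by (simp add: fr_reg)
 next
  fix k t assume k: "frl ''i6'' ?c s1 t" "?I k t"
  have t: "tr t" using k(2) by blast
  have mt: "regs t ''m'' = m" using k(1) s1(1) assms(3) by (simp add: fr_reg)
  have ar: "arrs t ''EU'' j = fst (AL ! j) & arrs t ''G_out'' j = snd (AL ! j)" if "j < m" for j
   using k(1) s1 assms(5)[OF that] by (simp add: fr_arr)
  obtain t' where t': "runs ?c (m * 13 + 2) t t'" "tr t'" "vs t' = {..<n} | card (vs t) < card (vs t')" "card (vs t) <= card (vs t')"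
   using inner_spec[OF t mt ar] by blast
  have fin: "vs t' <= {..<n}" using t'(2) by (auto simp: tree_def)
  have "vs t' = {..<n} | Suc (Suc k) <= card (vs t')"
  proof (cases "vs t = {..<n}")
   case True
   thus ?thesis using t'(4) fin by (metis card_seteq finite_lessThan)
  qed (use k(2) t'(3) in auto)
  thus "EX t'. runs ?c (m * 13 + 2) t t' & ?I (Suc k) t'" using t'(1,2) by blast
 qed (use t1 v1 in auto)
 then obtain s2 where s2: "runs (For ''i6'' (Reg ''nG'') ?c) (n * ((m * 13 + 2) + 2) + 2) s1 s2" "?I n s2" by blast
 have sub: "vs s2 <= {..<n}" using s2(2) by (auto simp: tree_def)
 have v: "vs s2 = {..<n}" using s2(2) card_mono[OF _ sub] by auto
 have t: "tr s2" using s2(2) by blast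
 have r: "runs bfsc (2 + (n * ((m * 13 + 2) + 2) + 2)) s s2" unfolding bfsc_def by (rule runs_Seq[OF r1 s2(1)])
 have f: "fr {''u'', ''v'', ''i5'', ''i6''} {''vis'', ''par''} s s2" using runs_fr[OF r] by simp
 show ?thesis by (intro exI[of _ s2] conjI t v f runs_mono[OF r]) (simp add: algebra_simps)
qed

definition ups :: "(nat => nat) => nat => nat list" where
 "ups par v = map (%i. (par ^^ i) v) [0..<n + 1]"

lemma ups_props:
 assumes "tree vis par" "!!v. v < n ==> 0 < vis v" "v < n"
 shows "ups par v ~= []" "hd (ups par v) = v" "last (ups par v) = q" "successively (%x y. x = y | adj x y) (ups par v)"
  "set (ups par v) <= {..<n}" "set (ups par q) = {q}" "length (ups par v) = n + 1" "!!i. i <= n ==> ups par v ! i = (par ^^ i) v"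
proof -
 have pn: "par x < n & (x = par x | adj x (par x))" if "x < n" for x
 proof -
  have old: "y < n & (y = q | adj y (par y) & 0 < vis (par y))" if "0 < vis y" for y
   using assms(1) that unfolding tree_def by blast
  have "par q = q" using assms(1) by (simp add: tree_def)
  thus ?thesis using old[OF assms(2)[OF that]] old[of "par x"] qn by (cases "x = q") auto
 qed
 have it: "(par ^^ i) v < n" for i by (induction i) (use assms(3) pn in auto)
 show nth: "ups par v ! i = (par ^^ i) v" if "i <= n" for i using that by (simp add: ups_def del: upt_Suc)
 show l: "length (ups par v) = n + 1" by (simp add: ups_def)
 show ne: "ups par v ~= []" using l by auto
 show "hd (ups par v) = v" using ne nth[of 0] by (simp add: hd_conv_nth)
 have "last (ups par v) = (par ^^ n) v" using ne nth[of n] l by (simp add: last_conv_nth)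
 thus "last (ups par v) = q" using tree_n[OF assms(1) assms(2)[OF assms(3)]] by simp
 show "set (ups par v) <= {..<n}" using it by (auto simp: ups_def)
 show "successively (%x y. x = y | adj x y) (ups par v)"
  unfolding successively_conv_nth
 proof (intro allI impI)
  fix i assume "Suc i < length (ups par v)"
  hence i: "Suc i <= n" using l by simp
  have "ups par v ! Suc i = par (ups par v ! i)" using nth[of "Suc i"] nth[of i] i by simp
  moreover have "ups par v ! i < n" using nth[of i] i it by simp
  ultimately show "ups par v ! i = ups par v ! Suc i | adj (ups par v ! i) (ups par v ! Suc i)" using pn by metis
 qed
 have "(par ^^ i) q = q" for i by (rule funpow_fixpoint) (use assms(1) in \<open>simp add: tree_def\<close>)
 thus "set (ups par q) = {q}" by (auto simp: ups_def image_iff)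
qed

end

section \<open>The two programs\<close>

abbreviation "cycw a \<equiv> word [eDn a ''u'', eUp a ''v'']"

text \<open>\<open>e0\<close> keeps the number plus one of an arc whose cycle has a nontrivial
  \<open>al\<close>-image; for \<open>be2\<close> it is enough to record in \<open>f0\<close> that
  there is one.\<close>

definition scb :: com where
 "scb = Seq (Seq (Assign ''u'' (Read ''EU'' (Reg ''i3''))) (Assign ''v'' (Read ''G_out'' (Reg ''i3''))))
   (Seq (cycw ''alpha'') (Seq (Cond (Less (Const 1) (Reg ''sl'')) (Assign ''e0'' (Add (Reg ''i3'') (Const 1))) Skip)
   (Seq (cycw ''beta'') (Cond (Less (Const 1) (Reg ''sl'')) (Assign ''f0'' (Const 1)) Skip))))"

definition scanc :: com where
 "scanc = Seq (Seq (Assign ''e0'' (Const 0)) (Assign ''f0'' (Const 0))) (For ''i3'' (Reg ''m'') scb)"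

text \<open>Four doublings of \<open>n + 1\<close> give \<open>d\<close>. A closed walk ends with
  its tail reversed, so \<open>T2\<close> is read off the end of \<open>Y0\<close>, from position
  \<open>yo\<close> on.\<close>

definition setB :: com where
 "setB = Seq (Assign ''t1c'' (Add (Reg ''t1'') (Const 1))) (Seq (Assign ''t2c'' (Add (Reg ''t2'') (Const 1)))
   (Seq (Assign ''yo'' (Sub (Sub (Reg ''yn'') (Const 1)) (Reg ''t2''))) (Seq (Assign ''ll'' (Sub (Sub (Sub (Reg ''xn'') (Const 1)) (Reg ''t1'')) (Reg ''t1'')))
   (Seq (Assign ''d'' (Add (Reg ''n1'') (Reg ''n1''))) (Seq (Assign ''d'' (Add (Reg ''d'') (Reg ''d'')))
   (Seq (Assign ''d'' (Add (Reg ''d'') (Reg ''d''))) (Seq (Assign ''d'' (Add (Reg ''d'') (Reg ''d''))) (Assign ''zr'' (Const 0)))))))))"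

text \<open>Raises \<open>zr\<close> to a multiple of the period that is at least \<open>d\<close>.
  Because \<open>- zr\<close> then is the beginning of a period, the array \<open>F\<close> can be
  filled cyclically from the start of the core.\<close>

definition zlp :: com where
 "zlp = For ''i5'' (Reg ''d'') (Cond (Less (Reg ''zr'') (Reg ''d'')) (Assign ''zr'' (Add (Reg ''zr'') (Reg ''ll''))) Skip)"

definition setC :: com where
 "setC = Seq (Assign ''zc'' (Add (Reg ''zr'') (Const 1))) (Seq (Assign ''zz'' (Add (Reg ''zr'') (Reg ''zc'')))
   (Seq (Assign ''p'' (Reg ''t1'')) (Assign ''pe'' (Add (Reg ''t1'') (Reg ''ll'')))))"

definition flp :: com where
 "flp = For ''i5'' (Reg ''zz'') (Seq (Store ''F'' (Reg ''i5'') (Read ''X0'' (Reg ''p''))) (Seq (Assign ''p'' (Add (Reg ''p'') (Const 1)))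
   (Cond (Less (Reg ''p'') (Reg ''pe'')) Skip (Assign ''p'' (Reg ''t1'')))))"

definition cysc :: com where
 "cysc = Seq (Seq (Assign ''ej'' (Sub (Reg ''e0'') (Const 1))) (Seq (Assign ''u'' (Read ''EU'' (Reg ''ej''))) (Assign ''v'' (Read ''G_out'' (Reg ''ej'')))))
   (Seq (cycw ''alpha'') (Seq (cpy ''X0'' ''xn'' ''S'' ''sl'') (Seq (cycw ''beta'') (cpy ''Y0'' ''yn'' ''S'' ''sl''))))"

text \<open>A trivial \<open>be2\<close>-image is not conjugate to the nontrivial
  \<open>al\<close>-image of the same cycle, so nothing is realizable then.\<close>

definition prepB :: com where
 "prepB = Seq cysc (Cond (Less (Reg ''yn'') (Const 2)) (Assign ''case'' (Const 1))
   (Seq (tlc ''X0'' ''xn'' ''t1'') (Seq (tlc ''Y0'' ''yn'' ''t2'') (Seq setB (Seq zlp (Seq setC (Seq flp caseB)))))))"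

definition mainc :: com where
 "mainc = Seq scanc (Cond (Less (Reg ''e0'') (Const 1))
   (Cond (Less (Const 0) (Reg ''f0'')) (Assign ''case'' (Const 1)) caseA) prepB)"

lemma zlp_spec:
 assumes "regs s ''zr'' = 0" "regs s ''d'' = D" "regs s ''ll'' = l" "0 < l"
 shows "EX s'. runs zlp (D * 5 + 2) s s' & D <= regs s' ''zr'' & regs s' ''zr'' <= D + l & l dvd regs s' ''zr'' & fr {''zr'', ''i5''} {} s s'"
proof -
 let ?c = "Cond (Less (Reg ''zr'') (Reg ''d'')) (Assign ''zr'' (Add (Reg ''zr'') (Reg ''ll''))) Skip"
 let ?I = "%k s'. (k <= regs s' ''zr'' | D <= regs s' ''zr'') & regs s' ''zr'' <= D + l & l dvd regs s' ''zr''"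
 have "EX s'. runs (For ''i5'' (Reg ''d'') ?c) (D * (3 + 2) + 2) s s' & ?I D s' & frl ''i5'' ?c s s'"
 proof (rule For_rule[where I = ?I])
  fix s' assume "frl ''i5'' ?c s s'"
  thus "aval (Reg ''d'') s' = D" using assms(2) by (simp add: fr_reg)
 next
  fix k t assume k: "frl ''i5'' ?c s t" "?I k t"
  have d: "regs t ''d'' = D" "regs t ''ll'' = l" using k(1) assms(2,3) by (simp_all add: fr_reg)
  have z': "regs (ev ?c t) ''zr'' = (if regs t ''zr'' < D then regs t ''zr'' + l else regs t ''zr'')" using d by simp
  have "?I (Suc k) (ev ?c t)" unfolding z' using k(2) assms(4) by auto
  moreover have "runs ?c 3 t (ev ?c t)" by (rule run_ev) simp_all
  ultimately show "EX t'. runs ?c 3 t t' & ?I (Suc k) t'" by blast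
 qed (use assms in auto)
 then obtain s' where s': "runs (For ''i5'' (Reg ''d'') ?c) (D * (3 + 2) + 2) s s'" "?I D s'" "frl ''i5'' ?c s s'" by blast
 have "fr {''zr'', ''i5''} {} s s'" by (rule fr_mono[OF s'(3)]) auto
 thus ?thesis using s'(1,2) unfolding zlp_def by (intro exI[of _ s'] conjI) auto
qed

lemma flp_spec:
 assumes "regs s ''zz'' = Z" "regs s ''p'' = t" "regs s ''t1'' = t" "regs s ''pe'' = t + l" "0 < l" "X = arrs s ''X0''"
 shows "EX s'. runs flp (Z * 8 + 2) s s' & (ALL j<Z. arrs s' ''F'' j = X (t + j mod l)) & fr {''p'', ''i5''} {''F''} s s'"
proof -
 let ?c = "Seq (Store ''F'' (Reg ''i5'') (Read ''X0'' (Reg ''p''))) (Seq (Assign ''p'' (Add (Reg ''p'') (Const 1)))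
   (Cond (Less (Reg ''p'') (Reg ''pe'')) Skip (Assign ''p'' (Reg ''t1''))))"
 let ?I = "%k s'. regs s' ''p'' = t + k mod l & (ALL j<k. arrs s' ''F'' j = X (t + j mod l))"
 have "EX s'. runs (For ''i5'' (Reg ''zz'') ?c) (Z * (6 + 2) + 2) s s' & ?I Z s' & frl ''i5'' ?c s s'"
 proof (rule For_rule[where I = ?I])
  fix s' assume "frl ''i5'' ?c s s'"
  thus "aval (Reg ''zz'') s' = Z" using assms(1) by (simp add: fr_reg)
 next
  fix k s' assume k: "frl ''i5'' ?c s s'" "regs s' ''i5'' = k" "?I k s'"
  have d: "regs s' ''t1'' = t" "regs s' ''pe'' = t + l" "arrs s' ''X0'' = X" using k(1) assms(3,4,6) by (simp_all add: fr_reg fr_arr)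
  have m: "Suc k mod l = (if k mod l + 1 < l then k mod l + 1 else 0)"
  proof (cases "Suc (k mod l) = l")
   case False
   moreover have "k mod l < l" using assms(5) by (rule mod_less_divisor)
   ultimately have "Suc (k mod l) < l" by linarith
   thus ?thesis by (simp add: mod_Suc)
  qed (simp add: mod_Suc)
  have p': "regs (ev ?c s') ''p'' = (if t + k mod l + 1 < t + l then t + k mod l + 1 else t)" using d k(3) by simp
  have F': "arrs (ev ?c s') ''F'' = (arrs s' ''F'')(k := X (t + k mod l))" using d k(2,3) by simp
  have "?I (Suc k) (ev ?c s')" unfolding p' F' m using k(3) by (auto simp: less_Suc_eq)
  moreover have "runs ?c 6 s' (ev ?c s')" by (rule run_ev) simp_all
  ultimately show "EX t'. runs ?c 6 s' t' & ?I (Suc k) t'" by blast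
 qed (use assms in auto)
 then obtain s' where s': "runs (For ''i5'' (Reg ''zz'') ?c) (Z * (6 + 2) + 2) s s'" "?I Z s'" "frl ''i5'' ?c s s'" by blast
 have "fr {''p'', ''i5''} {''F''} s s'" by (rule fr_mono[OF s'(3)]) auto
 thus ?thesis using s'(1,2) unfolding flp_def by (intro exI[of _ s'] conjI) auto
qed

section \<open>Choosing between trivial cycles and an axis\<close>

context prg
begin

abbreviation "cycn f u v \<equiv> nf (map f (cyc u v))"

lemma cycw_spec:
 assumes "env s" "colors a f" "regs s ''u'' = u" "regs s ''v'' = v" "u < n" "v < n"
 shows "EX s'. runs (cycw a) (60 * np) s s' & seg s' ''S'' (regs s' ''sl'') = cycn f u v & fr wordR wordA s s'"
proof -
 have e: "list_all2 (emitted s) [eDn a ''u'', eUp a ''v''] [map f (rev (up u)), map f (up v)]"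
  using emitted_eDn[OF assms(1,2), of "''u''"] emitted_eUp[OF assms(1,2), of "''v''"] assms(3-6) by simp
 have l: "length (concat [map f (rev (up u)), map f (up v)]) <= 2 * np" using up_length assms(5,6) by simp
 from word_spec[OF e l] obtain s' where s': "runs (cycw a) (2 * np * 16 + 25) s s'"
  "seg s' ''S'' (regs s' ''sl'') = nf (concat [map f (rev (up u)), map f (up v)])" "fr wordR wordA s s'" by auto
 have r: "runs (cycw a) (60 * np) s s'" by (rule runs_mono[OF s'(1)]) simp
 show ?thesis using r s'(2,3) by (intro exI[of _ s']) (simp add: cyc_def)
qed

lemma cycn_len: "u < n ==> v < n ==> length (cycn f u v) <= 2 * np"
 using length_nf[of "map f (cyc u v)"] up_length by (simp add: cyc_def)

lemma cycn_trivial: "u < n ==> v < n ==> 1 < length (cycn f u v) <-> cycn f u v ~= [f q]"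
proof -
 assume uv: "u < n" "v < n"
 have c: "cyc u v ~= []" "hd (cyc u v) = q" using cyc_closed VG uv by auto
 have "length (cycn f u v) = 1 <-> cycn f u v = [f q]" using length_nf_1[of "map f (cyc u v)"] c by (simp add: hd_map)
 moreover have "length (cycn f u v) ~= 0" using c by simp
 ultimately show ?thesis by linarith
qed

lemma cycn_props:
 assumes "u < n" "v < n" "colors a f"
 shows "red (cycn f u v)" "hd (cycn f u v) = f q" "last (cycn f u v) = f q" "set (cycn f u v) <= {..<nH}" "cycn f u v ~= []"
proof -
 have c: "cyc u v ~= []" "hd (cyc u v) = q" "last (cyc u v) = q" using cyc_closed VG assms by auto
 show "red (cycn f u v)" "hd (cycn f u v) = f q" "last (cycn f u v) = f q" "cycn f u v ~= []"
  using c by (simp_all add: hd_map last_map)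
 have "set (cycn f u v) <= set (map f (cyc u v))" by (rule set_nf)
 also have "\<dots> <= {..<nH}" using up_V assms alpha_nH beta_nH by (fastforce simp: cyc_def colors_def)
 finally show "set (cycn f u v) <= {..<nH}" .
qed

abbreviation "au j \<equiv> fst (AL ! j)"
abbreviation "av j \<equiv> snd (AL ! j)"

definition scst :: "nat => ram_state => bool" where
 "scst k s <-> (regs s ''e0'' = 0 & (ALL j<k. cycn al (au j) (av j) = [al q]) |
    0 < regs s ''e0'' & regs s ''e0'' - 1 < k & cycn al (au (regs s ''e0'' - 1)) (av (regs s ''e0'' - 1)) ~= [al q]) &
   (regs s ''f0'' = 0 <-> (ALL j<k. cycn be2 (au j) (av j) = [be2 q]))"

lemma scanc_spec:
 assumes "env s"
 shows "EX s'. runs scanc (m * (140 * np) + 4) s s' & env s' & scst m s'"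
proof -
 let ?a = "Seq (Assign ''e0'' (Const 0)) (Assign ''f0'' (Const 0))"
 define s1 where "s1 = ev ?a s"
 have r1: "runs ?a 2 s s1" unfolding s1_def by (rule run_ev) simp_all
 have e1: "env s1" by (rule env_fr[OF assms runs_fr[OF r1]]) auto
 have w: "wR scb <= {''u'', ''v'', ''e0'', ''f0''} Un wordR" "wA scb <= wordA"
 proof -
  have "wR (cycw a) <= {''u'', ''v'', ''e0'', ''f0''} Un wordR" for a by (rule order.trans[OF wR_word]) auto
  thus "wR scb <= {''u'', ''v'', ''e0'', ''f0''} Un wordR" by (simp add: scb_def)
  show "wA scb <= wordA" using wA_word by (simp add: scb_def)
 qed
 have nw: "''i3'' ~: wR scb" using w(1) by (rule contra_subsetD) simp
 let ?I = "%k s'. env s' & scst k s'"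
 have "EX s'. runs (For ''i3'' (Reg ''m'') scb) (m * (135 * np + 2) + 2) s1 s' & ?I m s' & frl ''i3'' scb s1 s'"
 proof (rule For_rule[where I = ?I])
  fix s' assume F: "frl ''i3'' scb s1 s'"
  have "env s'" by (rule env_fr[OF e1 fr_mono[OF F insert_mono[OF w(1)] w(2)]]) auto
  thus "aval (Reg ''m'') s' = m" by (simp add: env_m)
 next
  fix k t assume k: "k < m" "regs t ''i3'' = k" "?I k t"
  note A = AL_nth[OF k(1)]
  let ?b = "Seq (Assign ''u'' (Read ''EU'' (Reg ''i3''))) (Assign ''v'' (Read ''G_out'' (Reg ''i3'')))"
  define t1 where "t1 = ev ?b t"
  have r1: "runs ?b 2 t t1" unfolding t1_def by (rule run_ev) simp_all
  have f1: "fr {''u'', ''v''} {} t t1" by (rule fr_mono[OF runs_fr[OF r1]]) auto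
  have e1: "env t1" by (rule env_fr[OF _ f1]) (use k(3) in auto)
  have uv1: "regs t1 ''u'' = au k" "regs t1 ''v'' = av k" using k by (simp_all add: t1_def env_def)
  obtain t2 where t2: "runs (cycw ''alpha'') (60 * np) t1 t2" "seg t2 ''S'' (regs t2 ''sl'') = cycn al (au k) (av k)" "fr wordR wordA t1 t2"
   using cycw_spec[OF e1 colors_simps(1) uv1] A by blast
  have e2: "env t2" by (rule env_fr[OF e1 t2(3)]) auto
  have sl2: "1 < regs t2 ''sl'' <-> cycn al (au k) (av k) ~= [al q]"
   using cycn_trivial[of "au k" "av k" al] A arg_cong[OF t2(2), of length] by simp
  let ?c = "Cond (Less (Const 1) (Reg ''sl'')) (Assign ''e0'' (Add (Reg ''i3'') (Const 1))) Skip"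
  define t3 where "t3 = ev ?c t2"
  have r3: "runs ?c 3 t2 t3" unfolding t3_def by (rule run_ev) simp_all
  have f3: "fr {''e0''} {} t2 t3" by (rule fr_mono[OF runs_fr[OF r3]]) auto
  have e3: "env t3" by (rule env_fr[OF e2 f3]) auto
  have i2: "regs t2 ''i3'' = k" "regs t2 ''e0'' = regs t ''e0''" using t2(3) f1 k(2) by (simp_all add: fr_reg)
  have e0: "regs t3 ''e0'' = (if cycn al (au k) (av k) ~= [al q] then k + 1 else regs t ''e0'')"
   using sl2 i2 by (simp add: t3_def)
  have uv3: "regs t3 ''u'' = au k" "regs t3 ''v'' = av k" using uv1 t2(3) f3 by (simp_all add: fr_reg)
  obtain t4 where t4: "runs (cycw ''beta'') (60 * np) t3 t4" "seg t4 ''S'' (regs t4 ''sl'') = cycn be2 (au k) (av k)" "fr wordR wordA t3 t4"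
   using cycw_spec[OF e3 colors_simps(2) uv3] A by blast
  have e4: "env t4" by (rule env_fr[OF e3 t4(3)]) auto
  have sl4: "1 < regs t4 ''sl'' <-> cycn be2 (au k) (av k) ~= [be2 q]"
   using cycn_trivial[of "au k" "av k" be2] A arg_cong[OF t4(2), of length] by simp
  let ?d = "Cond (Less (Const 1) (Reg ''sl'')) (Assign ''f0'' (Const 1)) Skip"
  define t5 where "t5 = ev ?d t4"
  have r5: "runs ?d 3 t4 t5" unfolding t5_def by (rule run_ev) simp_all
  have f5: "fr {''f0''} {} t4 t5" by (rule fr_mono[OF runs_fr[OF r5]]) auto
  have e5: "env t5" by (rule env_fr[OF e4 f5]) auto
  have "regs t4 ''f0'' = regs t ''f0''" using t4(3) f3 t2(3) f1 by (simp add: fr_reg)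
  hence f0: "regs t5 ''f0'' = (if cycn be2 (au k) (av k) ~= [be2 q] then 1 else regs t ''f0'')"
   using sl4 by (simp add: t5_def)
  have e0': "regs t5 ''e0'' = (if cycn al (au k) (av k) ~= [al q] then k + 1 else regs t ''e0'')"
   using e0 t4(3) f5 by (simp add: fr_reg)
  have "scst k t" using k(3) by simp
  hence "scst (Suc k) t5" unfolding scst_def e0' f0 by (auto simp: less_Suc_eq)
  moreover have r: "runs scb (2 + (60 * np + (3 + (60 * np + 3)))) t t5"
   unfolding scb_def by (rule runs_Seq[OF r1 runs_Seq[OF t2(1) runs_Seq[OF r3 runs_Seq[OF t4(1) r5]]]])
  ultimately show "EX t'. runs scb (135 * np) t t' & ?I (Suc k) t'"
   using e5 by (intro exI[of _ t5] conjI runs_mono[OF r]) simp_all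
 next
  fix k t v assume i: "?I k t"
  have "env (t\<lparr>regs := (regs t)(''i3'' := v)\<rparr>)"
   by (rule env_fr[of t "{''i3''}" "{}"]) (use i in \<open>auto simp: fr_def\<close>)
  moreover have "scst k (t\<lparr>regs := (regs t)(''i3'' := v)\<rparr>)" using i by (simp add: scst_def)
  ultimately show "?I k (t\<lparr>regs := (regs t)(''i3'' := v)\<rparr>)" by simp
 next
  show "?I 0 s1" using e1 by (simp add: scst_def s1_def)
 qed (rule nw)
 then obtain s2 where s2: "runs (For ''i3'' (Reg ''m'') scb) (m * (135 * np + 2) + 2) s1 s2" "?I m s2" by blast
 have r: "runs scanc (2 + (m * (135 * np + 2) + 2)) s s2" unfolding scanc_def by (rule runs_Seq[OF r1 s2(1)])
 have "m * (135 * np + 2) <= m * (140 * np)" by (rule mult_left_mono) simp_all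
 thus ?thesis using s2(2) by (intro exI[of _ s2] conjI runs_mono[OF r]) simp_all
qed

text \<open>With a trivial \<open>be2\<close>-image the equation reads \<open>X Q = Q\<close>, and
  \<open>Q\<close> cancels.\<close>

lemma trivial_beta_arcT:
 assumes "base Q" "u < n" "v < n" "arcT u v Q" "cycn be2 u v = [be2 q]"
 shows "cycn al u v = [al q]"
proof -
 have V: "u : pverts G" "v : pverts G" using assms VG by auto
 note c = cyc_closed[OF V]
 have b: "Q ~= []" "red Q" "hd Q = al q" "last Q = be2 q" using assms(1) by (auto simp: base_def)
 have "nf (map al (cyc u v) @ Q) = nf (Q @ map be2 (cyc u v))" using arcT_iff[OF assms(1) V] assms(4) by simp
 also have "\<dots> = nf (Q @ [be2 q])" using assms(5) by (metis nf_append_nf)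
 also have "\<dots> = nf Q" using nf_join[of Q "be2 q" "[]" "[]"] b by simp
 finally have e: "nf (map al (cyc u v) @ Q) = nf Q" .
 have "cycn al u v = nf (map al (cyc u v) @ Q @ rev Q)"
  using nf_cancel_L[of Q "map al (cyc u v)" "[]"] b c by (simp add: last_map)
 also have "\<dots> = nf (Q @ rev Q)" using nf_cong_l[OF e, of "rev Q"] by simp
 also have "\<dots> = [al q]" using nf_cancel[of Q "[]" "[]"] b by (simp add: nf_def)
 finally show ?thesis .
qed

lemma cysc_spec:
 assumes "env s" "regs s ''e0'' = j0 + 1" "j0 < m"
 shows "EX s'. runs cysc (160 * np) s s' & env s' & seg s' ''X0'' (regs s' ''xn'') = cycn al (au j0) (av j0) &
  seg s' ''Y0'' (regs s' ''yn'') = cycn be2 (au j0) (av j0) & regs s' ''ej'' = j0"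
proof -
 note A = AL_nth[OF assms(3)]
 let ?b = "Seq (Assign ''ej'' (Sub (Reg ''e0'') (Const 1))) (Seq (Assign ''u'' (Read ''EU'' (Reg ''ej''))) (Assign ''v'' (Read ''G_out'' (Reg ''ej''))))"
 define t1 where "t1 = ev ?b s"
 have r1: "runs ?b 3 s t1" unfolding t1_def by (rule run_ev) simp_all
 have f1: "fr {''ej'', ''u'', ''v''} {} s t1" by (rule fr_mono[OF runs_fr[OF r1]]) auto
 have e1: "env t1" by (rule env_fr[OF assms(1) f1]) auto
 have k1: "regs t1 ''u'' = au j0" "regs t1 ''v'' = av j0" "regs t1 ''ej'' = j0" using assms by (simp_all add: t1_def env_def)
 obtain t2 where t2: "runs (cycw ''alpha'') (60 * np) t1 t2" "seg t2 ''S'' (regs t2 ''sl'') = cycn al (au j0) (av j0)" "fr wordR wordA t1 t2"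
  using cycw_spec[OF e1 colors_simps(1) k1(1,2)] A by blast
 have e2: "env t2" by (rule env_fr[OF e1 t2(3)]) auto
 have l2: "regs t2 ''sl'' <= 2 * np" using cycn_len[of "au j0" "av j0" al] A arg_cong[OF t2(2), of length] by simp
 obtain t3 where t3: "runs (cpy ''X0'' ''xn'' ''S'' ''sl'') (2 * np * 4 + 3) t2 t3" "seg t3 ''X0'' (regs t3 ''xn'') = cycn al (au j0) (av j0)" "fr {''xn'', ''j''} {''X0''} t2 t3"
  using cpy_spec[of "''X0''" "''S''" "''xn''" "''sl''" t2 "2 * np"] l2 t2(2) by auto
 have e3: "env t3" by (rule env_fr[OF e2 t3(3)]) auto
 have f13: "fr (wordR Un {''xn'', ''j''}) (wordA Un {''X0''}) t1 t3" by (rule fr_trans[OF t2(3) t3(3)])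
 have k3: "regs t3 ''u'' = au j0" "regs t3 ''v'' = av j0" "regs t3 ''ej'' = j0" using k1 f13 by (simp_all add: fr_reg)
 obtain t4 where t4: "runs (cycw ''beta'') (60 * np) t3 t4" "seg t4 ''S'' (regs t4 ''sl'') = cycn be2 (au j0) (av j0)" "fr wordR wordA t3 t4"
  using cycw_spec[OF e3 colors_simps(2) k3(1,2)] A by blast
 have e4: "env t4" by (rule env_fr[OF e3 t4(3)]) auto
 have l4: "regs t4 ''sl'' <= 2 * np" using cycn_len[of "au j0" "av j0" be2] A arg_cong[OF t4(2), of length] by simp
 obtain t5 where t5: "runs (cpy ''Y0'' ''yn'' ''S'' ''sl'') (2 * np * 4 + 3) t4 t5" "seg t5 ''Y0'' (regs t5 ''yn'') = cycn be2 (au j0) (av j0)" "fr {''yn'', ''j''} {''Y0''} t4 t5"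
  using cpy_spec[of "''Y0''" "''S''" "''yn''" "''sl''" t4 "2 * np"] l4 t4(2) by auto
 have e5: "env t5" by (rule env_fr[OF e4 t5(3)]) auto
 have f35: "fr (wordR Un {''yn'', ''j''}) (wordA Un {''Y0''}) t3 t5" by (rule fr_trans[OF t4(3) t5(3)])
 have x5: "seg t5 ''X0'' (regs t5 ''xn'') = cycn al (au j0) (av j0)" "regs t5 ''ej'' = j0"
  using t3(2) k3(3) f35 by (simp_all add: fr_reg fr_arr seg_def)
 have r: "runs cysc (3 + (60 * np + ((2 * np * 4 + 3) + (60 * np + (2 * np * 4 + 3))))) s t5"
  unfolding cysc_def by (rule runs_Seq[OF r1 runs_Seq[OF t2(1) runs_Seq[OF t3(1) runs_Seq[OF t4(1) t5(1)]]]])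
 show ?thesis using e5 x5 t5(2) by (intro exI[of _ t5] conjI runs_mono[OF r]) simp_all
qed

definition Cb :: nat where
 "Cb = 2 * (37 * np * (6300 * np)) + 2 * Vb + 4000 * np"

lemma prepB_spec:
 assumes "env s" "regs s ''e0'' = j0 + 1" "j0 < m" "cycn al (au j0) (av j0) ~= [al q]"
 shows "EX s'. runs prepB (Cb + 700 * np) s s' & outcome s'"
proof -
 note A = AL_nth[OF assms(3)]
 define u0 v0 where "u0 = au j0" and "v0 = av j0"
 have uv: "u0 < n" "v0 < n" "(u0, v0) : parcs G" "AL ! j0 = (u0, v0)" using A by (simp_all add: u0_def v0_def)
 define xs ys where "xs = cycn al u0 v0" and "ys = cycn be2 u0 v0"
 obtain s1 where s1: "runs cysc (160 * np) s s1" "env s1" "seg s1 ''X0'' (regs s1 ''xn'') = xs"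
   "seg s1 ''Y0'' (regs s1 ''yn'') = ys" "regs s1 ''ej'' = j0"
  using cysc_spec[OF assms(1-3)] unfolding xs_def ys_def u0_def v0_def by blast
 have yn: "regs s1 ''yn'' = length ys" and xn: "regs s1 ''xn'' = length xs"
  using arg_cong[OF s1(4), of length] arg_cong[OF s1(3), of length] by simp_all
 note px = cycn_props[OF uv(1,2) colors_simps(1), folded xs_def] and py = cycn_props[OF uv(1,2) colors_simps(2), folded ys_def]
 have lx: "length xs <= 2 * np" "length ys <= 2 * np" using cycn_len[OF uv(1,2)] by (simp_all add: xs_def ys_def)
 have x1: "1 < length xs" using cycn_trivial[OF uv(1,2), of al] assms(4) by (simp add: xs_def u0_def v0_def)
 show ?thesis
 proof (cases "length ys < 2")
  case True
  let ?d = "Assign ''case'' (Const 1)"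
  define s2 where "s2 = ev ?d s1"
  have r2: "runs ?d 1 s1 s2" unfolding s2_def by (rule run_ev) simp_all
  have r: "runs prepB (160 * np + Suc 1) s s2" unfolding prepB_def
   by (rule runs_Seq[OF s1(1) runs_CondTrue[OF _ r2]]) (use True yn in simp)
  have yt: "cycn be2 u0 v0 = [be2 q]" using cycn_trivial[OF uv(1,2), of be2] True by (auto simp: ys_def)
  have nR: "~ Real Q" for Q
  proof
   assume R: "Real Q"
   have "arcT u0 v0 Q" using Real_iff[OF Real_base[OF R]] R uv(3) by blast
   thus False using trivial_beta_arcT[OF Real_base[OF R] uv(1,2) _ yt] assms(4) by (simp add: u0_def v0_def)
  qed
  have "outcome s2" by (rule outcome_1[OF _ nR]) (simp add: s2_def)
  thus ?thesis by (intro exI[of _ s2] conjI runs_mono[OF r]) simp_all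
 next
  case False
  hence y1: "1 < length ys" by simp
  have hx: "hd xs = last xs" "hd ys = last ys" using px(2,3) py(2,3) by simp_all
  obtain s2 where s2: "runs (tlc ''X0'' ''xn'' ''t1'') (2 * np * 5 + 3) s1 s2" "cwalk xs (regs s2 ''t1'')" "fr {''t1'', ''i5''} {} s1 s2"
   using tlc_spec[OF s1(3) px(1) x1 hx(1), of "''t1''" "2 * np"] lx by auto
  have y2: "seg s2 ''Y0'' (regs s2 ''yn'') = ys" using s1(4) s2(3) by (simp add: fr_reg fr_arr seg_def)
  obtain s3 where s3: "runs (tlc ''Y0'' ''yn'' ''t2'') (2 * np * 5 + 3) s2 s3" "cwalk ys (regs s3 ''t2'')" "fr {''t2'', ''i5''} {} s2 s3"
   using tlc_spec[OF y2 py(1) y1 hx(2), of "''t2''" "2 * np"] lx by auto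
  define t1 where "t1 = regs s2 ''t1''"
  define t2 where "t2 = regs s3 ''t2''"
  interpret cx: cwalk xs t1 using s2(2) by (simp add: t1_def)
  interpret cy: cwalk ys t2 using s3(2) by (simp add: t2_def)
  have f13: "fr ({''t1'', ''i5''} Un {''t2'', ''i5''}) ({} Un {}) s1 s3" by (rule fr_trans[OF s2(3) s3(3)])
  have e3: "env s3" by (rule env_fr[OF s1(2) f13]) auto
  have a: "regs s3 ''t1'' = t1" "regs s3 ''t2'' = t2" using s3(3) by (simp_all add: fr_reg t1_def t2_def)
  have b: "regs s3 ''xn'' = length xs" "regs s3 ''yn'' = length ys" "regs s3 ''ej'' = j0" using f13 xn yn s1(5) by (simp_all add: fr_reg)
  note k3 = a b env_n1[OF e3]
  have a3: "arrs s3 ''X0'' = arrs s1 ''X0''" "arrs s3 ''Y0'' = arrs s1 ''Y0''" using f13 by (simp_all add: fr_arr)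
  define s4 where "s4 = ev setB s3"
  have r4: "runs setB 9 s3 s4" unfolding s4_def by (rule run_ev) (simp_all add: setB_def)
  have f4: "fr {''t1c'', ''t2c'', ''yo'', ''ll'', ''d'', ''zr''} {} s3 s4" by (rule fr_mono[OF runs_fr[OF r4]]) (auto simp: setB_def)
  have e4: "env s4" by (rule env_fr[OF e3 f4]) auto
  have cl: "cx.cl = length xs - 1 - t1 - t1" using cx.cl by simp
  have k4: "regs s4 ''t1c'' = t1 + 1" "regs s4 ''t2c'' = t2 + 1" "regs s4 ''yo'' = length ys - 1 - t2" "regs s4 ''ll'' = cx.cl"
   "regs s4 ''d'' = 16 * np" "regs s4 ''zr'' = 0" unfolding cl using k3 by (simp_all add: s4_def setB_def)
  have t4: "regs s4 ''t1'' = t1" using k3 f4 by (simp add: fr_reg)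
  obtain s5 where s5: "runs zlp (16 * np * 5 + 2) s4 s5" "16 * np <= regs s5 ''zr''" "regs s5 ''zr'' <= 16 * np + cx.cl"
    "cx.cl dvd regs s5 ''zr''" "fr {''zr'', ''i5''} {} s4 s5"
   using zlp_spec[OF k4(6,5,4)] cx.cl(1) by auto
  define z where "z = regs s5 ''zr''"
  have clx: "cx.cl <= 2 * np" using cx.cl(2) lx(1) by simp
  have z: "16 * np <= z" "z <= 18 * np" "cx.cl dvd z" using s5 clx by (simp_all add: z_def)
  have e5: "env s5" by (rule env_fr[OF e4 s5(5)]) auto
  define s6 where "s6 = ev setC s5"
  have r6: "runs setC 4 s5 s6" unfolding s6_def by (rule run_ev) (simp_all add: setC_def)
  have f6: "fr {''zc'', ''zz'', ''p'', ''pe''} {} s5 s6" by (rule fr_mono[OF runs_fr[OF r6]]) (auto simp: setC_def)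
  have e6: "env s6" by (rule env_fr[OF e5 f6]) auto
  have k5: "regs s5 ''t1'' = t1" "regs s5 ''ll'' = cx.cl" using s5(5) k4 t4 by (simp_all add: fr_reg)
  have k6: "regs s6 ''zc'' = z + 1" "regs s6 ''zz'' = 2 * z + 1" "regs s6 ''p'' = t1" "regs s6 ''pe'' = t1 + cx.cl" "regs s6 ''t1'' = t1" "regs s6 ''zr'' = z"
   using k5 by (simp_all add: s6_def setC_def z_def)
  have f36: "fr ({''t1c'', ''t2c'', ''yo'', ''ll'', ''d'', ''zr''} Un ({''zr'', ''i5''} Un {''zc'', ''zz'', ''p'', ''pe''})) ({} Un ({} Un {})) s3 s6"
   by (rule fr_trans[OF f4 fr_trans[OF s5(5) f6]])
  have f46: "fr ({''zr'', ''i5''} Un {''zc'', ''zz'', ''p'', ''pe''}) ({} Un {}) s4 s6" by (rule fr_trans[OF s5(5) f6])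
  have pos: "0 < cx.cl" using cx.cl(1) by simp
  obtain s7 where s7: "runs flp ((2 * z + 1) * 8 + 2) s6 s7" "ALL j<2 * z + 1. arrs s7 ''F'' j = arrs s6 ''X0'' (t1 + j mod cx.cl)" "fr {''p'', ''i5''} {''F''} s6 s7"
   using flp_spec[OF k6(2,3,5,4) pos refl] by blast
  have e7: "env s7" by (rule env_fr[OF e6 s7(3)]) auto
  have X6: "arrs s6 ''X0'' i = xs ! i" if "i < length xs" for i
  proof -
   have "arrs s6 ''X0'' = arrs s1 ''X0''" using f36 a3 by (simp add: fr_arr)
   thus ?thesis using nth_seg[of i "regs s1 ''xn''" s1 "''X0''"] s1(3) xn that by metis
  qed
  have Y7: "arrs s7 ''Y0'' i = ys ! i" if "i < length ys" for i
  proof -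
   have "arrs s7 ''Y0'' = arrs s1 ''Y0''" using s7(3) f36 a3 by (simp add: fr_arr)
   thus ?thesis using nth_seg[of i "regs s1 ''yn''" s1 "''Y0''"] s1(4) yn that by metis
  qed
  have F7: "arrs s7 ''F'' j = cx.ax (int j - int z)" if "j <= 2 * z" for j
  proof -
   have l: "j mod cx.cl < cx.cl" using pos by simp
   have "arrs s7 ''F'' j = arrs s6 ''X0'' (t1 + j mod cx.cl)" using s7(2) that by simp
   also have "\<dots> = xs ! (t1 + j mod cx.cl)" by (rule X6) (use l cx.cl(2) in simp)
   finally have e: "arrs s7 ''F'' j = xs ! (t1 + j mod cx.cl)" .
   \<comment> \<open>As \<open>z\<close> is a multiple of the period, shifting the index by
     \<open>z\<close> does not change its residue.\<close>
   obtain c where c: "z = cx.cl * c" using z(3) by (elim dvdE)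
   have "(int j - int z) mod int cx.cl = int (j mod cx.cl)" unfolding c by (simp add: zmod_int mod_diff_right_eq[symmetric])
   thus ?thesis unfolding e cx.ax_def by simp
  qed
  have B: "prgB G H al be2 q up n nH m AL cx.ax cy.ax cx.ctl (rev cy.ctl) (int cx.cl) (int cy.cl) u0 v0 z j0"
  proof (unfold_locales)
   show "bired cx.ax" "bired cy.ax" "per cx.ax (int cx.cl)" "per cy.ax (int cy.cl)"
    by (rule cx.bired_ax cy.bired_ax cx.ax_per cy.ax_per)+
   show "0 < int cx.cl" "0 < int cy.cl" using cx.cl(1) cy.cl(1) by simp_all
   show "int cx.cl <= 2 * int np" using clx by linarith
   show "cx.ctl ~= []" "hd cx.ctl = al q" "last cx.ctl = cx.ax 0" using cx.ctl px by simp_all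
   show "length cx.ctl <= 2 * np" using cx.ctl(4) cx.cl(2) lx by simp
   show "rev cy.ctl ~= []" "hd (rev cy.ctl) = cy.ax 0" "last (rev cy.ctl) = be2 q" using cy.ctl py by (simp_all add: hd_rev last_rev)
   show "length (rev cy.ctl) <= 2 * np" using cy.ctl(4) cy.cl(2) lx by simp
   show "length (up v) <= n + 1" if "v : pverts G" for v using up_length that VG by simp
   show "(u0, v0) : parcs G" by (rule uv(3))
   show "cycn al u0 v0 = nf (cx.ctl @ sg cx.ax 0 (int cx.cl) @ rev cx.ctl)" using cx.xs_decomp px(1) by (simp add: xs_def)
   show "cycn be2 u0 v0 = nf (rev (rev cy.ctl) @ sg cy.ax 0 (int cy.cl) @ rev cy.ctl)" using cy.xs_decomp py(1) by (simp add: ys_def)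
   show "16 * np <= z" "z <= 18 * np" by (rule z)+
   show "j0 < m" "AL ! j0 = (u0, v0)" by (rule assms(3) uv(4))+
   show "cx.ax i < nH" for i using cx.ax_set[of i] px(4) by auto
   show "set cx.ctl <= {..<nH}" using cx.ctl(5) px(4) by simp
   show "set (rev cy.ctl) <= {..<nH}" using cy.ctl(5) py(4) by simp
  qed
  have ej: "regs s7 ''ej'' = j0" using s7(3) f36 k3 by (simp add: fr_reg)
  have f47: "regs s7 ''t1c'' = t1 + 1" "regs s7 ''t2c'' = t2 + 1" "regs s7 ''yo'' = length ys - 1 - t2"
   using s7(3) f46 k4 by (simp_all add: fr_reg)
  have f67: "regs s7 ''zr'' = z" "regs s7 ''zc'' = z + 1" "regs s7 ''zz'' = 2 * z + 1" using s7(3) k6 by (simp_all add: fr_reg)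
  have sX: "seg s7 ''X0'' (length cx.ctl) = cx.ctl"
  proof (rule nth_equalityI)
   fix i assume "i < length (seg s7 ''X0'' (length cx.ctl))"
   hence i: "i < Suc t1" using cx.ctl(4) by simp
   hence l: "i < length xs" using cx.cl(2) by simp
   have "arrs s7 ''X0'' = arrs s6 ''X0''" using s7(3) by (simp add: fr_arr)
   hence "arrs s7 ''X0'' i = xs ! i" using X6[OF l] by simp
   thus "seg s7 ''X0'' (length cx.ctl) ! i = cx.ctl ! i" using i cx.ctl(4) by (simp add: cx.ctl_def)
  qed simp
  have sY: "arrs s7 ''Y0'' (regs s7 ''yo'' + i) = rev cy.ctl ! i" if "i < length (rev cy.ctl)" for i
  proof -
   have i: "i <= t2" using that cy.ctl(4) by simp
   have "length ys - 1 - t2 + i < length ys" using i cy.cl(2) by simp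
   thus ?thesis unfolding f47(3) using Y7 cy.rev_ctl[OF i] by simp
  qed
  have "prgB.bctx G H al be2 up n nH m AL cx.ax cx.ctl (rev cy.ctl) z j0 s7"
   unfolding prgB.bctx_def[OF B] using e7 f47 ej f67 sX sY F7 cx.ctl(4) cy.ctl(4) by simp
  then obtain s8 where s8: "runs caseB Cb s7 s8" "outcome s8"
   using prgB.caseB_spec[OF B] unfolding Cb_def by blast
  have r: "runs prepB (160 * np + Suc ((2 * np * 5 + 3) + ((2 * np * 5 + 3) + (9 + ((16 * np * 5 + 2) + (4 + (((2 * z + 1) * 8 + 2) + Cb))))))) s s8"
   unfolding prepB_def
   by (rule runs_Seq[OF s1(1) runs_CondFalse[OF _ runs_Seq[OF s2(1) runs_Seq[OF s3(1) runs_Seq[OF r4 runs_Seq[OF s5(1) runs_Seq[OF r6 runs_Seq[OF s7(1) s8(1)]]]]]]]])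
    (use False yn in simp)
  show ?thesis by (intro exI[of _ s8] conjI s8(2) runs_mono[OF r]) (use z(2) in simp)
 qed
qed

lemma mainc_spec:
 assumes "env s" "!!v. bi v ==> bi q"
 shows "EX s'. runs mainc (Cb + m * (140 * np) + 160 * n * np + 800 * np) s s' & outcome s'"
proof -
 obtain s1 where s1: "runs scanc (m * (140 * np) + 4) s s1" "env s1" "scst m s1" using scanc_spec[OF assms(1)] by blast
 have triv: "(ALL j<m. cycn f (au j) (av j) = [f q]) <-> trivial_arcs f" for f
 proof -
  have "(ALL j<m. cycn f (au j) (av j) = [f q]) <-> (ALL e:set AL. cycn f (fst e) (snd e) = [f q])"
   using AL(2) by (metis in_set_conv_nth)
  thus ?thesis unfolding trivial_arcs_def AL(1) by (simp add: case_prod_beta)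
 qed
 show ?thesis
 proof (cases "regs s1 ''e0'' = 0")
  case False
  define j0 where "j0 = regs s1 ''e0'' - 1"
  have j0: "regs s1 ''e0'' = j0 + 1" "j0 < m" "cycn al (au j0) (av j0) ~= [al q]"
   using s1(3) False by (auto simp: scst_def j0_def)
  obtain s2 where s2: "runs prepB (Cb + 700 * np) s1 s2" "outcome s2" using prepB_spec[OF s1(2) j0] by blast
  have r: "runs mainc ((m * (140 * np) + 4) + Suc (Cb + 700 * np)) s s2" unfolding mainc_def
   by (rule runs_Seq[OF s1(1) runs_CondFalse[OF _ s2(1)]]) (use False in simp)
  show ?thesis by (intro exI[of _ s2] conjI s2(2) runs_mono[OF r]) simp
 next
  case True
  hence ta: "trivial_arcs al" using s1(3) triv[of al] by (auto simp: scst_def)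
  have tb: "regs s1 ''f0'' = 0 <-> trivial_arcs be2" using s1(3) triv[of be2] by (simp add: scst_def)
  show ?thesis
  proof (cases "regs s1 ''f0'' = 0")
   case f: True
   have tb': "trivial_arcs be2" using tb f by simp
   have "EX s'. runs caseA (Vb + 160 * n * np + 300 * np) s1 s' & outcome s'"
    by (rule caseA_spec[OF s1(2) ta tb']) (rule assms(2))
   then obtain s2 where s2: "runs caseA (Vb + 160 * n * np + 300 * np) s1 s2" "outcome s2" by blast
   have r: "runs mainc ((m * (140 * np) + 4) + Suc (Suc (Vb + 160 * n * np + 300 * np))) s s2" unfolding mainc_def
    by (rule runs_Seq[OF s1(1) runs_CondTrue[OF _ runs_CondFalse[OF _ s2(1)]]]) (use True f in simp_all)
   show ?thesis by (intro exI[of _ s2] conjI s2(2) runs_mono[OF r]) (simp add: Cb_def)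
  next
   case f: False
   let ?d = "Assign ''case'' (Const 1)"
   define s2 where "s2 = ev ?d s1"
   have r2: "runs ?d 1 s1 s2" unfolding s2_def by (rule run_ev) simp_all
   have r: "runs mainc ((m * (140 * np) + 4) + Suc (Suc 1)) s s2" unfolding mainc_def
    by (rule runs_Seq[OF s1(1) runs_CondTrue[OF _ runs_CondTrue[OF _ r2]]]) (use True f in simp_all)
   have nR: "~ Real Q" for Q using trivial_Real_iff[OF ta Real_base, of Q] tb f by blast
   have "outcome s2" by (rule outcome_1[OF _ nR]) (simp add: s2_def)
   thus ?thesis by (intro exI[of _ s2] conjI runs_mono[OF r]) simp_all
  qed
 qed
qed

end

text \<open>Only consecutive offsets are compared, which takes time linear in the number of
  vertices; 0 is the answer if no vertex has arcs in both directions.\<close>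

definition findq :: com where
 "findq = Seq (Assign ''q'' (Const 0)) (For ''i5'' (Reg ''nG'')
   (Cond (Conj (Less (Read ''G_out_off'' (Reg ''i5'')) (Read ''G_out_off'' (Add (Reg ''i5'') (Const 1))))
         (Less (Read ''G_in_off'' (Reg ''i5'')) (Read ''G_in_off'' (Add (Reg ''i5'') (Const 1)))))
    (Assign ''q'' (Reg ''i5'')) Skip))"

lemma findq_spec:
 assumes "regs s ''nG'' = n" "0 < n"
  and B: "!!v. v < n ==> B v <-> arrs s ''G_out_off'' v < arrs s ''G_out_off'' (v + 1) & arrs s ''G_in_off'' v < arrs s ''G_in_off'' (v + 1)"
 shows "EX s'. runs findq (n * 5 + 3) s s' & regs s' ''q'' < n & (ALL v<n. B v --> B (regs s' ''q'')) & fr {''q'', ''i5''} {} s s'"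
proof -
 let ?b = "Conj (Less (Read ''G_out_off'' (Reg ''i5'')) (Read ''G_out_off'' (Add (Reg ''i5'') (Const 1))))
         (Less (Read ''G_in_off'' (Reg ''i5'')) (Read ''G_in_off'' (Add (Reg ''i5'') (Const 1))))"
 let ?c = "Cond ?b (Assign ''q'' (Reg ''i5'')) Skip"
 define s1 where "s1 = s\<lparr>regs := (regs s)(''q'' := 0)\<rparr>"
 have r1: "runs (Assign ''q'' (Const 0)) 1 s s1" using runs_Assign[of "''q''" "Const 0" s] by (simp add: s1_def)
 let ?I = "%k s'. regs s' ''q'' < n & (ALL v<k. B v --> B (regs s' ''q''))"
 have "EX s'. runs (For ''i5'' (Reg ''nG'') ?c) (n * (3 + 2) + 2) s1 s' & ?I n s' & frl ''i5'' ?c s1 s'"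
 proof (rule For_rule[where I = ?I])
  fix s' assume "frl ''i5'' ?c s1 s'"
  thus "aval (Reg ''nG'') s' = n" using assms(1) by (simp add: fr_reg s1_def)
 next
  fix k t assume k: "k < n" "frl ''i5'' ?c s1 t" "regs t ''i5'' = k" "?I k t"
  have "arrs t ''G_out_off'' = arrs s ''G_out_off''" "arrs t ''G_in_off'' = arrs s ''G_in_off''" using k(2) by (simp_all add: fr_arr s1_def)
  hence b: "bval ?b t <-> B k" using B[OF k(1)] k(3) by simp
  have q': "regs (ev ?c t) ''q'' = (if B k then k else regs t ''q'')" unfolding ev.simps b using k(3) by simp
  have "?I (Suc k) (ev ?c t)" unfolding q' using k(1,4) by (auto simp: less_Suc_eq)
  moreover have "runs ?c 3 t (ev ?c t)" by (rule run_ev) simp_all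
  ultimately show "EX t'. runs ?c 3 t t' & ?I (Suc k) t'" by blast
 qed (use assms(2) in \<open>auto simp: s1_def\<close>)
 then obtain s2 where s2: "runs (For ''i5'' (Reg ''nG'') ?c) (n * (3 + 2) + 2) s1 s2" "?I n s2" by blast
 have r: "runs findq (1 + (n * (3 + 2) + 2)) s s2" unfolding findq_def by (rule runs_Seq[OF r1 s2(1)])
 have "wR findq = {''q'', ''i5''}" "wA findq = {}" by (auto simp: findq_def)
 hence "fr {''q'', ''i5''} {} s s2" using runs_fr[OF r] by simp
 thus ?thesis using s2(2) by (intro exI[of _ s2] conjI runs_mono[OF r]) simp_all
qed

subsection \<open>Adjacency lists\<close>

text \<open>The arcs in the order of the concatenated lists, so that positions agree with those in
  the array of targets.\<close>

definition arcl :: "nat list list => (nat \<times> nat) list" where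
 "arcl L = concat (map (%v. map (Pair v) (L ! v)) [0..<length L])"

definition ofs :: "nat list list => nat => nat" where
 "ofs L v = length (concat (take v L))"

lemma arr_offsets: "v <= length L ==> arr (offsets L) v = ofs L v"
 by (simp add: arr_def offsets_def ofs_def del: upt_Suc)

lemma ofs_0: "ofs L 0 = 0" and ofs_length: "ofs L (length L) = length (concat L)"
 and ofs_Suc: "v < length L ==> ofs L (Suc v) = ofs L v + length (L ! v)"
 by (simp_all add: ofs_def take_Suc_conv_app_nth)

lemma length_arcl_prefix: "v <= length L ==> length (concat (map (%v. map (Pair v) (L ! v)) [0..<v])) = ofs L v"
 by (induction v) (simp_all add: ofs_0 ofs_Suc)

lemma length_arcl: "length (arcl L) = length (concat L)"
 using length_arcl_prefix[of "length L" L] by (simp add: arcl_def ofs_length)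

lemma map_snd_arcl: "map snd (arcl L) = concat L"
proof -
 have "map snd (arcl L) = concat (map (%v. L ! v) [0..<length L])" by (simp add: arcl_def map_concat comp_def)
 thus ?thesis by (simp add: map_nth)
qed

lemma snd_arcl: "j < length (concat L) ==> snd (arcl L ! j) = concat L ! j"
 using length_arcl[of L] map_snd_arcl[of L] by (metis nth_map)

lemma fst_arcl:
 assumes "v < length L" "ofs L v <= j" "j < ofs L (Suc v)"
 shows "fst (arcl L ! j) = v"
proof -
 let ?g = "%v. map (Pair v) (L ! v)"
 have "[0..<length L] = [0..<v] @ [v..<length L]" using assms(1) upt_add_eq_append[of 0 v "length L - v"] by simp
 also have "[v..<length L] = v # [Suc v..<length L]" using assms(1) by (rule upt_conv_Cons)
 finally have a: "arcl L = concat (map ?g [0..<v]) @ ?g v @ concat (map ?g [Suc v..<length L])" by (simp add: arcl_def)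
 have l: "length (concat (map ?g [0..<v])) = ofs L v" using assms(1) by (intro length_arcl_prefix) simp
 have j: "j - ofs L v < length (L ! v)" using assms ofs_Suc[OF assms(1)] by simp
 have "arcl L ! j = ?g v ! (j - ofs L v)" unfolding a nth_append l using assms(2) j by simp
 thus ?thesis using j by simp
qed

lemma set_arcl: "set (arcl L) = {(u, v). u < length L & v : set (L ! u)}"
 by (auto simp: arcl_def)

lemma distinct_arcl: "(!!v. v < length L ==> distinct (L ! v)) ==> distinct (arcl L)"
proof -
 assume d: "!!v. v < length L ==> distinct (L ! v)"
 have "distinct (concat (map (%v. map (Pair v) (L ! v)) us))" if "distinct us" "ALL v:set us. distinct (L ! v)" for us
  using that by (induction us) (auto simp: distinct_map inj_on_def)
 thus ?thesis using d by (simp add: arcl_def)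
qed

section \<open>Setting up the tables and the total running time\<close>

definition setupc :: com where
 "setupc = Seq (Seq (Assign ''n1'' (Add (Reg ''nG'') (Const 1))) (Seq (Assign ''m'' (Read ''G_out_off'' (Reg ''nG''))) (Assign ''mH'' (Read ''H_out_off'' (Reg ''nH'')))))
   (Seq (ptrc ''G_out_off'' ''EU'' (Add (Reg ''nG'') (Reg ''m''))) (Seq (ptrc ''H_out_off'' ''HU'' (Add (Reg ''nH'') (Reg ''mH'')))
   (Seq hmc (Seq bfsc upc))))"

definition decidec :: com where
 "decidec = Seq setupc mainc"

text \<open>Every vertex is an end of some arc. This absorbs \<open>n * n\<close> into
  \<open>n * m\<close>, and the number of vertices of \<open>H\<close> into that of its
  arcs.\<close>

lemma (in hom_pair) card_pverts_le:
 assumes "finite (parcs G)"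
 shows "card (pverts G) <= 2 * card (parcs G)"
proof -
 have "pverts G <= fst ` parcs G Un snd ` parcs G"
 proof
  fix v assume "v : pverts G"
  then obtain u where "adj u v" using ex_nbr by blast
  thus "v : fst ` parcs G Un snd ` parcs G" by (force simp: adj_def image_iff)
 qed
 hence "card (pverts G) <= card (fst ` parcs G Un snd ` parcs G)" using assms by (intro card_mono) auto
 also have "\<dots> <= card (fst ` parcs G) + card (snd ` parcs G)" by (rule card_Un_le)
 also have "\<dots> <= card (parcs G) + card (parcs G)" using assms by (intro add_mono card_image_le)
 finally show ?thesis by simp
qed

lemma offsets_less:
 assumes "length L = n" "v < n"
 shows "arr (offsets L) v < arr (offsets L) (v + 1) <-> set (L ! v) ~= {}"
 using arr_offsets[of v L] arr_offsets[of "v + 1" L] ofs_Suc[of v L] assms by simp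

lemma arcl_graph:
 assumes "length L = n" "ALL v<n. distinct (L ! v) & set (L ! v) = {w. (v, w) : A}" "A <= {..<n} \<times> {..<n}"
 shows "set (arcl L) = A" "length (arcl L) = card A"
proof -
 show s: "set (arcl L) = A" using assms by (auto simp: set_arcl)
 have "distinct (arcl L)" using assms by (intro distinct_arcl) auto
 thus "length (arcl L) = card A" using s distinct_card by metis
qed

lemma ptrc_arcl:
 assumes "length L = N" "length (arcl L) = M" "arrs s off = arr (offsets L)" "0 < N" "D ~= off"
  "!!s'. fr {''a'', ''p'', ''i5''} {D} s s' ==> aval e s' = N + M"
 shows "EX s'. runs (ptrc off D e) ((N + M) * 6 + 4) s s' & (ALL j<M. arrs s' D j = fst (arcl L ! j)) & fr {''a'', ''p'', ''i5''} {D} s s'"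
proof (rule ptrc_spec[where ofs = "ofs L"])
 show "arrs s off v = ofs L v" if "v <= N" for v using arr_offsets that assms(1,3) by simp
 show "ofs L N = M" using ofs_length[of L] length_arcl[of L] assms(1,2) by simp
 show "ofs L v <= ofs L (Suc v)" if "v < N" for v using ofs_Suc[of v L] that assms(1) by simp
 show "fst (arcl L ! j) = v" if "v < N" "ofs L v <= j" "j < ofs L (Suc v)" for v j using fst_arcl that assms(1) by simp
qed (use assms ofs_0 in auto)

lemma findq_decidec:
 fixes G H :: "nat pair_pre_digraph"
 assumes G: "pair_digraph G" "connected (with_proj G)" "2 <= card (pverts G)" "standard_vertices G"
  and H: "pair_digraph H" "connected (with_proj H)" "2 <= card (pverts H)" "standard_vertices H"
  and hom: "digraph_hom G H al" "digraph_hom G H be2" and inp: "input_state G H al be2 s"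
 shows "EX s1. runs findq (10000000 * card (pverts G)) s s1 & regs s1 ''q'' : pverts G &
  (EX s2. runs decidec (10000000 * (card (pverts G) * card (parcs G) + card (parcs H))) s1 s2 &
   (let q = regs s1 ''q''; W = realizable_walks G H al be2 q in
    regs s2 ''case'' = 1 & W = {} |
    regs s2 ''case'' = 2 & W = {output_walk s2 ''Q''} |
    regs s2 ''case'' = 3 & output_walk s2 ''R'' : pi_hom H (al q) (al q) & output_walk s2 ''P'' : pi_hom H (al q) (be2 q) &
     W = power_walks H (al q) (be2 q) (output_walk s2 ''R'') (output_walk s2 ''P'') |
    regs s2 ''case'' = 4 & zigzag_walks G H al be2 q <= W))"
proof -
 define n nH where "n = card (pverts G)" and "nH = card (pverts H)"
 define m mH where "m = card (parcs G)" and "mH = card (parcs H)"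
 have VG: "pverts G = {..<n}" and VH: "pverts H = {..<nH}" using G(4) H(4) by (simp_all add: standard_vertices_def n_def nH_def)
 have n2: "2 <= n" "2 <= nH" using G(3) H(3) by (simp_all add: n_def nH_def)
 interpret hp: hom_pair G H by (rule hom_pair.intro[OF G(1-3) H(1)])
 \<comment> \<open>\<open>H\<close> in the place of \<open>G\<close>, in order to bound its vertices
   by its arcs.\<close>
 interpret hh: hom_pair H H by (rule hom_pair.intro[OF H(1-3) H(1)])
 obtain GO GI HO HI where L: "out_lists G GO" "in_lists G GI" "out_lists H HO" and s: "s = \<lparr> regs = (%_. 0)(''nG'' := card (pverts G), ''nH'' := card (pverts H)),
       arrs = (%_ _. 0)
        (''G_out'' := arr (concat GO), ''G_out_off'' := arr (offsets GO),
         ''G_in'' := arr (concat GI), ''G_in_off'' := arr (offsets GI),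
         ''H_out'' := arr (concat HO), ''H_out_off'' := arr (offsets HO),
         ''H_in'' := arr (concat HI), ''H_in_off'' := arr (offsets HI),
         ''alpha'' := arr (map al [0..<card (pverts G)]),
         ''beta'' := arr (map be2 [0..<card (pverts G)])) \<rparr>"
  using inp unfolding input_state_def by blast
 have lGO: "length GO = n" "ALL v<n. distinct (GO ! v) & set (GO ! v) = {w. (v, w) : parcs G}"
  and lGI: "length GI = n" "ALL v<n. distinct (GI ! v) & set (GI ! v) = {u. (u, v) : parcs G}"
  and lHO: "length HO = nH" "ALL v<nH. distinct (HO ! v) & set (HO ! v) = {w. (v, w) : parcs H}"
  using L by (simp_all add: out_lists_def in_lists_def adj_lists_def n_def nH_def)
 have "parcs G <= {..<n} \<times> {..<n}" using hp.parcs_V VG by auto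
 note AG = arcl_graph[OF lGO this, folded m_def]
 have HV: "parcs H <= {..<nH} \<times> {..<nH}" using hh.parcs_V VH by auto
 note AH = arcl_graph[OF lHO this, folded mH_def]
 have nm: "n <= 2 * m" "nH <= 2 * mH"
  using hp.card_pverts_le hh.card_pverts_le AG(1) AH(1) finite_set unfolding n_def m_def nH_def mH_def by metis+
 have ini: "regs s ''nG'' = n" "regs s ''nH'' = nH" "arrs s ''G_out'' = arr (concat GO)" "arrs s ''H_out'' = arr (concat HO)"
  "arrs s ''G_out_off'' = arr (offsets GO)" "arrs s ''G_in_off'' = arr (offsets GI)" "arrs s ''H_out_off'' = arr (offsets HO)"
  "arrs s ''alpha'' = arr (map al [0..<n])" "arrs s ''beta'' = arr (map be2 [0..<n])" "arrs s ''HM'' = (%_. 0)" "arrs s ''vis'' = (%_. 0)"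
  unfolding s by (simp_all add: n_def nH_def)
 define bi where "bi v <-> (EX u. (u, v) : parcs G) & (EX u. (v, u) : parcs G)" for v
 have oG: "arr (offsets GO) v < arr (offsets GO) (v + 1) <-> (EX u. (v, u) : parcs G)" if "v < n" for v
  using offsets_less[OF lGO(1) that] lGO(2) that by auto
 have iG: "arr (offsets GI) v < arr (offsets GI) (v + 1) <-> (EX u. (u, v) : parcs G)" if "v < n" for v
  using offsets_less[OF lGI(1) that] lGI(2) that by auto
 have biv: "bi v <-> arrs s ''G_out_off'' v < arrs s ''G_out_off'' (v + 1) & arrs s ''G_in_off'' v < arrs s ''G_in_off'' (v + 1)" if "v < n" for v
  using oG[OF that] iG[OF that] unfolding ini bi_def by blast
 have n0: "0 < n" "0 < nH" using n2 by simp_all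
 obtain s1 where s1: "runs findq (n * 5 + 3) s s1" "regs s1 ''q'' < n" "ALL v<n. bi v --> bi (regs s1 ''q'')" "fr {''q'', ''i5''} {} s s1"
  using findq_spec[OF ini(1) n0(1) biv] by blast
 define q where "q = regs s1 ''q''"
 have qn: "q < n" using s1(2) by (simp add: q_def)
 interpret bf: bfs G H n m "arcl GO" q by unfold_locales (rule VG AG qn)+
 have i1: "arrs s1 = arrs s" using s1(4) by (auto simp: fr_def)
 let ?a = "Seq (Assign ''n1'' (Add (Reg ''nG'') (Const 1))) (Seq (Assign ''m'' (Read ''G_out_off'' (Reg ''nG''))) (Assign ''mH'' (Read ''H_out_off'' (Reg ''nH''))))"
 define s2 where "s2 = ev ?a s1"
 have r2: "runs ?a 3 s1 s2" unfolding s2_def by (rule run_ev) simp_all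
 have nr: "regs s1 ''nG'' = n" "regs s1 ''nH'' = nH" using s1(4) ini by (simp_all add: fr_reg)
 have om: "arr (offsets GO) n = m" "arr (offsets HO) nH = mH"
  using arr_offsets[of n GO] arr_offsets[of nH HO] ofs_length[of GO] ofs_length[of HO] length_arcl[of GO] length_arcl[of HO] AG(2) AH(2) lGO(1) lHO(1) by simp_all
 have k2: "regs s2 ''n1'' = n + 1" "regs s2 ''m'' = m" "regs s2 ''mH'' = mH" "regs s2 ''nG'' = n" "regs s2 ''nH'' = nH" "regs s2 ''q'' = q" "arrs s2 = arrs s"
  using nr i1 ini om by (simp_all add: s2_def q_def)
 have e2: "aval (Add (Reg ''nG'') (Reg ''m'')) s' = n + m" if "fr {''a'', ''p'', ''i5''} {''EU''} s2 s'" for s'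
  using that k2 by (simp add: fr_reg)
 have o2: "arrs s2 ''G_out_off'' = arr (offsets GO)" using k2(7) ini by simp
 obtain s3 where s3: "runs (ptrc ''G_out_off'' ''EU'' (Add (Reg ''nG'') (Reg ''m''))) ((n + m) * 6 + 4) s2 s3" "ALL j<m. arrs s3 ''EU'' j = fst (arcl GO ! j)"
   "fr {''a'', ''p'', ''i5''} {''EU''} s2 s3"
  using ptrc_arcl[where D = "''EU''", OF lGO(1) AG(2) o2 n0(1) _ e2] by auto
 have e3: "aval (Add (Reg ''nH'') (Reg ''mH'')) s' = nH + mH" if "fr {''a'', ''p'', ''i5''} {''HU''} s3 s'" for s'
  using that k2 s3(3) by (simp add: fr_reg)
 have o3: "arrs s3 ''H_out_off'' = arr (offsets HO)" using s3(3) k2(7) ini by (simp add: fr_arr)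
 obtain s4 where s4: "runs (ptrc ''H_out_off'' ''HU'' (Add (Reg ''nH'') (Reg ''mH''))) ((nH + mH) * 6 + 4) s3 s4" "ALL j<mH. arrs s4 ''HU'' j = fst (arcl HO ! j)"
   "fr {''a'', ''p'', ''i5''} {''HU''} s3 s4"
  using ptrc_arcl[where D = "''HU''", OF lHO(1) AH(2) o3 n0(2) _ e3] by auto
 have f24: "fr ({''a'', ''p'', ''i5''} Un {''a'', ''p'', ''i5''}) ({''EU''} Un {''HU''}) s2 s4" by (rule fr_trans[OF s3(3) s4(3)])
 have k4: "regs s4 ''nH'' = nH" "regs s4 ''mH'' = mH" "arrs s4 ''HM'' = (%_. 0)" using f24 k2 ini by (simp_all add: fr_reg fr_arr)
 have h4: "arrs s4 ''HU'' j = fst (arcl HO ! j) & arrs s4 ''H_out'' j = snd (arcl HO ! j)" if "j < mH" for j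
 proof -
  have j: "j < length (concat HO)" using that AH(2) length_arcl[of HO] by simp
  have "arrs s4 ''H_out'' j = arr (concat HO) j" using f24 k2(7) ini by (simp add: fr_arr)
  also have "\<dots> = snd (arcl HO ! j)" using j snd_arcl[OF j] by (simp add: arr_def)
  finally show ?thesis using s4(2) that by simp
 qed
 have sH: "set (arcl HO) <= {..<nH} \<times> {..<nH}" using AH(1) HV by simp
 obtain s5 where s5: "runs hmc (nH * 4 + mH * 3 + 5) s4 s5" "ALL a<nH. ALL b<nH. 0 < arrs s5 ''HM'' (arrs s5 ''rH'' a + b) <-> (a, b) : set (arcl HO)"
   "fr {''p'', ''i5''} {''rH'', ''HM''} s4 s5"
  using hmc_spec[OF k4(1,2) AH(2) sH h4 k4(3)] by blast
 have f25: "fr (({''a'', ''p'', ''i5''} Un {''a'', ''p'', ''i5''}) Un {''p'', ''i5''}) (({''EU''} Un {''HU''}) Un {''rH'', ''HM''}) s2 s5" by (rule fr_trans[OF f24 s5(3)])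
 have k5: "regs s5 ''nG'' = n" "regs s5 ''q'' = q" "regs s5 ''m'' = m" "arrs s5 ''vis'' = (%_. 0)" using f25 k2 ini by (simp_all add: fr_reg fr_arr)
 have EU: "arrs s5 ''EU'' j = fst (arcl GO ! j) & arrs s5 ''G_out'' j = snd (arcl GO ! j)" if "j < m" for j
 proof -
  have j: "j < length (concat GO)" using that AG(2) length_arcl[of GO] by simp
  have "arrs s5 ''G_out'' j = arr (concat GO) j" using f25 k2(7) ini by (simp add: fr_arr)
  also have "\<dots> = snd (arcl GO ! j)" using j snd_arcl[OF j] by (simp add: arr_def)
  finally show ?thesis using s3(2) that s4(3) s5(3) by (simp add: fr_arr)
 qed
 obtain s6 where s6: "runs bfsc (n * (m * 13 + 4) + 4) s5 s6" "bf.tree (arrs s6 ''vis'') (arrs s6 ''par'')" "{v. 0 < arrs s6 ''vis'' v} = {..<n}"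
   "fr {''u'', ''v'', ''i5'', ''i6''} {''vis'', ''par''} s5 s6"
  using bf.bfsc_spec[OF k5 EU] by blast
 define par where "par = arrs s6 ''par''"
 have k6: "regs s6 ''nG'' = n" "regs s6 ''n1'' = n + 1" using s6(4) f25 k2 by (simp_all add: fr_reg)
 obtain s7 where s7: "runs upc (n * ((n + 1) * 5 + 6) + 3) s6 s7" "ALL v<n. arrs s7 ''rG'' v = v * (n + 1)"
   "ALL v<n. ALL i<=n. arrs s7 ''UP'' (v * (n + 1) + i) = (par ^^ i) v" "fr {''p'', ''i5'', ''i6'', ''x''} {''rG'', ''UP''} s6 s7"
  using upc_spec[OF k6 par_def] by blast
 have vis: "0 < arrs s6 ''vis'' v" if "v < n" for v using s6(3) that by blast
 note up = bf.ups_props[OF s6(2) vis, folded par_def]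
 interpret P: prg G H al be2 q "bf.ups par" n nH m "arcl GO"
 proof (unfold_locales)
  show "digraph_hom G H al" "digraph_hom G H be2" by (rule hom)+
  show "q : pverts G" using qn VG by simp
  show "bf.ups par v ~= [] & hd (bf.ups par v) = v & last (bf.ups par v) = q & successively (%x y. x = y | hp.adj x y) (bf.ups par v)" if "v : pverts G" for v
   using up(1-4) that VG by blast
  show "set (bf.ups par q) = {q}" using up(6)[OF _ qn] by blast
  show "pverts G = {..<n}" "pverts H = {..<nH}" by (rule VG VH)+
  show "set (arcl GO) = parcs G" "length (arcl GO) = m" by (rule AG)+
  show "length (bf.ups par v) = n + 1" if "v < n" for v using up(7) that by blast
  show "set (bf.ups par v) <= {..<n}" if "v < n" for v using up(5) that by blast
 qed
 have f27: "fr (((({''a'', ''p'', ''i5''} Un {''a'', ''p'', ''i5''}) Un {''p'', ''i5''}) Un {''u'', ''v'', ''i5'', ''i6''}) Un {''p'', ''i5'', ''i6'', ''x''})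
   (((({''EU''} Un {''HU''}) Un {''rH'', ''HM''}) Un {''vis'', ''par''}) Un {''rG'', ''UP''}) s2 s7"
  by (rule fr_trans[OF fr_trans[OF f25 s6(4)] s7(4)])
 have f57: "fr ({''u'', ''v'', ''i5'', ''i6''} Un {''p'', ''i5'', ''i6'', ''x''}) ({''vis'', ''par''} Un {''rG'', ''UP''}) s5 s7"
  by (rule fr_trans[OF s6(4) s7(4)])
 have g7: "regs s7 ''nG'' = n" "regs s7 ''n1'' = n + 1" "regs s7 ''m'' = m" "arrs s7 ''alpha'' = arr (map al [0..<n])" "arrs s7 ''beta'' = arr (map be2 [0..<n])"
  "arrs s7 ''G_out_off'' = arr (offsets GO)" "arrs s7 ''G_in_off'' = arr (offsets GI)"
  using f27 k2 ini by (simp_all add: fr_reg fr_arr)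
 have h7: "arrs s7 ''EU'' = arrs s5 ''EU''" "arrs s7 ''G_out'' = arrs s5 ''G_out''" "arrs s7 ''HM'' = arrs s5 ''HM''" "arrs s7 ''rH'' = arrs s5 ''rH''"
  using f57 by (simp_all add: fr_arr)
 have e7: "P.env s7"
  unfolding P.env_def g7 h7
 proof (intro conjI allI impI refl)
  fix v assume v: "v < n"
  show "arr (map al [0..<n]) v = al v" "arr (map be2 [0..<n]) v = be2 v" using v by (simp_all add: arr_def)
  show "arrs s7 ''rG'' v = v * (n + 1)" using s7(2) v by blast
  show "arrs s7 ''UP'' (v * (n + 1) + i) = bf.ups par v ! i" if "i <= n" for i
  proof -
   have "bf.ups par v ! i = (par ^^ i) v" by (rule up(8)[OF _ v that])
   thus ?thesis using s7(3) v that by simp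
  qed
  show "arr (offsets GO) v < arr (offsets GO) (Suc v) <-> (EX u. (v, u) : parcs G)" using oG[OF v] by simp
  show "arr (offsets GI) v < arr (offsets GI) (Suc v) <-> (EX u. (u, v) : parcs G)" using iG[OF v] by simp
 next
  fix j assume "j < m"
  thus "arrs s5 ''EU'' j = fst (arcl GO ! j)" "arrs s5 ''G_out'' j = snd (arcl GO ! j)" using EU by blast+
 next
  fix a b assume "a < nH" "b < nH"
  thus "0 < arrs s5 ''HM'' (arrs s5 ''rH'' a + b) <-> (a, b) : parcs H" using s5(2) AH(1) by simp
 qed
 have b7: "P.bi q" if "P.bi v" for v
 proof -
  have "v < n" using that hp.parcs_V VG by (auto simp: P.bi_def)
  thus ?thesis using s1(3) that unfolding P.bi_def bi_def q_def by blast
 qed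
 have "EX s'. runs mainc (P.Cb + m * (140 * (n + 1)) + 160 * n * (n + 1) + 800 * (n + 1)) s7 s' & P.outcome s'"
  by (rule P.mainc_spec[OF e7]) (rule b7)
 then obtain s8 where s8: "runs mainc (P.Cb + m * (140 * (n + 1)) + 160 * n * (n + 1) + 800 * (n + 1)) s7 s8" "P.outcome s8"
  by blast
 have r: "runs decidec ((3 + (((n + m) * 6 + 4) + (((nH + mH) * 6 + 4) + ((nH * 4 + mH * 3 + 5) + ((n * (m * 13 + 4) + 4) + (n * ((n + 1) * 5 + 6) + 3)))))) +
   (P.Cb + m * (140 * (n + 1)) + 160 * n * (n + 1) + 800 * (n + 1))) s1 s8"
  unfolding decidec_def setupc_def
  by (rule runs_Seq[OF runs_Seq[OF r2 runs_Seq[OF s3(1) runs_Seq[OF s4(1) runs_Seq[OF s5(1) runs_Seq[OF s6(1) s7(1)]]]]] s8(1)])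
 have le: "n * n <= 2 * (n * m)" "n <= n * m" "m <= n * m" "1 <= n * m"
 proof -
  have m1: "1 <= m" using nm(1) n0(1) by simp
  show "n <= n * m" "m <= n * m" "1 <= n * m" using m1 n0(1) by simp_all
  have "n * n <= n * (2 * m)" using nm(1) by (rule mult_left_mono) simp
  thus "n * n <= 2 * (n * m)" by simp
 qed
 \<comment> \<open>What remains of the total running time after expanding and cancelling common
   terms; the coefficients have no other meaning.\<close>
 have key: "nH * 10 + (m * 6146 + (477023 + (n * 949381 + n * (n * 472365)))) <= mH * 9999991 + m * (n * 9993847)"
 proof -
  have "n * (n * 472365) = 472365 * (n * n)" "m * (n * 9993847) = 9993847 * (n * m)" by simp_all
  thus ?thesis using le nm(2) by linarith
 qed
 have t: "(3 + (((n + m) * 6 + 4) + (((nH + mH) * 6 + 4) + ((nH * 4 + mH * 3 + 5) + ((n * (m * 13 + 4) + 4) + (n * ((n + 1) * 5 + 6) + 3)))))) +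
   (P.Cb + m * (140 * (n + 1)) + 160 * n * (n + 1) + 800 * (n + 1)) <= 10000000 * (n * m + mH)"
  using key unfolding P.Cb_def P.Vb_def by (simp add: algebra_simps)
 have d: "runs decidec (10000000 * (n * m + mH)) s1 s8" by (rule runs_mono[OF r t])
 have f: "runs findq (10000000 * n) s s1" by (rule runs_mono[OF s1(1)]) (use n0 in simp)
 have qV: "regs s1 ''q'' : pverts G" using qn VG by (simp add: q_def)
 note oc = s8(2)[unfolded P.outcome_def Let_def, unfolded q_def]
 show ?thesis unfolding Let_def n_def[symmetric] m_def[symmetric] mH_def[symmetric]
  by (rule exI[of _ s1], intro conjI f qV, rule exI[of _ s8], intro conjI d oc)
qed

theorem theorem9:
  shows "\<exists>(find_q :: com) (decide :: com) (C :: nat).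
    \<forall>(G :: nat pair_pre_digraph) (H :: nat pair_pre_digraph) \<alpha> \<beta> s.
      pair_digraph G \<and> connected (with_proj G) \<and> 2 \<le> card (pverts G) \<and> standard_vertices G \<and>
      pair_digraph H \<and> connected (with_proj H) \<and> 2 \<le> card (pverts H) \<and> standard_vertices H \<and>
      digraph_hom G H \<alpha> \<and> digraph_hom G H \<beta> \<and> input_state G H \<alpha> \<beta> s \<longrightarrow>
      (\<exists>t s1. exec find_q s t s1 \<and> t \<le> C * card (pverts G) \<and>
        (let q = regs s1 ''q''; W = realizable_walks G H \<alpha> \<beta> q in
          q \<in> pverts G \<and>
          (W = {} \<or>
           (\<exists>Q. W = {Q}) \<or>
           (\<exists>R \<in> pi_hom H (\<alpha> q) (\<alpha> q). \<exists>P \<in> pi_hom H (\<alpha> q) (\<beta> q).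
              W = power_walks H (\<alpha> q) (\<beta> q) R P) \<or>
           zigzag_walks G H \<alpha> \<beta> q \<subseteq> W) \<and>
          (\<exists>t' s2. exec decide s1 t' s2 \<and>
            t' \<le> C * (card (pverts G) * card (parcs G) + card (parcs H)) \<and>
            (regs s2 ''case'' = 1 \<and> W = {} \<or>
             regs s2 ''case'' = 2 \<and> W = {output_walk s2 ''Q''} \<or>
             regs s2 ''case'' = 3 \<and>
               output_walk s2 ''R'' \<in> pi_hom H (\<alpha> q) (\<alpha> q) \<and>
               output_walk s2 ''P'' \<in> pi_hom H (\<alpha> q) (\<beta> q) \<and>
               W = power_walks H (\<alpha> q) (\<beta> q) (output_walk s2 ''R'') (output_walk s2 ''P'') \<or>
             regs s2 ''case'' = 4 \<and> zigzag_walks G H \<alpha> \<beta> q \<subseteq> W))))"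
proof (rule exI[of _ findq], rule exI[of _ decidec], rule exI[of _ "10000000 :: nat"], intro allI impI, elim conjE)
  fix G H :: "nat pair_pre_digraph" and \<alpha> \<beta> s
  assume a: "pair_digraph G" "connected (with_proj G)" "2 \<le> card (pverts G)" "standard_vertices G"
    "pair_digraph H" "connected (with_proj H)" "2 \<le> card (pverts H)" "standard_vertices H"
    "digraph_hom G H \<alpha>" "digraph_hom G H \<beta>" "input_state G H \<alpha> \<beta> s"
  define W where "W q = realizable_walks G H \<alpha> \<beta> q" for q
  define ok where "ok q s2 \<longleftrightarrow> (regs s2 ''case'' = 1 \<and> W q = {} \<or>
       regs s2 ''case'' = 2 \<and> W q = {output_walk s2 ''Q''} \<or>
       regs s2 ''case'' = 3 \<and> output_walk s2 ''R'' \<in> pi_hom H (\<alpha> q) (\<alpha> q) \<and> output_walk s2 ''P'' \<in> pi_hom H (\<alpha> q) (\<beta> q) \<and>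
         W q = power_walks H (\<alpha> q) (\<beta> q) (output_walk s2 ''R'') (output_walk s2 ''P'') \<or>
       regs s2 ''case'' = 4 \<and> zigzag_walks G H \<alpha> \<beta> q \<subseteq> W q)" for q s2
  define exst where "exst q \<longleftrightarrow> (W q = {} \<or> (\<exists>Q. W q = {Q}) \<or>
       (\<exists>R \<in> pi_hom H (\<alpha> q) (\<alpha> q). \<exists>P \<in> pi_hom H (\<alpha> q) (\<beta> q). W q = power_walks H (\<alpha> q) (\<beta> q) R P) \<or>
       zigzag_walks G H \<alpha> \<beta> q \<subseteq> W q)" for q
  have ex: "ok q s2 \<Longrightarrow> exst q" for q s2 unfolding ok_def exst_def by (elim disjE conjE) blast+
  obtain s1 s2 where r: "runs findq (10000000 * card (pverts G)) s s1" "regs s1 ''q'' \<in> pverts G"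
      "runs decidec (10000000 * (card (pverts G) * card (parcs G) + card (parcs H))) s1 s2" "ok (regs s1 ''q'') s2"
    using findq_decidec[OF a] unfolding Let_def ok_def W_def by blast
  obtain t where t: "exec findq s t s1" "t \<le> 10000000 * card (pverts G)" using r(1) unfolding runs_def by blast
  obtain t' where t': "exec decidec s1 t' s2" "t' \<le> 10000000 * (card (pverts G) * card (parcs G) + card (parcs H))" using r(3) unfolding runs_def by blast
  show "\<exists>t s1. exec findq s t s1 \<and> t \<le> 10000000 * card (pverts G) \<and>
        (let q = regs s1 ''q''; W = realizable_walks G H \<alpha> \<beta> q in
          q \<in> pverts G \<and>
          (W = {} \<or>
           (\<exists>Q. W = {Q}) \<or>
           (\<exists>R \<in> pi_hom H (\<alpha> q) (\<alpha> q). \<exists>P \<in> pi_hom H (\<alpha> q) (\<beta> q).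
              W = power_walks H (\<alpha> q) (\<beta> q) R P) \<or>
           zigzag_walks G H \<alpha> \<beta> q \<subseteq> W) \<and>
          (\<exists>t' s2. exec decidec s1 t' s2 \<and>
            t' \<le> 10000000 * (card (pverts G) * card (parcs G) + card (parcs H)) \<and>
            (regs s2 ''case'' = 1 \<and> W = {} \<or>
             regs s2 ''case'' = 2 \<and> W = {output_walk s2 ''Q''} \<or>
             regs s2 ''case'' = 3 \<and>
               output_walk s2 ''R'' \<in> pi_hom H (\<alpha> q) (\<alpha> q) \<and>
               output_walk s2 ''P'' \<in> pi_hom H (\<alpha> q) (\<beta> q) \<and>
               W = power_walks H (\<alpha> q) (\<beta> q) (output_walk s2 ''R'') (output_walk s2 ''P'') \<or>
             regs s2 ''case'' = 4 \<and> zigzag_walks G H \<alpha> \<beta> q \<subseteq> W)))"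
    unfolding Let_def W_def[symmetric] ok_def[symmetric] exst_def[symmetric]
    by (intro exI[of _ t] exI[of _ s1] conjI t r(2) ex[OF r(4)] exI[of _ t'] exI[of _ s2] t' r(4))
qed

end
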